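(* Let $(\mathcal G,\mu),(\mathcal H,\nu)$ be discrete pmp topological groupoids such that $\mathcal G^0$ and $\mathcal H^0$ are compact metrizable spaces, let $\pi:(\mathcal G,\mu)\to(\mathcal H,\nu)$ be a continuous pmp class-bijective factor map, $\mathbb P=\{\mathbb P_j\}_{j\in J}$ a sofic approximation to $(\mathcal H,\nu)$, $\beta$ a bias for $J$ and $p\in[1,\infty]$. If $\rho$ is a dynamically generating continuous pseudo-metric on $\mathcal G^0$, $\mathcal H$ and $\mathcal G$ are étale, $\nu$ is regular and $\mathbb P$ is asymptotically continuous, then $h_{\mathbb P,\mu}(\pi,\rho)=h_{\mathbb P,\mu}(\pi)$.
   Context: **Groupoids.** A groupoid $\mathcal H$ is a small category in which every morphism is invertible; it is identified with its set of morphisms, $\mathcal H^0\subset\mathcal H$ denotes the units (objects), $\mathfrak s,\mathfrak r:\mathcal H\to\mathcal H^0$ are source and range, and $fg$ is defined iff $\mathfrak s(f)=\mathfrak r(g)$. It is discrete if $\mathfrak s^{-1}(x),\mathfrak r^{-1}(x)$ are countable for all $x\in\mathcal H^0$. A measurable groupoid carries a standard Borel structure for which $\mathcal H^0$ and the set of composable pairs are Borel and source, range, composition and inversion are Borel. A discrete measurable groupoid with a Borel probability measure $\nu$ on $\mathcal H^0$ is pmp if the measures $\nu_{\mathfrak s}(B)=\int|\mathfrak s^{-1}(x)\cap B|\,d\nu(x)$ and $\nu_{\mathfrak r}(B)=\int|\mathfrak r^{-1}(x)\cap B|\,d\nu(x)$ on $\mathcal H$ coincide; the common measure is again denoted $\nu$.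 $[[\mathcal H]]$ is the set of Borel $f\subset\mathcal H$ such that $\mathfrak s|_f,\mathfrak r|_f$ are Borel isomorphisms onto their images, with $fg=\{f'g':f'\in f,g'\in g \text{ composable}\}$ and $f^{-1}=\{h^{-1}:h\in f\}$. Put $\mathrm{tr}_{\mathcal H}(f)=\nu(f\cap\mathcal H^0)$. For $d\in\mathbb N$, $\Delta_d=\{1,\dots,d\}^2$ is the groupoid with $\mathfrak s(i,j)=(j,j)$, $\mathfrak r(i,j)=(i,i)$, $(i,j)(j,k)=(i,k)$; its unit set $\Delta_d^0$ is identified with $\{1,\dots,d\}$. $[[d]]:=[[\Delta_d]]$, $|f|_d=|f|/d$, $\mathrm{tr}_d(f)=|f\cap\Delta_d^0|/d$. For $f\in[[d]]$: $fj=i$ if $(i,j)\in f$, and for $A\subset\Delta_d^0$, $f\cdot A=\{i:(i,j)\in f\text{ for some }j\in A\}$. **Sofic approximations.** For finite $F\subset[[\mathcal H]]$ and $\delta>0$, $\sigma:[[\mathcal H]]\to[[d]]$ is $(F,\delta)$-multiplicative if $|\sigma(st)\vartriangle\sigma(s)\sigma(t)|_d<\delta$ for all $s,t\in F$, and $(F,\delta)$-trace-preserving if $|\mathrm{tr}_d(\sigma(s))-\mathrm{tr}_{\mathcal H}(s)|<\delta$ for all $s\in F$. $\mathrm{Map}([[\mathcal H]],[[d]])$ is the set of all maps, with the Borel structure generated by the sets $\{\sigma':\sigma'|_F=\sigma|_F\}$, $F$ finite. A sofic approximation to $(\mathcal H,\nu)$ is a family $\{\mathbb P_j\}_{j\in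 J}$ ($J$ a directed set) of Borel probability measures on $\mathrm{Map}([[\mathcal H]],[[d_j]])$, $d_j\in\mathbb N$, such that: (1) for all finite $F$ and $\delta>0$, $\lim_{j\to J}\mathbb P_j(\sigma\text{ is }(F,\delta)\text{-trace-preserving})=1$; (2) for all finite $F$ and $\delta>0$ there is $j$ such that for $j'\ge j$, $\mathbb P_{j'}$-a.e. $\sigma$ is $(F,\delta)$-multiplicative; (3) $\lim_{j\to J} d_j=\infty$; (4) if $\nu(f\vartriangle f')=0$ then $\sigma(f)=\sigma(f')$ for $\mathbb P_j$-a.e. $\sigma$. $\mathbb P$ is asymptotically continuous if for every finite $F\subset[[\mathcal H]]$ and $\delta>0$ there is $j\in J$ such that for all $j'\ge j$, $\mathbb P_{j'}$-a.e. $\sigma$ satisfies $|\sigma(f)\vartriangle\sigma(g)|_{d_{j'}}<\delta+\nu(f\vartriangle g)$ for all $f,g\in F$. **Bias.** A bias $\beta$ for $J$ is an element of $\{-,+\}$ or an ultrafilter on $J$ containing $\{j'\in J:j'\ge j\}$ for each $j$. $\lim_{j\to\beta}\Phi(j)$ means $\liminf_{j\to J}$ if $\beta=-$, $\limsup_{j\to J}$ if $\beta=+$, and the ultralimit otherwise. $\|\cdot\|_{p,\mathbb P_j}$ is the $L^p$-norm with respect to $\mathbb P_j$. **Topological groupoids.** A discrete topological groupoid is a discrete groupoid with a topology making source, range, inverse, composition continuous. A bisection is an open $U\subset\mathcal H$ such that $\mathfrak s|_U,\mathfrak r|_U$ are homeomorphisms onto open subsets of $\mathcal H^0$. $\mathcal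 H$ is étale if each element lies in a bisection. $[\mathcal H]_{top}$ is the set of bisections $U$ for which $\mathfrak s|_U,\mathfrak r|_U$ are homeomorphisms onto $\mathcal H^0$. For $A\subset\mathcal H^0$, $\partial A=\overline A\cap\overline{\mathcal H^0\setminus A}$, and $\mathcal B_\partial(\mathcal H^0,\nu)$ is the collection of Borel $A\subset\mathcal H^0$ with $\nu(\partial A)=0$. $[[\mathcal H]]_{top}$ is the set of $f\in[[\mathcal H]]$ of the form $f=\bigcup_{i=1}^nf_i$ where for each $i$ there is a bisection $U_i$ with $\overline{f_i}\subset U_i$, $\overline{\mathfrak s(f_i)}\subset\mathfrak s(U_i)$, $\overline{\mathfrak r(f_i)}\subset\mathfrak r(U_i)$; the $\mathfrak s(f_i)$ are pairwise disjoint elements of $\mathcal B_\partial(\mathcal H^0,\nu)$, and so are the $\mathfrak r(f_i)$. **Factor maps.** A groupoid morphism $\pi:\mathcal G\to\mathcal H$ (preserving products, inverses, units) is class-bijective if for every $a\in\mathcal G^0$ it restricts to bijections $\mathfrak s^{-1}(a)\to\mathfrak s^{-1}(\pi(a))$ and $\mathfrak r^{-1}(a)\to\mathfrak r^{-1}(\pi(a))$; a class-bijective factor map is moreover surjective. It is pmp if both groupoids are pmp and $\pi_*\mu=\nu$. For $f\in[[\mathcal H]]$ and $x\in\mathcal G^0$ with $\pi(x)\in\mathfrak s(f)$, $f\cdot x\in\mathcal G^0$ is the range of the unique element of $\pi^{-1}(f)$ with source $x$; if $\pi(x)\notin\mathfrak s(f)$ put $f\cdot x=*$, a special symbol. For $P\subset\mathcal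 G^0$, $f\cdot P=\{f\cdot x:x\in P,\pi(x)\in\mathfrak s(f)\}$. **Entropy via partitions.** For a finite partition $\mathcal P$ of $\mathcal G^0$ and finite $F\subset[[\mathcal H]]$, $\mathcal P^F$ is the coarsest partition of $\mathcal G^0$ such that each $f\cdot P$ ($f\in F,P\in\mathcal P$) is a union of its atoms, and $\Sigma(\mathcal P)$ is the sigma-algebra generated by $\mathcal P$. $\mathcal B(\Delta_d^0)$ is the set of all subsets of $\Delta_d^0$. A homomorphism $\phi:\Sigma(\mathcal P)\to\mathcal B(\Delta_d^0)$ is a map preserving unions and intersections with $\phi(\emptyset)=\emptyset$, $\phi(\mathcal G^0)=\Delta_d^0$. For $\sigma:[[\mathcal H]]\to[[d]]$, $\delta>0$ and finite $F\ni\mathcal H^0$, $\mathrm{Hom}(\pi,\sigma,\mathcal P,F,\delta)$ is the set of homomorphisms $\phi:\Sigma(\mathcal P^F)\to\mathcal B(\Delta_d^0)$ with $\sum_{P\in\mathcal P}|\sigma(f)\cdot\phi(P)\vartriangle\phi(f\cdot P)|d^{-1}<\delta$ for all $f\in F$ and $\sum_{P\in\mathcal P^F}\big||\phi(P)|d^{-1}-\mu(P)\big|<\delta$. For $\mathcal Q\le\mathcal P$ (meaning $\mathcal P$ refines $\mathcal Q$), $|\mathrm{Hom}(\pi,\sigma,\mathcal P,F,\delta)|_{\mathcal Q}$ is the number of distinct restrictions to $\Sigma(\mathcal Q)$ of elements of $\mathrm{Hom}(\pi,\sigma,\mathcal P,F,\delta)$. For finite Borel partitions $\mathcal Q\le\mathcal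 P$ let $$h_{\mathbb P,\mu}(\pi,\mathcal Q,\mathcal P)=\inf_F\inf_{\delta>0}\lim_{j\to\beta}\frac1{d_j}\log\big\||\mathrm{Hom}(\pi,\cdot,\mathcal P,F,\delta)|_{\mathcal Q}\big\|_{p,\mathbb P_j},$$ $F$ over finite subsets of $[[\mathcal H]]$ containing $\mathcal H^0$; and $h_{\mathbb P,\mu}(\pi)=\sup_{\mathcal Q}\inf_{\mathcal P\ge\mathcal Q}h_{\mathbb P,\mu}(\pi,\mathcal Q,\mathcal P)$ over finite Borel partitions of $\mathcal G^0$. **Entropy via pseudo-metrics.** For $x=(x_1,\dots,x_d)\in(\mathcal G^0)^d$ put $f\cdot x=(f\cdot x_1,\dots,f\cdot x_d)$ and $x\circ\sigma(f)=(x_{\sigma(f)1},\dots,x_{\sigma(f)d})$, with $x_{\sigma(f)i}=*$ if $i\notin\mathfrak s(\sigma(f))$. A continuous pseudo-metric $\rho$ on $\mathcal G^0$ is extended to $\mathcal G^0\cup\{*\}$ by $\rho( *,* )=0$, $\rho( *,x)=\max_{y,z\in\mathcal G^0}\rho(y,z)$; on $d$-tuples $\rho_2(x,x')=(\frac1d\sum_i\rho(x_i,x_i')^2)^{1/2}$ and $\rho_\infty(x,x')=\max_i\rho(x_i,x'_i)$. For finite $F\subset[[\mathcal H]]_{top}$, finite $K\subset C(\mathcal G^0)$ and $\delta>0$, $Orb_\mu(\pi,\sigma,F,K,\delta,\rho)$ is the set of $x\in(\mathcal G^0)^d$ with $\rho_2(f\cdot x,x\circ\sigma(f))<\delta$ for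 all $f\in F$ and $|d^{-1}\sum_ik(x_i)-\int k\,d\mu|<\delta$ for all $k\in K$. $N_\epsilon(X,\cdot)$ is the maximal cardinality of a subset of $X$ whose distinct points are at distance $>\epsilon$. For $q\in\{2,\infty\}$, $$h_{\mathbb P,\mu}(\pi,\rho,q)=\sup_{\epsilon>0}\inf_{\delta>0}\inf_{F}\inf_{K}\lim_{j\to\beta}\frac1{d_j}\log\|N_\epsilon(Orb_\mu(\pi,\cdot,F,K,\delta,\rho),\rho_q)\|_{p,\mathbb P_j},$$ $F$ over finite subsets of $[[\mathcal H]]_{top}$, $K$ over finite subsets of $C(\mathcal G^0)$. The quantities for $q=2,\infty$ coincide, and $h_{\mathbb P,\mu}(\pi,\rho)$ denotes the common value. $\rho$ is dynamically generating for $\pi$ if for all distinct $x,y\in\mathcal G^0$ there is $f\in[\mathcal H]_{top}$ with $\rho(f\cdot x,f\cdot y)>0$.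
   Formalization: The topologies on the groupoids are assumed Hausdorff; for a non-Hausdorff étale groupoid every element of the topological pseudogroup can be null, and the stated equality then fails already for the identity factor map. *)

theory Defs
  imports "HOL-Probability.Probability"
begin

section \<open>Groupoids\<close>

text \<open>A groupoid is its set of morphisms; units are the identity morphisms.  The product
  \<open>gmult g h\<close> is meaningful when \<open>src g = rng h\<close>.\<close>

record 'a groupoid =
  arrows :: "'a set"
  src :: "'a \<Rightarrow> 'a"
  rng :: "'a \<Rightarrow> 'a"
  gmult :: "'a \<Rightarrow> 'a \<Rightarrow> 'a"
  ginv :: "'a \<Rightarrow> 'a"

record 'a top_groupoid = "'a groupoid" +
  gtop :: "'a topology"

definition units :: "('a, 'm) groupoid_scheme \<Rightarrow> 'a set" where
  "units G = {x \<in> arrows G. src G x = x}"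

definition composable :: "('a, 'm) groupoid_scheme \<Rightarrow> ('a \<times> 'a) set" where
  "composable G = {(g, h). g \<in> arrows G \<and> h \<in> arrows G \<and> src G g = rng G h}"

definition is_groupoid :: "('a, 'm) groupoid_scheme \<Rightarrow> bool" where
  "is_groupoid G \<longleftrightarrow>
     (\<forall>g\<in>arrows G. src G g \<in> units G \<and> rng G g \<in> units G \<and> ginv G g \<in> arrows G) \<and>
     (\<forall>x\<in>units G. rng G x = x) \<and>
     (\<forall>(g, h)\<in>composable G. gmult G g h \<in> arrows G \<and>
        src G (gmult G g h) = src G h \<and> rng G (gmult G g h) = rng G g) \<and>
     (\<forall>g h k. (g, h) \<in> composable G \<longrightarrow> (h, k) \<in> composable G \<longrightarrow>
        gmult G (gmult G g h) k = gmult G g (gmult G h k)) \<and>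
     (\<forall>g\<in>arrows G. gmult G g (src G g) = g \<and> gmult G (rng G g) g = g) \<and>
     (\<forall>g\<in>arrows G. src G (ginv G g) = rng G g \<and> rng G (ginv G g) = src G g \<and>
        gmult G g (ginv G g) = rng G g \<and> gmult G (ginv G g) g = src G g)"

definition discrete_groupoid :: "('a, 'm) groupoid_scheme \<Rightarrow> bool" where
  "discrete_groupoid G \<longleftrightarrow> is_groupoid G \<and>
     (\<forall>x\<in>units G. countable {g \<in> arrows G. src G g = x} \<and> countable {g \<in> arrows G. rng G g = x})"

section \<open>Measurable and pmp groupoids\<close>

definition borel_of :: "'a topology \<Rightarrow> 'a measure" where
  "borel_of T = sigma (topspace T) {U. openin T U}"

definition standard_borel :: "'a measure \<Rightarrow> bool" where
  "standard_borel M \<longleftrightarrow> (\<exists>T. topspace T = space M \<and> completely_metrizable_space T \<and>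
     second_countable T \<and> sets M = sets (borel_of T))"

text \<open>Throughout, \<open>M\<close> carries the Borel structure of the groupoid; only its sigma-algebra
  matters.\<close>

definition discrete_measurable_groupoid :: "('a, 'm) groupoid_scheme \<Rightarrow> 'a measure \<Rightarrow> bool" where
  "discrete_measurable_groupoid G M \<longleftrightarrow> discrete_groupoid G \<and>
     space M = arrows G \<and> standard_borel M \<and>
     units G \<in> sets M \<and> composable G \<in> sets (M \<Otimes>\<^sub>M M) \<and>
     src G \<in> measurable M M \<and> rng G \<in> measurable M M \<and> ginv G \<in> measurable M M \<and>
     (\<lambda>(g, h). gmult G g h) \<in> measurable (restrict_space (M \<Otimes>\<^sub>M M) (composable G)) M"

definition source_mass :: "('a, 'm) groupoid_scheme \<Rightarrow> 'a measure \<Rightarrow> 'a set \<Rightarrow> ennreal" where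
  "source_mass G \<nu> B =
     (\<integral>\<^sup>+ x. emeasure (count_space UNIV) {g \<in> B. src G g = x} \<partial>\<nu>)"

definition range_mass :: "('a, 'm) groupoid_scheme \<Rightarrow> 'a measure \<Rightarrow> 'a set \<Rightarrow> ennreal" where
  "range_mass G \<nu> B =
     (\<integral>\<^sup>+ x. emeasure (count_space UNIV) {g \<in> B. rng G g = x} \<partial>\<nu>)"

text \<open>For a pmp groupoid, \<open>source_mass G \<nu>\<close> is the measure on \<open>arrows G\<close> that is again denoted
  \<open>\<nu>\<close> in the literature; the measure \<open>\<nu>\<close> itself lives on \<open>units G\<close>.\<close>

definition pmp_groupoid :: "('a, 'm) groupoid_scheme \<Rightarrow> 'a measure \<Rightarrow> 'a measure \<Rightarrow> bool" where
  "pmp_groupoid G M \<nu> \<longleftrightarrow> discrete_measurable_groupoid G M \<and>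
     prob_space \<nu> \<and> space \<nu> = units G \<and> sets \<nu> = sets (restrict_space M (units G)) \<and>
     (\<forall>B\<in>sets M. source_mass G \<nu> B = range_mass G \<nu> B)"

definition borel_iso_onto_image :: "'a measure \<Rightarrow> ('a \<Rightarrow> 'a) \<Rightarrow> 'a set \<Rightarrow> bool" where
  "borel_iso_onto_image M s f \<longleftrightarrow> inj_on s f \<and>
     s \<in> measurable (restrict_space M f) (restrict_space M (s ` f)) \<and>
     the_inv_into f s \<in> measurable (restrict_space M (s ` f)) (restrict_space M f)"

text \<open>The inverse semigroup usually written \<open>[[G]]\<close>.\<close>

definition pseudogroup :: "('a, 'm) groupoid_scheme \<Rightarrow> 'a measure \<Rightarrow> 'a set set" where
  "pseudogroup G M = {f \<in> sets M. f \<subseteq> arrows G \<and>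
     borel_iso_onto_image M (src G) f \<and> borel_iso_onto_image M (rng G) f}"

definition set_mult :: "('a, 'm) groupoid_scheme \<Rightarrow> 'a set \<Rightarrow> 'a set \<Rightarrow> 'a set" where
  "set_mult G f g = {gmult G f' g' | f' g'. f' \<in> f \<and> g' \<in> g \<and> (f', g') \<in> composable G}"

definition gtrace :: "('a, 'm) groupoid_scheme \<Rightarrow> 'a measure \<Rightarrow> 'a set \<Rightarrow> real" where
  "gtrace G \<nu> f = measure \<nu> (f \<inter> units G)"

section \<open>The finite full groupoids\<close>

definition full_groupoid :: "nat \<Rightarrow> (nat \<times> nat) groupoid" where
  "full_groupoid d = \<lparr>arrows = {1..d} \<times> {1..d},
     src = (\<lambda>(i, j). (j, j)), rng = (\<lambda>(i, j). (i, i)),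
     gmult = (\<lambda>(i, j) (k, l). (i, l)), ginv = (\<lambda>(i, j). (j, i))\<rparr>"

definition fin_pseudogroup :: "nat \<Rightarrow> (nat \<times> nat) set set" where
  "fin_pseudogroup d = pseudogroup (full_groupoid d) (count_space (arrows (full_groupoid d)))"

definition fin_size :: "nat \<Rightarrow> 'b set \<Rightarrow> real" where
  "fin_size d f = real (card f) / real d"

definition fin_trace :: "nat \<Rightarrow> (nat \<times> nat) set \<Rightarrow> real" where
  "fin_trace d f = fin_size d (f \<inter> units (full_groupoid d))"

text \<open>Units \<open>(i, i)\<close> of the full groupoid are identified with \<open>i\<close> from here on; \<open>(i, j)\<close> maps
  \<open>j\<close> to \<open>i\<close>.\<close>

definition fin_apply :: "(nat \<times> nat) set \<Rightarrow> nat \<Rightarrow> nat option" where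
  "fin_apply f j = (if \<exists>i. (i, j) \<in> f then Some (THE i. (i, j) \<in> f) else None)"

definition fin_image :: "(nat \<times> nat) set \<Rightarrow> nat set \<Rightarrow> nat set" where
  "fin_image f A = {i. \<exists>j\<in>A. (i, j) \<in> f}"

section \<open>Directed sets and biases\<close>

definition directed_set :: "'j set \<Rightarrow> ('j \<Rightarrow> 'j \<Rightarrow> bool) \<Rightarrow> bool" where
  "directed_set J le \<longleftrightarrow> J \<noteq> {} \<and> (\<forall>i\<in>J. le i i) \<and>
     (\<forall>i\<in>J. \<forall>j\<in>J. \<forall>k\<in>J. le i j \<longrightarrow> le j k \<longrightarrow> le i k) \<and>
     (\<forall>i\<in>J. \<forall>j\<in>J. \<exists>k\<in>J. le i k \<and> le j k)"

definition net_filter :: "'j set \<Rightarrow> ('j \<Rightarrow> 'j \<Rightarrow> bool) \<Rightarrow> 'j filter" where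
  "net_filter J le = (INF j\<in>J. principal {j' \<in> J. le j j'})"

datatype 'j bias = Minus | Plus | Ultra "'j filter"

definition is_ultrafilter :: "'j filter \<Rightarrow> bool" where
  "is_ultrafilter U \<longleftrightarrow> U \<noteq> bot \<and> (\<forall>S. eventually S U \<or> eventually (\<lambda>j. \<not> S j) U)"

definition is_bias :: "'j set \<Rightarrow> ('j \<Rightarrow> 'j \<Rightarrow> bool) \<Rightarrow> 'j bias \<Rightarrow> bool" where
  "is_bias J le \<beta> \<longleftrightarrow> (case \<beta> of Minus \<Rightarrow> True | Plus \<Rightarrow> True
     | Ultra U \<Rightarrow> is_ultrafilter U \<and> eventually (\<lambda>j. j \<in> J) U \<and>
         (\<forall>j\<in>J. eventually (\<lambda>j'. j' \<in> J \<and> le j j') U))"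

definition bias_lim ::
  "'j set \<Rightarrow> ('j \<Rightarrow> 'j \<Rightarrow> bool) \<Rightarrow> 'j bias \<Rightarrow> ('j \<Rightarrow> ereal) \<Rightarrow> ereal" where
  "bias_lim J le \<beta> \<Phi> = (case \<beta> of Minus \<Rightarrow> Liminf (net_filter J le) \<Phi>
     | Plus \<Rightarrow> Limsup (net_filter J le) \<Phi>
     | Ultra U \<Rightarrow> Lim U \<Phi>)"

section \<open>Sofic approximations\<close>

definition multiplicative :: "('h, 'm) groupoid_scheme \<Rightarrow> nat \<Rightarrow> 'h set set \<Rightarrow> real \<Rightarrow>
    ('h set \<Rightarrow> (nat \<times> nat) set) \<Rightarrow> bool" where
  "multiplicative H d F \<delta> \<sigma> \<longleftrightarrow> (\<forall>s\<in>F. \<forall>t\<in>F.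
     fin_size d (sym_diff (\<sigma> (set_mult H s t)) (set_mult (full_groupoid d) (\<sigma> s) (\<sigma> t))) < \<delta>)"

definition trace_preserving :: "('h, 'm) groupoid_scheme \<Rightarrow> 'h measure \<Rightarrow> nat \<Rightarrow> 'h set set \<Rightarrow>
    real \<Rightarrow> ('h set \<Rightarrow> (nat \<times> nat) set) \<Rightarrow> bool" where
  "trace_preserving H \<nu> d F \<delta> \<sigma> \<longleftrightarrow> (\<forall>s\<in>F. \<bar>fin_trace d (\<sigma> s) - gtrace H \<nu> s\<bar> < \<delta>)"

text \<open>Maps from the pseudogroup of \<open>H\<close> to that of the full groupoid on \<open>d\<close> points, extensional
  outside the pseudogroup of \<open>H\<close>, with the sigma-algebra generated by cylinder sets.\<close>

definition map_space :: "('h, 'm) groupoid_scheme \<Rightarrow> 'h measure \<Rightarrow> nat \<Rightarrow>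
    ('h set \<Rightarrow> (nat \<times> nat) set) measure" where
  "map_space H M d = (let Maps = pseudogroup H M \<rightarrow>\<^sub>E fin_pseudogroup d in
     sigma Maps {{\<sigma>' \<in> Maps. \<forall>f\<in>F. \<sigma>' f = \<sigma> f} | \<sigma> F.
       \<sigma> \<in> Maps \<and> finite F \<and> F \<subseteq> pseudogroup H M})"

record ('j, 'h) approx =
  idx :: "'j set"
  idx_le :: "'j \<Rightarrow> 'j \<Rightarrow> bool"
  degree :: "'j \<Rightarrow> nat"
  law :: "'j \<Rightarrow> ('h set \<Rightarrow> (nat \<times> nat) set) measure"

definition sofic_approximation :: "('h, 'm) groupoid_scheme \<Rightarrow> 'h measure \<Rightarrow> 'h measure \<Rightarrow>
    ('j, 'h) approx \<Rightarrow> bool" where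
  "sofic_approximation H M \<nu> A \<longleftrightarrow>
     directed_set (idx A) (idx_le A) \<and>
     (\<forall>j\<in>idx A. 0 < degree A j \<and> prob_space (law A j) \<and>
        space (law A j) = space (map_space H M (degree A j)) \<and>
        sets (law A j) = sets (map_space H M (degree A j))) \<and>
     (\<forall>F \<delta>. finite F \<longrightarrow> F \<subseteq> pseudogroup H M \<longrightarrow> 0 < \<delta> \<longrightarrow>
        ((\<lambda>j. measure (law A j)
            {\<sigma> \<in> space (law A j). trace_preserving H \<nu> (degree A j) F \<delta> \<sigma>}) \<longlongrightarrow> 1)
          (net_filter (idx A) (idx_le A))) \<and>
     (\<forall>F \<delta>. finite F \<longrightarrow> F \<subseteq> pseudogroup H M \<longrightarrow> 0 < \<delta> \<longrightarrow>
        (\<exists>j\<in>idx A. \<forall>j'\<in>idx A. idx_le A j j' \<longrightarrow>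
           (AE \<sigma> in law A j'. multiplicative H (degree A j') F \<delta> \<sigma>))) \<and>
     filterlim (degree A) at_top (net_filter (idx A) (idx_le A)) \<and>
     (\<forall>f\<in>pseudogroup H M. \<forall>g\<in>pseudogroup H M. source_mass H \<nu> (sym_diff f g) = 0 \<longrightarrow>
        (\<forall>j\<in>idx A. AE \<sigma> in law A j. \<sigma> f = \<sigma> g))"

definition asymptotically_continuous :: "('h, 'm) groupoid_scheme \<Rightarrow> 'h measure \<Rightarrow> 'h measure \<Rightarrow>
    ('j, 'h) approx \<Rightarrow> bool" where
  "asymptotically_continuous H M \<nu> A \<longleftrightarrow>
     (\<forall>F \<delta>. finite F \<longrightarrow> F \<subseteq> pseudogroup H M \<longrightarrow> 0 < \<delta> \<longrightarrow>
        (\<exists>j\<in>idx A. \<forall>j'\<in>idx A. idx_le A j j' \<longrightarrow>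
           (AE \<sigma> in law A j'. \<forall>f\<in>F. \<forall>g\<in>F.
              ennreal (fin_size (degree A j') (sym_diff (\<sigma> f) (\<sigma> g)))
                < ennreal \<delta> + source_mass H \<nu> (sym_diff f g))))"

section \<open>Topological groupoids\<close>

definition unit_top :: "'a top_groupoid \<Rightarrow> 'a topology" where
  "unit_top G = subtopology (gtop G) (units G)"

text \<open>Topologies on groupoids are assumed Hausdorff, as is usual when speaking of compact sets
  and regular measures on them.  For a non-Hausdorff etale groupoid even the set of units need not
  belong to \<open>top_pseudogroup\<close> below, and the two notions of entropy can differ already for the
  identity map.\<close>

definition discrete_topological_groupoid :: "'a top_groupoid \<Rightarrow> bool" where
  "discrete_topological_groupoid G \<longleftrightarrow> discrete_groupoid G \<and>
     topspace (gtop G) = arrows G \<and> Hausdorff_space (gtop G) \<and>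
     continuous_map (gtop G) (gtop G) (src G) \<and>
     continuous_map (gtop G) (gtop G) (rng G) \<and>
     continuous_map (gtop G) (gtop G) (ginv G) \<and>
     continuous_map (subtopology (prod_topology (gtop G) (gtop G)) (composable G)) (gtop G)
       (\<lambda>(g, h). gmult G g h)"

definition pmp_topological_groupoid :: "'a top_groupoid \<Rightarrow> 'a measure \<Rightarrow> bool" where
  "pmp_topological_groupoid G \<nu> \<longleftrightarrow> discrete_topological_groupoid G \<and>
     pmp_groupoid G (borel_of (gtop G)) \<nu>"

definition bisection :: "'a top_groupoid \<Rightarrow> 'a set \<Rightarrow> bool" where
  "bisection G U \<longleftrightarrow> openin (gtop G) U \<and>
     openin (unit_top G) (src G ` U) \<and> openin (unit_top G) (rng G ` U) \<and>
     homeomorphic_map (subtopology (gtop G) U) (subtopology (unit_top G) (src G ` U)) (src G) \<and>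
     homeomorphic_map (subtopology (gtop G) U) (subtopology (unit_top G) (rng G ` U)) (rng G)"

definition etale :: "'a top_groupoid \<Rightarrow> bool" where
  "etale G \<longleftrightarrow> (\<forall>g\<in>arrows G. \<exists>U. bisection G U \<and> g \<in> U)"

text \<open>\<open>top_full_group\<close> and \<open>top_pseudogroup\<close> are usually written \<open>[G]\<close> and \<open>[[G]]\<close> with index
  \<open>top\<close>.\<close>

definition top_full_group :: "'a top_groupoid \<Rightarrow> 'a set set" where
  "top_full_group G = {U. bisection G U \<and> src G ` U = units G \<and> rng G ` U = units G}"

definition unit_boundary :: "'a top_groupoid \<Rightarrow> 'a set \<Rightarrow> 'a set" where
  "unit_boundary G A = unit_top G closure_of A \<inter> unit_top G closure_of (units G - A)"

definition null_boundary_sets :: "'a top_groupoid \<Rightarrow> 'a measure \<Rightarrow> 'a set set" where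
  "null_boundary_sets G \<nu> = {A \<in> sets \<nu>. A \<subseteq> units G \<and> emeasure \<nu> (unit_boundary G A) = 0}"

definition top_pseudogroup :: "'a top_groupoid \<Rightarrow> 'a measure \<Rightarrow> 'a set set" where
  "top_pseudogroup G \<nu> = {f \<in> pseudogroup G (borel_of (gtop G)).
     \<exists>(n::nat) fs Us. f = (\<Union>i<n. fs i) \<and>
       (\<forall>i<n. bisection G (Us i) \<and>
          gtop G closure_of (fs i) \<subseteq> Us i \<and>
          unit_top G closure_of (src G ` fs i) \<subseteq> src G ` Us i \<and>
          unit_top G closure_of (rng G ` fs i) \<subseteq> rng G ` Us i \<and>
          src G ` fs i \<in> null_boundary_sets G \<nu> \<and> rng G ` fs i \<in> null_boundary_sets G \<nu>) \<and>
       disjoint_family_on (\<lambda>i. src G ` fs i) {..<n} \<and>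
       disjoint_family_on (\<lambda>i. rng G ` fs i) {..<n}}"

text \<open>Regularity of the measure induced by \<open>\<nu>\<close> on all arrows.  For its restriction to a compact
  metrizable unit space, regularity is automatic.\<close>

definition regular_measure :: "'a top_groupoid \<Rightarrow> 'a measure \<Rightarrow> bool" where
  "regular_measure G \<nu> \<longleftrightarrow> (\<forall>B\<in>sets (borel_of (gtop G)).
     source_mass G \<nu> B = (INF U\<in>{U. openin (gtop G) U \<and> B \<subseteq> U}. source_mass G \<nu> U) \<and>
     source_mass G \<nu> B = (SUP K\<in>{K. compactin (gtop G) K \<and> K \<subseteq> B}. source_mass G \<nu> K))"

section \<open>Factor maps\<close>

definition groupoid_morphism :: "('g, 'm) groupoid_scheme \<Rightarrow> ('h, 'n) groupoid_scheme \<Rightarrow>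
    ('g \<Rightarrow> 'h) \<Rightarrow> bool" where
  "groupoid_morphism G H \<pi> \<longleftrightarrow>
     \<pi> ` arrows G \<subseteq> arrows H \<and> \<pi> ` units G \<subseteq> units H \<and>
     (\<forall>g\<in>arrows G. src H (\<pi> g) = \<pi> (src G g) \<and> rng H (\<pi> g) = \<pi> (rng G g) \<and>
        \<pi> (ginv G g) = ginv H (\<pi> g)) \<and>
     (\<forall>(g, h)\<in>composable G. \<pi> (gmult G g h) = gmult H (\<pi> g) (\<pi> h))"

definition class_bijective_factor :: "('g, 'm) groupoid_scheme \<Rightarrow> ('h, 'n) groupoid_scheme \<Rightarrow>
    ('g \<Rightarrow> 'h) \<Rightarrow> bool" where
  "class_bijective_factor G H \<pi> \<longleftrightarrow> groupoid_morphism G H \<pi> \<and> \<pi> ` arrows G = arrows H \<and>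
     (\<forall>a\<in>units G.
        bij_betw \<pi> {g \<in> arrows G. src G g = a} {h \<in> arrows H. src H h = \<pi> a} \<and>
        bij_betw \<pi> {g \<in> arrows G. rng G g = a} {h \<in> arrows H. rng H h = \<pi> a})"

definition pmp_factor :: "'g top_groupoid \<Rightarrow> 'g measure \<Rightarrow> 'h top_groupoid \<Rightarrow> 'h measure \<Rightarrow>
    ('g \<Rightarrow> 'h) \<Rightarrow> bool" where
  "pmp_factor G \<mu> H \<nu> \<pi> \<longleftrightarrow> class_bijective_factor G H \<pi> \<and>
     \<pi> \<in> measurable (borel_of (gtop G)) (borel_of (gtop H)) \<and>
     (\<forall>B\<in>sets \<nu>. emeasure \<nu> B = emeasure \<mu> (\<pi> -` B \<inter> units G))"

text \<open>\<open>None\<close> plays the role of the extra symbol \<open>*\<close>.\<close>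

definition act :: "('g, 'm) groupoid_scheme \<Rightarrow> ('h, 'n) groupoid_scheme \<Rightarrow> ('g \<Rightarrow> 'h) \<Rightarrow>
    'h set \<Rightarrow> 'g \<Rightarrow> 'g option" where
  "act G H \<pi> f x = (if \<pi> x \<in> src H ` f
     then Some (rng G (THE g. g \<in> arrows G \<and> \<pi> g \<in> f \<and> src G g = x)) else None)"

definition act_set :: "('g, 'm) groupoid_scheme \<Rightarrow> ('h, 'n) groupoid_scheme \<Rightarrow> ('g \<Rightarrow> 'h) \<Rightarrow>
    'h set \<Rightarrow> 'g set \<Rightarrow> 'g set" where
  "act_set G H \<pi> f P = {y. \<exists>x\<in>P. act G H \<pi> f x = Some y}"

section \<open>Norms and logarithms\<close>

definition ennreal_powr :: "ennreal \<Rightarrow> real \<Rightarrow> ennreal" where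
  "ennreal_powr x a = (if x = \<top> then \<top> else ennreal (enn2real x powr a))"

definition Lp_norm :: "ennreal \<Rightarrow> 'a measure \<Rightarrow> ('a \<Rightarrow> ennreal) \<Rightarrow> ennreal" where
  "Lp_norm p M f = (if p = \<top> then esssup M f
     else ennreal_powr (\<integral>\<^sup>+ x. ennreal_powr (f x) (enn2real p) \<partial>M) (1 / enn2real p))"

definition ext_ln :: "ennreal \<Rightarrow> ereal" where
  "ext_ln x = (if x = 0 then -\<infinity> else if x = \<top> then \<infinity> else ereal (ln (enn2real x)))"

text \<open>The exponential growth rate of a random count along a sofic approximation; \<open>\<Phi> d \<sigma>\<close> is the
  count at a map \<open>\<sigma>\<close> into the pseudogroup on \<open>d\<close> points.\<close>

definition growth_rate :: "('j, 'h) approx \<Rightarrow> 'j bias \<Rightarrow> ennreal \<Rightarrow>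
    (nat \<Rightarrow> ('h set \<Rightarrow> (nat \<times> nat) set) \<Rightarrow> ennreal) \<Rightarrow> ereal" where
  "growth_rate A \<beta> p \<Phi> = bias_lim (idx A) (idx_le A) \<beta>
     (\<lambda>j. ereal (1 / real (degree A j)) * ext_ln (Lp_norm p (law A j) (\<Phi> (degree A j))))"

section \<open>Entropy via partitions\<close>

definition atoms_of :: "'a set \<Rightarrow> 'a set set \<Rightarrow> 'a set set" where
  "atoms_of Y C = {{y \<in> Y. \<forall>S\<in>C. y \<in> S \<longleftrightarrow> x \<in> S} | x. x \<in> Y}"

lemma atoms_of_coarsest:
  assumes "\<And>S. S \<in> C \<Longrightarrow> S \<subseteq> Y"
  shows "partition_on Y (atoms_of Y C)"
    and "\<And>S. S \<in> C \<Longrightarrow> \<exists>R\<subseteq>atoms_of Y C. S = \<Union>R"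
    and "\<And>\<R>. partition_on Y \<R> \<Longrightarrow> (\<And>S. S \<in> C \<Longrightarrow> \<exists>R\<subseteq>\<R>. S = \<Union>R) \<Longrightarrow>
           refines Y \<R> (atoms_of Y C)"
proof -
  let ?A = "\<lambda>x. {y \<in> Y. \<forall>S\<in>C. y \<in> S \<longleftrightarrow> x \<in> S}"
  have eq: "?A x = ?A z" if "z \<in> ?A x" for x z
    using that by auto
  show part: "partition_on Y (atoms_of Y C)"
  proof (rule partition_onI)
    show "\<Union>(atoms_of Y C) = Y"
      unfolding atoms_of_def by auto
    show "{} \<notin> atoms_of Y C"
      unfolding atoms_of_def by auto
    show "disjnt p q" if pq: "p \<in> atoms_of Y C" "q \<in> atoms_of Y C" "p \<noteq> q" for p q
    proof -
      obtain x where x: "p = ?A x"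
        using pq(1) unfolding atoms_of_def by auto
      obtain w where w: "q = ?A w"
        using pq(2) unfolding atoms_of_def by auto
      have "p = q" if z: "z \<in> p" "z \<in> q" for z
      proof -
        have "?A x = ?A z" using z(1) unfolding x by (rule eq)
        moreover have "?A w = ?A z" using z(2) unfolding w by (rule eq)
        ultimately show ?thesis unfolding x w by (rule trans[OF _ sym])
      qed
      then show ?thesis
        using pq(3) by (auto simp only: disjnt_iff)
    qed
  qed
  show "\<exists>R\<subseteq>atoms_of Y C. S = \<Union>R" if S: "S \<in> C" for S
  proof (intro exI conjI)
    show "?A ` S \<subseteq> atoms_of Y C"
      using assms[OF S] unfolding atoms_of_def by (intro image_subsetI CollectI) blast
    show "S = \<Union>(?A ` S)"
    proof
      show "S \<subseteq> \<Union>(?A ` S)" using assms[OF S] by (intro subsetI UN_I) auto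
      show "\<Union>(?A ` S) \<subseteq> S" using S by (intro UN_least) auto
    qed
  qed
  show "refines Y \<R> (atoms_of Y C)"
    if \<R>: "partition_on Y \<R>" and un: "\<And>S. S \<in> C \<Longrightarrow> \<exists>R\<subseteq>\<R>. S = \<Union>R" for \<R>
  proof -
    have "\<exists>B\<in>atoms_of Y C. A \<subseteq> B" if A: "A \<in> \<R>" for A
    proof -
      obtain x where x: "x \<in> A"
        using \<R> A by (metis all_not_in_conv partition_onD3)
      have AY: "A \<subseteq> Y"
        using partition_onD1[OF \<R>] A by auto
      have same: "y \<in> S \<longleftrightarrow> x \<in> S" if y: "y \<in> A" and S: "S \<in> C" for y S
      proof -
        obtain R where R: "R \<subseteq> \<R>" "S = \<Union>R"
          using un[OF S] by metis
        have "z \<in> S \<longleftrightarrow> A \<in> R" if z: "z \<in> A" for z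
        proof
          assume "z \<in> S"
          then obtain B where B: "B \<in> R" "z \<in> B" using R(2) by auto
          then have "B = A"
            using disjointD[OF partition_onD2[OF \<R>], of B A] R(1) A z by auto
          then show "A \<in> R" using B(1) by simp
        next
          assume "A \<in> R"
          then show "z \<in> S" using R(2) z by auto
        qed
        then show ?thesis using x y by metis
      qed
      have "A \<subseteq> ?A x"
        using AY same by (intro subsetI) (simp add: subset_iff)
      moreover have "?A x \<in> atoms_of Y C"
        using x AY unfolding atoms_of_def by auto
      ultimately show ?thesis by (rule bexI)
    qed
    then show ?thesis
      using \<R> part by (simp add: refines_def)
  qed
qed

definition partition_power :: "('g, 'm) groupoid_scheme \<Rightarrow> ('h, 'n) groupoid_scheme \<Rightarrow>
    ('g \<Rightarrow> 'h) \<Rightarrow> 'g set set \<Rightarrow> 'h set set \<Rightarrow> 'g set set" where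
  "partition_power G H \<pi> \<P> F = atoms_of (units G) {act_set G H \<pi> f P | f P. f \<in> F \<and> P \<in> \<P>}"

definition Hom_sets :: "('g, 'm) groupoid_scheme \<Rightarrow> 'g measure \<Rightarrow> ('h, 'n) groupoid_scheme \<Rightarrow>
    ('g \<Rightarrow> 'h) \<Rightarrow> 'g set set \<Rightarrow> 'h set set \<Rightarrow> real \<Rightarrow> nat \<Rightarrow> ('h set \<Rightarrow> (nat \<times> nat) set) \<Rightarrow>
    ('g set \<Rightarrow> nat set) set" where
  "Hom_sets G \<mu> H \<pi> \<P> F \<delta> d \<sigma> =
     (let \<Sigma> = sigma_sets (units G) (partition_power G H \<pi> \<P> F) in
      {\<phi> \<in> \<Sigma> \<rightarrow>\<^sub>E Pow {1..d}.
         \<phi> {} = {} \<and> \<phi> (units G) = {1..d} \<and>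
         (\<forall>A\<in>\<Sigma>. \<forall>B\<in>\<Sigma>. \<phi> (A \<union> B) = \<phi> A \<union> \<phi> B \<and> \<phi> (A \<inter> B) = \<phi> A \<inter> \<phi> B) \<and>
         (\<forall>f\<in>F. (\<Sum>P\<in>\<P>. fin_size d
            (sym_diff (fin_image (\<sigma> f) (\<phi> P)) (\<phi> (act_set G H \<pi> f P)))) < \<delta>) \<and>
         (\<Sum>P\<in>partition_power G H \<pi> \<P> F. \<bar>fin_size d (\<phi> P) - measure \<mu> P\<bar>) < \<delta>})"

definition Hom_count :: "('g, 'm) groupoid_scheme \<Rightarrow> 'g measure \<Rightarrow> ('h, 'n) groupoid_scheme \<Rightarrow>
    ('g \<Rightarrow> 'h) \<Rightarrow> 'g set set \<Rightarrow> 'g set set \<Rightarrow> 'h set set \<Rightarrow> real \<Rightarrow> nat \<Rightarrow>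
    ('h set \<Rightarrow> (nat \<times> nat) set) \<Rightarrow> nat" where
  "Hom_count G \<mu> H \<pi> \<Q> \<P> F \<delta> d \<sigma> =
     card ((\<lambda>\<phi>. restrict \<phi> (sigma_sets (units G) \<Q>)) ` Hom_sets G \<mu> H \<pi> \<P> F \<delta> d \<sigma>)"

definition finite_borel_partition :: "('g, 'm) groupoid_scheme \<Rightarrow> 'g measure \<Rightarrow> 'g set set \<Rightarrow> bool"
  where "finite_borel_partition G \<mu> \<P> \<longleftrightarrow>
    finite \<P> \<and> partition_on (units G) \<P> \<and> \<P> \<subseteq> sets \<mu>"

definition partition_entropy :: "('g, 'm) groupoid_scheme \<Rightarrow> 'g measure \<Rightarrow>
    ('h, 'n) groupoid_scheme \<Rightarrow> 'h measure \<Rightarrow> ('g \<Rightarrow> 'h) \<Rightarrow> ('j, 'h) approx \<Rightarrow> 'j bias \<Rightarrow> ennreal \<Rightarrow>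
    'g set set \<Rightarrow> 'g set set \<Rightarrow> ereal" where
  "partition_entropy G \<mu> H M \<pi> A \<beta> p \<Q> \<P> =
     (INF F\<in>{F. finite F \<and> F \<subseteq> pseudogroup H M \<and> units H \<in> F}. INF \<delta>\<in>{0<..}.
        growth_rate A \<beta> p (\<lambda>d \<sigma>. of_nat (Hom_count G \<mu> H \<pi> \<Q> \<P> F \<delta> d \<sigma>)))"

definition sofic_entropy :: "('g, 'm) groupoid_scheme \<Rightarrow> 'g measure \<Rightarrow>
    ('h, 'n) groupoid_scheme \<Rightarrow> 'h measure \<Rightarrow> ('g \<Rightarrow> 'h) \<Rightarrow> ('j, 'h) approx \<Rightarrow> 'j bias \<Rightarrow> ennreal \<Rightarrow>
    ereal" where
  "sofic_entropy G \<mu> H M \<pi> A \<beta> p =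
     (SUP \<Q>\<in>{\<Q>. finite_borel_partition G \<mu> \<Q>}.
      INF \<P>\<in>{\<P>. finite_borel_partition G \<mu> \<P> \<and> refines (units G) \<P> \<Q>}.
        partition_entropy G \<mu> H M \<pi> A \<beta> p \<Q> \<P>)"

section \<open>Entropy via pseudo-metrics\<close>

definition continuous_pseudometric :: "'a topology \<Rightarrow> ('a \<Rightarrow> 'a \<Rightarrow> real) \<Rightarrow> bool" where
  "continuous_pseudometric X \<rho> \<longleftrightarrow>
     (\<forall>x\<in>topspace X. \<rho> x x = 0) \<and>
     (\<forall>x\<in>topspace X. \<forall>y\<in>topspace X. 0 \<le> \<rho> x y \<and> \<rho> x y = \<rho> y x) \<and>
     (\<forall>x\<in>topspace X. \<forall>y\<in>topspace X. \<forall>z\<in>topspace X. \<rho> x z \<le> \<rho> x y + \<rho> y z) \<and>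
     continuous_map (prod_topology X X) euclideanreal (\<lambda>(x, y). \<rho> x y)"

definition pm_diam :: "'a set \<Rightarrow> ('a \<Rightarrow> 'a \<Rightarrow> real) \<Rightarrow> real" where
  "pm_diam Y \<rho> = (SUP (y, z)\<in>Y \<times> Y. \<rho> y z)"

fun pm_ext :: "'a set \<Rightarrow> ('a \<Rightarrow> 'a \<Rightarrow> real) \<Rightarrow> 'a option \<Rightarrow> 'a option \<Rightarrow> real" where
  "pm_ext Y \<rho> (Some x) (Some y) = \<rho> x y"
| "pm_ext Y \<rho> None None = 0"
| "pm_ext Y \<rho> None (Some y) = pm_diam Y \<rho>"
| "pm_ext Y \<rho> (Some x) None = pm_diam Y \<rho>"

definition rho2 :: "('b \<Rightarrow> 'b \<Rightarrow> real) \<Rightarrow> nat \<Rightarrow> (nat \<Rightarrow> 'b) \<Rightarrow> (nat \<Rightarrow> 'b) \<Rightarrow> real" where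
  "rho2 \<rho> d x x' = sqrt ((\<Sum>i\<in>{1..d}. (\<rho> (x i) (x' i))\<^sup>2) / real d)"

definition rho_inf :: "('b \<Rightarrow> 'b \<Rightarrow> real) \<Rightarrow> nat \<Rightarrow> (nat \<Rightarrow> 'b) \<Rightarrow> (nat \<Rightarrow> 'b) \<Rightarrow> real" where
  "rho_inf \<rho> d x x' = Max ((\<lambda>i. \<rho> (x i) (x' i)) ` {1..d})"

definition Orb :: "'g top_groupoid \<Rightarrow> 'g measure \<Rightarrow> 'h top_groupoid \<Rightarrow> ('g \<Rightarrow> 'h) \<Rightarrow>
    ('g \<Rightarrow> 'g \<Rightarrow> real) \<Rightarrow> 'h set set \<Rightarrow> ('g \<Rightarrow> real) set \<Rightarrow> real \<Rightarrow> nat \<Rightarrow>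
    ('h set \<Rightarrow> (nat \<times> nat) set) \<Rightarrow> (nat \<Rightarrow> 'g) set" where
  "Orb G \<mu> H \<pi> \<rho> F K \<delta> d \<sigma> = {x \<in> {1..d} \<rightarrow>\<^sub>E units G.
     (\<forall>f\<in>F. rho2 (pm_ext (units G) \<rho>) d
        (\<lambda>i. act G H \<pi> f (x i)) (\<lambda>i. map_option x (fin_apply (\<sigma> f) i)) < \<delta>) \<and>
     (\<forall>k\<in>K. \<bar>(\<Sum>i\<in>{1..d}. k (x i)) / real d - (\<integral>y. k y \<partial>\<mu>)\<bar> < \<delta>)}"

definition sep_number :: "real \<Rightarrow> ('b \<Rightarrow> 'b \<Rightarrow> real) \<Rightarrow> 'b set \<Rightarrow> ennreal" where
  "sep_number \<epsilon> D X = (SUP S\<in>{S. finite S \<and> S \<subseteq> X \<and> (\<forall>x\<in>S. \<forall>y\<in>S. x \<noteq> y \<longrightarrow> \<epsilon> < D x y)}.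
     of_nat (card S))"

text \<open>The exponent \<open>q\<close> of the metric on tuples, \<open>2\<close> or infinity.\<close>

datatype metric_exponent = Q_two | Q_infinity

definition rho_q :: "metric_exponent \<Rightarrow> ('b \<Rightarrow> 'b \<Rightarrow> real) \<Rightarrow> nat \<Rightarrow>
    (nat \<Rightarrow> 'b) \<Rightarrow> (nat \<Rightarrow> 'b) \<Rightarrow> real" where
  "rho_q q = (case q of Q_two \<Rightarrow> rho2 | Q_infinity \<Rightarrow> rho_inf)"

definition pm_entropy :: "'g top_groupoid \<Rightarrow> 'g measure \<Rightarrow> 'h top_groupoid \<Rightarrow> 'h measure \<Rightarrow>
    ('g \<Rightarrow> 'h) \<Rightarrow> ('j, 'h) approx \<Rightarrow> 'j bias \<Rightarrow> ennreal \<Rightarrow> ('g \<Rightarrow> 'g \<Rightarrow> real) \<Rightarrow> metric_exponent \<Rightarrow>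
    ereal" where
  "pm_entropy G \<mu> H \<nu> \<pi> A \<beta> p \<rho> q =
     (SUP \<epsilon>\<in>{0<..}. INF \<delta>\<in>{0<..}. INF F\<in>{F. finite F \<and> F \<subseteq> top_pseudogroup H \<nu>}.
      INF K\<in>{K. finite K \<and> (\<forall>k\<in>K. continuous_map (unit_top G) euclideanreal k)}.
        growth_rate A \<beta> p (\<lambda>d \<sigma>. sep_number \<epsilon> (rho_q q \<rho> d) (Orb G \<mu> H \<pi> \<rho> F K \<delta> d \<sigma>)))"

definition dynamically_generating :: "'g top_groupoid \<Rightarrow> 'h top_groupoid \<Rightarrow> ('g \<Rightarrow> 'h) \<Rightarrow>
    ('g \<Rightarrow> 'g \<Rightarrow> real) \<Rightarrow> bool" where
  "dynamically_generating G H \<pi> \<rho> \<longleftrightarrow>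
     (\<forall>x\<in>units G. \<forall>y\<in>units G. x \<noteq> y \<longrightarrow>
        (\<exists>f\<in>top_full_group H. 0 < pm_ext (units G) \<rho> (act G H \<pi> f x) (act G H \<pi> f y)))"

end

theory Submission
  imports Defs
begin

text \<open>Homomorphisms of a finite partition algebra and tuples of units are two ways of labelling
  \<open>{1..d}\<close> by atoms.  Choosing a point in the selected atom turns a homomorphism into an approximate
  orbit; conversely, an approximate orbit becomes a homomorphism after its entries near large compact
  subsets of the atoms are moved into those atoms.  The orbit condition only concerns the
  topological pseudogroup: it is dense in the pseudogroup for the distance
  \<open>\<nu> (f \<triangle> g)\<close>, and asymptotic continuity carries the density over to the finite models.
  A generating pseudo-metric enters through finitely many of its translates, which separate disjoint
  compact sets of units.  Hence \<open>\<rho>\<close>-close approximate orbits select the same atoms except at a small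
  proportion of the places, and the number of labellings lost in this way is subexponential.\<close>

section \<open>Injective Borel images\<close>

text \<open>Measure preservation concerns sets of arrows, whereas partitions are moved by the
  action; so \<open>act_set\<close> of a Borel set must be Borel with the right measure. This is the
  reason for the Lusin--Souslin theorem, applied to \<open>src\<close> and \<open>rng\<close>.
  Continuous test functions bound frequencies of open sets only from below. Upper bounds come from
  complements, or from the fact that the frequencies and the measures of a partition both sum to 1;
  in particular the domain of a finite model is controlled by testing the complement of a closed
  set. An orbit condition sees the extra symbol only through the diameter of \<rho>. A positive
  diameter lets a smaller distance exclude that exactly one side is defined; with diameter 0 the
  generating property leaves a single unit, and that case rests on trace preservation, which holds
  only with probability tending to 1. The partition count is compared with separation for
  \<open>rho2\<close>, and separation for \<open>rho_inf\<close> with the partition count; both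
  exponents lie between, so one argument covers them. Losses are factors exp(\<kappa> d) with
  \<kappa> arbitrarily small.\<close>

text \<open>A code embeds a Polish space onto a closed subset of the Baire space such that the inverse is
  continuous.  Every Borel set is clopen for some code; this replaces the usual refinement of the
  topology in the proof of the Lusin--Souslin theorem.\<close>

definition polish_code :: "'a topology \<Rightarrow> ('a \<Rightarrow> nat \<Rightarrow> nat) \<Rightarrow> bool" where
  "polish_code T c \<longleftrightarrow>
     (\<forall>b. (\<forall>n. \<exists>x\<in>topspace T. \<forall>i<n. c x i = b i) \<longrightarrow> (\<exists>x\<in>topspace T. c x = b)) \<and>
     (\<forall>U x. openin T U \<longrightarrow> x \<in> U \<longrightarrow> (\<exists>n. \<forall>y\<in>topspace T. (\<forall>i<n. c y i = c x i) \<longrightarrow> y \<in> U))"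

definition code_clopen :: "'a topology \<Rightarrow> ('a \<Rightarrow> nat \<Rightarrow> nat) \<Rightarrow> 'a set \<Rightarrow> bool" where
  "code_clopen T c B \<longleftrightarrow>
     (\<forall>x\<in>topspace T. \<exists>n. \<forall>y\<in>topspace T. (\<forall>i<n. c y i = c x i) \<longrightarrow> (y \<in> B \<longleftrightarrow> x \<in> B))"

lemma polish_code_limit:
  assumes "polish_code T c" "\<And>n. \<exists>x\<in>topspace T. \<forall>i<n. c x i = b i"
  obtains x where "x \<in> topspace T" "c x = b"
  using assms unfolding polish_code_def by (metis (no_types))

lemma polish_code_nhd:
  assumes "polish_code T c" "openin T U" "x \<in> U"
  obtains n where "\<And>y. y \<in> topspace T \<Longrightarrow> \<forall>i<n. c y i = c x i \<Longrightarrow> y \<in> U"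
  using assms unfolding polish_code_def by (metis (no_types))

lemma code_clopenD:
  assumes "code_clopen T c B" "x \<in> topspace T"
  obtains n where "\<And>y. y \<in> topspace T \<Longrightarrow> \<forall>i<n. c y i = c x i \<Longrightarrow> y \<in> B \<longleftrightarrow> x \<in> B"
  using assms unfolding code_clopen_def by (metis (no_types))

lemma code_clopen_cong:
  assumes "\<And>x. x \<in> topspace T \<Longrightarrow> x \<in> A \<longleftrightarrow> x \<in> B"
  shows "code_clopen T c A \<longleftrightarrow> code_clopen T c B"
  unfolding code_clopen_def using assms by (intro ball_cong refl ex_cong1) auto

section \<open>Countable joins of codes\<close>

definition join_codes :: "(nat \<Rightarrow> 'a \<Rightarrow> nat \<Rightarrow> nat) \<Rightarrow> 'a \<Rightarrow> nat \<Rightarrow> nat" where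
  "join_codes c x i = c (fst (prod_decode i)) x (snd (prod_decode i))"

text \<open>The prefix has to reach past the encodings of the pairs (k, j) with j < n; their sum is
  a convenient upper bound.\<close>

lemma join_codes_agree:
  "\<exists>N. \<forall>b b'. (\<forall>i<N. b i = b' i) \<longrightarrow> (\<forall>j<n. b (prod_encode (k, j)) = (b' (prod_encode (k, j)) :: nat))"
proof (intro exI allI impI)
  fix b b' :: "nat \<Rightarrow> nat" and j
  assume *: "\<forall>i<Suc (\<Sum>j<n. prod_encode (k, j)). b i = b' i" and "j < n"
  then have "prod_encode (k, j) \<le> (\<Sum>j<n. prod_encode (k, j))"
    by (intro member_le_sum) auto
  with * show "b (prod_encode (k, j)) = b' (prod_encode (k, j))" by simp
qed

lemma join_codes_part: "join_codes c x (prod_encode (k, j)) = c k x j"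
  by (simp add: join_codes_def)

lemma code_clopen_join:
  assumes "code_clopen T (c k) B"
  shows "code_clopen T (join_codes c) B"
  unfolding code_clopen_def
proof
  fix x assume "x \<in> topspace T"
  then obtain n where n: "\<And>y. y \<in> topspace T \<Longrightarrow> \<forall>i<n. c k y i = c k x i \<Longrightarrow> y \<in> B \<longleftrightarrow> x \<in> B"
    by (rule code_clopenD[OF assms]) blast
  obtain N where N: "\<And>b b' :: nat \<Rightarrow> nat. (\<forall>i<N. b i = b' i) \<Longrightarrow> \<forall>j<n. b (prod_encode (k, j)) = b' (prod_encode (k, j))"
    using join_codes_agree by metis
  show "\<exists>n. \<forall>y\<in>topspace T. (\<forall>i<n. join_codes c y i = join_codes c x i) \<longrightarrow> (y \<in> B \<longleftrightarrow> x \<in> B)"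
  proof (intro exI ballI impI)
    fix y assume "y \<in> topspace T" "\<forall>i<N. join_codes c y i = join_codes c x i"
    with n N[of "join_codes c y" "join_codes c x"] show "y \<in> B \<longleftrightarrow> x \<in> B"
      unfolding join_codes_part by blast
  qed
qed

text \<open>The limits produced by the component codes coincide: an approximant agreeing with a long
  prefix lies near two of them at once, which is impossible for distinct points of a Hausdorff
  space. Thus the join describes the diagonal and its image stays closed.\<close>

lemma polish_code_join:
  assumes T: "Hausdorff_space T" and c: "\<And>k. polish_code T (c k)"
  shows "polish_code T (join_codes c)"
  unfolding polish_code_def
proof (intro conjI allI impI)
  fix b assume b: "\<forall>n. \<exists>x\<in>topspace T. \<forall>i<n. join_codes c x i = b i"
  have near: "\<exists>x\<in>topspace T. \<forall>j<n. c k x j = b (prod_encode (k, j)) \<and> c l x j = b (prod_encode (l, j))"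
    for k l n
  proof -
    obtain N where N: "\<And>b b' :: nat \<Rightarrow> nat. (\<forall>i<N. b i = b' i) \<Longrightarrow> \<forall>j<n. b (prod_encode (k, j)) = b' (prod_encode (k, j))"
      using join_codes_agree by metis
    obtain N' where N': "\<And>b b' :: nat \<Rightarrow> nat. (\<forall>i<N'. b i = b' i) \<Longrightarrow> \<forall>j<n. b (prod_encode (l, j)) = b' (prod_encode (l, j))"
      using join_codes_agree by metis
    obtain x where x: "x \<in> topspace T" "\<forall>i<max N N'. join_codes c x i = b i"
      using b[rule_format, of "max N N'"] by blast
    show ?thesis
    proof (intro bexI allI impI conjI)
      show "x \<in> topspace T" by (rule x)
      show "c k x j = b (prod_encode (k, j))" if "j < n" for j
        using x(2) N[of "join_codes c x" b] that unfolding join_codes_part by simp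
      show "c l x j = b (prod_encode (l, j))" if "j < n" for j
        using x(2) N'[of "join_codes c x" b] that unfolding join_codes_part by simp
    qed
  qed
  have "\<exists>z\<in>topspace T. c k z = (\<lambda>j. b (prod_encode (k, j)))" for k
  proof -
    have "\<exists>x\<in>topspace T. \<forall>i<n. c k x i = b (prod_encode (k, i))" for n
      using near[of n k k] by blast
    then show ?thesis by (rule polish_code_limit[OF c[of k]]) blast+
  qed
  then obtain z where z: "\<And>k. z k \<in> topspace T" "\<And>k. c k (z k) = (\<lambda>j. b (prod_encode (k, j)))"
    by metis
  have eq: "z k = z 0" for k
  proof (rule ccontr)
    assume ne: "z k \<noteq> z 0"
    obtain U V where UV: "openin T U" "openin T V" "z k \<in> U" "z 0 \<in> V" "disjnt U V"
      using T z(1) ne unfolding Hausdorff_space_def by metis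
    obtain n1 where n1: "\<And>y. y \<in> topspace T \<Longrightarrow> \<forall>i<n1. c k y i = c k (z k) i \<Longrightarrow> y \<in> U"
      by (rule polish_code_nhd[OF c[of k] UV(1,3)]) blast
    obtain n2 where n2: "\<And>y. y \<in> topspace T \<Longrightarrow> \<forall>i<n2. c 0 y i = c 0 (z 0) i \<Longrightarrow> y \<in> V"
      by (rule polish_code_nhd[OF c[of 0] UV(2,4)]) blast
    obtain x where x: "x \<in> topspace T" "\<forall>j<max n1 n2. c k x j = b (prod_encode (k, j)) \<and> c 0 x j = b (prod_encode (0, j))"
      using near[of "max n1 n2" k 0] by blast
    have "x \<in> U" using x by (intro n1) (auto simp: z(2))
    moreover have "x \<in> V" using x by (intro n2) (auto simp: z(2))
    ultimately show False using UV(5) by (auto simp: disjnt_iff)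
  qed
  have "join_codes c (z 0) i = b i" for i
    using z(2)[of "fst (prod_decode i)"] eq[of "fst (prod_decode i)"]
    by (metis join_codes_def prod.collapse prod_decode_inverse)
  then show "\<exists>x\<in>topspace T. join_codes c x = b" using z(1) by blast
next
  fix U x assume U: "openin T U" "x \<in> U"
  obtain n where n: "\<And>y. y \<in> topspace T \<Longrightarrow> \<forall>i<n. c 0 y i = c 0 x i \<Longrightarrow> y \<in> U"
    by (rule polish_code_nhd[OF c[of 0] U]) blast
  obtain N where N: "\<And>b b' :: nat \<Rightarrow> nat. (\<forall>i<N. b i = b' i) \<Longrightarrow> \<forall>j<n. b (prod_encode (0, j)) = b' (prod_encode (0, j))"
    using join_codes_agree by metis
  show "\<exists>n. \<forall>y\<in>topspace T. (\<forall>i<n. join_codes c y i = join_codes c x i) \<longrightarrow> y \<in> U"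
  proof (intro exI ballI impI)
    fix y assume "y \<in> topspace T" "\<forall>i<N. join_codes c y i = join_codes c x i"
    with n N[of "join_codes c y" "join_codes c x"] show "y \<in> U"
      unfolding join_codes_part by blast
  qed
qed

definition case_code :: "('a \<Rightarrow> nat) \<Rightarrow> ('a \<Rightarrow> nat \<Rightarrow> nat) \<Rightarrow> 'a \<Rightarrow> nat \<Rightarrow> nat" where
  "case_code v c x i = (case i of 0 \<Rightarrow> v x | Suc j \<Rightarrow> c x j)"

lemma case_code_simps [simp]: "case_code v c x 0 = v x" "case_code v c x (Suc j) = c x j"
  by (simp_all add: case_code_def)

text \<open>In the join of the codes the union is only open. A further leading coordinate, 1 plus
  the least k with x in \<open>B k\<close> or else 0, makes it clopen. The image stays closed
  because near a limit point the first few memberships are constant, which forces the recorded index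
  to be that of the limit.\<close>

lemma code_exists_UN:
  fixes c :: "nat \<Rightarrow> 'a \<Rightarrow> nat \<Rightarrow> nat"
  assumes T: "Hausdorff_space T" and c: "\<And>k. polish_code T (c k)" "\<And>k. code_clopen T (c k) (B k)"
  shows "\<exists>c. polish_code T c \<and> code_clopen T c (\<Union>k. B k)"
proof -
  define j where "j = join_codes c"
  have j: "polish_code T j" "\<And>k. code_clopen T j (B k)"
    unfolding j_def using polish_code_join[OF T c(1)] code_clopen_join[OF c(2)] by auto
  define v where "v x = (if \<exists>k. x \<in> B k then Suc (LEAST k. x \<in> B k) else 0)" for x
  have "polish_code T (case_code v j)"
    unfolding polish_code_def
  proof (intro conjI allI impI)
    fix b assume b: "\<forall>n. \<exists>x\<in>topspace T. \<forall>i<n. case_code v j x i = b i"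
    have near: "\<exists>x\<in>topspace T. v x = b 0 \<and> (\<forall>i<n. j x i = b (Suc i))" for n
      using b[rule_format, of "Suc n"] by force
    have "\<exists>x\<in>topspace T. \<forall>i<n. j x i = b (Suc i)" for n using near[of n] by blast
    then obtain x where x: "x \<in> topspace T" "j x = (\<lambda>i. b (Suc i))"
      by (rule polish_code_limit[OF j(1)]) blast+
    \<comment> \<open>A single membership is decided by finitely many coordinates around x, hence so
      are the first m together. Infinitely many cannot be decided at once, but each conclusion below
      uses finitely many.\<close>
    have dec: "\<exists>n. \<forall>y\<in>topspace T. (\<forall>i<n. j y i = b (Suc i)) \<longrightarrow> (\<forall>k<m. y \<in> B k \<longleftrightarrow> x \<in> B k)" for m
    proof (induction m)
      case (Suc m)
      then obtain n where n: "\<forall>y\<in>topspace T. (\<forall>i<n. j y i = b (Suc i)) \<longrightarrow> (\<forall>k<m. y \<in> B k \<longleftrightarrow> x \<in> B k)"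
        by blast
      obtain n' where "\<And>y. y \<in> topspace T \<Longrightarrow> \<forall>i<n'. j y i = j x i \<Longrightarrow> (y \<in> B m \<longleftrightarrow> x \<in> B m)"
        by (rule code_clopenD[OF j(2)[of m] x(1)]) blast
      with n show ?case by (intro exI[of _ "max n n'"]) (auto simp: x(2) less_Suc_eq)
    qed simp
    have "v x = b 0"
    proof (cases "b 0")
      case 0
      have "x \<notin> B k" for k
      proof -
        obtain n where n: "\<forall>y\<in>topspace T. (\<forall>i<n. j y i = b (Suc i)) \<longrightarrow> (\<forall>l<Suc k. y \<in> B l \<longleftrightarrow> x \<in> B l)"
          using dec[of "Suc k"] by blast
        obtain y where y: "y \<in> topspace T" "v y = b 0" "\<forall>i<n. j y i = b (Suc i)" using near[of n] by blast
        then have "y \<notin> B k" using 0 by (auto simp: v_def split: if_splits)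
        then show ?thesis using n y by blast
      qed
      then show ?thesis using 0 by (simp add: v_def)
    next
      case (Suc k)
      obtain n where n: "\<forall>y\<in>topspace T. (\<forall>i<n. j y i = b (Suc i)) \<longrightarrow> (\<forall>l<Suc k. y \<in> B l \<longleftrightarrow> x \<in> B l)"
        using dec[of "Suc k"] by blast
      obtain y where y: "y \<in> topspace T" "v y = b 0" "\<forall>i<n. j y i = b (Suc i)" using near[of n] by blast
      then have same: "\<forall>l<Suc k. y \<in> B l \<longleftrightarrow> x \<in> B l" using n by blast
      have ex: "\<exists>k. y \<in> B k" and k: "(LEAST k. y \<in> B k) = k"
        using y(2) Suc by (auto simp: v_def split: if_splits)
      have yk: "y \<in> B k" using ex k LeastI_ex by metis
      have yl: "y \<notin> B l" if "l < k" for l using that k not_less_Least by blast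
      have "x \<in> B k" "\<And>l. l < k \<Longrightarrow> x \<notin> B l" using same yk yl by auto
      then have "(LEAST k. x \<in> B k) = k" by (intro Least_equality) (auto simp: not_less[symmetric])
      then show ?thesis using Suc \<open>x \<in> B k\<close> by (auto simp: v_def)
    qed
    then have "case_code v j x i = b i" for i by (cases i) (simp_all add: x)
    then show "\<exists>x\<in>topspace T. case_code v j x = b" using x(1) by blast
  next
    fix U x assume "openin T U" "x \<in> U"
    then obtain n where "\<And>y. y \<in> topspace T \<Longrightarrow> \<forall>i<n. j y i = j x i \<Longrightarrow> y \<in> U"
      by (rule polish_code_nhd[OF j(1)]) blast
    then show "\<exists>n. \<forall>y\<in>topspace T. (\<forall>i<n. case_code v j y i = case_code v j x i) \<longrightarrow> y \<in> U"
      by (intro exI[of _ "Suc n"]) (metis Suc_mono case_code_simps(2))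
  qed
  moreover have "code_clopen T (case_code v j) (\<Union>k. B k)"
    unfolding code_clopen_def by (intro ballI exI[of _ 1]) (auto simp: v_def split: if_splits)
  ultimately show ?thesis by blast
qed

text \<open>Closures of a countable base: regularity inserts such a closure between a point and any
  neighbourhood. Closed members are wanted because a limit inherits membership in them.\<close>

lemma countable_closed_base:
  assumes "regular_space T" "second_countable T"
  obtains F :: "nat \<Rightarrow> 'a set" where "\<And>k. closedin T (F k)"
    "\<And>U x. openin T U \<Longrightarrow> x \<in> U \<Longrightarrow> \<exists>k. x \<in> F k \<and> F k \<subseteq> U"
proof -
  from assms(2) obtain \<B> where "countable \<B>"
      and \<B>': "\<forall>U x. openin T U \<and> x \<in> U \<longrightarrow> (\<exists>V\<in>\<B>. x \<in> V \<and> V \<subseteq> U)"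
    unfolding second_countable_def by (elim exE conjE)
  then have \<B>: "countable \<B>" "\<And>U x. openin T U \<Longrightarrow> x \<in> U \<Longrightarrow> \<exists>V\<in>\<B>. x \<in> V \<and> V \<subseteq> U"
    by simp_all
  define F where "F k = T closure_of (from_nat_into \<B> k)" for k
  have "\<exists>k. x \<in> F k \<and> F k \<subseteq> U" if U: "openin T U" "x \<in> U" for U x
  proof -
    obtain V C where V: "openin T V" "closedin T C" "x \<in> V" "V \<subseteq> C" "C \<subseteq> U"
      using assms(1) U unfolding neighbourhood_base_of_closedin[symmetric] neighbourhood_base_of
      by meson
    obtain B where B: "B \<in> \<B>" "x \<in> B" "B \<subseteq> V" using \<B>(2)[OF V(1,3)] by blast
    have "T closure_of B \<subseteq> C" using B V by (intro closure_of_minimal) auto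
    moreover have "x \<in> T closure_of B"
      using B V(1) by (meson closure_of_subset openin_subset subset_iff subset_trans)
    moreover have "from_nat_into \<B> (to_nat_on \<B> B) = B" using \<B>(1) B(1) by simp
    ultimately show ?thesis using V by (intro exI[of _ "to_nat_on \<B> B"]) (auto simp: F_def)
  qed
  then show ?thesis using that[of F] by (simp add: F_def)
qed

text \<open>The coordinates record, for each member of a closed base, whether a point belongs to it or else
  a disjoint member of the base containing the point; least witnesses make membership of the limit
  agree with membership of the approximants.\<close>

lemma polish_base_code:
  assumes "completely_metrizable_space T" "second_countable T"
  shows "\<exists>c F. polish_code T c \<and> (\<forall>k. closedin T (F k) \<and> code_clopen T c (F k)) \<and>
     (\<forall>U x. openin T U \<longrightarrow> x \<in> U \<longrightarrow> (\<exists>k::nat. x \<in> F k \<and> F k \<subseteq> U))"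
proof -
  obtain M d where "Metric_space M d" and com: "Metric_space.mcomplete M d"
    and T: "T = Metric_space.mtopology M d"
    using assms(1) unfolding completely_metrizable_space_def by blast
  then interpret Metric_space M d by simp
  have "regular_space T"
    using assms(1) completely_metrizable_imp_metrizable_space metrizable_imp_regular_space by blast
  from countable_closed_base[OF this assms(2)]
  obtain F :: "nat \<Rightarrow> 'a set" where F: "\<And>k. closedin T (F k)"
    and base: "\<And>U x. openin T U \<Longrightarrow> x \<in> U \<Longrightarrow> \<exists>k. x \<in> F k \<and> F k \<subseteq> U"
    by (metis (no_types, lifting))
  have M: "topspace T = M" by (simp add: T)
  \<comment> \<open>The value 0 marks membership in \<open>F k\<close>; a positive value is the
    successor of a witness, so the two cases cannot be confused.\<close>
  define v where "v x k = (if x \<in> F k then 0 else Suc (LEAST w. x \<in> F w \<and> F w \<inter> F k = {}))" for x k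
  define small where "small n w \<longleftrightarrow> (\<forall>y\<in>F w. \<forall>z\<in>F w. d y z < inverse (real (Suc n)))" for n w
  \<comment> \<open>This coordinate makes the approximants of a limit a Cauchy sequence;
    completeness of d then supplies the point.\<close>
  define s where "s x n = (LEAST w. x \<in> F w \<and> small n w)" for x n
  have vw: "x \<in> F (LEAST w. x \<in> F w \<and> F w \<inter> F k = {}) \<and> F (LEAST w. x \<in> F w \<and> F w \<inter> F k = {}) \<inter> F k = {}"
    if "x \<in> M" "x \<notin> F k" for x k
  proof -
    have "openin T (M - F k)" using F[of k] M by (metis closedin_def)
    then obtain w where "x \<in> F w" "F w \<subseteq> M - F k"
      using base[of "M - F k" x] \<open>x \<in> M\<close> \<open>x \<notin> F k\<close> by blast
    then show ?thesis by (intro LeastI_ex[of "\<lambda>w. x \<in> F w \<and> F w \<inter> F k = {}"]) auto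
  qed
  have sw: "x \<in> F (s x n) \<and> small n (s x n)" if "x \<in> M" for x n
  proof -
    let ?e = "inverse (real (Suc n)) / 2"
    obtain w where w: "x \<in> F w" "F w \<subseteq> mball x ?e"
      using base[of "mball x ?e" x] \<open>x \<in> M\<close> by (auto simp: T openin_mball)
    have "d y z < inverse (real (Suc n))" if "y \<in> F w" "z \<in> F w" for y z
    proof -
      have "y \<in> mball x ?e" "z \<in> mball x ?e" using w that by auto
      then have "d x y < ?e" "d x z < ?e" "y \<in> M" "z \<in> M" by auto
      then show ?thesis using triangle[of y x z] \<open>x \<in> M\<close> commute[of x y] by linarith
    qed
    then have "small n w" by (simp add: small_def)
    then show ?thesis unfolding s_def using w LeastI[of "\<lambda>w. x \<in> F w \<and> small n w" w] by simp
  qed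
  define c where "c x i = (if even i then v x (i div 2) else s x (i div 2))" for x i
  have cv: "c x (2 * k) = v x k" and cs: "c x (Suc (2 * k)) = s x k" for x k
    by (simp_all add: c_def)
  have clop: "code_clopen T c (F k)" for k
    unfolding code_clopen_def
  proof (intro ballI exI impI)
    fix x y assume "\<forall>i<Suc (2 * k). c y i = c x i"
    then have "v y k = v x k" using cv by (metis lessI)
    then show "y \<in> F k \<longleftrightarrow> x \<in> F k" by (auto simp: v_def split: if_splits)
  qed
  have code: "polish_code T c"
    unfolding polish_code_def
  proof (intro conjI allI impI)
    fix b assume "\<forall>n. \<exists>x\<in>topspace T. \<forall>i<n. c x i = b i"
    then obtain x where x: "\<And>n. x n \<in> M" "\<And>n i. i < n \<Longrightarrow> c (x n) i = b i"
      unfolding M by metis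
    have xv: "v (x n) k = b (2 * k)" if "2 * k < n" for n k using x(2)[OF that] cv by simp
    have xs: "s (x n) k = b (Suc (2 * k))" if "Suc (2 * k) < n" for n k using x(2)[OF that] cs by simp
    have "MCauchy x"
      unfolding MCauchy_def
    proof (intro conjI allI impI)
      fix e :: real assume "e > 0"
      then obtain k where k: "inverse (real (Suc k)) < e" using reals_Archimedean by blast
      have "d (x n) (x m) < e" if "n \<ge> Suc (Suc (2 * k))" "m \<ge> Suc (Suc (2 * k))" for n m
      proof -
        have "s (x n) k = b (Suc (2 * k))" "s (x m) k = b (Suc (2 * k))" using xs that by auto
        then have "x n \<in> F (b (Suc (2 * k)))" "x m \<in> F (b (Suc (2 * k)))" "small k (b (Suc (2 * k)))"
          using sw[OF x(1)[of n], of k] sw[OF x(1)[of m], of k] by auto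
        then show ?thesis using k unfolding small_def by force
      qed
      then show "\<exists>N. \<forall>n n'. N \<le> n \<longrightarrow> N \<le> n' \<longrightarrow> d (x n) (x n') < e" by blast
    qed (use x(1) in auto)
    then obtain z where z: "limitin T x z sequentially"
      using com unfolding mcomplete_def T by blast
    then have zM: "z \<in> M" using limitin_topspace M by metis
    have mem: "z \<in> F k" if "x n \<in> F k" "2 * k < n" for k n
    proof (rule limitin_closedin[OF z F])
      have "v (x n) k = 0" using that by (simp add: v_def)
      then have "b (2 * k) = 0" using xv that by simp
      then have "x m \<in> F k" if "2 * k < m" for m using xv[OF that] by (auto simp: v_def split: if_splits)
      then show "\<forall>\<^sub>F m in sequentially. x m \<in> F k"
        unfolding eventually_sequentially by (intro exI[of _ "Suc (2 * k)"]) auto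
    qed simp
    have nmem: "z \<notin> F k" if "x n \<notin> F k" "2 * k < n" for k n
    proof -
      let ?L = "\<lambda>x. LEAST w. x \<in> F w \<and> F w \<inter> F k = {}"
      have L: "x m \<notin> F k \<and> ?L (x m) = ?L (x n)" if "2 * k < m" for m
        using xv[OF that] xv[OF \<open>2 * k < n\<close>] \<open>x n \<notin> F k\<close> by (auto simp: v_def split: if_splits)
      define w where "w = ?L (x n)"
      \<comment> \<open>At stage m the coordinate of k still prescribes the witness w, and the
        coordinate of w is already fixed, so membership in the closed set \<open>F w\<close> passes
        to z.\<close>
      define m where "m = Suc (max (2 * w) (2 * k))"
      have m: "2 * k < m" "2 * w < m" unfolding m_def by auto
      have "x m \<in> F w \<and> F w \<inter> F k = {}"
        using vw[OF x(1), of m k] L[OF m(1)] by (simp add: w_def)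
      then show ?thesis using mem[of m w] m by auto
    qed
    have iff: "x n \<in> F k \<longleftrightarrow> z \<in> F k" if "2 * k < n" for k n
      using mem nmem that by blast
    have vz: "v z k = b (2 * k)" for k
    proof (cases "z \<in> F k")
      case True
      then show ?thesis using iff[of k "Suc (2 * k)"] xv[of k "Suc (2 * k)"] by (simp add: v_def)
    next
      case False
      define w where "w = (LEAST w. z \<in> F w \<and> F w \<inter> F k = {})"
      \<comment> \<open>The index n exceeds the positions of k, of the witness w of z and of the
        prescribed witness \<open>b (2 * k) - 1\<close>. The points \<open>x n\<close> and z have
        the same memberships in all three sets, so each least witness is also a witness for the
        other point.\<close>
      define n where "n = Suc (2 * k + 2 * w + 2 * (b (2 * k)))"
      have n: "2 * k < n" "2 * w < n" "2 * b (2 * k) < n" unfolding n_def by auto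
      have xn: "x n \<notin> F k" using iff[OF n(1)] False by simp
      define w' where "w' = (LEAST w. x n \<in> F w \<and> F w \<inter> F k = {})"
      have b: "b (2 * k) = Suc w'" using xv[OF n(1)] xn by (simp add: v_def w'_def)
      have w1: "z \<in> F w \<and> F w \<inter> F k = {}" using vw[OF zM False] by (simp add: w_def)
      have w2: "x n \<in> F w' \<and> F w' \<inter> F k = {}" using vw[OF x(1) xn] by (simp add: w'_def)
      have "w' \<le> w" unfolding w'_def using w1 iff[OF n(2)] by (intro Least_le) auto
      moreover have "w \<le> w'" unfolding w_def using w2 iff[of w' n] n(3) b by (intro Least_le) auto
      ultimately show ?thesis using b False by (simp add: v_def w_def)
    qed
    have sz: "s z k = b (Suc (2 * k))" for k
    proof -
      define n where "n = Suc (Suc (2 * k) + 2 * s z k + 2 * (b (Suc (2 * k))))"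
      have n: "Suc (2 * k) < n" "2 * s z k < n" "2 * b (Suc (2 * k)) < n" unfolding n_def by auto
      have b: "s (x n) k = b (Suc (2 * k))" using xs[OF n(1)] .
      have "s (x n) k \<le> s z k"
        unfolding s_def[of "x n"] using sw[OF zM, of k] iff[OF n(2)] by (intro Least_le) auto
      moreover have "s z k \<le> s (x n) k"
        unfolding s_def[of z] using sw[OF x(1), of n k] iff[of "s (x n) k" n] n(3) b
        by (intro Least_le) auto
      ultimately show ?thesis using b by simp
    qed
    have "c z i = b i" for i
      unfolding c_def using vz[of "i div 2"] sz[of "i div 2"] by auto
    then show "\<exists>x\<in>topspace T. c x = b" using zM M by blast
  next
    fix U x assume U: "openin T U" "x \<in> U"
    then obtain k where k: "x \<in> F k" "F k \<subseteq> U" using base by blast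
    have "x \<in> topspace T" using U openin_subset by blast
    then obtain n where "\<And>y. y \<in> topspace T \<Longrightarrow> \<forall>i<n. c y i = c x i \<Longrightarrow> (y \<in> F k \<longleftrightarrow> x \<in> F k)"
      by (rule code_clopenD[OF clop[of k]]) blast
    then show "\<exists>n. \<forall>y\<in>topspace T. (\<forall>i<n. c y i = c x i) \<longrightarrow> y \<in> U" using k by blast
  qed
  show ?thesis using code F clop base by blast
qed

section \<open>Borel sets as clopen sets of a code\<close>

lemma space_borel_of [simp]: "space (borel_of T) = topspace T"
  unfolding borel_of_def by (intro space_measure_of) (auto dest: openin_subset)

lemma sets_borel_of: "sets (borel_of T) = sigma_sets (topspace T) {U. openin T U}"
  unfolding borel_of_def by (intro sets_measure_of) (auto dest: openin_subset)

lemma borel_of_open: "openin T U \<Longrightarrow> U \<in> sets (borel_of T)"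
  by (simp add: sets_borel_of sigma_sets.Basic)

lemma borel_of_closed: "closedin T C \<Longrightarrow> C \<in> sets (borel_of T)"
  by (metis borel_of_open closedin_def double_diff openin_subset sets.compl_sets space_borel_of subset_refl)

text \<open>Induction over the generated sigma-algebra: an open set is a countable union of members
  of a clopen base, complements keep the same code, and countable unions change the code.\<close>

lemma borel_set_code:
  assumes T: "completely_metrizable_space T" "second_countable T" and B: "B \<in> sets (borel_of T)"
  shows "\<exists>c. polish_code T c \<and> code_clopen T c B"
proof -
  have H: "Hausdorff_space T"
    using T(1) completely_metrizable_imp_metrizable_space metrizable_imp_Hausdorff_space by blast
  obtain c and F :: "nat \<Rightarrow> _" where c: "polish_code T c" "\<And>k. code_clopen T c (F k)"
    and base: "\<And>U x. openin T U \<Longrightarrow> x \<in> U \<Longrightarrow> \<exists>k. x \<in> F k \<and> F k \<subseteq> U"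
    using polish_base_code[OF T] by blast
  have empty: "code_clopen T c {}" by (simp add: code_clopen_def)
  have "B \<in> sigma_sets (topspace T) {U. openin T U}" using B by (simp add: sets_borel_of)
  then show ?thesis
  proof induction
    case (Basic U)
    have "code_clopen T c (if F k \<subseteq> U then F k else {})" for k using c(2) empty by simp
    moreover have "(\<Union>k. if F k \<subseteq> U then F k else {}) = U" using base[of U] Basic by auto
    ultimately show ?case
      using code_exists_UN[OF H, of "\<lambda>_. c" "\<lambda>k. if F k \<subseteq> U then F k else {}"] c(1) by simp
  next
    case Empty
    then show ?case using c(1) empty by blast
  next
    case (Compl a)
    then obtain c where c: "polish_code T c" "code_clopen T c a" by blast
    have "code_clopen T c (topspace T - a)"
      unfolding code_clopen_def
    proof
      fix x assume x: "x \<in> topspace T"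
      then obtain n where "\<And>y. y \<in> topspace T \<Longrightarrow> \<forall>i<n. c y i = c x i \<Longrightarrow> y \<in> a \<longleftrightarrow> x \<in> a"
        by (rule code_clopenD[OF c(2)]) blast
      then show "\<exists>n. \<forall>y\<in>topspace T. (\<forall>i<n. c y i = c x i) \<longrightarrow>
          (y \<in> topspace T - a \<longleftrightarrow> x \<in> topspace T - a)" using x by (intro exI[of _ n]) blast
    qed
    then show ?case using c by blast
  next
    case (Union a)
    then obtain c where "\<And>k. polish_code T (c k)" "\<And>k. code_clopen T (c k) (a k)" by metis
    then show ?case by (rule code_exists_UN[OF H])
  qed
qed

text \<open>The situation after the topology has been replaced by a code for which B and the
  preimages of a countable point-separating family E are clopen: r then behaves like a continuous
  injection on a closed subset of the Baire space.\<close>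

locale borel_injection =
  fixes T :: "'a topology" and c :: "'a \<Rightarrow> nat \<Rightarrow> nat" and B :: "'a set" and r :: "'a \<Rightarrow> 'b"
    and N :: "'b measure" and E :: "nat \<Rightarrow> 'b set"
  assumes c: "polish_code T c" and B: "code_clopen T c B" "B \<subseteq> topspace T"
    and E: "\<And>k. E k \<in> sets N" "\<And>k. code_clopen T c {x. r x \<in> E k}"
    and sep: "\<And>y y'. y \<in> space N \<Longrightarrow> y' \<in> space N \<Longrightarrow> y \<noteq> y' \<Longrightarrow> \<exists>k. (y \<in> E k) \<noteq> (y' \<in> E k)"
    and r: "inj_on r B" "r ` B \<subseteq> space N"
begin

definition cyl :: "nat list \<Rightarrow> 'a set" where
  "cyl s = {x \<in> B. \<forall>i<length s. c x i = s ! i}"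

definition separated :: "'b set \<Rightarrow> 'b set \<Rightarrow> bool" where
  "separated X Y \<longleftrightarrow> (\<exists>D\<in>sets N. X \<subseteq> D \<and> D \<inter> Y = {})"

lemma cyl_UN: "cyl s = (\<Union>k. cyl (s @ [k]))"
  unfolding cyl_def by (auto simp: nth_append less_Suc_eq)

lemma cyl_subset: "cyl (s @ t) \<subseteq> cyl s"
  unfolding cyl_def by (auto simp: nth_append)

text \<open>The separator is the union over k of the intersections over l of the separators given
  for the pairs.\<close>

lemma separated_UN:
  assumes "\<And>k l. separated (X k) (Y l)"
  shows "separated (\<Union>k::nat. X k) (\<Union>l::nat. Y l)"
proof -
  obtain D where D: "\<And>k l. D k l \<in> sets N" "\<And>k l. X k \<subseteq> D k l" "\<And>k l. D k l \<inter> Y l = {}"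
    using assms unfolding separated_def by metis
  have "(\<Union>k. \<Inter>l. D k l) \<in> sets N" using D(1) by auto
  moreover have "(\<Union>k. X k) \<subseteq> (\<Union>k. \<Inter>l. D k l)" using D(2) by blast
  moreover have "(\<Union>k. \<Inter>l. D k l) \<inter> (\<Union>l. Y l) = {}" using D(3) by blast
  ultimately show ?thesis unfolding separated_def by blast
qed

text \<open>The limit stays in B since B is clopen for the code, and the clopen preimages of the
  sets \<open>E k\<close> turn convergence in the code into eventual agreement in every
  \<open>E k\<close>.\<close>

lemma branch_point:
  assumes "\<And>n. cyl (map b [0..<n]) \<noteq> {}"
  obtains x where "x \<in> B" "c x = b"
    "\<And>k. \<exists>n. \<forall>m\<ge>n. \<forall>y\<in>cyl (map b [0..<m]). r y \<in> E k \<longleftrightarrow> r x \<in> E k"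
proof -
  have "\<exists>x\<in>topspace T. \<forall>i<n. c x i = b i" for n
    using assms[of n] B(2) unfolding cyl_def by fastforce
  then obtain x where x: "x \<in> topspace T" "c x = b"
    by (rule polish_code_limit[OF c]) blast+
  obtain n where n: "\<And>y. y \<in> topspace T \<Longrightarrow> \<forall>i<n. c y i = c x i \<Longrightarrow> y \<in> B \<longleftrightarrow> x \<in> B"
    by (rule code_clopenD[OF B(1) x(1)]) blast
  obtain y where "y \<in> B" "\<forall>i<n. c y i = b i"
    using assms[of n] unfolding cyl_def by auto
  then have xB: "x \<in> B" using n[of y] B(2) x(2) by auto
  have "\<exists>n. \<forall>m\<ge>n. \<forall>y\<in>cyl (map b [0..<m]). r y \<in> E k \<longleftrightarrow> r x \<in> E k" for k
  proof -
    obtain n where n: "\<And>y. y \<in> topspace T \<Longrightarrow> \<forall>i<n. c y i = c x i \<Longrightarrow>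
        y \<in> {x. r x \<in> E k} \<longleftrightarrow> x \<in> {x. r x \<in> E k}"
      by (rule code_clopenD[OF E(2)[of k] x(1)]) blast
    show ?thesis
    proof (intro exI allI impI ballI)
      fix m y assume "n \<le> m" "y \<in> cyl (map b [0..<m])"
      then have "y \<in> topspace T" "\<forall>i<n. c y i = c x i" using B(2) x(2) by (auto simp: cyl_def)
      then show "r y \<in> E k \<longleftrightarrow> r x \<in> E k" using n[of y] by simp
    qed
  qed
  then show ?thesis using that xB x(2) by blast
qed

text \<open>Lusin's argument. By \<open>separated_UN\<close> a pair of cylinders that is not
  separated has a pair of extensions that is not separated; iterating gives two branches with
  distinct limits. By injectivity the limits have different images, some \<open>E k\<close> tells
  these apart, and it already separates the cylinders at a finite stage.\<close>

lemma separated_cyl: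
  assumes st: "length s = length t" "s \<noteq> t"
  shows "separated (r ` cyl s) (r ` cyl t)"
proof (rule ccontr)
  assume ns: "\<not> separated (r ` cyl s) (r ` cyl t)"
  let ?ns = "\<lambda>p. \<not> separated (r ` cyl (fst p)) (r ` cyl (snd p))"
  have step: "\<exists>q. ?ns q \<and> (\<exists>k l. q = (fst p @ [k], snd p @ [l]))" if "?ns p" for p
  proof (rule ccontr)
    assume "\<nexists>q. ?ns q \<and> (\<exists>k l. q = (fst p @ [k], snd p @ [l]))"
    then have "separated (r ` cyl (fst p @ [k])) (r ` cyl (snd p @ [l]))" for k l by auto
    then have "separated (\<Union>k. r ` cyl (fst p @ [k])) (\<Union>l. r ` cyl (snd p @ [l]))"
      by (rule separated_UN)
    then show False using that cyl_UN[of "fst p"] cyl_UN[of "snd p"] by (metis image_UN)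
  qed
  have "\<exists>u. \<forall>n. (?ns (u n) \<and> (n = 0 \<longrightarrow> u n = (s, t))) \<and>
     (\<exists>k l. u (Suc n) = (fst (u n) @ [k], snd (u n) @ [l]))"
    using ns step by (intro dependent_nat_choice) (fastforce)+
  then obtain u where u: "\<And>n. ?ns (u n)" "u 0 = (s, t)"
      "\<And>n. \<exists>k l. u (Suc n) = (fst (u n) @ [k], snd (u n) @ [l])" by metis
  \<comment> \<open>Lists that grow by one entry at a time are the prefixes of one sequence.\<close>
  have branch: "\<exists>b. \<forall>n. w n = map b [0..<length (w 0) + n]"
    if w: "\<And>n. \<exists>k. w (Suc n) = w n @ [k]" for w :: "nat \<Rightarrow> nat list"
  proof -
    have len: "length (w n) = length (w 0) + n" for n
    proof (induction n)
      case (Suc n)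
      then show ?case using w[of n] by auto
    qed simp
    define b where "b i = w (Suc i) ! i" for i
    have pre: "\<exists>v. w (n + m) = w n @ v" for n m
    proof (induction m)
      case (Suc m)
      then show ?case using w[of "n + m"] by auto
    qed simp
    have "w n ! i = b i" if "i < length (w n)" for n i
    proof (cases "n \<le> Suc i")
      case True
      then obtain v where "w (Suc i) = w n @ v" using pre[of n "Suc i - n"] by auto
      then show ?thesis using that by (simp add: b_def nth_append)
    next
      case False
      then obtain v where "w n = w (Suc i) @ v" using pre[of "Suc i" "n - Suc i"] by auto
      then show ?thesis using len[of "Suc i"] by (simp add: b_def nth_append)
    qed
    then have "w n = map b [0..<length (w 0) + n]" for n
      using len[of n] by (intro nth_equalityI) auto
    then show ?thesis by blast
  qed
  obtain b1 where b1: "\<And>n. fst (u n) = map b1 [0..<length s + n]"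
    using branch[of "\<lambda>n. fst (u n)"] u(2,3) by (metis fst_conv)
  obtain b2 where b2: "\<And>n. snd (u n) = map b2 [0..<length t + n]"
    using branch[of "\<lambda>n. snd (u n)"] u(2,3) by (metis snd_conv)
  \<comment> \<open>An empty image is separated from anything, so the cylinders along both branches
    are nonempty and the limits exist.\<close>
  have nonempty: "cyl (map b1 [0..<n]) \<noteq> {}" "cyl (map b2 [0..<n]) \<noteq> {}" for n
  proof -
    have "separated {} X" "X \<subseteq> space N \<Longrightarrow> separated X {}" for X
      unfolding separated_def by (blast intro: sets.empty_sets sets.top)+
    moreover have "r ` cyl s \<subseteq> space N" for s using r(2) by (auto simp: cyl_def)
    ultimately have "cyl (fst (u n)) \<noteq> {}" "cyl (snd (u n)) \<noteq> {}"
      using u(1)[of n] by (metis image_empty)+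
    moreover have "map b [0..<length s + n] = map b [0..<n] @ map b [n..<length s + n]" for b :: "nat \<Rightarrow> nat" and s :: "nat list"
      using upt_add_eq_append[of 0 n "length s"] by (simp add: add.commute)
    ultimately show "cyl (map b1 [0..<n]) \<noteq> {}" "cyl (map b2 [0..<n]) \<noteq> {}"
      unfolding b1 b2 using cyl_subset by (metis subset_empty)+
  qed
  obtain x where x: "x \<in> B" "c x = b1"
    "\<And>k. \<exists>n. \<forall>m\<ge>n. \<forall>y\<in>cyl (map b1 [0..<m]). r y \<in> E k \<longleftrightarrow> r x \<in> E k"
    using branch_point[OF nonempty(1)] by blast
  obtain z where z: "z \<in> B" "c z = b2"
    "\<And>k. \<exists>n. \<forall>m\<ge>n. \<forall>y\<in>cyl (map b2 [0..<m]). r y \<in> E k \<longleftrightarrow> r z \<in> E k"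
    using branch_point[OF nonempty(2)] by blast
  have "map b1 [0..<length s] \<noteq> map b2 [0..<length t]"
    using b1[of 0] b2[of 0] u(2) st(2) by simp
  then have "x \<noteq> z" using x(2) z(2) st(1) by auto
  then have "r x \<noteq> r z" using r(1) x(1) z(1) by (auto dest: inj_onD)
  then obtain k where k: "(r x \<in> E k) \<noteq> (r z \<in> E k)" using sep x(1) z(1) r(2) by blast
  obtain n1 where n1: "\<forall>m\<ge>n1. \<forall>y\<in>cyl (map b1 [0..<m]). r y \<in> E k \<longleftrightarrow> r x \<in> E k" using x(3) by blast
  obtain n2 where n2: "\<forall>m\<ge>n2. \<forall>y\<in>cyl (map b2 [0..<m]). r y \<in> E k \<longleftrightarrow> r z \<in> E k" using z(3) by blast
  define n where "n = max n1 n2"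
  have 1: "\<forall>y\<in>cyl (fst (u n)). r y \<in> E k \<longleftrightarrow> r x \<in> E k"
    unfolding b1 using n1[rule_format, of "length s + n"] by (simp add: n_def)
  have 2: "\<forall>y\<in>cyl (snd (u n)). r y \<in> E k \<longleftrightarrow> r z \<in> E k"
    unfolding b2 using n2[rule_format, of "length t + n"] by (simp add: n_def)
  define D where "D = (if r x \<in> E k then E k else space N - E k)"
  have "D \<in> sets N" using E(1) by (auto simp: D_def)
  moreover have "r ` cyl (fst (u n)) \<subseteq> D" using 1 r(2) unfolding D_def cyl_def by auto
  moreover have "D \<inter> r ` cyl (snd (u n)) = {}" using 2 k unfolding D_def by auto
  ultimately show False using u(1)[of n] unfolding separated_def by blast
qed

text \<open>Images of cylinders of equal length can be enclosed in disjoint Borel sets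
  \<open>G s\<close>. A point of the resulting set R selects one cylinder of each length, these are
  nested, and the limit of the branch is its preimage, since no \<open>E k\<close> distinguishes the
  point from the image of the limit.\<close>

lemma image_measurable: "r ` B \<in> sets N"
proof -
  have "\<exists>D. D \<in> sets N \<and> (length s = length t \<and> s \<noteq> t \<longrightarrow> r ` cyl s \<subseteq> D \<and> D \<inter> r ` cyl t = {})" for s t
    using separated_cyl[of s t] unfolding separated_def by (cases "length s = length t \<and> s \<noteq> t") auto
  then obtain D where D: "\<And>s t. D s t \<in> sets N"
      "\<And>s t. length s = length t \<Longrightarrow> s \<noteq> t \<Longrightarrow> r ` cyl s \<subseteq> D s t \<and> D s t \<inter> r ` cyl t = {}" by metis
  \<comment> \<open>Adds to the envelope whatever \<open>E k\<close> decides on the whole cylinder;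
    an undecided \<open>E k\<close> gives no restriction.\<close>
  define side where "side s k = (if r ` cyl s \<subseteq> E k then E k
     else if r ` cyl s \<inter> E k = {} then space N - E k else space N)" for s k
  \<comment> \<open>Empty cylinders receive an empty envelope, so membership in \<open>G\<close>
    along a branch forces its cylinders to be nonempty.\<close>
  define G where "G s = (if cyl s = {} then {} else
     space N \<inter> (\<Inter>k. side s k) \<inter> (\<Inter>t. if length t = length s \<and> t \<noteq> s then D s t - D t s else space N))" for s
  have G: "G s \<in> sets N" for s
  proof -
    have "(\<Inter>k. side s k) \<in> sets N"
      by (rule sets.countable_INT') (use E(1) in \<open>auto simp: side_def\<close>)
    moreover have "(\<Inter>t. if length t = length s \<and> t \<noteq> s then D s t - D t s else space N) \<in> sets N"
      by (rule sets.countable_INT') (use D(1) in auto)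
    ultimately have "space N \<inter> (\<Inter>k. side s k) \<inter>
        (\<Inter>t. if length t = length s \<and> t \<noteq> s then D s t - D t s else space N) \<in> sets N"
      by (intro sets.Int sets.top)
    then show ?thesis unfolding G_def by (cases "cyl s = {}") simp_all
  qed
  have cylG: "r ` cyl s \<subseteq> G s" for s
  proof (cases "cyl s = {}")
    case False
    have "r ` cyl s \<subseteq> side s k" for k using r(2) by (auto simp: side_def cyl_def)
    moreover have "r ` cyl s \<subseteq> (if length t = length s \<and> t \<noteq> s then D s t - D t s else space N)" for t
    proof (cases "length t = length s \<and> t \<noteq> s")
      case True
      then have "r ` cyl s \<subseteq> D s t" "D t s \<inter> r ` cyl s = {}"
        using D(2)[of s t] D(2)[of t s] by auto
      then show ?thesis using True by auto
    qed (use r(2) in \<open>auto simp: cyl_def\<close>)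
    moreover have "r ` cyl s \<subseteq> space N" using r(2) by (auto simp: cyl_def)
    ultimately show ?thesis using False unfolding G_def by (simp only: if_False Int_subset_iff INT_greatest)
  qed simp
  have Gdisj: "s = t" if "length s = length t" "y \<in> G s" "y \<in> G t" for s t y
  proof (rule ccontr)
    assume ne: "s \<noteq> t"
    have "y \<in> D s t - D t s"
      using that(1,2) ne INT_E[of y "\<lambda>t. if length t = length s \<and> t \<noteq> s then D s t - D t s else space N" UNIV t]
      unfolding G_def by (auto split: if_splits)
    moreover have "y \<in> D t s - D s t"
      using that(1,3) ne INT_E[of y "\<lambda>s. if length s = length t \<and> s \<noteq> t then D t s - D s t else space N" UNIV s]
      unfolding G_def by (auto split: if_splits)
    ultimately show False by blast
  qed
  \<comment> \<open>Only countably many lists occur, and the envelopes of a given length are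
    disjoint. So the set is Borel although it describes a union over uncountably many
    branches.\<close>
  define R where "R = (\<Inter>n. \<Union>s\<in>{s. length s = n}. \<Inter>m\<in>{..n}. G (take m s))"
  have "R \<in> sets N"
    unfolding R_def using G
    by (intro sets.countable_INT' image_subsetI sets.countable_UN' sets.finite_INT) auto
  moreover have "r ` B = R"
  proof (intro equalityI subsetI)
    fix y assume "y \<in> r ` B"
    then obtain x where x: "x \<in> B" "y = r x" by blast
    have "\<exists>s\<in>{s. length s = n}. \<forall>m\<in>{..n}. y \<in> G (take m s)" for n
    proof (intro bexI ballI)
      fix m assume "m \<in> {..n}"
      have "x \<in> cyl (take m (map (c x) [0..<n]))" using x(1) by (simp add: cyl_def)
      then show "y \<in> G (take m (map (c x) [0..<n]))" using cylG x(2) by blast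
    qed simp
    then show "y \<in> R" unfolding R_def by (intro INT_I) (simp only: UN_iff INT_iff)
  next
    fix y assume y: "y \<in> R"
    then have "\<exists>s. length s = n \<and> (\<forall>m\<le>n. y \<in> G (take m s))" for n
      unfolding R_def by (auto dest!: spec[of _ n])
    then obtain s where s: "\<And>n. length (s n) = n" "\<And>n m. m \<le> n \<Longrightarrow> y \<in> G (take m (s n))" by metis
    have take: "take m (s n) = s m" if "m \<le> n" for m n
      using Gdisj[of "take m (s n)" "s m" y] s(1)[of m] s(1)[of n] s(2)[OF that] s(2)[of m m] that by simp
    define b where "b i = s (Suc i) ! i" for i
    have sb: "s n = map b [0..<n]" for n
    proof (intro nth_equalityI)
      fix i assume "i < length (s n)"
      then have "Suc i \<le> n" using s(1) by simp
      then show "s n ! i = map b [0..<n] ! i"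
        using take[of "Suc i" n] nth_take[of i "Suc i" "s n"] by (simp add: b_def)
    qed (simp add: s(1))
    have yG: "y \<in> G (map b [0..<n])" for n using s(2)[of n n] s(1)[of n] sb[of n] by simp
    then have "cyl (map b [0..<n]) \<noteq> {}" for n by (metis G_def empty_iff)
    then obtain x where x: "x \<in> B" "c x = b"
      "\<And>k. \<exists>n. \<forall>m\<ge>n. \<forall>y\<in>cyl (map b [0..<m]). r y \<in> E k \<longleftrightarrow> r x \<in> E k"
      using branch_point by blast
    have "y \<in> space N" using yG[of 0] G sets.sets_into_space by blast
    have "y = r x"
    proof (rule ccontr)
      assume "y \<noteq> r x"
      then obtain k where k: "(y \<in> E k) \<noteq> (r x \<in> E k)"
        using sep \<open>y \<in> space N\<close> x(1) r(2) by blast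
      obtain n where n: "\<forall>z\<in>cyl (map b [0..<n]). r z \<in> E k \<longleftrightarrow> r x \<in> E k" using x(3)[of k] by blast
      have "y \<in> side (map b [0..<n]) k" using yG[of n] unfolding G_def by (auto split: if_splits)
      moreover have "x \<in> cyl (map b [0..<n])" using x(1,2) by (simp add: cyl_def)
      moreover from this n have "r ` cyl (map b [0..<n]) \<subseteq> E k \<longleftrightarrow> r x \<in> E k"
        "r ` cyl (map b [0..<n]) \<inter> E k = {} \<longleftrightarrow> r x \<notin> E k" by blast+
      ultimately show False using k unfolding side_def by (simp split: if_splits)
    qed
    then show "y \<in> r ` B" using x(1) by blast
  qed
  ultimately show ?thesis by simp
qed

end

text \<open>The Lusin--Souslin theorem: one joined code makes B and the preimages of a countable
  closed base of N clopen, which reduces the claim to \<open>borel_injection\<close>.\<close>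

lemma standard_borel_injective_image:
  assumes M: "standard_borel M" and N: "standard_borel N" and r: "r \<in> measurable M N"
    and B: "B \<in> sets M" "inj_on r B"
  shows "r ` B \<in> sets N"
proof -
  obtain T where T: "topspace T = space M" "completely_metrizable_space T" "second_countable T"
      "sets M = sets (borel_of T)" using M unfolding standard_borel_def by blast
  obtain S where S: "topspace S = space N" "completely_metrizable_space S" "second_countable S"
      "sets N = sets (borel_of S)" using N unfolding standard_borel_def by blast
  have H: "Hausdorff_space T" "regular_space S" "Hausdorff_space S"
    using T(2) S(2) completely_metrizable_imp_metrizable_space metrizable_imp_Hausdorff_space
      metrizable_imp_regular_space by blast+
  obtain E :: "nat \<Rightarrow> _" where E: "\<And>k. closedin S (E k)"
    "\<And>U x. openin S U \<Longrightarrow> x \<in> U \<Longrightarrow> \<exists>k. x \<in> E k \<and> E k \<subseteq> U"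
    using countable_closed_base[OF H(2) S(3)] by metis
  have EN: "E k \<in> sets N" for k using borel_of_closed[OF E(1)] S(4) by simp
  define C where "C k = (case k of 0 \<Rightarrow> B | Suc j \<Rightarrow> r -` E j \<inter> space M)" for k
  have "\<exists>c. polish_code T c \<and> code_clopen T c (C k)" for k
    using B(1) measurable_sets[OF r EN] T by (intro borel_set_code) (auto simp: C_def split: nat.split)
  then obtain c where c: "\<And>k. polish_code T (c k)" "\<And>k. code_clopen T (c k) (C k)" by metis
  interpret borel_injection T "join_codes c" B r N E
  proof
    show "polish_code T (join_codes c)" by (rule polish_code_join[OF H(1) c(1)])
    show "code_clopen T (join_codes c) B"
      using code_clopen_join[where c = c and k = 0, OF c(2)] unfolding C_def nat.case(1) .
    show "B \<subseteq> topspace T" using B(1) T(1) sets.sets_into_space by auto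
    show "E k \<in> sets N" for k by (rule EN)
    show "code_clopen T (join_codes c) {x. r x \<in> E k}" for k
    proof (rule code_clopen_cong[THEN iffD1])
      show "code_clopen T (join_codes c) (C (Suc k))" by (rule code_clopen_join[where c = c and k = "Suc k", OF c(2)])
      show "x \<in> C (Suc k) \<longleftrightarrow> x \<in> {x. r x \<in> E k}" if "x \<in> topspace T" for x
        using that T(1) by (simp add: C_def)
    qed
    show "\<exists>k. (y \<in> E k) \<noteq> (y' \<in> E k)" if "y \<in> space N" "y' \<in> space N" "y \<noteq> y'" for y y'
    proof -
      obtain U V where U: "openin S U" "y \<in> U" and V: "y' \<in> V" "disjnt U V"
        using H(3) \<open>y \<in> space N\<close> \<open>y' \<in> space N\<close> \<open>y \<noteq> y'\<close>
        unfolding Hausdorff_space_def S(1) by metis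
      obtain k where "y \<in> E k" "E k \<subseteq> U" using E(2)[OF U] by blast
      then show ?thesis using V by (intro exI[of _ k]) (auto simp: disjnt_iff)
    qed
    show "inj_on r B" by (rule B)
    show "r ` B \<subseteq> space N"
      using sets.sets_into_space[OF B(1)] measurable_space[OF r] by blast
  qed
  show ?thesis by (rule image_measurable)
qed

section \<open>Measured groupoids and factor maps\<close>

lemma the_inv_into_vimage:
  assumes "inj_on s f" "A \<subseteq> f"
  shows "the_inv_into f s -` A \<inter> s ` f = s ` A"
  using assms by (auto simp: the_inv_into_f_f subset_iff image_iff)

text \<open>Preimages under the inverse map are images under s, and these are Borel by
  Lusin--Souslin.\<close>

lemma measurable_inj_borel_iso:
  assumes "standard_borel M" "s \<in> measurable M M" "f \<in> sets M" "inj_on s f"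
  shows "borel_iso_onto_image M s f"
  unfolding borel_iso_onto_image_def
proof (intro conjI)
  show "inj_on s f" by (rule assms(4))
  have im: "s ` f \<in> sets M" by (rule standard_borel_injective_image[OF assms(1,1,2,3,4)])
  have sp: "f \<subseteq> space M" "s ` f \<subseteq> space M" using assms(3) im sets.sets_into_space by auto
  show "s \<in> measurable (restrict_space M f) (restrict_space M (s ` f))"
    using sp by (intro measurable_restrict_space3 assms(2)) auto
  show "the_inv_into f s \<in> measurable (restrict_space M (s ` f)) (restrict_space M f)"
  proof (rule measurableI)
    fix x assume "x \<in> space (restrict_space M (s ` f))"
    then show "the_inv_into f s x \<in> space (restrict_space M f)"
      using sp the_inv_into_into[OF assms(4) _ subset_refl] by (auto simp: space_restrict_space)
  next
    fix A assume "A \<in> sets (restrict_space M f)"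
    then have A: "A \<in> sets M" "A \<subseteq> f"
      using assms(3) by (auto simp: sets_restrict_space_iff)
    have "inj_on s A" using assms(4) A(2) inj_on_subset by blast
    then have "s ` A \<in> sets M" by (rule standard_borel_injective_image[OF assms(1,1,2) A(1)])
    moreover have "the_inv_into f s -` A \<inter> space (restrict_space M (s ` f)) = s ` A"
      using the_inv_into_vimage[OF assms(4) A(2)] sp by (simp add: space_restrict_space Int_absorb2)
    ultimately show "the_inv_into f s -` A \<inter> space (restrict_space M (s ` f)) \<in> sets (restrict_space M (s ` f))"
      using im A(2) by (auto simp: sets_restrict_space_iff)
  qed
qed

section \<open>Groupoids with an invariant probability measure on the units\<close>

locale pmp_gpd =
  fixes G :: "'a top_groupoid" and \<mu> :: "'a measure"
  assumes pmp: "pmp_groupoid G (borel_of (gtop G)) \<mu>"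
begin

abbreviation "M \<equiv> borel_of (gtop G)"

sublocale prob_space \<mu> using pmp unfolding pmp_groupoid_def by blast

lemma groupoid: "is_groupoid G" and meas_groupoid: "discrete_measurable_groupoid G M"
  using pmp unfolding pmp_groupoid_def discrete_measurable_groupoid_def discrete_groupoid_def by auto

lemma space_mu: "space \<mu> = units G" using pmp unfolding pmp_groupoid_def by blast
lemma standard: "standard_borel M"
  and topspace_arrows [simp]: "topspace (gtop G) = arrows G"
  and units_measurable: "units G \<in> sets M"
  and src_measurable: "src G \<in> measurable M M"
  and rng_measurable: "rng G \<in> measurable M M"
  using meas_groupoid unfolding discrete_measurable_groupoid_def by auto

lemma units_subset: "units G \<subseteq> arrows G" by (auto simp: units_def)

lemma sets_mu: "A \<in> sets \<mu> \<longleftrightarrow> A \<in> sets M \<and> A \<subseteq> units G"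
proof -
  have "sets \<mu> = sets (restrict_space M (units G))" using pmp unfolding pmp_groupoid_def by blast
  then show ?thesis using units_measurable units_subset
    by (auto simp: sets_restrict_space_iff Int_absorb2)
qed

lemma src_units: "g \<in> arrows G \<Longrightarrow> src G g \<in> units G"
  and rng_units: "g \<in> arrows G \<Longrightarrow> rng G g \<in> units G"
  and inv_arrow: "g \<in> arrows G \<Longrightarrow> ginv G g \<in> arrows G"
  and src_inv: "g \<in> arrows G \<Longrightarrow> src G (ginv G g) = rng G g"
  and rng_inv: "g \<in> arrows G \<Longrightarrow> rng G (ginv G g) = src G g"
  and mult_src: "g \<in> arrows G \<Longrightarrow> gmult G g (src G g) = g"
  and mult_rng: "g \<in> arrows G \<Longrightarrow> gmult G (rng G g) g = g"
  and mult_inv: "g \<in> arrows G \<Longrightarrow> gmult G g (ginv G g) = rng G g"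
  and inv_mult: "g \<in> arrows G \<Longrightarrow> gmult G (ginv G g) g = src G g"
  and rng_unit: "x \<in> units G \<Longrightarrow> rng G x = x"
  using groupoid unfolding is_groupoid_def by blast+

lemma src_unit: "x \<in> units G \<Longrightarrow> src G x = x" by (simp add: units_def)

lemma mult_arrow: "g \<in> arrows G \<Longrightarrow> h \<in> arrows G \<Longrightarrow> src G g = rng G h \<Longrightarrow> gmult G g h \<in> arrows G"
  and mult_src_rng: "g \<in> arrows G \<Longrightarrow> h \<in> arrows G \<Longrightarrow> src G g = rng G h \<Longrightarrow>
    src G (gmult G g h) = src G h \<and> rng G (gmult G g h) = rng G g"
  using groupoid unfolding is_groupoid_def composable_def by blast+

lemma mult_assoc:
  "g \<in> arrows G \<Longrightarrow> h \<in> arrows G \<Longrightarrow> k \<in> arrows G \<Longrightarrow> src G g = rng G h \<Longrightarrow> src G h = rng G k \<Longrightarrow>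
    gmult G (gmult G g h) k = gmult G g (gmult G h k)"
  using groupoid unfolding is_groupoid_def composable_def by blast

lemma arrows_subset: "B \<in> sets M \<Longrightarrow> B \<subseteq> arrows G"
  using sets.sets_into_space[of B M] by simp

lemma src_image: "B \<in> sets M \<Longrightarrow> inj_on (src G) B \<Longrightarrow> src G ` B \<in> sets \<mu>"
  using standard_borel_injective_image[OF standard standard src_measurable] arrows_subset src_units
  unfolding sets_mu by blast

lemma rng_image: "B \<in> sets M \<Longrightarrow> inj_on (rng G) B \<Longrightarrow> rng G ` B \<in> sets \<mu>"
  using standard_borel_injective_image[OF standard standard rng_measurable] arrows_subset rng_units
  unfolding sets_mu by blast

text \<open>The source and range maps restricted to a Borel set on which they are injective are
  Borel isomorphisms onto their images by Lusin--Souslin, so only injectivity has to be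
  checked.\<close>

lemma pseudogroup_iff:
  "f \<in> pseudogroup G M \<longleftrightarrow> f \<in> sets M \<and> inj_on (src G) f \<and> inj_on (rng G) f"
  unfolding pseudogroup_def
  using arrows_subset measurable_inj_borel_iso[OF standard src_measurable]
    measurable_inj_borel_iso[OF standard rng_measurable]
  by (auto simp: borel_iso_onto_image_def)

lemma fibre_count:
  assumes "inj_on s B"
  shows "emeasure (count_space UNIV) {g \<in> B. s g = x} = indicator (s ` B) x"
proof (cases "x \<in> s ` B")
  case True
  then obtain g where "{g \<in> B. s g = x} = {g}" using assms by (auto simp: inj_on_def)
  then show ?thesis using True by (simp add: emeasure_count_space_finite)
next
  case False
  then have "{g \<in> B. s g = x} = {}" by auto
  then show ?thesis using False by (simp only: emeasure_empty indicator_simps not_False_eq_True)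
qed

lemma source_mass_inj:
  assumes "B \<in> sets M" "inj_on (src G) B"
  shows "source_mass G \<mu> B = emeasure \<mu> (src G ` B)"
  using src_image[OF assms] by (simp add: source_mass_def fibre_count[OF assms(2)])

lemma range_mass_inj:
  assumes "B \<in> sets M" "inj_on (rng G) B"
  shows "range_mass G \<mu> B = emeasure \<mu> (rng G ` B)"
  using rng_image[OF assms] by (simp add: range_mass_def fibre_count[OF assms(2)])

text \<open>For an injective map the fibre count is an indicator, so the two masses equated by
  invariance are the measures of the two images. All later uses of invariance pass through this
  equation.\<close>

lemma measure_src_rng:
  assumes "f \<in> pseudogroup G M"
  shows "measure \<mu> (src G ` f) = measure \<mu> (rng G ` f)"
proof -
  have "source_mass G \<mu> f = range_mass G \<mu> f"
    using assms pmp unfolding pmp_groupoid_def pseudogroup_iff by blast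
  then show ?thesis
    using assms unfolding pseudogroup_iff by (simp add: source_mass_inj range_mass_inj measure_def)
qed

lemma pseudogroup_subset: "f \<in> pseudogroup G M \<Longrightarrow> A \<in> sets M \<Longrightarrow> A \<subseteq> f \<Longrightarrow> A \<in> pseudogroup G M"
  unfolding pseudogroup_iff using inj_on_subset by blast

lemma units_pseudogroup: "units G \<in> pseudogroup G M"
  unfolding pseudogroup_iff using units_measurable src_unit rng_unit by (auto simp: inj_on_def)

lemma src_vimage: "A \<in> sets M \<Longrightarrow> {g \<in> arrows G. src G g \<in> A} \<in> sets M"
  using measurable_sets[OF src_measurable, of A] by (simp add: vimage_def Int_def conj_commute)

lemma rng_vimage: "A \<in> sets M \<Longrightarrow> {g \<in> arrows G. rng G g \<in> A} \<in> sets M"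
  using measurable_sets[OF rng_measurable, of A] by (simp add: vimage_def Int_def conj_commute)

end

section \<open>Class-bijective factor maps and the partial action on the units\<close>

locale pmp_factor_map = G: pmp_gpd G \<mu> + H: pmp_gpd H \<nu>
  for G :: "'g top_groupoid" and \<mu> and H :: "'h top_groupoid" and \<nu> +
  fixes \<pi> :: "'g \<Rightarrow> 'h"
  assumes factor: "pmp_factor G \<mu> H \<nu> \<pi>"
begin

lemma pi_arrow: "g \<in> arrows G \<Longrightarrow> \<pi> g \<in> arrows H"
  and pi_unit: "x \<in> units G \<Longrightarrow> \<pi> x \<in> units H"
  and src_pi: "g \<in> arrows G \<Longrightarrow> src H (\<pi> g) = \<pi> (src G g)"
  and rng_pi: "g \<in> arrows G \<Longrightarrow> rng H (\<pi> g) = \<pi> (rng G g)"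
  using factor unfolding pmp_factor_def class_bijective_factor_def groupoid_morphism_def by blast+

lemma pi_mult: "g \<in> arrows G \<Longrightarrow> h \<in> arrows G \<Longrightarrow> src G g = rng G h \<Longrightarrow>
    \<pi> (gmult G g h) = gmult H (\<pi> g) (\<pi> h)"
  using factor unfolding pmp_factor_def class_bijective_factor_def groupoid_morphism_def composable_def
  by blast

lemma pi_measurable: "\<pi> \<in> measurable G.M H.M"
  using factor unfolding pmp_factor_def by blast

lemma src_bij: "a \<in> units G \<Longrightarrow> bij_betw \<pi> {g \<in> arrows G. src G g = a} {h \<in> arrows H. src H h = \<pi> a}"
  and rng_bij: "a \<in> units G \<Longrightarrow> bij_betw \<pi> {g \<in> arrows G. rng G g = a} {h \<in> arrows H. rng H h = \<pi> a}"
  using factor unfolding pmp_factor_def class_bijective_factor_def by blast+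

definition lift :: "'h set \<Rightarrow> 'g set" where
  "lift f = {g \<in> arrows G. \<pi> g \<in> f}"

lemma lift_measurable: "f \<in> sets H.M \<Longrightarrow> lift f \<in> sets G.M"
  using measurable_sets[OF pi_measurable, of f] by (simp add: lift_def vimage_def Int_def conj_commute)

lemma unit_vimage_measurable: "B \<in> sets \<nu> \<Longrightarrow> {x \<in> units G. \<pi> x \<in> B} \<in> sets \<mu>"
proof -
  assume "B \<in> sets \<nu>"
  then have "lift B \<inter> units G \<in> sets G.M"
    using lift_measurable G.units_measurable H.sets_mu by blast
  moreover have "lift B \<inter> units G = {x \<in> units G. \<pi> x \<in> B}"
    using G.units_subset by (auto simp: lift_def)
  ultimately show ?thesis unfolding G.sets_mu by auto
qed

lemma measure_vimage: "B \<in> sets \<nu> \<Longrightarrow> measure \<mu> {x \<in> units G. \<pi> x \<in> B} = measure \<nu> B"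
proof -
  assume "B \<in> sets \<nu>"
  then have "emeasure \<nu> B = emeasure \<mu> (\<pi> -` B \<inter> units G)"
    using factor unfolding pmp_factor_def by blast
  moreover have "\<pi> -` B \<inter> units G = {x \<in> units G. \<pi> x \<in> B}" by auto
  ultimately show ?thesis by (simp add: measure_def)
qed

text \<open>Equal sources in G give equal sources in H, hence the same arrow of f; injectivity of
  \<pi> on the source fibre finishes. Thus sections lift to sections, and the action is obtained
  from subsets of G.\<close>

lemma lift_inj_src:
  assumes "f \<subseteq> arrows H" "inj_on (src H) f"
  shows "inj_on (src G) (lift f)"
proof (rule inj_onI)
  fix g h assume gh: "g \<in> lift f" "h \<in> lift f" "src G g = src G h"
  then have "src H (\<pi> g) = src H (\<pi> h)" by (simp add: lift_def src_pi)
  then have "\<pi> g = \<pi> h" using assms(2) gh by (auto simp: lift_def dest: inj_onD)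
  moreover have "src G h \<in> units G" using gh by (simp add: lift_def G.src_units)
  ultimately show "g = h"
    using gh src_bij[of "src G h"] by (auto simp: lift_def bij_betw_def dest: inj_onD)
qed

lemma lift_inj_rng:
  assumes "f \<subseteq> arrows H" "inj_on (rng H) f"
  shows "inj_on (rng G) (lift f)"
proof (rule inj_onI)
  fix g h assume gh: "g \<in> lift f" "h \<in> lift f" "rng G g = rng G h"
  then have "rng H (\<pi> g) = rng H (\<pi> h)" by (simp add: lift_def rng_pi)
  then have "\<pi> g = \<pi> h" using assms(2) gh by (auto simp: lift_def dest: inj_onD)
  moreover have "rng G h \<in> units G" using gh by (simp add: lift_def G.rng_units)
  ultimately show "g = h"
    using gh rng_bij[of "rng G h"] by (auto simp: lift_def bij_betw_def dest: inj_onD)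
qed

text \<open>Surjectivity of \<pi> on source fibres lifts the arrow of f starting at \<pi> x to an
  arrow starting at x.\<close>

lemma lift_src: "x \<in> units G \<Longrightarrow> f \<subseteq> arrows H \<Longrightarrow> x \<in> src G ` lift f \<longleftrightarrow> \<pi> x \<in> src H ` f"
proof
  assume "x \<in> units G" "x \<in> src G ` lift f"
  then show "\<pi> x \<in> src H ` f" by (auto simp: lift_def src_pi[symmetric])
next
  assume x: "x \<in> units G" and f: "f \<subseteq> arrows H" and "\<pi> x \<in> src H ` f"
  then obtain h where h: "h \<in> f" "src H h = \<pi> x" by auto
  then have "h \<in> \<pi> ` {g \<in> arrows G. src G g = x}"
    using src_bij[OF x] f by (auto simp: bij_betw_def)
  then show "x \<in> src G ` lift f" using h by (auto simp: lift_def)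
qed

lemma lift_pseudogroup: "f \<in> pseudogroup H H.M \<Longrightarrow> lift f \<in> pseudogroup G G.M"
  unfolding H.pseudogroup_iff G.pseudogroup_iff
  using lift_measurable lift_inj_src lift_inj_rng H.arrows_subset by blast

abbreviation "ac \<equiv> act G H \<pi>"

lemma act_None: "ac f x = None \<longleftrightarrow> \<pi> x \<notin> src H ` f"
  by (simp add: act_def)

text \<open>Uniqueness of the lifted arrow makes the definite description in \<open>act\<close>
  meaningful.\<close>

lemma act_eq:
  assumes f: "f \<subseteq> arrows H" "inj_on (src H) f" and g: "g \<in> arrows G" "\<pi> g \<in> f"
  shows "ac f (src G g) = Some (rng G g)"
proof -
  have "(THE g'. g' \<in> arrows G \<and> \<pi> g' \<in> f \<and> src G g' = src G g) = g"
    using lift_inj_src[OF f] g by (intro the_equality) (auto simp: lift_def dest: inj_onD)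
  moreover have "\<pi> (src G g) \<in> src H ` f" using g by (auto simp: src_pi[symmetric])
  ultimately show ?thesis by (simp add: act_def)
qed

lemma act_Some:
  assumes f: "f \<subseteq> arrows H" "inj_on (src H) f" and x: "x \<in> units G"
  shows "ac f x = Some y \<longleftrightarrow> (\<exists>g\<in>arrows G. \<pi> g \<in> f \<and> src G g = x \<and> rng G g = y)"
proof
  assume y: "ac f x = Some y"
  then have "\<pi> x \<in> src H ` f" using act_None[of f x] by auto
  then obtain g where "g \<in> lift f" "x = src G g" using lift_src[OF x f(1)] by auto
  then show "\<exists>g\<in>arrows G. \<pi> g \<in> f \<and> src G g = x \<and> rng G g = y"
    using act_eq[OF f, of g] y by (auto simp: lift_def)
qed (use act_eq[OF f] in auto)

lemma pseudogroupD:
  assumes "f \<in> pseudogroup H H.M"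
  shows "f \<subseteq> arrows H" "inj_on (src H) f" "inj_on (rng H) f" "f \<in> sets H.M"
  using assms unfolding H.pseudogroup_iff using H.arrows_subset by auto

lemma act_unit: "f \<in> pseudogroup H H.M \<Longrightarrow> x \<in> units G \<Longrightarrow> ac f x = Some y \<Longrightarrow> y \<in> units G"
proof -
  assume "f \<in> pseudogroup H H.M" "x \<in> units G" "ac f x = Some y"
  then show "y \<in> units G"
    using act_Some[OF pseudogroupD(1,2)[OF \<open>f \<in> pseudogroup H H.M\<close>], of x y] G.rng_units by auto
qed

lemma act_inj: "f \<in> pseudogroup H H.M \<Longrightarrow> x \<in> units G \<Longrightarrow> x' \<in> units G \<Longrightarrow>
    ac f x = Some y \<Longrightarrow> ac f x' = Some y \<Longrightarrow> x = x'"
proof -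
  assume f: "f \<in> pseudogroup H H.M" and x: "x \<in> units G" "x' \<in> units G"
    "ac f x = Some y" "ac f x' = Some y"
  obtain g where g: "g \<in> lift f" "src G g = x" "rng G g = y"
    using act_Some[OF pseudogroupD(1,2)[OF f] x(1)] x(3) unfolding lift_def by blast
  obtain h where h: "h \<in> lift f" "src G h = x'" "rng G h = y"
    using act_Some[OF pseudogroupD(1,2)[OF f] x(2)] x(4) unfolding lift_def by blast
  have "g = h" using inj_onD[OF lift_inj_rng[OF pseudogroupD(1,3)[OF f]]] g h by simp
  then show "x = x'" using g h by simp
qed

lemma act_units: "x \<in> units G \<Longrightarrow> ac (units H) x = Some x"
  using act_eq[OF pseudogroupD(1,2)[OF H.units_pseudogroup], of x] G.units_subset
  by (auto simp: G.src_unit G.rng_unit pi_unit)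

lemma act_set_units: "P \<subseteq> units G \<Longrightarrow> act_set G H \<pi> (units H) P = P"
  using act_units by (auto simp: act_set_def subset_iff)

lemma act_set_eq:
  assumes "f \<in> pseudogroup H H.M" "P \<subseteq> units G"
  shows "act_set G H \<pi> f P = rng G ` {g \<in> lift f. src G g \<in> P}"
proof -
  have "act_set G H \<pi> f P = {y. \<exists>x\<in>P. \<exists>g\<in>arrows G. \<pi> g \<in> f \<and> src G g = x \<and> rng G g = y}"
    unfolding act_set_def using act_Some[OF pseudogroupD(1,2)[OF assms(1)]] assms(2)
    by (intro Collect_cong bex_cong refl) auto
  then show ?thesis unfolding lift_def by auto
qed

definition act_vimage :: "'h set \<Rightarrow> 'g set \<Rightarrow> 'g set" where
  "act_vimage f A = {x \<in> units G. \<exists>y\<in>A. ac f x = Some y}"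

lemma act_vimage_eq:
  assumes "f \<in> pseudogroup H H.M"
  shows "act_vimage f A = src G ` {g \<in> lift f. rng G g \<in> A}"
proof -
  have "act_vimage f A = {x \<in> units G. \<exists>y\<in>A. \<exists>g\<in>arrows G. \<pi> g \<in> f \<and> src G g = x \<and> rng G g = y}"
    unfolding act_vimage_def using act_Some[OF pseudogroupD(1,2)[OF assms]] by auto
  then show ?thesis unfolding lift_def using G.src_units by auto
qed

text \<open>The part of the lift of f with source in P is a section. Its range is f . P, its source
  is the part of P over the domain of f, and invariance of \<mu> equates their measures.\<close>

lemma act_set_measurable:
  assumes f: "f \<in> pseudogroup H H.M" and P: "P \<in> sets \<mu>"
  shows "act_set G H \<pi> f P \<in> sets \<mu>"
    and "measure \<mu> (act_set G H \<pi> f P) = measure \<mu> {x \<in> P. \<pi> x \<in> src H ` f}"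
proof -
  let ?B = "{g \<in> lift f. src G g \<in> P}"
  have P': "P \<in> sets G.M" "P \<subseteq> units G" using P G.sets_mu by auto
  have "?B = lift f \<inter> {g \<in> arrows G. src G g \<in> P}" by (auto simp: lift_def)
  then have "?B \<in> sets G.M"
    using lift_measurable[OF pseudogroupD(4)[OF f]] G.src_vimage[OF P'(1)] by auto
  then have B: "?B \<in> pseudogroup G G.M"
    using G.pseudogroup_subset[OF lift_pseudogroup[OF f]] by blast
  then show "act_set G H \<pi> f P \<in> sets \<mu>"
    unfolding act_set_eq[OF f P'(2)] using G.rng_image G.pseudogroup_iff by blast
  have "src G ` ?B = {x \<in> P. x \<in> src G ` lift f}" by auto
  also have "\<dots> = {x \<in> P. \<pi> x \<in> src H ` f}"
    using lift_src[OF _ pseudogroupD(1)[OF f]] P'(2) by blast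
  finally show "measure \<mu> (act_set G H \<pi> f P) = measure \<mu> {x \<in> P. \<pi> x \<in> src H ` f}"
    unfolding act_set_eq[OF f P'(2)] using G.measure_src_rng[OF B] by simp
qed

text \<open>Points of A outside the range of f have no preimage, hence only an inequality of
  measures.\<close>

lemma act_vimage_measurable:
  assumes f: "f \<in> pseudogroup H H.M" and A: "A \<in> sets \<mu>"
  shows "act_vimage f A \<in> sets \<mu>" and "measure \<mu> (act_vimage f A) \<le> measure \<mu> A"
proof -
  let ?B = "{g \<in> lift f. rng G g \<in> A}"
  have A': "A \<in> sets G.M" "A \<subseteq> units G" using A G.sets_mu by auto
  have "?B = lift f \<inter> {g \<in> arrows G. rng G g \<in> A}" by (auto simp: lift_def)
  then have "?B \<in> sets G.M"
    using lift_measurable[OF pseudogroupD(4)[OF f]] G.rng_vimage[OF A'(1)] by auto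
  then have B: "?B \<in> pseudogroup G G.M"
    using G.pseudogroup_subset[OF lift_pseudogroup[OF f]] by blast
  then show "act_vimage f A \<in> sets \<mu>"
    unfolding act_vimage_eq[OF f] using G.src_image G.pseudogroup_iff by blast
  have "measure \<mu> (act_vimage f A) = measure \<mu> (rng G ` ?B)"
    unfolding act_vimage_eq[OF f] using G.measure_src_rng[OF B] by simp
  also have "\<dots> \<le> measure \<mu> A" using A by (intro G.finite_measure_mono) auto
  finally show "measure \<mu> (act_vimage f A) \<le> measure \<mu> A" .
qed

lemma dom_measurable: "f \<in> pseudogroup H H.M \<Longrightarrow> {x \<in> units G. \<pi> x \<in> src H ` f} \<in> sets \<mu>"
  using unit_vimage_measurable H.src_image H.pseudogroup_iff by blast

text \<open>Composable lifts multiply to a lift of the product. Conversely, if the product is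
  defined at x, class-bijectivity lifts its right factor at x and then its left factor at the range
  of that lift. \<open>Option.bind\<close> expresses that the extra symbol is absorbing.\<close>

lemma act_set_mult:
  assumes e: "e \<in> pseudogroup H H.M" and f: "f \<in> pseudogroup H H.M"
    and ef: "set_mult H e f \<in> pseudogroup H H.M" and x: "x \<in> units G"
  shows "ac (set_mult H e f) x = Option.bind (ac f x) (ac e)"
proof -
  have comp: "ac (set_mult H e f) x = Some z" if y: "ac f x = Some y" and z: "ac e y = Some z" for y z
  proof -
    obtain g where g: "g \<in> arrows G" "\<pi> g \<in> f" "src G g = x" "rng G g = y"
      using y act_Some[OF pseudogroupD(1,2)[OF f] x] by blast
    obtain h where h: "h \<in> arrows G" "\<pi> h \<in> e" "src G h = y" "rng G h = z"
      using z act_Some[OF pseudogroupD(1,2)[OF e] act_unit[OF f x y]] by blast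
    have hg: "src G h = rng G g" using g h by simp
    have "(\<pi> h, \<pi> g) \<in> composable H"
      using g h hg by (simp add: composable_def pi_arrow src_pi rng_pi)
    then have "\<pi> (gmult G h g) \<in> set_mult H e f"
      using pi_mult[OF h(1) g(1) hg] g(2) h(2) unfolding set_mult_def by blast
    then show ?thesis
      using act_eq[OF pseudogroupD(1,2)[OF ef] G.mult_arrow[OF h(1) g(1) hg]]
        G.mult_src_rng[OF h(1) g(1) hg] g h by simp
  qed
  have dom: "\<exists>y z. ac f x = Some y \<and> ac e y = Some z" if "ac (set_mult H e f) x \<noteq> None"
  proof -
    have "\<pi> x \<in> src H ` set_mult H e f" using that act_None[of "set_mult H e f" x] by auto
    then obtain e' f' where ef': "e' \<in> e" "f' \<in> f" "e' \<in> arrows H" "f' \<in> arrows H" "src H e' = rng H f'"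
        "\<pi> x = src H (gmult H e' f')" unfolding set_mult_def composable_def by auto
    then have "\<pi> x = src H f'" using H.mult_src_rng by simp
    then have "f' \<in> \<pi> ` {g \<in> arrows G. src G g = x}"
      using src_bij[OF x] ef' by (auto simp: bij_betw_def)
    then obtain g where g: "g \<in> arrows G" "src G g = x" "\<pi> g = f'" by auto
    then have y: "ac f x = Some (rng G g)" using act_eq[OF pseudogroupD(1,2)[OF f] g(1)] ef' by simp
    have "\<pi> (rng G g) \<in> src H ` e" using ef' g rng_pi[OF g(1)] by (metis image_eqI)
    then have "ac e (rng G g) \<noteq> None" using act_None[of e] by blast
    then show ?thesis using y by auto
  qed
  show ?thesis
  proof (cases "ac (set_mult H e f) x")
    case None
    then show ?thesis using comp by (cases "ac f x"; cases "ac e (the (ac f x))") auto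
  next
    case (Some z)
    then obtain y z' where "ac f x = Some y" "ac e y = Some z'" using dom by auto
    then show ?thesis using comp Some by simp
  qed
qed

end

section \<open>Etale groupoids over compact metrizable unit spaces\<close>

locale etale_gpd =
  fixes G :: "'a top_groupoid" and \<mu> :: "'a measure"
  assumes top: "pmp_topological_groupoid G \<mu>" and etale: "etale G"
    and compact: "compact_space (unit_top G)" and metrizable: "metrizable_space (unit_top G)"
begin

sublocale pmp_gpd G \<mu>
  using top unfolding pmp_topological_groupoid_def by unfold_locales blast

abbreviation "X \<equiv> unit_top G"
abbreviation "T \<equiv> gtop G"

lemma topspace_X [simp]: "topspace X = units G"
  using units_subset by (auto simp: unit_top_def)

lemma hausdorff: "Hausdorff_space T"
  and src_continuous: "continuous_map T T (src G)"
  and rng_continuous: "continuous_map T T (rng G)"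
  and inv_continuous: "continuous_map T T (ginv G)"
  and mult_continuous: "continuous_map (subtopology (prod_topology T T) (composable G)) T
       (\<lambda>(g, h). gmult G g h)"
  using top unfolding pmp_topological_groupoid_def discrete_topological_groupoid_def by blast+

lemma hausdorff_X: "Hausdorff_space X"
  using metrizable metrizable_imp_Hausdorff_space by blast

lemma normal_X: "normal_space X"
  using metrizable metrizable_imp_normal_space by blast

lemma src_continuous_X: "continuous_map T X (src G)"
  unfolding unit_top_def using src_continuous src_units by (auto simp: continuous_map_in_subtopology)

lemma rng_continuous_X: "continuous_map T X (rng G)"
  unfolding unit_top_def using rng_continuous rng_units by (auto simp: continuous_map_in_subtopology)

lemma bisection_nhd: "g \<in> arrows G \<Longrightarrow> \<exists>U. bisection G U \<and> g \<in> U"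
  using etale unfolding etale_def by blast

lemma bisectionD:
  assumes "bisection G U"
  shows "openin T U" "U \<subseteq> arrows G" "inj_on (src G) U" "inj_on (rng G) U"
    "openin X (src G ` U)" "openin X (rng G ` U)"
proof -
  show U: "openin T U" "openin X (src G ` U)" "openin X (rng G ` U)"
    using assms unfolding bisection_def by blast+
  show sub: "U \<subseteq> arrows G" using U(1) openin_subset by fastforce
  then have "topspace (subtopology T U) = U" by auto
  then show "inj_on (src G) U" "inj_on (rng G) U"
    using assms homeomorphic_imp_injective_map unfolding bisection_def by metis+
qed

text \<open>Openness is local, and on a bisection s is a homeomorphism onto an open set; s stands
  for \<open>src\<close> or \<open>rng\<close>.\<close>

lemma open_map_bisection:
  assumes s: "\<And>U. bisection G U \<Longrightarrow> openin X (s ` U) \<and>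
      homeomorphic_map (subtopology T U) (subtopology X (s ` U)) s"
    and V: "openin T V"
  shows "openin X (s ` V)"
proof -
  have "\<exists>W. openin X W \<and> y \<in> W \<and> W \<subseteq> s ` V" if y: "y \<in> s ` V" for y
  proof -
    obtain g where g: "g \<in> V" "y = s g" using y by blast
    then have "g \<in> arrows G" using V openin_subset by fastforce
    then obtain U where U: "bisection G U" "g \<in> U" using bisection_nhd by blast
    have "openin (subtopology T U) (U \<inter> V)"
      using V by (metis Int_commute openin_subtopology_Int2)
    then have "openin (subtopology X (s ` U)) (s ` (U \<inter> V))"
      using s[OF U(1)] homeomorphic_imp_open_map open_map_def by blast
    then have "openin X (s ` (U \<inter> V))"
      using s[OF U(1)] by (simp add: openin_open_subtopology)
    then show ?thesis using g U(2) by blast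
  qed
  then show ?thesis by (metis openin_subopen)
qed

lemma src_open: "openin T V \<Longrightarrow> openin X (src G ` V)"
  by (rule open_map_bisection) (auto simp: bisection_def)

lemma rng_open: "openin T V \<Longrightarrow> openin X (rng G ` V)"
  by (rule open_map_bisection) (auto simp: bisection_def)

lemma section_homeo:
  assumes U: "openin T U" and cont: "continuous_map T X s" and inj: "inj_on s U"
    and op: "\<And>V. openin T V \<Longrightarrow> openin X (s ` V)"
  shows "homeomorphic_map (subtopology T U) (subtopology X (s ` U)) s"
proof (rule bijective_open_imp_homeomorphic_map)
  have U': "topspace (subtopology T U) = U" using U openin_subset by fastforce
  have sU: "topspace (subtopology X (s ` U)) = s ` U" using op[OF U] openin_subset by fastforce
  show "continuous_map (subtopology T U) (subtopology X (s ` U)) s"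
    using cont U' by (auto simp: continuous_map_in_subtopology continuous_map_from_subtopology)
  show "open_map (subtopology T U) (subtopology X (s ` U)) s"
    unfolding open_map_def using op U op[OF U] by (auto simp: openin_open_subtopology)
  show "s ` topspace (subtopology T U) = topspace (subtopology X (s ` U))" using U' sU by simp
  show "inj_on s (topspace (subtopology T U))" using U' inj by simp
qed

text \<open>Source and range are open maps on an etale groupoid, so their injective restrictions to
  an open set are homeomorphisms onto open sets.\<close>

lemma bisectionI:
  assumes "openin T U" "inj_on (src G) U" "inj_on (rng G) U"
  shows "bisection G U"
  unfolding bisection_def
  using assms src_open rng_open section_homeo[OF _ src_continuous_X] section_homeo[OF _ rng_continuous_X]
  by blast

text \<open>Near a unit x choose a bisection U and keep the arrows g of U whose source also lies in
  U. Then g and its source are elements of U with the same source, so g is a unit.\<close>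

lemma units_open: "openin T (units G)"
proof -
  have "\<exists>W. openin T W \<and> x \<in> W \<and> W \<subseteq> units G" if x: "x \<in> units G" for x
  proof -
    obtain U where U: "bisection G U" "x \<in> U" using bisection_nhd x units_subset by blast
    let ?V = "U \<inter> {g \<in> topspace T. src G g \<in> U}"
    have "openin T ?V"
      using bisectionD(1)[OF U(1)] openin_continuous_map_preimage[OF src_continuous] by blast
    moreover have "x \<in> ?V" using U(2) x units_subset src_unit by auto
    moreover have "?V \<subseteq> units G"
    proof
      fix g assume g: "g \<in> ?V"
      then have "src G (src G g) = src G g" using src_unit src_units by auto
      then have "src G g = g" using g bisectionD(3)[OF U(1)] by (auto dest: inj_onD)
      then show "g \<in> units G" using g by (simp add: units_def)
    qed
    ultimately show ?thesis by blast
  qed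
  then show ?thesis by (metis openin_subopen)
qed

lemma openin_X: "openin X U \<longleftrightarrow> openin T U \<and> U \<subseteq> units G"
  unfolding unit_top_def by (rule openin_open_subtopology[OF units_open])

lemma open_sets: "openin X U \<Longrightarrow> U \<in> sets \<mu>"
  unfolding sets_mu openin_X by (simp add: borel_of_open)

lemma closed_sets: "closedin X C \<Longrightarrow> C \<in> sets \<mu>"
proof -
  assume C: "closedin X C"
  then have "units G - (units G - C) \<in> sets \<mu>"
    using open_sets[of "units G - C"] space_mu sets.compl_sets by (metis closedin_def topspace_X)
  then show ?thesis using C closedin_subset by (metis double_diff subset_refl topspace_X)
qed

lemma compactin_X: "compactin X K \<longleftrightarrow> closedin X K"
  using compact hausdorff_X closedin_compact_space compactin_imp_closedin by blast

lemma section_continuous: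
  assumes U: "openin T U" and inj: "inj_on (src G) U"
  shows "continuous_map (subtopology X (src G ` U)) T (the_inv_into U (src G))"
proof -
  have hom: "homeomorphic_map (subtopology T U) (subtopology X (src G ` U)) (src G)"
    by (rule section_homeo[OF U src_continuous_X inj src_open])
  have U': "topspace (subtopology T U) = U" using U openin_subset by fastforce
  obtain g where g: "homeomorphic_maps (subtopology T U) (subtopology X (src G ` U)) (src G) g"
    using hom homeomorphic_map_maps by blast
  then have cont: "continuous_map (subtopology X (src G ` U)) (subtopology T U) g"
    and gs: "\<And>u. u \<in> U \<Longrightarrow> g (src G u) = u"
    unfolding homeomorphic_maps_def U' by auto
  have "continuous_map (subtopology X (src G ` U)) T g"
    using cont by (simp add: continuous_map_in_subtopology)
  then show ?thesis
    by (rule continuous_map_eq) (auto simp: gs the_inv_into_f_f[OF inj])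
qed

text \<open>The inverse of the source map on U is continuous, so the section over K is a compact
  image. In a Hausdorff topology it is closed, which is how closures of restricted bisections are
  bounded.\<close>

lemma compact_section:
  assumes U: "openin T U" and inj: "inj_on (src G) U" and K: "compactin X K" "K \<subseteq> src G ` U"
  shows "compactin T {u \<in> U. src G u \<in> K}"
proof -
  have "compactin (subtopology X (src G ` U)) K" using K by (simp add: compactin_subtopology)
  then have "compactin T (the_inv_into U (src G) ` K)"
    by (rule image_compactin[OF _ section_continuous[OF U inj]])
  moreover have "the_inv_into U (src G) ` K = {u \<in> U. src G u \<in> K}"
  proof (intro equalityI subsetI)
    fix u assume "u \<in> the_inv_into U (src G) ` K"
    then obtain x where "x \<in> K" "u = the_inv_into U (src G) x" by blast
    then show "u \<in> {u \<in> U. src G u \<in> K}"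
      using K(2) f_the_inv_into_f[OF inj, of x] the_inv_into_into[OF inj, of x U] by auto
  next
    fix u assume u: "u \<in> {u \<in> U. src G u \<in> K}"
    then have "the_inv_into U (src G) (src G u) = u" by (simp add: the_inv_into_f_f[OF inj])
    then show "u \<in> the_inv_into U (src G) ` K" using u by (metis (lifting) image_eqI mem_Collect_eq)
  qed
  ultimately show ?thesis by simp
qed

lemma bisection_pseudogroup: "bisection G U \<Longrightarrow> U \<in> pseudogroup G M"
  unfolding pseudogroup_iff using bisectionD(1,3,4)[of U] borel_of_open[of T U] by simp

lemma restrict_bisection:
  assumes U: "bisection G U" and V: "openin X V"
  shows "bisection G {u \<in> U. src G u \<in> V}"
proof (rule bisectionI)
  have "{u \<in> U. src G u \<in> V} = U \<inter> {u \<in> topspace T. src G u \<in> V}"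
    using bisectionD(2)[OF U] by auto
  then show "openin T {u \<in> U. src G u \<in> V}"
    using bisectionD(1)[OF U] openin_continuous_map_preimage[OF src_continuous_X V] by auto
qed (use bisectionD(3,4)[OF U] in \<open>auto intro: inj_on_subset\<close>)

text \<open>A single piece suffices. Its closure lies in the compact section over the closure of V,
  hence in U. The boundary of its range lies in the range of the section over
  \<open>X closure_of V - V\<close>, and invariance gives that range the measure of this set, which
  is 0.\<close>

lemma top_pseudogroupI:
  assumes U: "bisection G U" and V: "openin X V" "X closure_of V \<subseteq> src G ` U"
    and null: "measure \<mu> (X closure_of V - V) = 0"
  shows "{u \<in> U. src G u \<in> V} \<in> top_pseudogroup G \<mu>"
proof -
  let ?f = "{u \<in> U. src G u \<in> V}" and ?K = "{u \<in> U. src G u \<in> X closure_of V}"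
  have bis: "bisection G ?f" by (rule restrict_bisection[OF U V(1)])
  have VX: "V \<subseteq> units G" using openin_subset[OF V(1)] by simp
  have clV: "V \<subseteq> X closure_of V" using VX by (intro closure_of_subset) simp
  have K: "compactin T ?K"
    using bisectionD[OF U] V(2) by (intro compact_section) (simp_all add: compactin_X)
  have fK: "?f \<subseteq> ?K" using clV by auto
  have clf: "T closure_of ?f \<subseteq> ?K"
    using fK by (rule closure_of_minimal) (rule compactin_imp_closedin[OF hausdorff K])
  have srcf: "src G ` ?f = V" using clV V(2) by auto
  have rngK: "closedin X (rng G ` ?K)"
    using image_compactin[OF K rng_continuous_X] by (simp add: compactin_X)
  have clrng: "X closure_of (rng G ` ?f) \<subseteq> rng G ` ?K"
    by (rule closure_of_minimal[OF image_mono[OF fK] rngK])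
  have pg: "?K - ?f \<in> pseudogroup G M"
  proof (rule pseudogroup_subset[OF bisection_pseudogroup[OF U]])
    show "?K - ?f \<in> sets M"
      by (intro sets.Diff borel_of_open borel_of_closed compactin_imp_closedin[OF hausdorff K]
          bisectionD(1)[OF bis])
  qed blast
  have "src G ` (?K - ?f) = X closure_of V - V" using V(2) by auto
  then have "measure \<mu> (rng G ` (?K - ?f)) = 0" using measure_src_rng[OF pg] null by simp
  then have rnull: "emeasure \<mu> (rng G ` (?K - ?f)) = 0" by (simp add: emeasure_eq_measure)
  have "rng G ` (?K - ?f) \<in> sets \<mu>" using rng_image pg unfolding pseudogroup_iff by blast
  moreover have "unit_boundary G (rng G ` ?f) \<subseteq> rng G ` (?K - ?f)"
  proof -
    have "closedin X (units G - rng G ` ?f)"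
      using closedin_diff[OF closedin_topspace bisectionD(6)[OF bis]] by simp
    then have "unit_boundary G (rng G ` ?f) \<subseteq> rng G ` ?K - rng G ` ?f"
      unfolding unit_boundary_def using clrng closure_of_minimal[of "units G - rng G ` ?f"] by blast
    then show ?thesis by blast
  qed
  ultimately have "emeasure \<mu> (unit_boundary G (rng G ` ?f)) = 0"
    using rnull emeasure_eq_0 by blast
  then have rb: "rng G ` ?f \<in> null_boundary_sets G \<mu>"
    unfolding null_boundary_sets_def
    using open_sets[OF bisectionD(6)[OF bis]] openin_subset[OF bisectionD(6)[OF bis]] by simp
  have "unit_boundary G V \<subseteq> X closure_of V - V"
  proof -
    have "closedin X (units G - V)" using V(1) by (metis closedin_diff closedin_topspace topspace_X)
    then show ?thesis unfolding unit_boundary_def using closure_of_minimal[of "units G - V"] by blast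
  qed
  moreover have "X closure_of V - V \<in> sets \<mu>"
    using V(1) by (intro sets.Diff closed_sets open_sets closedin_closure_of)
  ultimately have "emeasure \<mu> (unit_boundary G V) = 0"
    using null emeasure_eq_0[of "X closure_of V - V" \<mu> "unit_boundary G V"] emeasure_eq_measure by simp
  then have sb: "src G ` ?f \<in> null_boundary_sets G \<mu>"
    unfolding null_boundary_sets_def srcf using V(1) open_sets VX by simp
  have "T closure_of ?f \<subseteq> U" using clf by auto
  moreover have "X closure_of (src G ` ?f) \<subseteq> src G ` U" unfolding srcf by (rule V(2))
  moreover have "X closure_of (rng G ` ?f) \<subseteq> rng G ` U" using clrng by auto
  ultimately show ?thesis
    unfolding top_pseudogroup_def
    using bisection_pseudogroup[OF bis] U rb sb
    by (intro CollectI conjI exI[of _ "1::nat"] exI[of _ "\<lambda>_. ?f"] exI[of _ "\<lambda>_. U"])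
      (auto simp: disjoint_family_on_def)
qed

lemma top_full_groupD:
  assumes "e \<in> top_full_group G"
  shows "bisection G e" "src G ` e = units G" "rng G ` e = units G"
  using assms unfolding top_full_group_def by auto

lemma top_full_group_subset: "top_full_group G \<subseteq> top_pseudogroup G \<mu>"
proof
  fix e assume e: "e \<in> top_full_group G"
  have "{u \<in> e. src G u \<in> units G} \<in> top_pseudogroup G \<mu>"
    using top_full_groupD[OF e] closure_of_subset_topspace[of X "units G"] closure_of_topspace[of X]
    by (intro top_pseudogroupI) (auto simp: openin_X units_open)
  moreover have "{u \<in> e. src G u \<in> units G} = e"
    using bisectionD(2)[OF top_full_groupD(1)[OF e]] src_units by auto
  ultimately show "e \<in> top_pseudogroup G \<mu>" by simp
qed

lemma top_pseudogroup_subset: "top_pseudogroup G \<mu> \<subseteq> pseudogroup G M"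
  unfolding top_pseudogroup_def by blast

text \<open>The product is the preimage of U under left translation by the inverse of e; this
  translation is continuous, and it is defined everywhere because the range of e is the whole unit
  space. Injectivity of source and range follows by recovering one factor at a time.\<close>

lemma set_mult_bisection:
  assumes e: "e \<in> top_full_group G" and U: "bisection G U"
  shows "bisection G (set_mult G e U)" "src G ` set_mult G e U = src G ` U"
proof -
  note be = top_full_groupD[OF e]
  define t where "t = the_inv_into e (rng G)"
  have t: "t x \<in> e \<and> rng G (t x) = x" if "x \<in> units G" for x
    unfolding t_def using be that bisectionD(4)[OF be(1)]
    by (simp add: f_the_inv_into_f the_inv_into_into)
  have te: "t (rng G g) = g" if "g \<in> e" for g
    unfolding t_def using that bisectionD(4)[OF be(1)] by (simp add: the_inv_into_f_f)
  have eA: "e \<subseteq> arrows G" and UA: "U \<subseteq> arrows G" using bisectionD(2) be(1) U by auto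
  have tcont: "continuous_map X T t"
  proof -
    have hom: "homeomorphic_map (subtopology T e) (subtopology X (rng G ` e)) (rng G)"
      using be(1) unfolding bisection_def by blast
    obtain g where g: "homeomorphic_maps (subtopology T e) (subtopology X (rng G ` e)) (rng G) g"
      using hom homeomorphic_map_maps by blast
    have "topspace (subtopology T e) = e" using eA by auto
    then have "continuous_map (subtopology X (rng G ` e)) (subtopology T e) g"
      and gs: "\<And>u. u \<in> e \<Longrightarrow> g (rng G u) = u"
      using g unfolding homeomorphic_maps_def by auto
    then have "continuous_map X T g"
      using be(3) by (simp add: continuous_map_in_subtopology) (metis subtopology_topspace topspace_X)
    moreover have "g x = t x" if "x \<in> topspace X" for x
      using t[of x] gs[of "t x"] that by simp
    ultimately show ?thesis by (metis continuous_map_eq)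
  qed
  define L where "L g = gmult G (ginv G (t (rng G g))) g" for g
  have comp: "(ginv G (t (rng G g)), g) \<in> composable G" if "g \<in> arrows G" for g
    using t[of "rng G g"] that rng_units eA unfolding composable_def by (auto simp: inv_arrow src_inv)
  have "continuous_map T T (\<lambda>g. ginv G (t (rng G g)))"
    using continuous_map_compose[OF continuous_map_compose[OF rng_continuous_X tcont] inv_continuous]
    by (simp add: o_def)
  then have "continuous_map T (subtopology (prod_topology T T) (composable G))
      (\<lambda>g. (ginv G (t (rng G g)), g))"
    using comp by (auto simp: continuous_map_in_subtopology continuous_map_pairwise o_def)
  from continuous_map_compose[OF this mult_continuous]
  have Lcont: "continuous_map T T L" by (simp add: o_def L_def[abs_def])
  have inset: "gmult G g h \<in> arrows G \<and> src G (gmult G g h) = src G h \<and> rng G (gmult G g h) = rng G g"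
    if "g \<in> e" "h \<in> U" "src G g = rng G h" for g h
    using that mult_arrow mult_src_rng eA UA by blast
  have eq: "set_mult G e U = {g \<in> topspace T. L g \<in> U}"
  proof (intro equalityI subsetI)
    fix k assume "k \<in> set_mult G e U"
    then obtain g h where gh: "k = gmult G g h" "g \<in> e" "h \<in> U" "src G g = rng G h"
      unfolding set_mult_def composable_def by blast
    have A: "g \<in> arrows G" "h \<in> arrows G" using gh eA UA by auto
    have "L k = gmult G (ginv G g) (gmult G g h)"
      unfolding L_def using te[OF gh(2)] inset[OF gh(2,3,4)] gh(1) by simp
    also have "\<dots> = gmult G (gmult G (ginv G g) g) h"
      using A gh(4) by (intro mult_assoc[symmetric]) (auto simp: inv_arrow src_inv)
    also have "\<dots> = h" using A gh(4) by (simp add: inv_mult mult_rng)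
    finally show "k \<in> {g \<in> topspace T. L g \<in> U}" using gh inset by simp
  next
    fix k assume "k \<in> {g \<in> topspace T. L g \<in> U}"
    then have k: "k \<in> arrows G" "L k \<in> U" by auto
    define g where "g = t (rng G k)"
    have g: "g \<in> e" "rng G g = rng G k" using t rng_units k(1) by (auto simp: g_def)
    have gA: "g \<in> arrows G" using g eA by auto
    have "rng G (L k) = src G g"
      using comp[OF k(1)] mult_src_rng[of "ginv G g" k] gA unfolding L_def composable_def
      by (simp add: g_def rng_inv)
    then have c: "(g, L k) \<in> composable G" using gA k UA unfolding composable_def by auto
    have "gmult G g (L k) = gmult G (gmult G g (ginv G g)) k"
      unfolding L_def g_def[symmetric] using gA k(1) g(2)
      by (intro mult_assoc[symmetric]) (auto simp: inv_arrow src_inv rng_inv)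
    then have "gmult G g (L k) = k" using gA g(2) k(1) by (simp add: mult_inv mult_rng)
    then show "k \<in> set_mult G e U" using c g(1) k(2) unfolding set_mult_def by force
  qed
  have Lk: "src G (L k) = src G k" if "k \<in> arrows G" for k
    using comp[OF that] mult_src_rng unfolding L_def composable_def by auto
  have arr: "set_mult G e U \<subseteq> arrows G" using eq by auto
  show "src G ` set_mult G e U = src G ` U"
  proof (intro equalityI subsetI)
    fix x assume "x \<in> src G ` set_mult G e U"
    then obtain k where k: "k \<in> set_mult G e U" "x = src G k" by blast
    then have "L k \<in> U" "src G (L k) = x" using eq Lk arr by auto
    then show "x \<in> src G ` U" by blast
  next
    fix x assume "x \<in> src G ` U"
    then obtain h where h: "h \<in> U" "x = src G h" by blast
    then have "rng G h \<in> src G ` e" using be(2) UA rng_units by auto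
    then obtain g where g: "g \<in> e" "src G g = rng G h" by auto
    then have "(g, h) \<in> composable G" using h eA UA unfolding composable_def by auto
    then have "gmult G g h \<in> set_mult G e U" using g h unfolding set_mult_def by blast
    then show "x \<in> src G ` set_mult G e U" using inset[OF g(1) h(1) g(2)] h(2) by (metis image_eqI)
  qed
  show "bisection G (set_mult G e U)"
  proof (rule bisectionI)
    show "openin T (set_mult G e U)"
      unfolding eq using openin_continuous_map_preimage[OF Lcont bisectionD(1)[OF U]] .
    have dec: "\<exists>g h. k = gmult G g h \<and> g \<in> e \<and> h \<in> U \<and> src G g = rng G h" if "k \<in> set_mult G e U" for k
      using that unfolding set_mult_def composable_def by blast
    show "inj_on (src G) (set_mult G e U)"
    proof (rule inj_onI)
      fix k k' assume *: "k \<in> set_mult G e U" "k' \<in> set_mult G e U" "src G k = src G k'"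
      obtain g h g' h' where gh: "k = gmult G g h" "g \<in> e" "h \<in> U" "src G g = rng G h"
        "k' = gmult G g' h'" "g' \<in> e" "h' \<in> U" "src G g' = rng G h'" using dec[OF *(1)] dec[OF *(2)] by blast
      then have "src G h = src G h'" using *(3) inset[OF gh(2,3,4)] inset[OF gh(6,7,8)] by simp
      then have "h = h'" using gh(3,7) bisectionD(3)[OF U] by (simp add: inj_onD)
      moreover from this have "g = g'" using gh bisectionD(3)[OF be(1)] by (simp add: inj_onD)
      ultimately show "k = k'" using gh by simp
    qed
    show "inj_on (rng G) (set_mult G e U)"
    proof (rule inj_onI)
      fix k k' assume *: "k \<in> set_mult G e U" "k' \<in> set_mult G e U" "rng G k = rng G k'"
      obtain g h g' h' where gh: "k = gmult G g h" "g \<in> e" "h \<in> U" "src G g = rng G h"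
        "k' = gmult G g' h'" "g' \<in> e" "h' \<in> U" "src G g' = rng G h'" using dec[OF *(1)] dec[OF *(2)] by blast
      then have "rng G g = rng G g'" using *(3) inset[OF gh(2,3,4)] inset[OF gh(6,7,8)] by simp
      then have "g = g'" using gh(2,6) bisectionD(4)[OF be(1)] by (simp add: inj_onD)
      moreover from this have "h = h'" using gh bisectionD(4)[OF U] by (simp add: inj_onD)
      ultimately show "k = k'" using gh by simp
    qed
  qed
qed

text \<open>The source of a product is the source of its right factor. Hence translates of
  restricted bisections are again restrictions, to which \<open>top_pseudogroupI\<close>
  applies.\<close>

lemma set_mult_restrict:
  "set_mult G e {u \<in> U. src G u \<in> V} = {u \<in> set_mult G e U. src G u \<in> V}"
  
proof (intro equalityI subsetI)
  fix k assume "k \<in> set_mult G e {u \<in> U. src G u \<in> V}"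
  then show "k \<in> {u \<in> set_mult G e U. src G u \<in> V}"
    unfolding set_mult_def composable_def using mult_src_rng by fastforce
next
  fix k assume "k \<in> {u \<in> set_mult G e U. src G u \<in> V}"
  then obtain g h where "k = gmult G g h" "g \<in> e" "h \<in> U" "(g, h) \<in> composable G" "src G k \<in> V"
    unfolding set_mult_def by blast
  moreover from this have "src G h \<in> V" using mult_src_rng[of g h] by (simp add: composable_def)
  ultimately show "k \<in> set_mult G e {u \<in> U. src G u \<in> V}" unfolding set_mult_def by blast
qed


end

section \<open>Regularity, null boundaries and density of the topological pseudogroup\<close>

context etale_gpd
begin

text \<open>Induction over Borel sets, approximating from both sides so that complements are
  symmetric; open sets are increasing unions of closed sets because the unit space is metrizable.
  The induction runs over Borel sets of arrows cut down to the units, which is how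
  \<open>sets \<mu>\<close> is described.\<close>

lemma regular:
  assumes "A \<in> sets \<mu>" "e > 0"
  obtains C U where "closedin X C" "openin X U" "C \<subseteq> A" "A \<subseteq> U" "measure \<mu> (U - C) < e"
proof -
  define reg where "reg B e \<longleftrightarrow>
    (\<exists>C U. closedin X C \<and> openin X U \<and> C \<subseteq> B \<and> B \<subseteq> U \<and> measure \<mu> (U - C) < e)" for B and e :: real
  have "A \<in> sigma_sets (arrows G) {U. openin T U}"
    using assms(1) by (simp add: sets_mu sets_borel_of)
  then have "\<forall>e>0. reg (A \<inter> units G) e"
  proof induction
    case (Basic U)
    then have U: "openin X (U \<inter> units G)" using units_open by (simp add: openin_X openin_Int)
    obtain C where C: "\<And>n. closedin X (C n)" "\<And>n. C n \<subseteq> C (Suc n)" "\<Union>(range C) = U \<inter> units G"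
      using open_imp_fsigma_in[OF metrizable U] unfolding fsigma_in_ascending by blast
    have "(\<lambda>n. measure \<mu> (C n)) \<longlonglongrightarrow> measure \<mu> (\<Union>n. C n)"
      using C closed_sets by (intro finite_Lim_measure_incseq incseq_SucI) auto
    then have lim: "(\<lambda>n. measure \<mu> (C n)) \<longlonglongrightarrow> measure \<mu> (U \<inter> units G)" using C(3) by simp
    show ?case
    proof (intro allI impI)
      fix e :: real assume "e > 0"
      then have "\<forall>\<^sub>F n in sequentially. measure \<mu> (U \<inter> units G) - e < measure \<mu> (C n)"
        using lim by (intro order_tendstoD) auto
      then obtain n where n: "measure \<mu> (U \<inter> units G) - e < measure \<mu> (C n)"
        using eventually_happens trivial_limit_sequentially by blast
      have sub: "C n \<subseteq> U \<inter> units G" using C(3) by blast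
      then have "measure \<mu> (U \<inter> units G - C n) < e"
        using n finite_measure_Diff[OF open_sets[OF U] closed_sets[OF C(1)[of n]] sub] by simp
      then show "reg (U \<inter> units G) e" unfolding reg_def using C(1) U sub by blast
    qed
  next
    case Empty
    then show ?case unfolding reg_def by (auto intro!: exI[of _ "{}"])
  next
    case (Compl a)
    show ?case
    proof (intro allI impI)
      fix e :: real assume "e > 0"
      then have "reg (a \<inter> units G) e" using Compl.IH by simp
      then obtain C U where CU: "closedin X C" "openin X U" "C \<subseteq> a \<inter> units G" "a \<inter> units G \<subseteq> U"
        "measure \<mu> (U - C) < e" unfolding reg_def by (elim exE conjE)
      have C: "C \<subseteq> units G" "U \<subseteq> units G" using closedin_subset[OF CU(1)] openin_subset[OF CU(2)] by simp_all
      have "closedin X (units G - U)" "openin X (units G - C)"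
        using CU closedin_diff[OF closedin_topspace CU(2)] openin_diff[OF openin_topspace CU(1)] by auto
      moreover have "units G - U \<subseteq> (arrows G - a) \<inter> units G" "(arrows G - a) \<inter> units G \<subseteq> units G - C"
        using CU(3,4) units_subset by auto
      moreover have "(units G - C) - (units G - U) = U - C" using C by auto
      ultimately show "reg ((arrows G - a) \<inter> units G) e" unfolding reg_def using CU(5) by metis
    qed
  next
    case (Union a)
    show ?case
    proof (intro allI impI)
      fix e :: real assume e: "e > 0"
      \<comment> \<open>These errors sum to e / 2; the other half pays for replacing the countable
        union of closed sets by a finite one, which is closed.\<close>
      have "\<exists>C U. closedin X C \<and> openin X U \<and> C \<subseteq> a n \<inter> units G \<and> a n \<inter> units G \<subseteq> U \<and>
          measure \<mu> (U - C) < e / 2 * (1 / 2) ^ Suc n" for n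
        using Union.IH[of n, rule_format, of "e / 2 * (1 / 2) ^ Suc n"] e unfolding reg_def by simp
      then obtain C U where CU: "\<And>n. closedin X (C n)" "\<And>n. openin X (U n)"
          "\<And>n. C n \<subseteq> a n \<inter> units G" "\<And>n. a n \<inter> units G \<subseteq> U n"
          "\<And>n. measure \<mu> (U n - C n) < e / 2 * (1 / 2) ^ Suc n" by metis
      note sets = open_sets[OF CU(2)] closed_sets[OF CU(1)]
      have sums: "(\<lambda>n. e / 2 * (1 / 2) ^ Suc n) sums (e / 2)"
        using sums_mult[OF power_half_series, of "e / 2"] by simp
      have summ: "summable (\<lambda>n. measure \<mu> (U n - C n))"
        using sums CU(5) by (intro summable_comparison_test'[OF sums_summable[OF sums], of 0])
          (auto intro: less_imp_le)
      have "measure \<mu> ((\<Union>n. U n) - (\<Union>n. C n)) \<le> measure \<mu> (\<Union>n. U n - C n)"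
        using sets by (intro finite_measure_mono) auto
      also have "\<dots> \<le> (\<Sum>n. measure \<mu> (U n - C n))"
        using sets summ by (intro finite_measure_subadditive_countably) auto
      also have "\<dots> \<le> (\<Sum>n. e / 2 * (1 / 2) ^ Suc n)"
        using less_imp_le[OF CU(5)] by (rule suminf_le[OF _ summ sums_summable[OF sums]])
      also have "\<dots> = e / 2" by (rule sums_unique[OF sums, symmetric])
      finally have 1: "measure \<mu> ((\<Union>n. U n) - (\<Union>n. C n)) \<le> e / 2" .
      define D where "D n = (\<Union>i\<le>n. C i)" for n
      have D: "closedin X (D n)" for n unfolding D_def using CU(1) by (intro closedin_Union) auto
      have "(\<lambda>n. measure \<mu> (D n)) \<longlonglongrightarrow> measure \<mu> (\<Union>n. D n)"
        using closed_sets[OF D] by (intro finite_Lim_measure_incseq) (auto simp: D_def incseq_def, force)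
      then have "\<forall>\<^sub>F n in sequentially. measure \<mu> (\<Union>n. D n) - e / 2 < measure \<mu> (D n)"
        using e by (intro order_tendstoD) auto
      then obtain n where n: "measure \<mu> (\<Union>n. D n) - e / 2 < measure \<mu> (D n)"
        using eventually_happens trivial_limit_sequentially by blast
      have UD: "(\<Union>n. D n) = (\<Union>n. C n)" unfolding D_def by auto
      have "measure \<mu> ((\<Union>n. C n) - D n) < e / 2"
        using n sets closed_sets[OF D] unfolding UD
        by (subst finite_measure_Diff) (auto simp: D_def)
      then have "measure \<mu> ((\<Union>n. U n) - (\<Union>n. C n)) + measure \<mu> ((\<Union>n. C n) - D n) < e" using 1 by simp
      moreover have "measure \<mu> ((\<Union>n. U n) - D n) \<le>
          measure \<mu> (((\<Union>n. U n) - (\<Union>n. C n)) \<union> ((\<Union>n. C n) - D n))"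
        using sets closed_sets[OF D] by (intro finite_measure_mono) auto
      moreover have "\<dots> \<le> measure \<mu> ((\<Union>n. U n) - (\<Union>n. C n)) + measure \<mu> ((\<Union>n. C n) - D n)"
        using sets closed_sets[OF D] by (intro measure_Un_le) auto
      ultimately have "measure \<mu> ((\<Union>n. U n) - D n) < e" by linarith
      moreover have "openin X (\<Union>n. U n)" using CU(2) by blast
      moreover have "D n \<subseteq> (\<Union>i. a i) \<inter> units G"
        unfolding D_def using CU(3) by (intro UN_least) auto
      moreover have "(\<Union>i. a i) \<inter> units G \<subseteq> (\<Union>n. U n)"
        unfolding UN_extend_simps(4) by (intro UN_mono CU(4) subset_refl)
      ultimately show "reg (\<Union>(range a) \<inter> units G) e"
        unfolding reg_def using D[of n] by (intro exI[of _ "D n"] exI[of _ "\<Union>n. U n"] conjI)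
    qed
  qed
  moreover have "A \<inter> units G = A" using assms(1) sets_mu by auto
  ultimately have "reg A e" using assms(2) by simp
  then show ?thesis using that unfolding reg_def by blast
qed

lemma inner_closed:
  assumes "A \<in> sets \<mu>" "e > 0"
  obtains C where "closedin X C" "C \<subseteq> A" "measure \<mu> (A - C) < e"
proof -
  obtain C U where CU: "closedin X C" "openin X U" "C \<subseteq> A" "A \<subseteq> U" "measure \<mu> (U - C) < e"
    using regular[OF assms] .
  have "measure \<mu> (A - C) \<le> measure \<mu> (U - C)"
    using CU closed_sets open_sets by (intro finite_measure_mono) auto
  then show ?thesis using that CU by auto
qed

lemma continuous_vimage: "continuous_map X euclideanreal k \<Longrightarrow> open S \<Longrightarrow> openin X {x \<in> units G. k x \<in> S}"
  using openin_continuous_map_preimage[of X euclideanreal k S] by simp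

lemma continuous_measurable: "continuous_map X euclideanreal k \<Longrightarrow> k \<in> borel_measurable \<mu>"
proof (rule borel_measurableI)
  fix S :: "real set" assume k: "continuous_map X euclideanreal k" and "open S"
  then have "{x \<in> units G. k x \<in> S} \<in> sets \<mu>" by (intro open_sets continuous_vimage)
  then show "k -` S \<inter> space \<mu> \<in> sets \<mu>" by (simp add: space_mu vimage_def Int_def conj_commute)
qed

lemma continuous_bounded:
  assumes "continuous_map X euclideanreal k"
  obtains B where "B > 0" "\<And>x. x \<in> units G \<Longrightarrow> \<bar>k x\<bar> \<le> B"
proof -
  have "compactin euclideanreal (k ` units G)"
    using image_compactin[OF _ assms, of "units G"] compact compact_space_def[of X] by simp
  then have "bounded (k ` units G)" using compact_imp_bounded by simp
  then obtain B where "B > 0" "\<forall>y\<in>k ` units G. norm y \<le> B" unfolding bounded_pos by blast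
  then show ?thesis using that by auto
qed

lemma continuous_integrable: "continuous_map X euclideanreal k \<Longrightarrow> integrable \<mu> k"
proof -
  assume k: "continuous_map X euclideanreal k"
  obtain B where "\<And>x. x \<in> units G \<Longrightarrow> \<bar>k x\<bar> \<le> B" using continuous_bounded[OF k] by blast
  then show "integrable \<mu> k"
    using continuous_measurable[OF k] by (intro integrable_const_bound[of _ B]) (auto simp: space_mu)
qed

text \<open>The distribution of k has at most countably many atoms, while the interval is
  uncountable.\<close>

lemma null_level:
  assumes k: "continuous_map X euclideanreal k" and "a < b"
  obtains r where "a < r" "r < b" "measure \<mu> {x \<in> units G. k x = r} = 0"
proof -
  have km: "k \<in> measurable \<mu> borel" by (rule continuous_measurable[OF k])
  interpret D: finite_measure "distr \<mu> borel k" by (rule finite_measure_distr[OF km])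
  have "countable {r. measure (distr \<mu> borel k) {r} \<noteq> 0}" by (rule D.countable_support)
  moreover have "uncountable {a<..<b}" using assms(2) by (simp add: uncountable_open_interval)
  ultimately have "\<not> {a<..<b} \<subseteq> {r. measure (distr \<mu> borel k) {r} \<noteq> 0}"
    using countable_subset by blast
  then obtain r where r: "r \<in> {a<..<b}" "measure (distr \<mu> borel k) {r} = 0" by blast
  have "measure (distr \<mu> borel k) {r} = measure \<mu> (k -` {r} \<inter> space \<mu>)"
    using km by (intro measure_distr) auto
  moreover have "k -` {r} \<inter> space \<mu> = {x \<in> units G. k x = r}" by (auto simp: space_mu)
  ultimately show ?thesis using that r by auto
qed

text \<open>V is a sublevel set of a Urysohn function at a null level, so its boundary lies in that
  level set. The function equals 1 outside an open set of nearly the same measure as K, which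
  controls the measure of the closure.\<close>

lemma null_boundary_nhd:
  assumes K: "closedin X K" and W: "openin X W" "K \<subseteq> W" and e: "e > 0"
  obtains V where "openin X V" "K \<subseteq> V" "X closure_of V \<subseteq> W" "measure \<mu> (X closure_of V - V) = 0"
    "measure \<mu> (X closure_of V) < measure \<mu> K + e"
proof -
  obtain C U where CU: "closedin X C" "openin X U" "C \<subseteq> K" "K \<subseteq> U" "measure \<mu> (U - C) < e"
    using regular[OF closed_sets[OF K] e] .
  have Kd: "disjnt K (units G - U \<inter> W)" using CU(4) W(2) by (auto simp: disjnt_iff)
  have cl: "closedin X (units G - U \<inter> W)"
    using closedin_diff[OF closedin_topspace openin_Int[OF CU(2) W(1)]] by simp
  obtain k where k: "continuous_map X euclideanreal k" "k ` K \<subseteq> {0}" "k ` (units G - U \<inter> W) \<subseteq> {1}"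
    using Urysohn_lemma_alt[OF normal_X K cl Kd] by metis
  obtain r where r: "0 < r" "r < 1" "measure \<mu> {x \<in> units G. k x = r} = 0"
    using null_level[OF k(1), of 0 1] by auto
  define V where "V = {x \<in> units G. k x \<in> {..<r}}"
  have V: "openin X V" unfolding V_def by (rule continuous_vimage[OF k(1)]) simp
  have "closedin X (units G - {x \<in> units G. k x \<in> {r<..}})"
    using closedin_diff[OF closedin_topspace continuous_vimage[OF k(1), of "{r<..}"]] by simp
  moreover have "V \<subseteq> units G - {x \<in> units G. k x \<in> {r<..}}" by (auto simp: V_def)
  ultimately have clV: "X closure_of V \<subseteq> units G - {x \<in> units G. k x \<in> {r<..}}"
    by (intro closure_of_minimal)
  have KV: "K \<subseteq> V" using k(2) r(1) closedin_subset[OF K] by (auto simp: V_def)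
  have sub: "X closure_of V \<subseteq> U \<inter> W" using clV k(3) r(2) by (force simp: image_subset_iff)
  have lev: "{x \<in> units G. k x = r} \<in> sets \<mu>"
  proof -
    have "k -` {r} \<inter> space \<mu> \<in> sets \<mu>"
      using continuous_measurable[OF k(1)] by (intro measurable_sets[of _ _ borel]) auto
    then show ?thesis by (simp add: space_mu vimage_def Int_def conj_commute)
  qed
  have "X closure_of V - V \<subseteq> {x \<in> units G. k x = r}" using clV by (auto simp: V_def)
  then have "measure \<mu> (X closure_of V - V) \<le> measure \<mu> {x \<in> units G. k x = r}"
    by (rule finite_measure_mono[OF _ lev])
  then have "measure \<mu> (X closure_of V - V) \<le> 0" using r(3) by linarith
  then have null: "measure \<mu> (X closure_of V - V) = 0" by (simp add: measure_le_0_iff)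
  have "measure \<mu> (X closure_of V) \<le> measure \<mu> (C \<union> (U - C))"
    using sub open_sets[OF CU(2)] closed_sets[OF CU(1)] by (intro finite_measure_mono) auto
  also have "\<dots> \<le> measure \<mu> C + measure \<mu> (U - C)"
    using open_sets[OF CU(2)] closed_sets[OF CU(1)] by (intro measure_Un_le) auto
  also have "measure \<mu> C \<le> measure \<mu> K"
    using CU(3) closed_sets[OF K] by (intro finite_measure_mono)
  finally have "measure \<mu> (X closure_of V) < measure \<mu> K + e" using CU(5) by linarith
  with null sub show ?thesis using that[OF V KV] by auto
qed

text \<open>A Urysohn function that is 1 on a large closed subset of U and 0 outside U. As a
  minorant of the indicator it yields lower bounds for empirical frequencies of U.\<close>

lemma open_test_function:
  assumes U: "openin X U" and e: "e > 0"
  obtains k where "continuous_map X euclideanreal k" "\<And>x. x \<in> units G \<Longrightarrow> k x \<le> indicator U x"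
    "measure \<mu> U - e < (\<integral>x. k x \<partial>\<mu>)"
proof -
  obtain C where C: "closedin X C" "C \<subseteq> U" "measure \<mu> (U - C) < e"
    using inner_closed[OF open_sets[OF U] e] .
  have cl: "closedin X (units G - U)" using closedin_diff[OF closedin_topspace U] by simp
  have dj: "disjnt (units G - U) C" using C(2) by (auto simp: disjnt_iff)
  obtain k where k: "continuous_map X (top_of_set {0..1}) k" "k ` (units G - U) \<subseteq> {0}" "k ` C \<subseteq> {1::real}"
    using Urysohn_lemma[OF normal_X cl C(1) dj, of 0 1] by auto
  have kc: "continuous_map X euclideanreal k" and k01: "\<And>x. x \<in> units G \<Longrightarrow> 0 \<le> k x \<and> k x \<le> 1"
    using k(1) by (auto simp: continuous_map_in_subtopology image_subset_iff)
  have le: "k x \<le> indicator U x" if "x \<in> units G" for x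
    using k(2) k01[OF that] that by (cases "x \<in> U") (auto simp: image_subset_iff)
  have "measure \<mu> C = (\<integral>x. indicator C x \<partial>\<mu>)" using closed_sets[OF C(1)] by simp
  also have "\<dots> \<le> (\<integral>x. k x \<partial>\<mu>)"
  proof (rule integral_mono)
    show "indicator C x \<le> k x" if "x \<in> space \<mu>" for x
      using k(3) k01[of x] that by (cases "x \<in> C") (auto simp: space_mu image_subset_iff)
    show "integrable \<mu> (indicat_real C)"
      using closed_sets[OF C(1)] by (intro integrable_real_indicator) (auto simp: emeasure_eq_measure)
  qed (rule continuous_integrable[OF kc])
  finally have "measure \<mu> U - e < (\<integral>x. k x \<partial>\<mu>)"
    using C(3) finite_measure_Diff[OF open_sets[OF U] closed_sets[OF C(1)] C(2)] by simp
  then show ?thesis using that[OF kc le] by blast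
qed

text \<open>Injectivity is a condition on pairs. The good pairs form a neighbourhood of the square
  of C, by bisections at the diagonal and by the Hausdorff property elsewhere, and the tube lemma
  for compact sets extracts an open rectangle.\<close>

lemma compact_bisection_nhd:
  assumes C: "compactin T C" "inj_on (src G) C" "inj_on (rng G) C"
  obtains U where "bisection G U" "C \<subseteq> U"
proof -
  have nhd: "\<exists>U. openin T U \<and> C \<subseteq> U \<and> inj_on s U"
    if s: "continuous_map T X s" "inj_on s C" "\<And>U. bisection G U \<Longrightarrow> inj_on s U" for s
  proof -
    define R where "R = {(g, h). g \<in> arrows G \<and> h \<in> arrows G \<and> (s g = s h \<longrightarrow> g = h)}"
    have "\<exists>W. openin (prod_topology T T) W \<and> (g, h) \<in> W \<and> W \<subseteq> R" if gh: "g \<in> C" "h \<in> C" for g h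
    proof (cases "g = h")
      case True
      have "g \<in> arrows G" using gh compactin_subset_topspace[OF C(1)] by auto
      then obtain U where U: "bisection G U" "g \<in> U" using bisection_nhd by blast
      then have "openin (prod_topology T T) (U \<times> U)" by (simp add: openin_prod_Times_iff bisectionD(1))
      moreover have "U \<times> U \<subseteq> R"
        unfolding R_def using s(3)[OF U(1)] bisectionD(2)[OF U(1)] by (auto dest: inj_onD)
      moreover have "(g, h) \<in> U \<times> U" using U(2) True by simp
      ultimately show ?thesis by (intro exI[of _ "U \<times> U"] conjI)
    next
      case False
      have A: "g \<in> arrows G" "h \<in> arrows G" using gh compactin_subset_topspace[OF C(1)] by auto
      then have sX: "s g \<in> topspace X" "s h \<in> topspace X"
        using continuous_map_image_subset_topspace[OF s(1)] by auto
      have "s g \<noteq> s h" using False gh s(2) by (auto dest: inj_onD)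
      then obtain P Q where PQ: "openin X P" "openin X Q" "s g \<in> P" "s h \<in> Q" "disjnt P Q"
        using hausdorff_X sX unfolding Hausdorff_space_def by metis
      let ?P = "{g \<in> topspace T. s g \<in> P}" and ?Q = "{g \<in> topspace T. s g \<in> Q}"
      have "openin (prod_topology T T) (?P \<times> ?Q)"
        using openin_continuous_map_preimage[OF s(1)] PQ by (simp add: openin_prod_Times_iff)
      moreover have "?P \<times> ?Q \<subseteq> R" unfolding R_def using PQ(5) by (auto simp: disjnt_iff)
      moreover have "(g, h) \<in> ?P \<times> ?Q" using A PQ(3,4) by simp
      ultimately show ?thesis by (intro exI[of _ "?P \<times> ?Q"] conjI)
    qed
    then obtain W where W: "\<And>g h. g \<in> C \<Longrightarrow> h \<in> C \<Longrightarrow>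
        openin (prod_topology T T) (W g h) \<and> (g, h) \<in> W g h \<and> W g h \<subseteq> R" by metis
    have "openin (prod_topology T T) (\<Union>g\<in>C. \<Union>h\<in>C. W g h)" using W by blast
    moreover have "C \<times> C \<subseteq> (\<Union>g\<in>C. \<Union>h\<in>C. W g h)" using W by blast
    ultimately obtain U V where UV: "openin T U" "openin T V" "C \<subseteq> U" "C \<subseteq> V"
        "U \<times> V \<subseteq> (\<Union>g\<in>C. \<Union>h\<in>C. W g h)"
      using Wallace_theorem_prod_topology[OF C(1) C(1)] by metis
    have "U \<times> V \<subseteq> R" using UV(5) W by blast
    then have "inj_on s (U \<inter> V)" unfolding R_def inj_on_def by blast
    then show ?thesis using UV by (intro exI[of _ "U \<inter> V"]) auto
  qed
  obtain U where U: "openin T U" "C \<subseteq> U" "inj_on (src G) U"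
    using nhd[OF src_continuous_X C(2)] bisectionD(3) by blast
  obtain V where V: "openin T V" "C \<subseteq> V" "inj_on (rng G) V"
    using nhd[OF rng_continuous_X C(3)] bisectionD(4) by blast
  have "bisection G (U \<inter> V)"
    using U V by (intro bisectionI) (auto intro: inj_on_subset)
  then show ?thesis using that U V by blast
qed

text \<open>Inner regularity of the measure on arrows supplies a compact part C of f, which extends
  to a bisection U; V is a null-boundary neighbourhood of the source of C. Both f and the
  restriction of U to V contain C and exceed it by mass at most e. The set C and the bounds on V are
  returned too: they later control where f and its replacement agree and how large the domain
  becomes.\<close>

lemma top_pseudogroup_dense:
  assumes reg: "regular_measure G \<mu>" and f: "f \<in> pseudogroup G M" and e: "e > 0"
  obtains C U V where "C \<in> sets M" "C \<subseteq> f" "bisection G U" "C \<subseteq> U" "openin X V" "src G ` C \<subseteq> V"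
    "X closure_of V \<subseteq> src G ` U" "measure \<mu> (X closure_of V - V) = 0"
    "measure \<mu> (X closure_of V) < measure \<mu> (src G ` f) + e" "measure \<mu> (src G ` (f - C)) < e"
    "source_mass G \<mu> (sym_diff f {u \<in> U. src G u \<in> V}) \<le> ennreal (3 * e)"
proof -
  have fM: "f \<in> sets M" "inj_on (src G) f" "inj_on (rng G) f" using f pseudogroup_iff by auto
  have sf: "source_mass G \<mu> f = ennreal (measure \<mu> (src G ` f))"
    by (simp add: source_mass_inj[OF fM(1,2)] emeasure_eq_measure)
  obtain C where C: "compactin T C" "C \<subseteq> f" "measure \<mu> (src G ` f) - e < measure \<mu> (src G ` C)"
  \<comment> \<open>For small f the lower bound would be negative and truncated to 0 by
    \<open>ennreal\<close>, where strict inequality may fail; the empty set serves instead.\<close>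
  proof (cases "measure \<mu> (src G ` f) < e")
    case True
    then show ?thesis using that[of "{}"] by simp
  next
    case False
    have "ennreal (measure \<mu> (src G ` f) - e) < source_mass G \<mu> f"
      unfolding sf using False e by (intro ennreal_lessI) auto
    moreover have "source_mass G \<mu> f = (SUP K\<in>{K. compactin T K \<and> K \<subseteq> f}. source_mass G \<mu> K)"
      using reg fM(1) unfolding regular_measure_def by blast
    ultimately obtain K where K: "compactin T K" "K \<subseteq> f"
        "ennreal (measure \<mu> (src G ` f) - e) < source_mass G \<mu> K"
      by (auto simp: less_SUP_iff)
    have KM: "K \<in> sets M" using borel_of_closed compactin_imp_closedin[OF hausdorff K(1)] by blast
    have "source_mass G \<mu> K = ennreal (measure \<mu> (src G ` K))"
      using source_mass_inj[OF KM inj_on_subset[OF fM(2) K(2)]] by (simp add: emeasure_eq_measure)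
    then have "measure \<mu> (src G ` f) - e < measure \<mu> (src G ` K)"
      using K(3) False by (simp add: ennreal_less_iff)
    then show ?thesis using that K by blast
  qed
  have CM: "C \<in> sets M" using borel_of_closed compactin_imp_closedin[OF hausdorff C(1)] by blast
  have Cinj: "inj_on (src G) C" "inj_on (rng G) C" using C(2) fM inj_on_subset by blast+
  obtain U where U: "bisection G U" "C \<subseteq> U" using compact_bisection_nhd[OF C(1) Cinj] .
  have K: "closedin X (src G ` C)"
    using image_compactin[OF C(1) src_continuous_X] by (simp add: compactin_X)
  obtain V where V: "openin X V" "src G ` C \<subseteq> V" "X closure_of V \<subseteq> src G ` U"
      "measure \<mu> (X closure_of V - V) = 0" "measure \<mu> (X closure_of V) < measure \<mu> (src G ` C) + e"
    using null_boundary_nhd[OF K bisectionD(5)[OF U(1)] image_mono[OF U(2)] e] .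
  have Cf: "measure \<mu> (src G ` C) \<le> measure \<mu> (src G ` f)"
    using C(2) src_image[OF fM(1,2)] by (intro finite_measure_mono image_mono)
  have fC: "src G ` (f - C) = src G ` f - src G ` C"
    by (rule inj_on_image_set_diff[OF fM(2) Diff_subset C(2)])
  have CS: "src G ` C \<in> sets \<mu>" by (rule src_image[OF CM Cinj(1)])
  have mfC: "measure \<mu> (src G ` (f - C)) < e"
    unfolding fC using finite_measure_Diff[OF src_image[OF fM(1,2)] CS image_mono[OF C(2)]] C(3) by simp
  let ?f' = "{u \<in> U. src G u \<in> V}"
  have bis': "bisection G ?f'" by (rule restrict_bisection[OF U(1) V(1)])
  have VX: "V \<subseteq> X closure_of V" using openin_subset[OF V(1)] by (intro closure_of_subset) simp
  have Cf': "C \<subseteq> ?f'" using U(2) V(2) by auto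
  have sf': "src G ` ?f' = V" using VX V(3) by auto
  have f'C: "src G ` (?f' - C) = V - src G ` C"
    using inj_on_image_set_diff[OF bisectionD(3)[OF bis'] Diff_subset Cf'] sf' by simp
  have "measure \<mu> V \<le> measure \<mu> (X closure_of V)"
    using VX by (intro finite_measure_mono closed_sets) auto
  then have mf'C: "measure \<mu> (src G ` (?f' - C)) \<le> e"
    unfolding f'C using finite_measure_Diff[OF open_sets[OF V(1)] CS V(2)] V(5) by simp
  have "source_mass G \<mu> (sym_diff f ?f') \<le>
      (\<integral>\<^sup>+ x. indicator (src G ` (f - C)) x + indicator (src G ` (?f' - C)) x \<partial>\<mu>)"
    unfolding source_mass_def
  proof (rule nn_integral_mono)
    fix x
    have "{g \<in> sym_diff f ?f'. src G g = x} \<subseteq> {g \<in> f - C. src G g = x} \<union> {g \<in> ?f' - C. src G g = x}"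
      using C(2) Cf' by auto
    then have "emeasure (count_space UNIV) {g \<in> sym_diff f ?f'. src G g = x}
      \<le> emeasure (count_space UNIV) ({g \<in> f - C. src G g = x} \<union> {g \<in> ?f' - C. src G g = x})"
      by (intro emeasure_mono) auto
    also have "\<dots> \<le> emeasure (count_space UNIV) {g \<in> f - C. src G g = x} +
        emeasure (count_space UNIV) {g \<in> ?f' - C. src G g = x}"
      by (intro emeasure_subadditive) auto
    also have "\<dots> = indicator (src G ` (f - C)) x + indicator (src G ` (?f' - C)) x"
      using fM(2) bisectionD(3)[OF bis'] by (intro arg_cong2[of _ _ _ _ "(+)"] fibre_count) (auto intro: inj_on_subset)
    finally show "emeasure (count_space UNIV) {g \<in> sym_diff f ?f'. src G g = x}
      \<le> indicator (src G ` (f - C)) x + indicator (src G ` (?f' - C)) x" .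
  qed
  also have "\<dots> = emeasure \<mu> (src G ` (f - C)) + emeasure \<mu> (src G ` (?f' - C))"
  proof (subst nn_integral_add)
    have "src G ` (f - C) \<in> sets \<mu>" unfolding fC using src_image[OF fM(1,2)] CS by auto
    moreover have "src G ` (?f' - C) \<in> sets \<mu>" unfolding f'C using open_sets[OF V(1)] CS by auto
    ultimately show "indicator (src G ` (f - C)) \<in> borel_measurable \<mu>"
      "indicator (src G ` (?f' - C)) \<in> borel_measurable \<mu>"
      "(\<integral>\<^sup>+ x. indicator (src G ` (f - C)) x \<partial>\<mu>) + (\<integral>\<^sup>+ x. indicator (src G ` (?f' - C)) x \<partial>\<mu>) =
        emeasure \<mu> (src G ` (f - C)) + emeasure \<mu> (src G ` (?f' - C))" by auto
  qed
  also have "\<dots> = ennreal (measure \<mu> (src G ` (f - C)) + measure \<mu> (src G ` (?f' - C)))"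
    by (simp add: emeasure_eq_measure)
  also have "\<dots> \<le> ennreal (3 * e)" using mfC mf'C e by (intro ennreal_leI) linarith
  finally have "source_mass G \<mu> (sym_diff f ?f') \<le> ennreal (3 * e)" .
  moreover have "measure \<mu> (X closure_of V) < measure \<mu> (src G ` f) + e" using V(5) Cf by linarith
  ultimately show ?thesis using that[OF CM C(2) U V(1-4) _ mfC] by blast
qed

end

section \<open>Continuous factor maps and generating pseudo-metrics\<close>

locale etale_factor = G: etale_gpd G \<mu> + H: etale_gpd H \<nu> + pmp_factor_map G \<mu> H \<nu> \<pi>
  for G :: "'g top_groupoid" and \<mu> and H :: "'h top_groupoid" and \<nu> and \<pi> :: "'g \<Rightarrow> 'h" +
  assumes pi_continuous: "continuous_map (gtop G) (gtop H) \<pi>"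
begin

lemma lift_open: "openin H.T U \<Longrightarrow> openin G.T (lift U)"
  using openin_continuous_map_preimage[OF pi_continuous, of U] by (simp add: lift_def)

lemma unit_vimage_open: "openin H.X V \<Longrightarrow> openin G.X {x \<in> units G. \<pi> x \<in> V}"
proof -
  assume "openin H.X V"
  then have "openin G.T (lift V \<inter> units G)"
    using lift_open[of V] G.units_open H.openin_X by blast
  moreover have "lift V \<inter> units G = {x \<in> units G. \<pi> x \<in> V}"
    using G.units_subset by (auto simp: lift_def)
  ultimately show ?thesis using G.openin_X by auto
qed

text \<open>The lift of an open bisection is open, and so is the source of its part with range in A;
  openness of the source map is where G being etale enters.\<close>

lemma act_vimage_open:
  assumes "bisection H U" "openin G.X A"
  shows "openin G.X (act_vimage U A)"
proof -
  have "{g \<in> lift U. rng G g \<in> A} = lift U \<inter> {g \<in> topspace G.T. rng G g \<in> A}"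
    by (auto simp: lift_def)
  then have "openin G.T {g \<in> lift U. rng G g \<in> A}"
    using lift_open[OF H.bisectionD(1)[OF assms(1)]]
      openin_continuous_map_preimage[OF G.rng_continuous_X assms(2)] by auto
  then show ?thesis
    unfolding act_vimage_eq[OF H.bisection_pseudogroup[OF assms(1)]] by (rule G.src_open)
qed

lemma top_full_group_pseudogroup: "e \<in> top_full_group H \<Longrightarrow> e \<in> pseudogroup H H.M"
  using H.top_full_group_subset H.top_pseudogroup_subset by blast

definition app :: "'h set \<Rightarrow> 'g \<Rightarrow> 'g" where
  "app e x = the (ac e x)"

lemma act_full: "e \<in> top_full_group H \<Longrightarrow> x \<in> units G \<Longrightarrow> ac e x = Some (app e x)"
  using act_None[of e x] H.top_full_groupD(2)[of e] pi_unit by (auto simp: app_def)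

lemma app_unit: "e \<in> top_full_group H \<Longrightarrow> x \<in> units G \<Longrightarrow> app e x \<in> units G"
  using act_unit[OF top_full_group_pseudogroup _ act_full] by blast

lemma app_continuous:
  assumes e: "e \<in> top_full_group H"
  shows "continuous_map G.X G.X (app e)"
  unfolding continuous_map
proof (intro conjI allI impI)
  show "app e ` topspace G.X \<subseteq> topspace G.X" using app_unit[OF e] by auto
  fix A assume A: "openin G.X A"
  have "{x \<in> topspace G.X. app e x \<in> A} = act_vimage e A"
    unfolding act_vimage_def using act_full[OF e] by auto
  then show "openin G.X {x \<in> topspace G.X. app e x \<in> A}"
    using act_vimage_open[OF H.top_full_groupD(1)[OF e] A] by simp
qed

text \<open>The complement of W is compact and avoids the diagonal. By the generating property it is
  covered by the open sets where some translate of \<rho> exceeds some 1/(n+1), and a finite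
  subcover gives E and r.\<close>

lemma generating_separation:
  assumes \<rho>: "continuous_pseudometric G.X \<rho>" and gen: "dynamically_generating G H \<pi> \<rho>"
    and W: "openin (prod_topology G.X G.X) W" "\<And>x. x \<in> units G \<Longrightarrow> (x, x) \<in> W"
  obtains E r where "finite E" "E \<subseteq> top_full_group H" "r > 0"
    "\<And>x y. x \<in> units G \<Longrightarrow> y \<in> units G \<Longrightarrow> \<forall>e\<in>E. \<rho> (app e x) (app e y) \<le> r \<Longrightarrow> (x, y) \<in> W"
proof -
  define S where "S p = {z \<in> units G \<times> units G.
      (case z of (x, y) \<Rightarrow> \<rho> (app (fst p) x) (app (fst p) y)) \<in> {inverse (real (Suc (snd p)))<..}}"
    for p :: "'h set \<times> nat"
  have \<rho>c: "continuous_map (prod_topology G.X G.X) euclideanreal (\<lambda>(x, y). \<rho> x y)"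
    using \<rho> unfolding continuous_pseudometric_def by blast
  have S: "openin (prod_topology G.X G.X) (S p)" if p: "fst p \<in> top_full_group H" for p
  proof -
    have "continuous_map (prod_topology G.X G.X) (prod_topology G.X G.X)
        (\<lambda>(x, y). (app (fst p) x, app (fst p) y))"
      using app_continuous[OF p] by (simp add: continuous_map_prod_top)
    from continuous_map_compose[OF this \<rho>c]
    have "continuous_map (prod_topology G.X G.X) euclideanreal
        (\<lambda>(x, y). \<rho> (app (fst p) x) (app (fst p) y))"
      by (simp add: o_def case_prod_unfold)
    from openin_continuous_map_preimage[OF this, of "{inverse (real (Suc (snd p)))<..}"]
    show ?thesis unfolding S_def by simp
  qed
  have "compact_space (prod_topology G.X G.X)" using G.compact by (simp add: compact_space_prod_topology)
  then have cpt: "compactin (prod_topology G.X G.X) (units G \<times> units G - W)"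
    using closedin_compact_space[of "prod_topology G.X G.X"] closedin_diff[OF closedin_topspace W(1)] by simp
  have cover: "units G \<times> units G - W \<subseteq> \<Union>(S ` (top_full_group H \<times> UNIV))"
  proof
    fix z assume z: "z \<in> units G \<times> units G - W"
    obtain x y where xy: "z = (x, y)" "x \<in> units G" "y \<in> units G" using z by auto
    then have "x \<noteq> y" using z W(2) by auto
    then obtain e where e: "e \<in> top_full_group H" "0 < pm_ext (units G) \<rho> (ac e x) (ac e y)"
      using gen xy unfolding dynamically_generating_def by blast
    then have "0 < \<rho> (app e x) (app e y)" using act_full[OF e(1)] xy by simp
    then obtain n where "inverse (real (Suc n)) < \<rho> (app e x) (app e y)" using reals_Archimedean by blast
    then have "z \<in> S (e, n)" unfolding S_def using xy by simp
    then show "z \<in> \<Union>(S ` (top_full_group H \<times> UNIV))" using e(1) by blast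
  qed
  obtain \<F> where \<F>: "finite \<F>" "\<F> \<subseteq> S ` (top_full_group H \<times> UNIV)" "units G \<times> units G - W \<subseteq> \<Union>\<F>"
    using compactinD[OF cpt, of "S ` (top_full_group H \<times> UNIV)"] S cover by fastforce
  obtain I where I: "finite I" "I \<subseteq> top_full_group H \<times> UNIV" "\<F> = S ` I"
    using finite_subset_image[OF \<F>(1,2)] by auto
  \<comment> \<open>The sum dominates every index that occurs and also makes sense for an empty
    subcover.\<close>
  define n where "n = (\<Sum>p\<in>I. snd p)"
  show ?thesis
  proof (rule that[of "fst ` I" "inverse (real (Suc n))"])
    fix x y assume xy: "x \<in> units G" "y \<in> units G"
      and small: "\<forall>e\<in>fst ` I. \<rho> (app e x) (app e y) \<le> inverse (real (Suc n))"
    show "(x, y) \<in> W"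
    proof (rule ccontr)
      assume "(x, y) \<notin> W"
      then obtain p where p: "p \<in> I" "(x, y) \<in> S p" using xy \<F>(3) I(3) by blast
      then have "inverse (real (Suc (snd p))) < \<rho> (app (fst p) x) (app (fst p) y)" by (simp add: S_def)
      moreover have "snd p \<le> n" unfolding n_def using p(1) I(1) by (intro member_le_sum) auto
      then have "inverse (real (Suc n)) \<le> inverse (real (Suc (snd p)))" by (simp add: le_imp_inverse_le)
      moreover have "\<rho> (app (fst p) x) (app (fst p) y) \<le> inverse (real (Suc n))"
        using small p(1) by simp
      ultimately show False by linarith
    qed
  qed (use I in auto)
qed

end

section \<open>Growth rates\<close>

lemma eventually_net_filter:
  assumes "directed_set J le"
  shows "eventually P (net_filter J le) \<longleftrightarrow> (\<exists>j\<in>J. \<forall>j'\<in>J. le j j' \<longrightarrow> P j')"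
proof -
  have "\<exists>x\<in>J. principal {j' \<in> J. le x j'} \<le> inf (principal {j' \<in> J. le a j'}) (principal {j' \<in> J. le b j'})"
    if "a \<in> J" "b \<in> J" for a b
  proof -
    obtain k where k: "k \<in> J" "le a k" "le b k"
      using assms \<open>a \<in> J\<close> \<open>b \<in> J\<close> unfolding directed_set_def by blast
    have tr: "\<forall>i\<in>J. \<forall>j\<in>J. \<forall>k\<in>J. le i j \<longrightarrow> le j k \<longrightarrow> le i k"
      using assms unfolding directed_set_def by (elim conjE)
    have "{j' \<in> J. le k j'} \<subseteq> {j' \<in> J. le a j'} \<inter> {j' \<in> J. le b j'}"
      using tr[rule_format, OF that(1) k(1) _ k(2)] tr[rule_format, OF that(2) k(1) _ k(3)] by auto
    then show ?thesis using k(1) by (intro bexI[of _ k]) auto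
  qed
  moreover have "J \<noteq> {}" using assms unfolding directed_set_def by (elim conjE)
  ultimately have "eventually P (net_filter J le) \<longleftrightarrow> (\<exists>j\<in>J. eventually P (principal {j' \<in> J. le j j'}))"
    unfolding net_filter_def by (intro eventually_INF_base)
  then show ?thesis unfolding eventually_principal by auto
qed

lemma net_filter_neq_bot:
  assumes "directed_set J le"
  shows "net_filter J le \<noteq> bot"
proof -
  have "J \<noteq> {}" "\<forall>j\<in>J. le j j" using assms unfolding directed_set_def by simp_all
  then show ?thesis unfolding trivial_limit_def eventually_net_filter[OF assms] by auto
qed

text \<open>The ultrafilter decides on which side of c the function lies, so no c fits strictly
  between lower and upper limit. Ultralimits can thus be handled as upper limits.\<close>

lemma Lim_ultrafilter:
  fixes f :: "'a \<Rightarrow> ereal"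
  assumes U: "is_ultrafilter U"
  shows "Lim U f = Limsup U f"
proof -
  have ne: "U \<noteq> bot" using U unfolding is_ultrafilter_def by blast
  have "Liminf U f = Limsup U f"
  proof (rule antisym[OF Liminf_le_Limsup[OF ne]], rule ccontr)
    assume "\<not> Limsup U f \<le> Liminf U f"
    then obtain c where c: "Liminf U f < c" "c < Limsup U f" 
      using dense[of "Liminf U f" "Limsup U f"] by (auto simp: not_le)
    have "eventually (\<lambda>j. f j \<le> c) U \<or> eventually (\<lambda>j. \<not> f j \<le> c) U"
      using U unfolding is_ultrafilter_def by blast
    then show False
    proof
      assume "eventually (\<lambda>j. f j \<le> c) U"
      then have "Limsup U f \<le> c" by (rule Limsup_bounded)
      then show False using c by simp
    next
      assume "eventually (\<lambda>j. \<not> f j \<le> c) U"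
      then have "eventually (\<lambda>j. c \<le> f j) U" by (rule eventually_mono) simp
      then have "c \<le> Liminf U f" by (rule Liminf_bounded)
      then show False using c by simp
    qed
  qed
  then show ?thesis using ne by (intro tendsto_Lim) (simp_all add: tendsto_iff_Liminf_eq_Limsup)
qed

text \<open>The constant is a real number, so it leaves \<open>Liminf\<close> and
  \<open>Limsup\<close>; an ultrafilter of a bias contains the tails of J, so the eventual
  inequality transfers to it.\<close>

lemma bias_lim_mono:
  assumes J: "directed_set J le" and \<beta>: "is_bias J le \<beta>"
    and ev: "eventually (\<lambda>j. \<Phi> j \<le> \<Psi> j + ereal c) (net_filter J le)"
  shows "bias_lim J le \<beta> \<Phi> \<le> bias_lim J le \<beta> \<Psi> + ereal c"
proof (cases \<beta>)
  case Minus
  have "Liminf (net_filter J le) \<Phi> \<le> Liminf (net_filter J le) (\<lambda>j. \<Psi> j + ereal c)"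
    by (rule Liminf_mono[OF ev])
  then show ?thesis
    using Minus net_filter_neq_bot[OF J] by (simp add: bias_lim_def Liminf_add_ereal_right)
next
  case Plus
  have "Limsup (net_filter J le) \<Phi> \<le> Limsup (net_filter J le) (\<lambda>j. \<Psi> j + ereal c)"
    by (rule Limsup_mono[OF ev])
  then show ?thesis
    using Plus net_filter_neq_bot[OF J] by (simp add: bias_lim_def Limsup_add_ereal_right)
next
  case (Ultra U)
  then have U: "is_ultrafilter U" and tail: "\<And>j. j \<in> J \<Longrightarrow> eventually (\<lambda>j'. j' \<in> J \<and> le j j') U"
    using \<beta> unfolding is_bias_def by auto
  obtain j where j: "j \<in> J" "\<forall>j'\<in>J. le j j' \<longrightarrow> \<Phi> j' \<le> \<Psi> j' + ereal c"
    using ev unfolding eventually_net_filter[OF J] by blast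
  have "eventually (\<lambda>j. \<Phi> j \<le> \<Psi> j + ereal c) U"
    using tail[OF j(1)] by (rule eventually_mono) (use j(2) in blast)
  then have "Limsup U \<Phi> \<le> Limsup U (\<lambda>j. \<Psi> j + ereal c)" by (rule Limsup_mono)
  moreover have "U \<noteq> bot" using U unfolding is_ultrafilter_def by blast
  ultimately show ?thesis
    using Ultra Lim_ultrafilter[OF U] by (simp add: bias_lim_def Limsup_add_ereal_right)
qed

section \<open>L^p norms and logarithms of counts\<close>

lemma ennreal_powr_mono: "0 \<le> a \<Longrightarrow> x \<le> y \<Longrightarrow> ennreal_powr x a \<le> ennreal_powr y a"
  by (cases x; cases y)
    (auto simp: ennreal_powr_def top_unique intro!: ennreal_leI powr_mono2)

lemma ennreal_powr_cmult:
  assumes "0 < c"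
  shows "ennreal_powr (ennreal c * x) a = ennreal (c powr a) * ennreal_powr x a"
proof (cases x)
  case (real r)
  then show ?thesis
    using assms
    by (simp add: ennreal_powr_def ennreal_mult[symmetric] powr_mult)
next
  case top
  then show ?thesis using assms by (simp add: ennreal_powr_def ennreal_mult_top)
qed

lemma ennreal_powr_ennreal: "0 \<le> x \<Longrightarrow> ennreal_powr (ennreal x) a = ennreal (x powr a)"
  by (simp add: ennreal_powr_def)

lemma measurable_ennreal_powr [measurable]:
  assumes [measurable]: "f \<in> borel_measurable M"
  shows "(\<lambda>x. ennreal_powr (f x) a) \<in> borel_measurable M"
  unfolding ennreal_powr_def by measurable

text \<open>Monotonicity and homogeneity, for both forms of the norm. Measurability of f is what
  bounds its \<open>esssup\<close>, that of g lets the factor leave the integral.\<close>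

lemma Lp_norm_le:
  assumes p: "1 \<le> p" and c: "0 < c" and f: "f \<in> borel_measurable M" and g: "g \<in> borel_measurable M"
    and le: "AE x in M. f x \<le> ennreal c * g x"
  shows "Lp_norm p M f \<le> ennreal c * Lp_norm p M g"
proof (cases "p = \<top>")
  case True
  have "AE x in M. f x \<le> ennreal c * esssup M g"
    using le esssup_AE[of g M]
    by eventually_elim (metis mult_left_mono order_trans zero_le)
  then show ?thesis using True f by (simp add: Lp_norm_def esssup_I)
next
  case False
  define q where "q = enn2real p"
  have q: "1 \<le> q" using p False unfolding q_def
    by (metis enn2real_1 enn2real_mono less_top)
  have "(\<integral>\<^sup>+ x. ennreal_powr (f x) q \<partial>M) \<le> (\<integral>\<^sup>+ x. ennreal (c powr q) * ennreal_powr (g x) q \<partial>M)"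
  proof (rule nn_integral_mono_AE)
    show "AE x in M. ennreal_powr (f x) q \<le> ennreal (c powr q) * ennreal_powr (g x) q"
      using le by eventually_elim (use ennreal_powr_mono[of q] q c in \<open>simp add: ennreal_powr_cmult[symmetric]\<close>)
  qed
  also have "\<dots> = ennreal (c powr q) * (\<integral>\<^sup>+ x. ennreal_powr (g x) q \<partial>M)"
    using g by (intro nn_integral_cmult) measurable
  finally have "ennreal_powr (\<integral>\<^sup>+ x. ennreal_powr (f x) q \<partial>M) (1 / q) \<le>
      ennreal_powr (ennreal (c powr q) * (\<integral>\<^sup>+ x. ennreal_powr (g x) q \<partial>M)) (1 / q)"
    using q by (intro ennreal_powr_mono) auto
  also have "\<dots> = ennreal c * ennreal_powr (\<integral>\<^sup>+ x. ennreal_powr (g x) q \<partial>M) (1 / q)"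
    using c q by (subst ennreal_powr_cmult) (auto simp: powr_powr)
  finally show ?thesis using False by (simp add: Lp_norm_def q_def)
qed

text \<open>For q at least 1 the power (1/2) powr (1/q) is at least 1/2, so one bound serves all
  exponents.\<close>

lemma Lp_norm_ge_half:
  assumes M: "prob_space M" and p: "1 \<le> p"
    and S: "S \<in> sets M" "1 / 2 \<le> measure M S" and f: "AE x in M. x \<in> S \<longrightarrow> 1 \<le> f x"
  shows "ennreal (1 / 2) \<le> Lp_norm p M f"
proof -
  interpret prob_space M by (rule M)
  show ?thesis
  proof (cases "p = \<top>")
    case True
    have "1 \<le> esssup M f"
    proof (rule ccontr)
      assume ne: "\<not> 1 \<le> esssup M f"
      have "AE x in M. x \<notin> S" using f esssup_AE[of f M] by eventually_elim (use ne in auto)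
      then have "measure M S = 0" using AE_iff_measurable[of S M "\<lambda>x. x \<notin> S"] S(1) sets.sets_into_space[OF S(1)]
        by (auto simp: measure_def Int_absorb1 subset_iff Collect_conj_eq)
      then show False using S(2) by simp
    qed
    moreover have "ennreal (1 / 2) \<le> 1" unfolding ennreal_le_1 by simp
    ultimately show ?thesis using True by (simp add: Lp_norm_def order_trans)
  next
    case False
    define q where "q = enn2real p"
    have q: "1 \<le> q" using p False unfolding q_def
      by (metis enn2real_1 enn2real_mono less_top)
    have one: "ennreal_powr 1 q = 1" by (simp add: ennreal_powr_def)
    have "emeasure M S = (\<integral>\<^sup>+ x. indicator S x \<partial>M)" using S(1) by simp
    also have "\<dots> \<le> (\<integral>\<^sup>+ x. ennreal_powr (f x) q \<partial>M)"
    proof (rule nn_integral_mono_AE)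
      show "AE x in M. indicator S x \<le> ennreal_powr (f x) q"
        using f
      proof eventually_elim
        case (elim x)
        then show ?case using ennreal_powr_mono[of q 1 "f x"] q one by (cases "x \<in> S") auto
      qed
    qed
    finally have "ennreal (1 / 2) \<le> (\<integral>\<^sup>+ x. ennreal_powr (f x) q \<partial>M)"
      using S(2) order_trans[OF ennreal_leI[OF S(2)]] by (simp add: emeasure_eq_measure)
    then have "ennreal_powr (ennreal (1 / 2)) (1 / q) \<le> ennreal_powr (\<integral>\<^sup>+ x. ennreal_powr (f x) q \<partial>M) (1 / q)"
      using q by (intro ennreal_powr_mono) auto
    moreover have "(1 / 2 :: real) \<le> (1 / 2) powr (1 / q)"
      using powr_mono'[of "1 / q" 1 "1 / 2"] q by simp
    then have "ennreal (1 / 2) \<le> ennreal_powr (ennreal (1 / 2)) (1 / q)"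
      by (subst ennreal_powr_ennreal) (auto intro!: ennreal_leI simp del: ennreal_half)
    ultimately show ?thesis using False by (simp add: Lp_norm_def q_def order_trans)
  qed
qed

lemma ext_ln_le:
  assumes "0 < c" "x \<le> ennreal c * y"
  shows "ext_ln x \<le> ereal (ln c) + ext_ln y"
proof (cases y)
  case (real r)
  show ?thesis
  proof (cases "x = 0")
    case False
    have "x \<le> ennreal (c * r)" using assms real by (simp add: ennreal_mult[symmetric])
    then obtain s where s: "x = ennreal s" "0 \<le> s" "s \<le> c * r"
      using assms(1) real by (cases x) (auto simp: top_unique)
    then have "0 < s" using False by (metis ennreal_0 order_le_less)
    have "0 < r"
    proof (rule ccontr)
      assume "\<not> 0 < r"
      then have "c * r \<le> 0" using assms(1) by (simp add: mult_nonneg_nonpos)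
      then show False using s(3) \<open>0 < s\<close> by linarith
    qed
    have "ln s \<le> ln (c * r)" using s \<open>0 < s\<close> by simp
    then have "ln s \<le> ln c + ln r" using assms(1) \<open>0 < r\<close> by (simp add: ln_mult)
    then show ?thesis using real s \<open>0 < s\<close> \<open>0 < r\<close> by (simp add: ext_ln_def)
  qed (simp add: ext_ln_def)
next
  case top
  then show ?thesis by (simp add: ext_ln_def)
qed

text \<open>A factor exp(\<kappa> d) costs only the additive constant \<kappa> after normalisation,
  which makes subexponential losses disappear as \<kappa> tends to 0.\<close>

lemma scaled_ext_ln_le:
  assumes d: "0 < d" and le: "x \<le> ennreal (exp (\<kappa> * real d)) * y"
  shows "ereal (1 / real d) * ext_ln x \<le> ereal (1 / real d) * ext_ln y + ereal \<kappa>"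
proof -
  have "ext_ln x \<le> ereal (\<kappa> * real d) + ext_ln y" using ext_ln_le[OF _ le] by simp
  then have "ereal (1 / real d) * ext_ln x \<le> ereal (1 / real d) * (ereal (\<kappa> * real d) + ext_ln y)"
    using d by (intro ereal_mult_left_mono) auto
  also have "\<dots> = ereal (1 / real d) * ext_ln y + ereal \<kappa>"
    using d by (cases "ext_ln y") (auto simp: field_simps)
  finally show ?thesis .
qed

section \<open>Finite models and counts determined by finitely many values\<close>

lemma fin_pseudogroupD:
  assumes "f \<in> fin_pseudogroup d"
  shows "f \<subseteq> {1..d} \<times> {1..d}" "\<And>i i' j. (i, j) \<in> f \<Longrightarrow> (i', j) \<in> f \<Longrightarrow> i = i'"
    "\<And>i j j'. (i, j) \<in> f \<Longrightarrow> (i, j') \<in> f \<Longrightarrow> j = j'"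
proof -
  have f: "f \<subseteq> {1..d} \<times> {1..d}" "inj_on (\<lambda>(i, j). (j, j)) f" "inj_on (\<lambda>(i, j). (i, i)) f"
    using assms unfolding fin_pseudogroup_def pseudogroup_def borel_iso_onto_image_def full_groupoid_def
    by auto
  show "f \<subseteq> {1..d} \<times> {1..d}" by (rule f)
  show "i = i'" if "(i, j) \<in> f" "(i', j) \<in> f" for i i' j using inj_onD[OF f(2) _ that] by simp
  show "j = j'" if "(i, j) \<in> f" "(i, j') \<in> f" for i j j' using inj_onD[OF f(3) _ that] by simp
qed

lemma finite_fin_pseudogroup: "finite (fin_pseudogroup d)"
  by (rule finite_subset[of _ "Pow ({1..d} \<times> {1..d})"]) (use fin_pseudogroupD(1) in blast)+

lemma finite_fin_pseudogroup_mem: "f \<in> fin_pseudogroup d \<Longrightarrow> finite f"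
  using fin_pseudogroupD(1) finite_subset by blast

lemma fin_apply_Some: "f \<in> fin_pseudogroup d \<Longrightarrow> fin_apply f j = Some i \<longleftrightarrow> (i, j) \<in> f"
proof -
  assume f: "f \<in> fin_pseudogroup d"
  have "(THE i. (i, j) \<in> f) = i" if "(i, j) \<in> f" for i
    using that fin_pseudogroupD(2)[OF f] by (intro the_equality) auto
  then show ?thesis unfolding fin_apply_def by auto
qed

text \<open>The pseudogroup on d points is finite, so the restrictions to F take finitely many
  values and every preimage is a finite union of cylinder sets.\<close>

lemma measurable_finitely_determined:
  assumes F: "finite F" "F \<subseteq> pseudogroup H M"
    and L: "space L = space (map_space H M d)" "sets L = sets (map_space H M d)"
    and g: "\<And>\<sigma> \<sigma>'. \<sigma> \<in> space L \<Longrightarrow> \<sigma>' \<in> space L \<Longrightarrow> \<forall>f\<in>F. \<sigma> f = \<sigma>' f \<Longrightarrow> g \<sigma> = g \<sigma>'"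
  shows "(g :: _ \<Rightarrow> 'b :: topological_space) \<in> borel_measurable L"
proof (rule measurableI)
  fix S :: "'b set"
  define Maps where "Maps = pseudogroup H M \<rightarrow>\<^sub>E fin_pseudogroup d"
  define \<C> where "\<C> = {{\<sigma>' \<in> Maps. \<forall>f\<in>F. \<sigma>' f = \<sigma> f} | \<sigma> F. \<sigma> \<in> Maps \<and> finite F \<and> F \<subseteq> pseudogroup H M}"
  have ms: "map_space H M d = sigma Maps \<C>" unfolding map_space_def Maps_def \<C>_def Let_def by simp
  have \<C>: "\<C> \<subseteq> Pow Maps" unfolding \<C>_def by auto
  have sp: "space L = Maps" using L(1) \<C> unfolding ms by simp
  have sets: "sets L = sigma_sets Maps \<C>" using L(2) \<C> unfolding ms by simp
  let ?V = "{\<sigma> \<in> Maps. g \<sigma> \<in> S}"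
  have eq: "?V = (\<Union>t\<in>(\<lambda>\<sigma>. restrict \<sigma> F) ` ?V. {\<sigma>' \<in> Maps. \<forall>f\<in>F. \<sigma>' f = t f})"
  proof (intro equalityI subsetI)
    fix \<sigma> assume "\<sigma> \<in> (\<Union>t\<in>(\<lambda>\<sigma>. restrict \<sigma> F) ` ?V. {\<sigma>' \<in> Maps. \<forall>f\<in>F. \<sigma>' f = t f})"
    then obtain \<tau> where \<tau>: "\<tau> \<in> ?V" "\<sigma> \<in> Maps" "\<forall>f\<in>F. \<sigma> f = \<tau> f" by auto
    then have "g \<sigma> = g \<tau>" by (intro g) (auto simp: sp)
    then show "\<sigma> \<in> ?V" using \<tau> by auto
  qed auto
  have "(\<lambda>\<sigma>. restrict \<sigma> F) ` ?V \<subseteq> F \<rightarrow>\<^sub>E fin_pseudogroup d"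
    using F(2) unfolding Maps_def by (auto simp: PiE_iff)
  then have fin: "finite ((\<lambda>\<sigma>. restrict \<sigma> F) ` ?V)"
    by (rule finite_subset) (intro finite_PiE F(1) finite_fin_pseudogroup)
  have "{\<sigma>' \<in> Maps. \<forall>f\<in>F. \<sigma>' f = t f} \<in> sets L" if "t \<in> (\<lambda>\<sigma>. restrict \<sigma> F) ` ?V" for t
  proof -
    obtain \<sigma> where \<sigma>: "\<sigma> \<in> Maps" "t = restrict \<sigma> F" using \<open>t \<in> _\<close> by auto
    have "{\<sigma>' \<in> Maps. \<forall>f\<in>F. \<sigma>' f = t f} = {\<sigma>' \<in> Maps. \<forall>f\<in>F. \<sigma>' f = \<sigma> f}" using \<sigma> by auto
    also have "\<dots> \<in> \<C>" unfolding \<C>_def using \<sigma>(1) F by blast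
    finally show ?thesis unfolding sets by (rule sigma_sets.Basic)
  qed
  then have "?V \<in> sets L" by (subst eq) (intro sets.finite_UN fin)
  moreover have "g -` S \<inter> space L = ?V" unfolding sp by auto
  ultimately show "g -` S \<inter> space L \<in> sets L" by simp
qed simp

locale sofic_setting = H: pmp_gpd H \<nu>
  for H :: "'h top_groupoid" and \<nu> +
  fixes A :: "('j, 'h) approx" and \<beta> :: "'j bias" and p :: ennreal
  assumes sofic: "sofic_approximation H H.M \<nu> A" and bias: "is_bias (idx A) (idx_le A) \<beta>" and p: "1 \<le> p"
begin

abbreviation "net \<equiv> net_filter (idx A) (idx_le A)"

lemma directed: "directed_set (idx A) (idx_le A)"
  using sofic unfolding sofic_approximation_def by (elim conjE)

lemma law:
  assumes "j \<in> idx A"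
  shows "0 < degree A j" "prob_space (law A j)"
    "space (law A j) = space (map_space H H.M (degree A j))"
    "sets (law A j) = sets (map_space H H.M (degree A j))"
proof -
  have "\<forall>j\<in>idx A. 0 < degree A j \<and> prob_space (law A j) \<and>
      space (law A j) = space (map_space H H.M (degree A j)) \<and>
      sets (law A j) = sets (map_space H H.M (degree A j))"
    using sofic unfolding sofic_approximation_def by (elim conjE)
  then show "0 < degree A j" "prob_space (law A j)"
    "space (law A j) = space (map_space H H.M (degree A j))"
    "sets (law A j) = sets (map_space H H.M (degree A j))"
    using assms by simp_all
qed

lemma space_law:
  assumes "j \<in> idx A"
  shows "space (law A j) = pseudogroup H H.M \<rightarrow>\<^sub>E fin_pseudogroup (degree A j)"
  unfolding law(3)[OF assms] map_space_def Let_def by (rule space_measure_of) auto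

lemma eventually_idx: "eventually (\<lambda>j. j \<in> idx A) net"
  proof -
  have "idx A \<noteq> {}" using directed unfolding directed_set_def by (elim conjE)
  then show ?thesis unfolding eventually_net_filter[OF directed] by blast
qed

lemma eventually_multiplicative:
  assumes "finite F" "F \<subseteq> pseudogroup H H.M" "0 < \<delta>"
  shows "eventually (\<lambda>j. AE \<sigma> in law A j. multiplicative H (degree A j) F \<delta> \<sigma>) net"
proof -
  have "\<forall>F \<delta>. finite F \<longrightarrow> F \<subseteq> pseudogroup H H.M \<longrightarrow> 0 < \<delta> \<longrightarrow>
      (\<exists>j\<in>idx A. \<forall>j'\<in>idx A. idx_le A j j' \<longrightarrow>
         (AE \<sigma> in law A j'. multiplicative H (degree A j') F \<delta> \<sigma>))"
    using sofic unfolding sofic_approximation_def by (elim conjE)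
  then show ?thesis unfolding eventually_net_filter[OF directed] using assms by simp
qed

lemma growth_rate_Lp_le:
  assumes "eventually (\<lambda>j. j \<in> idx A \<longrightarrow> Lp_norm p (law A j) (\<Phi> (degree A j)) \<le>
      ennreal (exp (\<kappa> * real (degree A j))) * Lp_norm p (law A j) (\<Psi> (degree A j))) net"
  shows "growth_rate A \<beta> p \<Phi> \<le> growth_rate A \<beta> p \<Psi> + ereal \<kappa>"
  unfolding growth_rate_def
proof (rule bias_lim_mono[OF directed bias])
  show "eventually (\<lambda>j. ereal (1 / real (degree A j)) * ext_ln (Lp_norm p (law A j) (\<Phi> (degree A j)))
      \<le> ereal (1 / real (degree A j)) * ext_ln (Lp_norm p (law A j) (\<Psi> (degree A j))) + ereal \<kappa>) net"
    using assms eventually_idx by eventually_elim (rule scaled_ext_ln_le, auto simp: law)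
qed

text \<open>Counts that depend on finitely many values of \<sigma> are measurable, so an almost sure
  comparison passes to the L^p norms.\<close>

lemma growth_rate_le:
  assumes F: "finite F" "F \<subseteq> pseudogroup H H.M"
    and \<Phi>: "\<And>d \<sigma> \<sigma>'. \<forall>f\<in>F. \<sigma> f = \<sigma>' f \<Longrightarrow> \<Phi> d \<sigma> = \<Phi> d \<sigma>'"
    and \<Psi>: "\<And>d \<sigma> \<sigma>'. \<forall>f\<in>F. \<sigma> f = \<sigma>' f \<Longrightarrow> \<Psi> d \<sigma> = \<Psi> d \<sigma>'"
    and le: "eventually (\<lambda>j. j \<in> idx A \<longrightarrow> (AE \<sigma> in law A j. \<Phi> (degree A j) \<sigma> \<le>
      ennreal (exp (\<kappa> * real (degree A j))) * \<Psi> (degree A j) \<sigma>)) net"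
  shows "growth_rate A \<beta> p \<Phi> \<le> growth_rate A \<beta> p \<Psi> + ereal \<kappa>"
proof (rule growth_rate_Lp_le)
  show "eventually (\<lambda>j. j \<in> idx A \<longrightarrow> Lp_norm p (law A j) (\<Phi> (degree A j)) \<le>
      ennreal (exp (\<kappa> * real (degree A j))) * Lp_norm p (law A j) (\<Psi> (degree A j))) net"
    using le
  proof eventually_elim
    case (elim j)
    show ?case
    proof
      assume j: "j \<in> idx A"
      show "Lp_norm p (law A j) (\<Phi> (degree A j)) \<le>
          ennreal (exp (\<kappa> * real (degree A j))) * Lp_norm p (law A j) (\<Psi> (degree A j))"
      proof (rule Lp_norm_le[OF p])
        show "\<Phi> (degree A j) \<in> borel_measurable (law A j)"
          by (rule measurable_finitely_determined[OF F law(3,4)[OF j]]) (rule \<Phi>)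
        show "\<Psi> (degree A j) \<in> borel_measurable (law A j)"
          by (rule measurable_finitely_determined[OF F law(3,4)[OF j]]) (rule \<Psi>)
      qed (use elim j in auto)
    qed
  qed
qed

end

section \<open>Hamming balls\<close>

text \<open>A Chernoff-type estimate: weight n by t to the power of its distance from
  \<open>n\<^sub>0\<close>. The total weight factorises and is at most (1 + t m)^d, while each
  member of the ball has weight at least t powr (a d).\<close>

lemma hamming_ball_bound:
  assumes Q: "finite Q" and \<kappa>: "(0::real) < \<kappa>"
  obtains a where "0 < a" "\<And>(d::nat) n\<^sub>0. real (card {n \<in> {1..d} \<rightarrow>\<^sub>E Q.
      real (card {i \<in> {1..d}. n i \<noteq> n\<^sub>0 i}) \<le> a * real d}) \<le> exp (\<kappa> * real d)"
proof -
  define m where "m = real (card Q)"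
  \<comment> \<open>The second bound gives 1 + t m <= exp(\<kappa> / 2); the first keeps t below 1,
    so that ln (1 / t) is positive.\<close>
  define t where "t = min (1 / 2) ((exp (\<kappa> / 2) - 1) / (m + 1))"
  have m: "0 \<le> m" unfolding m_def by simp
  have t: "0 < t" "t < 1" unfolding t_def using \<kappa> m by (auto simp: min_def)
  have "t * m \<le> t * (m + 1)" using t by simp
  also have "\<dots> \<le> (exp (\<kappa> / 2) - 1) / (m + 1) * (m + 1)"
    using m by (intro mult_right_mono) (auto simp: t_def)
  also have "\<dots> = exp (\<kappa> / 2) - 1" using m by simp
  finally have tm: "1 + t * m \<le> exp (\<kappa> / 2)" by simp
  \<comment> \<open>Chosen so that t powr (a d) = exp(- \<kappa> d / 2): half of the exponent pays
    for the total weight, half for the smallest weight in the ball.\<close>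
  define a where "a = \<kappa> / 2 / ln (1 / t)"
  have lt: "0 < ln (1 / t)" using t by simp
  have a: "0 < a" unfolding a_def using lt \<kappa> by simp
  show ?thesis
  proof (rule that[OF a])
    fix d :: nat and n\<^sub>0 :: "nat \<Rightarrow> 'a"
    let ?h = "\<lambda>n. card {i \<in> {1..d}. n i \<noteq> n\<^sub>0 i}"
    let ?B = "{n \<in> {1..d} \<rightarrow>\<^sub>E Q. real (?h n) \<le> a * real d}"
    have fin: "finite ({1..d} \<rightarrow>\<^sub>E Q)" using Q by (intro finite_PiE) auto
    have prod: "(\<Prod>i\<in>{1..d}. if n i \<noteq> n\<^sub>0 i then t else 1) = t ^ ?h n" for n
      by (simp add: prod.If_cases Int_def)
    have "(\<Sum>q\<in>Q. if q \<noteq> n\<^sub>0 i then t else 1) \<le> 1 + t * m" for i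
    proof -
      have "(\<Sum>q\<in>Q. if q \<noteq> n\<^sub>0 i then t else 1) \<le> (\<Sum>q\<in>Q. t + (if q = n\<^sub>0 i then 1 else 0))"
        using t by (intro sum_mono) auto
      also have "\<dots> = t * m + (if n\<^sub>0 i \<in> Q then 1 else 0)"
        using Q by (simp add: sum.distrib m_def)
      finally show ?thesis by (auto split: if_splits)
    qed
    then have "(\<Prod>i\<in>{1..d}. \<Sum>q\<in>Q. if q \<noteq> n\<^sub>0 i then t else 1) \<le> (\<Prod>i\<in>{1..d}. 1 + t * m)"
      using t by (intro prod_mono) (auto intro!: sum_nonneg)
    also have "\<dots> \<le> exp (\<kappa> / 2) ^ d" using tm t m by (simp add: power_mono)
    also have "(\<Prod>i\<in>{1..d}. \<Sum>q\<in>Q. if q \<noteq> n\<^sub>0 i then t else 1) = (\<Sum>n\<in>{1..d} \<rightarrow>\<^sub>E Q. t ^ ?h n)"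
      using prod_sum_PiE[of "{1..d}" "\<lambda>_. Q" "\<lambda>i q. if q \<noteq> n\<^sub>0 i then t else 1"] Q
      unfolding prod by simp
    also have "exp (\<kappa> / 2) ^ d = exp (\<kappa> / 2 * real d)"
      by (metis exp_of_nat_mult mult.commute)
    finally have "(\<Sum>n\<in>{1..d} \<rightarrow>\<^sub>E Q. t ^ ?h n) \<le> exp (\<kappa> / 2 * real d)" .
    moreover have "real (card ?B) * t powr (a * real d) \<le> (\<Sum>n\<in>?B. t ^ ?h n)"
    proof -
      have "t powr (a * real d) \<le> t ^ ?h n" if "n \<in> ?B" for n
      proof -
        have "t powr (a * real d) \<le> t powr (real (?h n))" using that t by (intro powr_mono') auto
        then show ?thesis using t by (simp add: powr_realpow)
      qed
      then show ?thesis using sum_bounded_below[of ?B "t powr (a * real d)" "\<lambda>n. t ^ ?h n"] by simp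
    qed
    moreover have "(\<Sum>n\<in>?B. t ^ ?h n) \<le> (\<Sum>n\<in>{1..d} \<rightarrow>\<^sub>E Q. t ^ ?h n)"
      using fin t by (intro sum_mono2) auto
    ultimately have le: "real (card ?B) * t powr (a * real d) \<le> exp (\<kappa> / 2 * real d)" by linarith
    have "t powr (a * real d) = exp (- (\<kappa> / 2 * real d))"
    proof -
      have "a * ln t = - (\<kappa> / 2)" unfolding a_def using t lt by (simp add: ln_div)
      moreover have "a * real d * ln t = real d * (a * ln t)" by simp
      ultimately have "a * real d * ln t = - (\<kappa> / 2 * real d)" by simp
      then show ?thesis using t by (simp add: powr_def)
    qed
    then have "real (card ?B) * exp (- (\<kappa> / 2 * real d)) * exp (\<kappa> / 2 * real d)
        \<le> exp (\<kappa> / 2 * real d) * exp (\<kappa> / 2 * real d)"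
      using le by (intro mult_right_mono) auto
    then show "real (card ?B) \<le> exp (\<kappa> * real d)"
      by (simp add: mult.assoc exp_add[symmetric] mult_exp_exp)
  qed
qed

section \<open>Partitions and homomorphisms\<close>

lemma atoms_of_decide: "B \<in> atoms_of Y C \<Longrightarrow> S \<in> C \<Longrightarrow> B \<subseteq> S \<or> B \<inter> S = {}"
  unfolding atoms_of_def by auto

lemma finite_atoms_of:
  assumes "finite C"
  shows "finite (atoms_of Y C)"
proof (rule finite_subset)
  show "atoms_of Y C \<subseteq> (\<lambda>D. {y \<in> Y. \<forall>S\<in>C. y \<in> S \<longleftrightarrow> S \<in> D}) ` Pow C"
  proof
    fix B assume "B \<in> atoms_of Y C"
    then obtain x where "B = {y \<in> Y. \<forall>S\<in>C. y \<in> S \<longleftrightarrow> x \<in> S}" unfolding atoms_of_def by blast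
    then have "B = {y \<in> Y. \<forall>S\<in>C. y \<in> S \<longleftrightarrow> S \<in> {S \<in> C. x \<in> S}}" by auto
    then show "B \<in> (\<lambda>D. {y \<in> Y. \<forall>S\<in>C. y \<in> S \<longleftrightarrow> S \<in> D}) ` Pow C" by blast
  qed
qed (use assms in simp)

text \<open>The unions of members of a partition already form a sigma-algebra.\<close>

lemma sigma_sets_partition:
  assumes P: "partition_on Y \<P>" and S: "S \<in> sigma_sets Y \<P>"
  shows "S = \<Union>{B \<in> \<P>. B \<subseteq> S}"
proof -
  have "\<exists>R\<subseteq>\<P>. S = \<Union>R"
    using S
  proof induction
    case (Basic a)
    then show ?case by (intro exI[of _ "{a}"]) auto
  next
    case Empty
    show ?case by (intro exI[of _ "{}"]) auto
  next
    case (Compl a)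
    then obtain R where R: "R \<subseteq> \<P>" "a = \<Union>R" by blast
    have "Y - a = \<Union>(\<P> - R)"
    proof (intro equalityI subsetI)
      fix y assume "y \<in> Y - a"
      then show "y \<in> \<Union>(\<P> - R)" using partition_onD1[OF P] R by auto
    next
      fix y assume "y \<in> \<Union>(\<P> - R)"
      then obtain B where B: "B \<in> \<P>" "B \<notin> R" "y \<in> B" by blast
      have "y \<notin> a"
      proof
        assume "y \<in> a"
        then obtain B' where B': "B' \<in> R" "y \<in> B'" using R(2) by auto
        then have "B' \<in> \<P>" "B' \<noteq> B" using R(1) B(2) by auto
        then show False using disjointD[OF partition_onD2[OF P], of B B'] B B'(2) by auto
      qed
      then show "y \<in> Y - a" using B partition_onD1[OF P] by auto
    qed
    then show ?case by (intro exI[of _ "\<P> - R"]) auto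
  next
    case (Union a)
    have a: "\<exists>B\<in>\<P>. y \<in> B \<and> B \<subseteq> a n" if y: "y \<in> a n" for y n
    proof -
      obtain R where R: "R \<subseteq> \<P>" "a n = \<Union>R" using Union.IH[of n] by auto
      then obtain B where "B \<in> R" "y \<in> B" using y by auto
      then show ?thesis using R by (intro bexI[of _ B]) auto
    qed
    have "(\<Union>n. a n) = \<Union>(\<Union>n. {B \<in> \<P>. B \<subseteq> a n})"
    proof (intro equalityI subsetI)
      fix y assume "y \<in> (\<Union>n. a n)"
      then obtain n where "y \<in> a n" by auto
      from a[OF this] show "y \<in> \<Union>(\<Union>n. {B \<in> \<P>. B \<subseteq> a n})" by auto
    qed auto
    then show ?case by (intro exI[of _ "\<Union>n. {B \<in> \<P>. B \<subseteq> a n}"]) auto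
  qed
  then show ?thesis by blast
qed

lemma sigma_sets_Union:
  assumes "finite \<P>" "R \<subseteq> \<P>"
  shows "\<Union>R \<in> sigma_sets Y \<P>"
proof (rule sigma_sets_UNION)
  show "countable R" using finite_subset[OF assms(2,1)] by (rule countable_finite)
qed (use assms(2) in \<open>auto intro: sigma_sets.Basic\<close>)

lemma finite_sigma_sets_partition:
  assumes "partition_on Y \<P>" "finite \<P>"
  shows "finite (sigma_sets Y \<P>)"
proof (rule finite_subset)
  show "sigma_sets Y \<P> \<subseteq> Union ` Pow \<P>"
  proof
    fix S assume "S \<in> sigma_sets Y \<P>"
    from sigma_sets_partition[OF assms(1) this] show "S \<in> Union ` Pow \<P>" by blast
  qed
qed (use assms(2) in simp)

section \<open>Empirical frequencies and counting in the finite models\<close>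

definition freq :: "nat \<Rightarrow> (nat \<Rightarrow> 'a) \<Rightarrow> 'a set \<Rightarrow> real" where
  "freq d x S = fin_size d {i \<in> {1..d}. x i \<in> S}"

lemma freq_UN:
  assumes "finite I" "\<And>i j. i \<in> I \<Longrightarrow> j \<in> I \<Longrightarrow> i \<noteq> j \<Longrightarrow> S i \<inter> S j = {}"
  shows "freq d x (\<Union>i\<in>I. S i) = (\<Sum>i\<in>I. freq d x (S i))"
proof -
  have "{k \<in> {1..d}. x k \<in> (\<Union>i\<in>I. S i)} = (\<Union>i\<in>I. {k \<in> {1..d}. x k \<in> S i})" by auto
  moreover have "card (\<Union>i\<in>I. {k \<in> {1..d}. x k \<in> S i}) = (\<Sum>i\<in>I. card {k \<in> {1..d}. x k \<in> S i})"
    using assms by (intro card_UN_disjoint) auto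
  ultimately show ?thesis
    unfolding freq_def fin_size_def by (simp only: sum_divide_distrib of_nat_sum)
qed

lemma freq_full: "0 < d \<Longrightarrow> x \<in> {1..d} \<rightarrow>\<^sub>E Y \<Longrightarrow> freq d x Y = 1"
proof -
  assume "0 < d" "x \<in> {1..d} \<rightarrow>\<^sub>E Y"
  then have "{i \<in> {1..d}. x i \<in> Y} = {1..d}" by auto
  then show "freq d x Y = 1" using \<open>0 < d\<close> by (simp add: freq_def fin_size_def)
qed

lemma card_le_sum_bound:
  assumes "finite A" "A \<subseteq> (\<Union>i\<in>I. B i)" "finite I" "\<And>i. i \<in> I \<Longrightarrow> finite (B i)"
  shows "card A \<le> (\<Sum>i\<in>I. card (B i))"
proof -
  have "card A \<le> card (\<Union>i\<in>I. B i)" using assms by (intro card_mono) auto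
  also have "\<dots> \<le> (\<Sum>i\<in>I. card (B i))" by (rule card_UN_le[OF assms(3)])
  finally show ?thesis .
qed

text \<open>A partial injection loses no point of its domain; the domain consists of the second
  components.\<close>

lemma card_injective_relation:
  assumes f: "f \<in> fin_pseudogroup d" and J: "J \<subseteq> snd ` f"
  shows "card (fin_image f J) = card J"
proof -
  have ex: "\<exists>i. (i, j) \<in> f" if "j \<in> J" for j using J that by force
  define h where "h j = (SOME i. (i, j) \<in> f)" for j
  have h: "(h j, j) \<in> f" if "j \<in> J" for j unfolding h_def using ex[OF that] by (rule someI_ex)
  have "fin_image f J = h ` J"
    unfolding fin_image_def using h fin_pseudogroupD(2)[OF f] by (auto simp: image_iff) metis+
  moreover have "inj_on h J"
    using h fin_pseudogroupD(3)[OF f] by (intro inj_onI) metis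
  ultimately show ?thesis by (simp add: card_image)
qed

lemma fin_image_subset: "f \<in> fin_pseudogroup d \<Longrightarrow> fin_image f J \<subseteq> {1..d}"
  using fin_pseudogroupD(1) unfolding fin_image_def by blast

text \<open>Chebyshev's inequality for the uniform distribution on {1..d}.\<close>

lemma markov_count:
  assumes d: "0 < d" and t: "0 < t" and c: "\<And>i. i \<in> {1..d} \<Longrightarrow> 0 \<le> c i"
    and le: "sqrt ((\<Sum>i\<in>{1..d}. (c i)\<^sup>2) / real d) \<le> s"
  shows "real (card {i \<in> {1..d}. t < c i}) \<le> s\<^sup>2 / t\<^sup>2 * real d"
proof -
  have "(\<Sum>i\<in>{1..d}. (c i)\<^sup>2) / real d \<le> s\<^sup>2"
    using le by (rule sqrt_le_D)
  then have sum: "(\<Sum>i\<in>{1..d}. (c i)\<^sup>2) \<le> s\<^sup>2 * real d" using d by (simp add: field_simps)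
  have "real (card {i \<in> {1..d}. t < c i}) * t\<^sup>2 \<le> (\<Sum>i\<in>{i \<in> {1..d}. t < c i}. (c i)\<^sup>2)"
    using t sum_bounded_below[of "{i \<in> {1..d}. t < c i}" "t\<^sup>2" "\<lambda>i. (c i)\<^sup>2"]
    by (auto intro!: power_mono)
  also have "\<dots> \<le> (\<Sum>i\<in>{1..d}. (c i)\<^sup>2)" by (intro sum_mono2) auto
  finally show ?thesis using sum t by (simp add: field_simps)
qed

text \<open>The set S is maximal under inclusion. D is not assumed symmetric or zero on the
  diagonal, so a point that cannot be added may violate the inequality in either order or belong to
  S already.\<close>

lemma maximal_separated:
  fixes D :: "'b \<Rightarrow> 'b \<Rightarrow> real"
  assumes "finite Z"
  obtains S where "S \<subseteq> Z" "\<And>x y. x \<in> S \<Longrightarrow> y \<in> S \<Longrightarrow> x \<noteq> y \<Longrightarrow> \<epsilon> < D x y"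
    "\<And>z. z \<in> Z \<Longrightarrow> \<exists>s\<in>S. z = s \<or> D z s \<le> \<epsilon> \<or> D s z \<le> \<epsilon>"
proof -
  let ?F = "{S. S \<subseteq> Z \<and> (\<forall>x\<in>S. \<forall>y\<in>S. x \<noteq> y \<longrightarrow> \<epsilon> < D x y)}"
  have "finite ?F" using assms by auto
  moreover have "{} \<in> ?F" by simp
  then have "?F \<noteq> {}" by (simp only: ex_in_conv[symmetric]) (rule exI)
  ultimately have "\<exists>S\<in>?F. \<forall>S'\<in>?F. S \<le> S' \<longrightarrow> S = S'" by (rule finite_has_maximal)
  then obtain S where S: "S \<in> ?F" and max: "\<forall>S'\<in>?F. S \<le> S' \<longrightarrow> S = S'" by (elim bexE)
  show ?thesis
  proof (rule that[of S])
    fix z assume z: "z \<in> Z"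
    show "\<exists>s\<in>S. z = s \<or> D z s \<le> \<epsilon> \<or> D s z \<le> \<epsilon>"
    proof (rule ccontr)
      assume *: "\<not> ?thesis"
      then have "insert z S \<in> ?F" using S z by auto
      from bspec[OF max this] have "S = insert z S" by (simp add: subset_insertI)
      then have "z \<in> S" by blast
      then show False using * by blast
    qed
  qed (use S in auto)
qed

lemma card_le_sep_number:
  assumes "finite S" "S \<subseteq> X" "\<And>x y. x \<in> S \<Longrightarrow> y \<in> S \<Longrightarrow> x \<noteq> y \<Longrightarrow> \<epsilon> < D x y"
  shows "of_nat (card S) \<le> sep_number \<epsilon> D X"
  unfolding sep_number_def using assms by (intro SUP_upper) auto

context pmp_gpd
begin

lemma finite_borel_atoms:
  assumes "finite C" "C \<subseteq> sets \<mu>"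
  shows "finite_borel_partition G \<mu> (atoms_of (units G) C)"
  unfolding finite_borel_partition_def
proof (intro conjI subsetI)
  show "finite (atoms_of (units G) C)" by (rule finite_atoms_of[OF assms(1)])
  have "S \<subseteq> units G" if "S \<in> C" for S using that assms(2) sets_mu by auto
  then show "partition_on (units G) (atoms_of (units G) C)" by (rule atoms_of_coarsest(1))
  fix B assume "B \<in> atoms_of (units G) C"
  then obtain x where B: "B = {y \<in> units G. \<forall>S\<in>C. y \<in> S \<longleftrightarrow> x \<in> S}" unfolding atoms_of_def by blast
  have "{y \<in> space \<mu>. \<forall>S\<in>C. y \<in> S \<longleftrightarrow> x \<in> S} \<in> sets \<mu>"
  proof (rule sets.sets_Collect_finite_All[OF _ assms(1)])
    fix S assume S: "S \<in> C"
    have "{y \<in> space \<mu>. y \<in> S \<longleftrightarrow> x \<in> S} = (if x \<in> S then S else space \<mu> - S)"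
      using S assms(2) sets.sets_into_space[of S \<mu>] by auto
    then show "{y \<in> space \<mu>. y \<in> S \<longleftrightarrow> x \<in> S} \<in> sets \<mu>" using S assms(2) by auto
  qed
  then show "B \<in> sets \<mu>" using B space_mu by simp
qed

lemma fbpD:
  assumes "finite_borel_partition G \<mu> \<P>"
  shows "finite \<P>" "partition_on (units G) \<P>" "\<And>B. B \<in> \<P> \<Longrightarrow> B \<in> sets \<mu>" "\<And>B. B \<in> \<P> \<Longrightarrow> B \<subseteq> units G"
    "\<And>B B'. B \<in> \<P> \<Longrightarrow> B' \<in> \<P> \<Longrightarrow> B \<noteq> B' \<Longrightarrow> B \<inter> B' = {}" "\<Union>\<P> = units G" "\<And>B. B \<in> \<P> \<Longrightarrow> B \<noteq> {}"
proof -
  show P: "finite \<P>" "partition_on (units G) \<P>" "\<And>B. B \<in> \<P> \<Longrightarrow> B \<in> sets \<mu>"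
    using assms unfolding finite_borel_partition_def by auto
  show "\<And>B. B \<in> \<P> \<Longrightarrow> B \<subseteq> units G" "\<Union>\<P> = units G" "\<And>B. B \<in> \<P> \<Longrightarrow> B \<noteq> {}"
    using partition_onD1[OF P(2)] partition_onD3[OF P(2)] by auto
  show "\<And>B B'. B \<in> \<P> \<Longrightarrow> B' \<in> \<P> \<Longrightarrow> B \<noteq> B' \<Longrightarrow> B \<inter> B' = {}"
    using disjointD[OF partition_onD2[OF P(2)]] by blast
qed

lemma measure_UN_disjoint:
  assumes "finite I" "\<And>i. i \<in> I \<Longrightarrow> S i \<in> sets \<mu>"
    "\<And>i j. i \<in> I \<Longrightarrow> j \<in> I \<Longrightarrow> i \<noteq> j \<Longrightarrow> S i \<inter> S j = {}"
  shows "measure \<mu> (\<Union>i\<in>I. S i) = (\<Sum>i\<in>I. measure \<mu> (S i))"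
  using assms by (intro finite_measure_finite_Union) (auto simp: disjoint_family_on_def)

text \<open>Each set is a union of atoms and disjoint sets use disjoint atoms, so the triangle
  inequality passes the total error on the atoms to any disjoint family.\<close>

lemma freq_error:
  assumes P: "finite_borel_partition G \<mu> \<R>" and I: "finite I"
    and S: "\<And>i. i \<in> I \<Longrightarrow> S i \<in> sigma_sets (units G) \<R>"
    and disj: "\<And>i j. i \<in> I \<Longrightarrow> j \<in> I \<Longrightarrow> i \<noteq> j \<Longrightarrow> S i \<inter> S j = {}"
  shows "(\<Sum>i\<in>I. \<bar>freq d x (S i) - measure \<mu> (S i)\<bar>) \<le> (\<Sum>B\<in>\<R>. \<bar>freq d x B - measure \<mu> B\<bar>)"
proof -
  let ?e = "\<lambda>B. \<bar>freq d x B - measure \<mu> B\<bar>" and ?B = "\<lambda>i. {B \<in> \<R>. B \<subseteq> S i}"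
  note P' = fbpD[OF P]
  have "?e (S i) \<le> (\<Sum>B\<in>?B i. ?e B)" if i: "i \<in> I" for i
  proof -
    have SU: "S i = (\<Union>B\<in>?B i. B)" using sigma_sets_partition[OF P'(2) S[OF i]] by simp
    have 1: "freq d x (S i) = (\<Sum>B\<in>?B i. freq d x B)"
      by (subst SU, rule freq_UN) (use P'(1,5) in auto)
    have 2: "measure \<mu> (S i) = (\<Sum>B\<in>?B i. measure \<mu> B)"
      by (subst SU, rule measure_UN_disjoint) (use P'(1,3,5) in auto)
    show ?thesis unfolding 1 2 sum_subtractf[symmetric] by (rule sum_abs)
  qed
  then have "(\<Sum>i\<in>I. ?e (S i)) \<le> (\<Sum>i\<in>I. \<Sum>B\<in>?B i. ?e B)" by (intro sum_mono)
  also have "\<dots> = (\<Sum>B\<in>(\<Union>i\<in>I. ?B i). ?e B)"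
  proof (rule sum.UNION_disjoint[symmetric, OF I])
    show "\<forall>i\<in>I. finite (?B i)" using P'(1) by auto
    show "\<forall>i\<in>I. \<forall>j\<in>I. i \<noteq> j \<longrightarrow> ?B i \<inter> ?B j = {}" using disj P'(7) by blast
  qed
  also have "\<dots> \<le> (\<Sum>B\<in>\<R>. ?e B)" using P'(1) by (intro sum_mono2) auto
  finally show ?thesis .
qed

end

section \<open>Partition algebras and their homomorphisms\<close>

context pmp_factor_map
begin

text \<open>Since \<open>units H\<close> acts as the identity, every part of \<P> is itself a
  generating set; this is why the power refines \<P>.\<close>

lemma partition_power:
  assumes P: "finite_borel_partition G \<mu> \<P>" and F: "finite F" "F \<subseteq> pseudogroup H H.M" "units H \<in> F"
  shows "finite_borel_partition G \<mu> (partition_power G H \<pi> \<P> F)"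
    "\<And>f A. f \<in> F \<Longrightarrow> A \<in> \<P> \<Longrightarrow> act_set G H \<pi> f A \<in> sigma_sets (units G) (partition_power G H \<pi> \<P> F)"
    "\<And>A. A \<in> \<P> \<Longrightarrow> A \<in> sigma_sets (units G) (partition_power G H \<pi> \<P> F)"
    "refines (units G) (partition_power G H \<pi> \<P> F) \<P>"
proof -
  let ?C = "{act_set G H \<pi> f P | f P. f \<in> F \<and> P \<in> \<P>}" and ?\<R> = "partition_power G H \<pi> \<P> F"
  have "?C = (\<lambda>(f, P). act_set G H \<pi> f P) ` (F \<times> \<P>)" by auto
  then have fin: "finite ?C" using F(1) G.fbpD(1)[OF P] by simp
  have meas: "?C \<subseteq> sets \<mu>" using act_set_measurable(1) F(2) G.fbpD(3)[OF P] by auto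
  show \<R>: "finite_borel_partition G \<mu> ?\<R>"
    unfolding partition_power_def by (rule G.finite_borel_atoms[OF fin meas])
  show 2: "act_set G H \<pi> f A \<in> sigma_sets (units G) ?\<R>" if "f \<in> F" "A \<in> \<P>" for f A
  proof -
    have C: "S \<subseteq> units G" if "S \<in> ?C" for S using that meas G.sets_mu by auto
    have "act_set G H \<pi> f A \<in> ?C" using that by blast
    from atoms_of_coarsest(2)[OF C this] obtain R where "R \<subseteq> ?\<R>" "act_set G H \<pi> f A = \<Union>R"
      unfolding partition_power_def by blast
    then show ?thesis using sigma_sets_Union[OF G.fbpD(1)[OF \<R>]] by metis
  qed
  show 3: "A \<in> sigma_sets (units G) ?\<R>" if "A \<in> \<P>" for A
    using 2[OF F(3) that] act_set_units[OF G.fbpD(4)[OF P that]] by simp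
  have "\<exists>A\<in>\<P>. B \<subseteq> A" if B: "B \<in> ?\<R>" for B
  proof -
    obtain y where y: "y \<in> B" using G.fbpD(7)[OF \<R> B] by blast
    then obtain A where A: "A \<in> \<P>" "y \<in> A" using G.fbpD(4)[OF \<R> B] G.fbpD(6)[OF P] by blast
    have "A \<in> ?C" using A(1) F(3) act_set_units[OF G.fbpD(4)[OF P A(1)]] by force
    then have "B \<subseteq> A" using atoms_of_decide[of B "units G" ?C A] B y A(2) unfolding partition_power_def by blast
    then show ?thesis using A(1) by blast
  qed
  then show "refines (units G) ?\<R> \<P>"
    using G.fbpD(2)[OF \<R>] G.fbpD(2)[OF P] by (simp add: refines_def)
qed

text \<open>The images of the atoms cover {1..d}, so each index selects an atom and x picks a point
  of it. Preservation of unions and intersections then turns membership of an index in an image into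
  membership of the point.\<close>

lemma Hom_points:
  assumes P: "finite_borel_partition G \<mu> \<P>" and F: "finite F" "F \<subseteq> pseudogroup H H.M" "units H \<in> F"
    and \<phi>: "\<phi> \<in> Hom_sets G \<mu> H \<pi> \<P> F \<delta> d \<sigma>"
  obtains x where "x \<in> {1..d} \<rightarrow>\<^sub>E units G"
    "\<And>S. S \<in> sigma_sets (units G) (partition_power G H \<pi> \<P> F) \<Longrightarrow> \<phi> S = {i \<in> {1..d}. x i \<in> S}"
proof -
  let ?\<R> = "partition_power G H \<pi> \<P> F"
  let ?\<Sigma> = "sigma_sets (units G) ?\<R>"
  note \<R> = partition_power(1)[OF P F]
  note \<R>' = G.fbpD[OF \<R>]
  have \<phi>0: "\<phi> {} = {}" and \<phi>1: "\<phi> (units G) = {1..d}" and \<phi>d: "\<And>S. S \<in> ?\<Sigma> \<Longrightarrow> \<phi> S \<subseteq> {1..d}"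
    and \<phi>U: "\<And>S S'. S \<in> ?\<Sigma> \<Longrightarrow> S' \<in> ?\<Sigma> \<Longrightarrow> \<phi> (S \<union> S') = \<phi> S \<union> \<phi> S'"
    and \<phi>I: "\<And>S S'. S \<in> ?\<Sigma> \<Longrightarrow> S' \<in> ?\<Sigma> \<Longrightarrow> \<phi> (S \<inter> S') = \<phi> S \<inter> \<phi> S'"
    using \<phi> unfolding Hom_sets_def Let_def by (auto simp: PiE_iff)
  have un: "\<phi> (\<Union>R) = (\<Union>B\<in>R. \<phi> B)" if "finite R" "R \<subseteq> ?\<R>" for R
    using that
  proof induction
    case (insert B R)
    have "\<phi> (B \<union> \<Union>R) = \<phi> B \<union> \<phi> (\<Union>R)"
      using insert.prems by (intro \<phi>U sigma_sets_Union \<R>'(1)) (auto intro: sigma_sets.Basic)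
    then show ?case using insert by simp
  qed (simp add: \<phi>0)
  have "\<exists>B\<in>?\<R>. i \<in> \<phi> B" if "i \<in> {1..d}" for i
    using un[OF \<R>'(1) subset_refl] \<R>'(6) \<phi>1 that by auto
  then obtain b where b: "\<And>i. i \<in> {1..d} \<Longrightarrow> b i \<in> ?\<R> \<and> i \<in> \<phi> (b i)" by metis
  define x where "x = restrict (\<lambda>i. SOME y. y \<in> b i) {1..d}"
  have x: "x i \<in> b i" if "i \<in> {1..d}" for i
    unfolding x_def using that b[OF that] \<R>'(7) some_in_eq[of "b i"] by simp
  show ?thesis
  proof (rule that[of x])
    show "x \<in> {1..d} \<rightarrow>\<^sub>E units G" using x b \<R>'(4) by (fastforce simp: x_def PiE_iff)
    fix S assume S: "S \<in> ?\<Sigma>"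
    have "i \<in> \<phi> S \<longleftrightarrow> x i \<in> S" if i: "i \<in> {1..d}" for i
    proof (cases "b i \<subseteq> S")
      case True
      have "\<phi> (S \<union> b i) = \<phi> S \<union> \<phi> (b i)" using b[OF i] by (intro \<phi>U S) (auto intro: sigma_sets.Basic)
      moreover have "S \<union> b i = S" using True by auto
      ultimately have "i \<in> \<phi> S" using b[OF i] by auto
      then show ?thesis using True x[OF i] by auto
    next
      case False
      have "b i \<inter> S = {}"
      proof -
        have "b i \<inter> B = {}" if "B \<in> ?\<R>" "B \<subseteq> S" for B
          using \<R>'(5)[of "b i" B] b[OF i] that False by auto
        moreover have "S = \<Union>{B \<in> ?\<R>. B \<subseteq> S}" by (rule sigma_sets_partition[OF \<R>'(2) S])
        ultimately show ?thesis by blast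
      qed
      moreover have "\<phi> (b i \<inter> S) = \<phi> (b i) \<inter> \<phi> S"
        using b[OF i] by (intro \<phi>I S) (auto intro: sigma_sets.Basic)
      ultimately have "i \<notin> \<phi> S" using b[OF i] \<phi>0 by auto
      then show ?thesis using x[OF i] \<open>b i \<inter> S = {}\<close> by auto
    qed
    then show "\<phi> S = {i \<in> {1..d}. x i \<in> S}" using \<phi>d[OF S] by auto
  qed
qed

lemma finite_Hom_sets:
  assumes P: "finite_borel_partition G \<mu> \<P>" and F: "finite F" "F \<subseteq> pseudogroup H H.M" "units H \<in> F"
  shows "finite (Hom_sets G \<mu> H \<pi> \<P> F \<delta> d \<sigma>)"
proof -
  note \<R> = partition_power(1)[OF P F]
  have "finite (sigma_sets (units G) (partition_power G H \<pi> \<P> F))"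
    by (rule finite_sigma_sets_partition[OF G.fbpD(2,1)[OF \<R>]])
  then have "finite (sigma_sets (units G) (partition_power G H \<pi> \<P> F) \<rightarrow>\<^sub>E Pow {1..d})"
    by (intro finite_PiE) auto
  then show ?thesis unfolding Hom_sets_def Let_def by (rule rev_finite_subset) auto
qed

end

section \<open>The partition entropy is at most the metric entropy\<close>

context etale_gpd
begin

text \<open>Balls of radius \<theta> / 2 are open by continuity of \<tau>, and compactness leaves
  finitely many.\<close>

lemma pseudometric_cover:
  assumes \<tau>: "continuous_pseudometric X \<tau>" and \<theta>: "0 < \<theta>"
  obtains N where "finite N" "\<And>n. n \<in> N \<Longrightarrow> openin X n" "\<Union>N = units G"
    "\<And>n x y. n \<in> N \<Longrightarrow> x \<in> n \<Longrightarrow> y \<in> n \<Longrightarrow> \<tau> x y < \<theta>"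
proof -
  define b where "b x = {y \<in> units G. \<tau> x y \<in> {..<\<theta> / 2}}" for x
  have \<tau>': "\<And>x. x \<in> units G \<Longrightarrow> \<tau> x x = 0"
    "\<And>x y. x \<in> units G \<Longrightarrow> y \<in> units G \<Longrightarrow> \<tau> x y = \<tau> y x"
    "\<And>x y z. x \<in> units G \<Longrightarrow> y \<in> units G \<Longrightarrow> z \<in> units G \<Longrightarrow> \<tau> x z \<le> \<tau> x y + \<tau> y z"
    "continuous_map (prod_topology X X) euclideanreal (\<lambda>(x, y). \<tau> x y)"
    using \<tau> unfolding continuous_pseudometric_def topspace_X by simp_all
  have op: "openin X (b x)" if x: "x \<in> units G" for x
  proof -
    have "continuous_map X (prod_topology X X) (\<lambda>y. (x, y))"
      using x by (simp add: continuous_map_pairwise o_def)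
    from continuous_map_compose[OF this \<tau>'(4)]
    have "continuous_map X euclideanreal (\<lambda>y. \<tau> x y)" by (simp add: o_def)
    then show ?thesis unfolding b_def by (rule continuous_vimage) simp
  qed
  have mem: "x \<in> b x" if "x \<in> units G" for x using that \<theta> \<tau>'(1) by (simp add: b_def)
  have cpt: "compactin X (units G)" using compact unfolding compact_space_def by simp
  have "\<exists>\<F>. finite \<F> \<and> \<F> \<subseteq> b ` units G \<and> units G \<subseteq> \<Union>\<F>"
    by (rule compactinD[OF cpt]) (use op mem in auto)
  then obtain \<F> where \<F>: "finite \<F>" "\<F> \<subseteq> b ` units G" "units G \<subseteq> \<Union>\<F>" by (elim exE conjE)
  show ?thesis
  proof (rule that[of \<F>])
    show "\<Union>\<F> = units G" using \<F> unfolding b_def by blast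
    fix n x y assume n: "n \<in> \<F>" "x \<in> n" "y \<in> n"
    then obtain z where z: "z \<in> units G" "n = b z" using \<F>(2) by blast
    then have "x \<in> units G" "y \<in> units G" "\<tau> z x < \<theta> / 2" "\<tau> z y < \<theta> / 2" using n by (auto simp: b_def)
    then show "\<tau> x y < \<theta>" using \<tau>'(3)[of x z y] \<tau>'(2)[of x z] z(1) by simp
  qed (use \<F> op in auto)
qed

text \<open>Makes small oscillation of a continuous function a case of
  \<open>pseudometric_cover\<close>.\<close>

lemma continuous_pseudometric_diff:
  assumes "continuous_map X euclideanreal k"
  shows "continuous_pseudometric X (\<lambda>x y. \<bar>k x - k y\<bar>)"
  unfolding continuous_pseudometric_def
proof (intro conjI ballI)
  have "continuous_map (prod_topology X X) euclideanreal (\<lambda>z. k (fst z))"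
    "continuous_map (prod_topology X X) euclideanreal (\<lambda>z. k (snd z))"
    using continuous_map_compose[OF continuous_map_fst assms]
      continuous_map_compose[OF continuous_map_snd assms] by (simp_all add: o_def)
  then have "continuous_map (prod_topology X X) euclideanreal (\<lambda>z. \<bar>k (fst z) - k (snd z)\<bar>)"
    by (intro continuous_map_real_abs continuous_map_diff)
  then show "continuous_map (prod_topology X X) euclideanreal (\<lambda>(x, y). \<bar>k x - k y\<bar>)"
    by (simp add: case_prod_unfold)
qed auto

text \<open>Compare k with a step function taking its value at a chosen point of each part: \<theta>
  is lost once in the integral and once in the empirical mean, and the step function sees only
  frequency errors, weighted by B.\<close>

lemma empirical_integral:
  assumes P: "finite_borel_partition G \<mu> \<P>" and k: "continuous_map X euclideanreal k"
    and osc: "\<And>A x y. A \<in> \<P> \<Longrightarrow> x \<in> A \<Longrightarrow> y \<in> A \<Longrightarrow> \<bar>k x - k y\<bar> \<le> \<theta>"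
    and B: "\<And>x. x \<in> units G \<Longrightarrow> \<bar>k x\<bar> \<le> B" and x: "x \<in> {1..d} \<rightarrow>\<^sub>E units G" and d: "0 < d"
    and err: "(\<Sum>A\<in>\<P>. \<bar>freq d x A - measure \<mu> A\<bar>) \<le> \<delta>" and B0: "0 \<le> B"
  shows "\<bar>(\<Sum>i\<in>{1..d}. k (x i)) / real d - (\<integral>y. k y \<partial>\<mu>)\<bar> \<le> 2 * \<theta> + B * \<delta>"
proof -
  note P' = fbpD[OF P]
  define t where "t A = (SOME y. y \<in> A)" for A :: "'a set"
  have t: "t A \<in> A" if "A \<in> \<P>" for A unfolding t_def using P'(7)[OF that] some_in_eq by blast
  define s where "s y = (\<Sum>A\<in>\<P>. k (t A) * indicator A y)" for y
  have sA: "s y = k (t A)" if "A \<in> \<P>" "y \<in> A" for A y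
  proof -
    have "s y = (\<Sum>A'\<in>\<P>. if A' = A then k (t A) else 0)"
      unfolding s_def using that P'(5)[of A] by (intro sum.cong) (auto simp: indicator_def)
    then show ?thesis using that P'(1) by simp
  qed
  have ks: "\<bar>k y - s y\<bar> \<le> \<theta>" if "y \<in> units G" for y
  proof -
    obtain A where "A \<in> \<P>" "y \<in> A" using \<open>y \<in> units G\<close> P'(6) by blast
    then show ?thesis using osc[of A y "t A"] sA[of A y] t by simp
  qed
  have s_int: "integrable \<mu> s"
    unfolding s_def using P'(3) by (intro Bochner_Integration.integrable_sum integrable_mult_right
        integrable_real_indicator) (auto simp: emeasure_eq_measure)
  have "(\<integral>y. s y \<partial>\<mu>) = (\<Sum>A\<in>\<P>. (\<integral>y. k (t A) * indicator A y \<partial>\<mu>))"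
    unfolding s_def using P'(3) by (intro Bochner_Integration.integral_sum integrable_mult_right
        integrable_real_indicator) (auto simp: emeasure_eq_measure)
  also have "\<dots> = (\<Sum>A\<in>\<P>. k (t A) * measure \<mu> A)"
    using P'(3) sets.sets_into_space by (intro sum.cong) (auto simp: Int_absorb2)
  finally have int_s: "(\<integral>y. s y \<partial>\<mu>) = (\<Sum>A\<in>\<P>. k (t A) * measure \<mu> A)" .
  have "\<bar>(\<integral>y. k y \<partial>\<mu>) - (\<integral>y. s y \<partial>\<mu>)\<bar> = \<bar>\<integral>y. k y - s y \<partial>\<mu>\<bar>"
    using continuous_integrable[OF k] s_int by simp
  also have "\<dots> \<le> (\<integral>y. \<bar>k y - s y\<bar> \<partial>\<mu>)" by (rule integral_abs_bound)
  also have "\<dots> \<le> (\<integral>y. \<theta> \<partial>\<mu>)"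
    using continuous_integrable[OF k] s_int ks by (intro integral_mono) (auto simp: space_mu)
  finally have 1: "\<bar>(\<integral>y. k y \<partial>\<mu>) - (\<integral>y. s y \<partial>\<mu>)\<bar> \<le> \<theta>" by (simp add: prob_space)
  have xu: "x i \<in> units G" if "i \<in> {1..d}" for i using x that by blast
  have "\<bar>(\<Sum>i\<in>{1..d}. k (x i)) - (\<Sum>i\<in>{1..d}. s (x i))\<bar> \<le> (\<Sum>i\<in>{1..d}. \<bar>k (x i) - s (x i)\<bar>)"
    unfolding sum_subtractf[symmetric] by (rule sum_abs)
  also have "\<dots> \<le> real d * \<theta>"
    using sum_bounded_above[of "{1..d}" "\<lambda>i. \<bar>k (x i) - s (x i)\<bar>" \<theta>] ks xu by simp
  finally have "\<bar>(\<Sum>i\<in>{1..d}. k (x i)) - (\<Sum>i\<in>{1..d}. s (x i))\<bar> / real d \<le> \<theta>"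
    using d by (simp add: field_simps)
  then have 2: "\<bar>(\<Sum>i\<in>{1..d}. k (x i)) / real d - (\<Sum>i\<in>{1..d}. s (x i)) / real d\<bar> \<le> \<theta>"
    by (simp add: diff_divide_distrib[symmetric])
  have "(\<Sum>i\<in>{1..d}. s (x i)) = (\<Sum>A\<in>\<P>. \<Sum>i\<in>{1..d}. k (t A) * indicator A (x i))"
    unfolding s_def by (rule sum.swap)
  also have "\<dots> = (\<Sum>A\<in>\<P>. k (t A) * real (card {i \<in> {1..d}. x i \<in> A}))"
    by (intro sum.cong refl) (simp add: sum_distrib_left[symmetric] indicator_def sum.If_cases Int_def)
  finally have "(\<Sum>i\<in>{1..d}. s (x i)) / real d = (\<Sum>A\<in>\<P>. k (t A) * freq d x A)"
    by (simp add: freq_def fin_size_def sum_divide_distrib)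
  then have "(\<Sum>i\<in>{1..d}. s (x i)) / real d - (\<integral>y. s y \<partial>\<mu>) =
      (\<Sum>A\<in>\<P>. k (t A) * (freq d x A - measure \<mu> A))"
    unfolding int_s by (simp add: sum_subtractf right_diff_distrib)
  also have "\<bar>\<dots>\<bar> \<le> (\<Sum>A\<in>\<P>. \<bar>k (t A) * (freq d x A - measure \<mu> A)\<bar>)" by (rule sum_abs)
  also have "\<dots> \<le> (\<Sum>A\<in>\<P>. B * \<bar>freq d x A - measure \<mu> A\<bar>)"
    using B t P'(4) unfolding abs_mult by (intro sum_mono mult_right_mono) auto
  also have "\<dots> \<le> B * \<delta>" unfolding sum_distrib_left[symmetric] using err B0 by (rule mult_left_mono)
  finally have 3: "\<bar>(\<Sum>i\<in>{1..d}. s (x i)) / real d - (\<integral>y. s y \<partial>\<mu>)\<bar> \<le> B * \<delta>" .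
  show ?thesis using 1 2 3 by linarith
qed

end

locale entropy_setting = etale_factor G \<mu> H \<nu> \<pi> + sofic_setting H \<nu> A \<beta> p
  for G :: "'g top_groupoid" and \<mu> and H :: "'h top_groupoid" and \<nu> and \<pi> :: "'g \<Rightarrow> 'h"
    and A :: "('j, 'h) approx" and \<beta> :: "'j bias" and p :: ennreal +
  fixes \<rho> :: "'g \<Rightarrow> 'g \<Rightarrow> real"
  assumes pseudometric: "continuous_pseudometric G.X \<rho>"
    and generating: "dynamically_generating G H \<pi> \<rho>"
begin

lemma rho_refl: "x \<in> units G \<Longrightarrow> \<rho> x x = 0"
  and rho_nonneg: "x \<in> units G \<Longrightarrow> y \<in> units G \<Longrightarrow> 0 \<le> \<rho> x y"
  and rho_sym: "x \<in> units G \<Longrightarrow> y \<in> units G \<Longrightarrow> \<rho> x y = \<rho> y x"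
  and rho_triangle: "x \<in> units G \<Longrightarrow> y \<in> units G \<Longrightarrow> z \<in> units G \<Longrightarrow> \<rho> x z \<le> \<rho> x y + \<rho> y z"
  and rho_continuous: "continuous_map (prod_topology G.X G.X) euclideanreal (\<lambda>(x, y). \<rho> x y)"
  using pseudometric unfolding continuous_pseudometric_def G.topspace_X by simp_all

abbreviation "diam \<equiv> pm_diam (units G) \<rho>"
abbreviation "\<rho>e \<equiv> pm_ext (units G) \<rho>"

lemma rho_le_diam: "x \<in> units G \<Longrightarrow> y \<in> units G \<Longrightarrow> \<rho> x y \<le> diam"
proof -
  assume xy: "x \<in> units G" "y \<in> units G"
  have "compactin (prod_topology G.X G.X) (units G \<times> units G)"
    using G.compact compact_space_prod_topology[of G.X G.X] unfolding compact_space_def by auto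
  from image_compactin[OF this rho_continuous]
  have "compact ((\<lambda>(x, y). \<rho> x y) ` (units G \<times> units G))" by simp
  then have "bdd_above ((\<lambda>(x, y). \<rho> x y) ` (units G \<times> units G))"
    by (intro bounded_imp_bdd_above compact_imp_bounded)
  then show ?thesis
    unfolding pm_diam_def using cSUP_upper[of "(x, y)" "units G \<times> units G" "\<lambda>(x, y). \<rho> x y"] xy by simp
qed

lemma units_nonempty: "units G \<noteq> {}" using G.not_empty G.space_mu by simp

lemma diam_nonneg: "0 \<le> diam"
proof -
  obtain x where "x \<in> units G" using units_nonempty by blast
  then show ?thesis using rho_le_diam[of x x] rho_refl by simp
qed

text \<open>The extra symbol counts as valid. The predicate is needed because \<rho> is a total
  function about which nothing is known off the units.\<close>

definition valid :: "'g option \<Rightarrow> bool" where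
  "valid u \<longleftrightarrow> (\<forall>y. u = Some y \<longrightarrow> y \<in> units G)"

lemma ext_bounds: "valid u \<Longrightarrow> valid v \<Longrightarrow> 0 \<le> \<rho>e u v \<and> \<rho>e u v \<le> diam"
  unfolding valid_def by (cases u; cases v) (auto simp: diam_nonneg rho_nonneg rho_le_diam)

lemma valid_act: "f \<in> pseudogroup H H.M \<Longrightarrow> x \<in> units G \<Longrightarrow> valid (ac f x)"
  unfolding valid_def using act_unit by blast

lemma valid_map:
  assumes "x \<in> {1..d} \<rightarrow>\<^sub>E units G" "s \<in> fin_pseudogroup d"
  shows "valid (map_option x (fin_apply s i))"
  unfolding valid_def using assms fin_apply_Some[OF assms(2), of i] fin_pseudogroupD(1)[OF assms(2)]
  by (auto simp: PiE_iff)

abbreviation orb_dist :: "'h set \<Rightarrow> (nat \<Rightarrow> 'g) \<Rightarrow> (nat \<times> nat) set \<Rightarrow> nat \<Rightarrow> real" where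
  "orb_dist f x s i \<equiv> \<rho>e (ac f (x i)) (map_option x (fin_apply s i))"

lemma orb_dist_bounds:
  assumes "f \<in> pseudogroup H H.M" "x \<in> {1..d} \<rightarrow>\<^sub>E units G" "s \<in> fin_pseudogroup d" "i \<in> {1..d}"
  shows "0 \<le> orb_dist f x s i \<and> orb_dist f x s i \<le> diam"
  using assms by (intro ext_bounds valid_act valid_map) auto

text \<open>Parts outside the domain of f have empty image, so every index where \<sigma> f still
  acts contributes to the action error. For a part B inside the domain, indices sent by \<sigma> f
  into f . B are good because f . B is small; their number falls short of that of all indices in B
  by the action error and two frequency errors, since B and f . B have equal measure. Summing over
  the partition gives the three \<delta>.\<close>

lemma Hom_orb_dist:
  assumes P: "finite_borel_partition G \<mu> \<P>" and F: "finite F" "F \<subseteq> pseudogroup H H.M" "units H \<in> F"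
    and d: "0 < d" and s: "\<sigma> f \<in> fin_pseudogroup d" and f: "f \<in> F"
    and \<phi>: "\<phi> \<in> Hom_sets G \<mu> H \<pi> \<P> F \<delta> d \<sigma>" and x: "x \<in> {1..d} \<rightarrow>\<^sub>E units G"
    and \<phi>x: "\<And>S. S \<in> sigma_sets (units G) (partition_power G H \<pi> \<P> F) \<Longrightarrow> \<phi> S = {i \<in> {1..d}. x i \<in> S}"
    and dec: "\<And>B. B \<in> \<P> \<Longrightarrow> B \<subseteq> {x \<in> units G. \<pi> x \<in> src H ` f} \<or> B \<inter> {x \<in> units G. \<pi> x \<in> src H ` f} = {}"
    and small: "\<And>B y y'. B \<in> \<P> \<Longrightarrow> y \<in> act_set G H \<pi> f B \<Longrightarrow> y' \<in> act_set G H \<pi> f B \<Longrightarrow> \<rho> y y' \<le> \<theta>"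
    and \<theta>: "0 \<le> \<theta>"
  shows "real (card {i \<in> {1..d}. \<theta> < orb_dist f x (\<sigma> f) i}) \<le> 3 * \<delta> * real d"
proof -
  let ?\<R> = "partition_power G H \<pi> \<P> F" and ?a = "act_set G H \<pi> f"
  note P' = G.fbpD[OF P]
  note \<R> = partition_power[OF P F]
  have fp: "f \<in> pseudogroup H H.M" using f F(2) by blast
  define I where "I B = {i \<in> {1..d}. x i \<in> B \<and> \<theta> < orb_dist f x (\<sigma> f) i}" for B
  define U where "U S = {i \<in> {1..d}. x i \<in> S}" for S
  define D where "D B = sym_diff (fin_image (\<sigma> f) (U B)) (U (?a B))" for B
  have finU: "finite (U S)" for S by (simp add: U_def)
  have finD: "finite (D B)" for B
    unfolding D_def using finU finite_subset[OF fin_image_subset[OF s, of "U B"]] by auto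
  have \<phi>U: "\<phi> B = U B" "\<phi> (?a B) = U (?a B)" if "B \<in> \<P>" for B
    using \<phi>x[OF \<R>(3)[OF that]] \<phi>x[OF \<R>(2)[OF f that]] by (simp_all add: U_def)
  have "(\<Sum>B\<in>\<P>. fin_size d (sym_diff (fin_image (\<sigma> f) (\<phi> B)) (\<phi> (?a B)))) < \<delta>"
    and "(\<Sum>B\<in>?\<R>. \<bar>fin_size d (\<phi> B) - measure \<mu> B\<bar>) < \<delta>"
    using \<phi> f unfolding Hom_sets_def Let_def by auto
  then have sumD: "(\<Sum>B\<in>\<P>. fin_size d (D B)) < \<delta>"
    and sumE: "(\<Sum>B\<in>?\<R>. \<bar>freq d x B - measure \<mu> B\<bar>) < \<delta>"
    using \<phi>U \<phi>x by (simp_all add: D_def freq_def sigma_sets.Basic cong: sum.cong)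
  have Ia: "fin_size d (I B) \<le> fin_size d (D B) + \<bar>freq d x B - measure \<mu> B\<bar> +
      \<bar>freq d x (?a B) - measure \<mu> (?a B)\<bar>" if B: "B \<in> \<P>" for B
  proof (cases "B \<inter> {x \<in> units G. \<pi> x \<in> src H ` f} = {}")
    case True
    have Bu: "B \<subseteq> units G" by (rule P'(4)[OF B])
    have none: "ac f y = None" if "y \<in> B" for y using True Bu that act_None[of f y] by auto
    then have empty: "?a B = {}" unfolding act_set_def by auto
    have "I B \<subseteq> snd ` \<sigma> f"
    proof
      fix i assume i: "i \<in> I B"
      then have "ac f (x i) = None" by (intro none) (simp add: I_def)
      then have "\<theta> < \<rho>e None (map_option x (fin_apply (\<sigma> f) i))" using i unfolding I_def by auto
      then have "fin_apply (\<sigma> f) i \<noteq> None" using \<theta> by (cases "fin_apply (\<sigma> f) i") simp_all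
      then obtain k where "(k, i) \<in> \<sigma> f" using fin_apply_Some[OF s, of i] by auto
      then show "i \<in> snd ` \<sigma> f" by force
    qed
    then have "card (I B) = card (fin_image (\<sigma> f) (I B))" using card_injective_relation[OF s] by simp
    also have "\<dots> \<le> card (D B)"
      using finD by (intro card_mono) (auto simp: D_def empty U_def I_def fin_image_def)
    finally show ?thesis unfolding fin_size_def by (simp add: divide_right_mono add_nonneg_nonneg add_increasing2)
  next
    case False
    then have Bd: "B \<subseteq> {x \<in> units G. \<pi> x \<in> src H ` f}" using dec[OF B] by blast
    define J where "J = {i \<in> U B. \<exists>k. (k, i) \<in> \<sigma> f \<and> k \<in> U (?a B)}"
    have "I B \<inter> J = {}"
    proof (rule ccontr)
      assume "I B \<inter> J \<noteq> {}"
      then obtain i k where i: "i \<in> I B" "i \<in> U B" "(k, i) \<in> \<sigma> f" "k \<in> U (?a B)" unfolding J_def by blast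
      then have xi: "x i \<in> B" by (simp add: U_def)
      then have "ac f (x i) \<noteq> None" using Bd act_None[of f "x i"] by auto
      then obtain y where y: "ac f (x i) = Some y" by blast
      then have "y \<in> ?a B" using xi unfolding act_set_def by blast
      moreover have "x k \<in> ?a B" using i(4) by (simp add: U_def)
      ultimately have "\<rho> y (x k) \<le> \<theta>" by (rule small[OF B])
      moreover have "fin_apply (\<sigma> f) i = Some k" using i(3) fin_apply_Some[OF s] by blast
      ultimately show False using i(1) y by (simp add: I_def)
    qed
    moreover have "I B \<union> J \<subseteq> U B" by (auto simp: I_def J_def U_def)
    ultimately have IJ: "card (I B) + card J \<le> card (U B)"
      using finU card_mono[of "U B" "I B \<union> J"] finite_subset[of _ "U B"]
      by (subst card_Un_disjoint[symmetric]) auto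
    have "fin_image (\<sigma> f) J = fin_image (\<sigma> f) (U B) \<inter> U (?a B)"
      unfolding J_def fin_image_def using fin_pseudogroupD(2)[OF s] by blast
    moreover have "J \<subseteq> snd ` \<sigma> f" unfolding J_def by force
    ultimately have "card J = card (fin_image (\<sigma> f) (U B) \<inter> U (?a B))"
      using card_injective_relation[OF s] by metis
    moreover have "card (U (?a B)) \<le> card ((fin_image (\<sigma> f) (U B) \<inter> U (?a B)) \<union> D B)"
      using finD finU by (intro card_mono) (auto simp: D_def)
    ultimately have "card (U (?a B)) \<le> card J + card (D B)"
      using card_Un_le[of "fin_image (\<sigma> f) (U B) \<inter> U (?a B)" "D B"] by linarith
    then have "real (card (I B)) + real (card (U (?a B))) \<le> real (card (U B)) + real (card (D B))"
      using IJ by linarith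
    from divide_right_mono[OF this, of "real d"]
    have "fin_size d (I B) + freq d x (?a B) \<le> freq d x B + fin_size d (D B)"
      unfolding freq_def fin_size_def U_def by (simp add: add_divide_distrib)
    moreover have "measure \<mu> (?a B) = measure \<mu> B"
    proof -
      have "{x \<in> B. \<pi> x \<in> src H ` f} = B" using Bd by blast
      then show ?thesis using act_set_measurable(2)[OF fp P'(3)[OF B]] by simp
    qed
    ultimately show ?thesis by linarith
  qed
  have aS: "?a B \<inter> ?a B' = {}" if B: "B \<in> \<P>" "B' \<in> \<P>" "B \<noteq> B'" for B B'
  proof (rule ccontr)
    assume "?a B \<inter> ?a B' \<noteq> {}"
    then obtain y u v where y: "u \<in> B" "v \<in> B'" "ac f u = Some y" "ac f v = Some y"
      unfolding act_set_def by blast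
    then have "u = v" using act_inj[OF fp] P'(4) B by blast
    then show False using y P'(5)[OF B] by blast
  qed
  have e1: "(\<Sum>B\<in>\<P>. \<bar>freq d x B - measure \<mu> B\<bar>) < \<delta>"
    using G.freq_error[OF \<R>(1) P'(1), of "\<lambda>B. B"] \<R>(3) P'(5) sumE by (meson le_less_trans)
  have e2: "(\<Sum>B\<in>\<P>. \<bar>freq d x (?a B) - measure \<mu> (?a B)\<bar>) < \<delta>"
    using G.freq_error[OF \<R>(1) P'(1), of ?a] \<R>(2)[OF f] aS sumE by (meson le_less_trans)
  have "{i \<in> {1..d}. \<theta> < orb_dist f x (\<sigma> f) i} \<subseteq> (\<Union>B\<in>\<P>. I B)"
    using x P'(6) unfolding I_def by (fastforce simp: PiE_iff)
  then have "card {i \<in> {1..d}. \<theta> < orb_dist f x (\<sigma> f) i} \<le> (\<Sum>B\<in>\<P>. card (I B))"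
    using P'(1) by (intro card_le_sum_bound) (auto simp: I_def)
  then have "fin_size d {i \<in> {1..d}. \<theta> < orb_dist f x (\<sigma> f) i} \<le> (\<Sum>B\<in>\<P>. fin_size d (I B))"
    unfolding fin_size_def sum_divide_distrib[symmetric] of_nat_sum[symmetric]
    by (intro divide_right_mono of_nat_mono) auto
  also have "\<dots> \<le> (\<Sum>B\<in>\<P>. fin_size d (D B) + \<bar>freq d x B - measure \<mu> B\<bar> +
      \<bar>freq d x (?a B) - measure \<mu> (?a B)\<bar>)" by (rule sum_mono) (rule Ia)
  also have "\<dots> \<le> 3 * \<delta>" using sumD e1 e2 by (simp add: sum.distrib)
  finally show ?thesis using d by (simp add: fin_size_def field_simps)
qed

text \<open>The square of \<open>rho2\<close> is bounded, because there the exceptional proportion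
  enters linearly.\<close>

lemma rho2_le:
  assumes d: "0 < d" and c: "\<And>i. i \<in> {1..d} \<Longrightarrow> 0 \<le> c i \<and> c i \<le> b"
    and bad: "real (card {i \<in> {1..d}. \<theta> < c i}) \<le> e * real d" and \<theta>: "0 \<le> \<theta>"
  shows "(\<Sum>i\<in>{1..d}. (c i)\<^sup>2) / real d \<le> \<theta>\<^sup>2 + e * b\<^sup>2"
proof -
  let ?I = "{i \<in> {1..d}. \<theta> < c i}"
  have "(\<Sum>i\<in>{1..d}. (c i)\<^sup>2) \<le> (\<Sum>i\<in>{1..d}. \<theta>\<^sup>2 + (if i \<in> ?I then b\<^sup>2 else 0))"
  proof (rule sum_mono)
    fix i assume i: "i \<in> {1..d}"
    have "(c i)\<^sup>2 \<le> b\<^sup>2" using c[OF i] by (intro power_mono) auto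
    moreover have "(c i)\<^sup>2 \<le> \<theta>\<^sup>2" if "\<not> \<theta> < c i" using c[OF i] that by (intro power_mono) auto
    moreover have "0 \<le> \<theta>\<^sup>2" by simp
    ultimately show "(c i)\<^sup>2 \<le> \<theta>\<^sup>2 + (if i \<in> ?I then b\<^sup>2 else 0)"
      using i by (cases "\<theta> < c i") (simp_all add: add_increasing)
  qed
  also have "\<dots> = real d * \<theta>\<^sup>2 + real (card ?I) * b\<^sup>2"
    by (simp add: sum.distrib sum.If_cases Int_def)
  also have "\<dots> \<le> real d * \<theta>\<^sup>2 + e * real d * b\<^sup>2"
    using bad by (intro add_left_mono mult_right_mono) auto
  finally show ?thesis using d by (simp add: field_simps)
qed

text \<open>The point e . x_i is compared with x at the index \<sigma> e i, then with x' there, then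
  with e . x'_i; r is split into thirds. Exceptions in the middle comparison are pulled back by the
  partial injection \<sigma> e, which does not increase their number.\<close>

lemma generating_close:
  assumes E: "finite E" "E \<subseteq> top_full_group H" and r: "0 < r" and d: "0 < d"
    and s: "\<And>e. e \<in> E \<Longrightarrow> \<sigma> e \<in> fin_pseudogroup d"
    and x: "x \<in> {1..d} \<rightarrow>\<^sub>E units G" "x' \<in> {1..d} \<rightarrow>\<^sub>E units G"
    and ox: "\<And>e. e \<in> E \<Longrightarrow> real (card {i \<in> {1..d}. r / 3 < orb_dist e x (\<sigma> e) i}) \<le> b * real d"
    and ox': "\<And>e. e \<in> E \<Longrightarrow> real (card {i \<in> {1..d}. r / 3 < orb_dist e x' (\<sigma> e) i}) \<le> b * real d"
    and xx': "real (card {i \<in> {1..d}. r / 3 < \<rho> (x i) (x' i)}) \<le> b * real d"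
  shows "real (card {i \<in> {1..d}. \<exists>e\<in>E. r < \<rho> (app e (x i)) (app e (x' i))}) \<le> 3 * real (card E) * b * real d"
proof -
  define B where "B e = {i \<in> {1..d}. r < \<rho> (app e (x i)) (app e (x' i))}" for e
  define B1 where "B1 e = {i \<in> {1..d}. r / 3 < orb_dist e x (\<sigma> e) i}" for e
  define B2 where "B2 e = {i \<in> {1..d}. r / 3 < orb_dist e x' (\<sigma> e) i}" for e
  define B0 where "B0 = {i \<in> {1..d}. r / 3 < \<rho> (x i) (x' i)}"
  define B3 where "B3 e = {i. \<exists>k\<in>B0. (k, i) \<in> \<sigma> e}" for e
  have "real (card (B e)) \<le> 3 * (b * real d)" if e: "e \<in> E" for e
  proof -
    note se = s[OF e]
    have eF: "e \<in> top_full_group H" using E e by blast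
    have B3d: "B3 e \<subseteq> {1..d}" unfolding B3_def using fin_pseudogroupD(1)[OF se] by blast
    have "B e \<subseteq> B1 e \<union> B2 e \<union> B3 e"
    proof
      fix i assume i: "i \<in> B e"
      then have id: "i \<in> {1..d}" by (simp add: B_def)
      have xu: "x i \<in> units G" "x' i \<in> units G" using x id by auto
      have a: "ac e (x i) = Some (app e (x i))" "ac e (x' i) = Some (app e (x' i))"
        using act_full[OF eF] xu by auto
      have au: "app e (x i) \<in> units G" "app e (x' i) \<in> units G" using app_unit[OF eF] xu by auto
      show "i \<in> B1 e \<union> B2 e \<union> B3 e"
      proof (rule ccontr)
        assume n: "i \<notin> B1 e \<union> B2 e \<union> B3 e"
        show False
        proof (cases "fin_apply (\<sigma> e) i")
          case None
          \<comment> \<open>Where \<sigma> e is undefined the extended distance is the full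
            diameter; an index that is not exceptional would make the diameter too small for any
            translate to exceed r.\<close>
          then have "diam \<le> r / 3" using n id a by (simp add: B1_def)
          then show False using i rho_le_diam[OF au] r by (simp add: B_def)
        next
          case (Some k)
          then have ki: "(k, i) \<in> \<sigma> e" using fin_apply_Some[OF se] by blast
          then have k: "k \<in> {1..d}" using fin_pseudogroupD(1)[OF se] by blast
          have ku: "x k \<in> units G" "x' k \<in> units G" using x k by auto
          have "\<rho> (app e (x i)) (x k) \<le> r / 3" using n id a Some by (simp add: B1_def)
          moreover have "\<rho> (app e (x' i)) (x' k) \<le> r / 3" using n id a Some by (simp add: B2_def)
          moreover have "k \<notin> B0" using n ki by (auto simp: B3_def)
          then have "\<rho> (x k) (x' k) \<le> r / 3" using k unfolding B0_def by auto
          moreover have "\<rho> (app e (x i)) (app e (x' i)) \<le>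
              \<rho> (app e (x i)) (x k) + (\<rho> (x k) (x' k) + \<rho> (x' k) (app e (x' i)))"
            using rho_triangle[OF au(1) ku(1) au(2)] rho_triangle[OF ku au(2)] by linarith
          ultimately show False using i rho_sym[OF ku(2) au(2)] by (simp add: B_def)
        qed
      qed
    qed
    then have "card (B e) \<le> card (B1 e \<union> B2 e \<union> B3 e)"
      using finite_subset[OF B3d] by (intro card_mono) (auto simp: B1_def B2_def)
    also have "\<dots> \<le> card (B1 e) + card (B2 e) + card (B3 e)"
      by (meson card_Un_le add_le_mono1 order_trans)
    also have "card (B3 e) \<le> card B0"
    proof -
      have "B3 e \<subseteq> snd ` \<sigma> e" unfolding B3_def by force
      then have "card (B3 e) = card (fin_image (\<sigma> e) (B3 e))" using card_injective_relation[OF se] by simp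
      also have "\<dots> \<le> card B0"
        using fin_pseudogroupD(2)[OF se] by (intro card_mono) (auto simp: B0_def B3_def fin_image_def)
      finally show ?thesis .
    qed
    finally have "card (B e) \<le> card (B1 e) + card (B2 e) + card B0" by simp
    then show ?thesis using ox[OF e] ox'[OF e] xx' unfolding B1_def B2_def B0_def by linarith
  qed
  then have "(\<Sum>e\<in>E. real (card (B e))) \<le> real (card E) * (3 * (b * real d))"
    using sum_bounded_above by metis
  moreover have "card {i \<in> {1..d}. \<exists>e\<in>E. r < \<rho> (app e (x i)) (app e (x' i))} \<le> (\<Sum>e\<in>E. card (B e))"
    using E(1) by (intro card_le_sum_bound) (auto simp: B_def)
  then have "real (card {i \<in> {1..d}. \<exists>e\<in>E. r < \<rho> (app e (x i)) (app e (x' i))}) \<le> (\<Sum>e\<in>E. real (card (B e)))"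
    unfolding of_nat_sum[symmetric] by (rule of_nat_mono)
  ultimately show ?thesis by (simp add: algebra_simps)
qed

end

context entropy_setting
begin

text \<open>A homomorphism is replaced by a tuple of points of the atoms it selects.  Tuples that are close
  for the pseudo-metric select the same atom of \<open>\<Q>\<close> at most places, since disjoint compact subsets of
  the atoms are separated by finitely many translates of the pseudo-metric.\<close>

lemma Hom_count_le_sep_number:
  assumes Q: "finite_borel_partition G \<mu> \<Q>" and \<kappa>: "0 < \<kappa>"
  obtains \<epsilon> where "0 < \<epsilon>"
    "\<And>\<delta>' F' K. 0 < \<delta>' \<Longrightarrow> finite F' \<Longrightarrow> F' \<subseteq> top_pseudogroup H \<nu> \<Longrightarrow> finite K \<Longrightarrow>
      \<forall>k\<in>K. continuous_map G.X euclideanreal k \<Longrightarrow>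
      \<exists>\<P> F \<delta>. finite_borel_partition G \<mu> \<P> \<and> refines (units G) \<P> \<Q> \<and> finite F \<and>
        F \<subseteq> pseudogroup H H.M \<and> units H \<in> F \<and> F' \<subseteq> F \<and> 0 < \<delta> \<and>
        (\<forall>d \<sigma>. 0 < d \<longrightarrow> (\<forall>f\<in>F. \<sigma> f \<in> fin_pseudogroup d) \<longrightarrow>
          of_nat (Hom_count G \<mu> H \<pi> \<Q> \<P> F \<delta> d \<sigma>) \<le>
          ennreal (exp (\<kappa> * real d)) * sep_number \<epsilon> (rho2 \<rho> d) (Orb G \<mu> H \<pi> \<rho> F' K \<delta>' d \<sigma>))"
proof -
  note Q' = G.fbpD[OF Q]
  \<comment> \<open>The constants are fixed in the order a, \<open>C\<close>, E and r, b,
    \<epsilon>, from \<Q> and \<kappa> alone, since \<epsilon> must be known before \<delta>', F'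
    and K are given. Labels of close tuples may differ at a proportion a of the indices.\<close>
  obtain a where a: "0 < a" and ball: "\<And>(d::nat) n\<^sub>0. real (card {n \<in> {1..d} \<rightarrow>\<^sub>E \<Q>.
      real (card {i \<in> {1..d}. n i \<noteq> n\<^sub>0 i}) \<le> a * real d}) \<le> exp (\<kappa> * real d)"
    using hamming_ball_bound[OF Q'(1) \<kappa>] by blast
  define q where "q = real (card \<Q>) + 1"
  have q: "0 < q" by (simp add: q_def)
  have "\<exists>C. closedin G.X C \<and> C \<subseteq> B \<and> measure \<mu> (B - C) < a / (8 * q)" if "B \<in> \<Q>" for B
    using G.inner_closed[OF Q'(3)[OF that], of "a / (8 * q)"] a q by (metis divide_pos_pos mult_pos_pos zero_less_numeral)
  then obtain C where C: "\<And>B. B \<in> \<Q> \<Longrightarrow> closedin G.X (C B)" "\<And>B. B \<in> \<Q> \<Longrightarrow> C B \<subseteq> B"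
      "\<And>B. B \<in> \<Q> \<Longrightarrow> measure \<mu> (B - C B) < a / (8 * q)" by metis
  define R where "R = (\<Union>B\<in>\<Q>. B - C B)"
  have Csets: "C B \<in> sets \<mu>" if "B \<in> \<Q>" for B by (rule G.closed_sets[OF C(1)[OF that]])
  have "measure \<mu> R \<le> (\<Sum>B\<in>\<Q>. measure \<mu> (B - C B))"
    unfolding R_def using Q'(1,3) Csets by (intro G.finite_measure_subadditive_finite) auto
  also have "\<dots> \<le> real (card \<Q>) * (a / (8 * q))"
    using sum_bounded_above[of \<Q> "\<lambda>B. measure \<mu> (B - C B)" "a / (8 * q)"] less_imp_le[OF C(3)] by simp
  also have "\<dots> \<le> q * (a / (8 * q))" using a q by (intro mult_right_mono) (auto simp: q_def)
  also have "\<dots> = a / 8" using q by simp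
  finally have R8: "measure \<mu> R \<le> a / 8" .
  \<comment> \<open>Pairs in compact parts of different atoms form a closed set off the diagonal. A
    change of label is therefore detected by the translates, unless one of the points lies in
    R.\<close>
  define Bd where "Bd = (\<Union>B\<in>\<Q>. \<Union>B'\<in>\<Q> - {B}. C B \<times> C B')"
  have "closedin (prod_topology G.X G.X) (\<Union>B'\<in>\<Q> - {B}. C B \<times> C B')" if "B \<in> \<Q>" for B
    by (rule closedin_Union) (use Q'(1) C(1) that in \<open>auto simp: closedin_prod_Times_iff\<close>)
  then have "closedin (prod_topology G.X G.X) Bd"
    unfolding Bd_def by (intro closedin_Union) (use Q'(1) in auto)
  then have W: "openin (prod_topology G.X G.X) (units G \<times> units G - Bd)"
    using openin_diff[OF openin_topspace, of "prod_topology G.X G.X" Bd] by simp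
  have diag: "(x, x) \<in> units G \<times> units G - Bd" if "x \<in> units G" for x
    using that C(2) Q'(5) unfolding Bd_def by blast
  obtain E r where E: "finite E" "E \<subseteq> top_full_group H" and r: "0 < r"
    and sepW: "\<And>x y. x \<in> units G \<Longrightarrow> y \<in> units G \<Longrightarrow> \<forall>e\<in>E. \<rho> (app e x) (app e y) \<le> r \<Longrightarrow>
        (x, y) \<in> units G \<times> units G - Bd"
    using generating_separation[OF pseudometric generating W diag] by blast
  \<comment> \<open>Three exceptional sets of proportion b for each translate in E amount to at most
    a / 2.\<close>
  define b where "b = a / (6 * (real (card E) + 1))"
  have b: "0 < b" unfolding b_def using a by simp
  have "3 * real (card E) * b \<le> 3 * (real (card E) + 1) * b" using b by simp
  also have "\<dots> = a / 2" unfolding b_def by (simp add: field_simps)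
  finally have b3: "3 * real (card E) * b \<le> a / 2" .
  \<comment> \<open>With \<open>markov_count\<close>, a \<open>rho2\<close> distance of at most
    \<epsilon> means a distance above r / 3 at no more than a proportion b of the indices.\<close>
  define \<epsilon> where "\<epsilon> = r / 3 * sqrt b"
  have \<epsilon>: "0 < \<epsilon>" unfolding \<epsilon>_def using r b by simp
  have \<epsilon>b: "\<epsilon>\<^sup>2 / (r / 3)\<^sup>2 = b" unfolding \<epsilon>_def using r b by (simp add: power_mult_distrib power_divide)
  show ?thesis
  proof (rule that[OF \<epsilon>])
    fix \<delta>' :: real and F' K
    assume \<delta>': "0 < \<delta>'" and F': "finite F'" "F' \<subseteq> top_pseudogroup H \<nu>"
      and K: "finite K" "\<forall>k\<in>K. continuous_map G.X euclideanreal k"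
    \<comment> \<open>The orbit error is also kept below \<epsilon>, so that the same count applies
      to the translates in E.\<close>
    define \<delta>1 where "\<delta>1 = min \<delta>' \<epsilon>"
    have \<delta>1: "0 < \<delta>1" "\<delta>1 \<le> \<delta>'" "\<delta>1 \<le> \<epsilon>" unfolding \<delta>1_def using \<delta>' \<epsilon> by auto
    define F where "F = insert (units H) (F' \<union> E)"
    have F: "finite F" "F \<subseteq> pseudogroup H H.M" "units H \<in> F"
      unfolding F_def using F' E H.top_pseudogroup_subset top_full_group_pseudogroup H.units_pseudogroup
      by auto
    obtain N where N: "finite N" "\<And>n. n \<in> N \<Longrightarrow> openin G.X n" "\<Union>N = units G"
      "\<And>n x y. n \<in> N \<Longrightarrow> x \<in> n \<Longrightarrow> y \<in> n \<Longrightarrow> \<rho> x y < \<delta>1 / 2"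
      using G.pseudometric_cover[OF pseudometric, of "\<delta>1 / 2"] \<delta>1(1) by (metis half_gt_zero)
    have "\<exists>M. finite M \<and> (\<forall>n\<in>M. openin G.X n) \<and> \<Union>M = units G \<and>
        (\<forall>n\<in>M. \<forall>x\<in>n. \<forall>y\<in>n. \<bar>k x - k y\<bar> < \<delta>1 / 4)" if k: "k \<in> K" for k
    proof -
      have "0 < \<delta>1 / 4" using \<delta>1(1) by simp
      then obtain M where "finite M" "\<And>n. n \<in> M \<Longrightarrow> openin G.X n" "\<Union>M = units G"
        "\<And>n x y. n \<in> M \<Longrightarrow> x \<in> n \<Longrightarrow> y \<in> n \<Longrightarrow> \<bar>k x - k y\<bar> < \<delta>1 / 4"
        using G.pseudometric_cover[OF G.continuous_pseudometric_diff[OF bspec[OF K(2) k]]] by metis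
      then show ?thesis by (intro exI[of _ M]) simp
    qed
    then obtain L where L: "\<And>k. k \<in> K \<Longrightarrow> finite (L k)" "\<And>k n. k \<in> K \<Longrightarrow> n \<in> L k \<Longrightarrow> openin G.X n"
      "\<And>k. k \<in> K \<Longrightarrow> \<Union>(L k) = units G"
      "\<And>k n x y. k \<in> K \<Longrightarrow> n \<in> L k \<Longrightarrow> x \<in> n \<Longrightarrow> y \<in> n \<Longrightarrow> \<bar>k x - k y\<bar> < \<delta>1 / 4" by metis
    have "\<exists>B. 0 < B \<and> (\<forall>x\<in>units G. \<bar>k x\<bar> \<le> B)" if "k \<in> K" for k
      using G.continuous_bounded[OF bspec[OF K(2) that]] by metis
    then obtain Bk where Bk: "\<And>k. k \<in> K \<Longrightarrow> 0 < Bk k" "\<And>k x. k \<in> K \<Longrightarrow> x \<in> units G \<Longrightarrow> \<bar>k x\<bar> \<le> Bk k"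
      by metis
    define B where "B = (\<Sum>k\<in>K. Bk k)"
    have B0: "0 \<le> B" unfolding B_def using Bk(1) by (intro sum_nonneg) (auto intro: less_imp_le)
    have BB: "\<bar>k x\<bar> \<le> B" if "k \<in> K" "x \<in> units G" for k x
      using Bk(2)[OF that] member_le_sum[of k K Bk] that K(1) Bk(1) unfolding B_def
      by (force intro: less_imp_le)
    \<comment> \<open>The three bounds serve, in this order, the frequency of R, the mean square
      orbit error and the integrals of K.\<close>
    define \<delta> where "\<delta> = min (a / 32) (min (\<delta>1\<^sup>2 / ((diam\<^sup>2 + 1) * 12)) (\<delta>1 / ((B + 1) * 4)))"
    have dpos: "0 < diam\<^sup>2 + 1" by (simp add: add_nonneg_pos)
    have \<delta>: "0 < \<delta>" unfolding \<delta>_def using a \<delta>1 B0 dpos by simp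
    have \<delta>a: "\<delta> \<le> a / 32" unfolding \<delta>_def by (rule min.cobounded1)
    have cancel: "x / (c * k) * c = x / k" if "0 < c" for x c k :: real using that by simp
    have \<delta>d: "3 * \<delta> * diam\<^sup>2 \<le> \<delta>1\<^sup>2 / 4"
    proof -
      have "\<delta> * diam\<^sup>2 \<le> \<delta> * (diam\<^sup>2 + 1)" using \<delta> by simp
      also have "\<dots> \<le> \<delta>1\<^sup>2 / ((diam\<^sup>2 + 1) * 12) * (diam\<^sup>2 + 1)"
        using dpos by (intro mult_right_mono) (auto simp: \<delta>_def)
      also have "\<dots> = \<delta>1\<^sup>2 / 12" using cancel[of "diam\<^sup>2 + 1"] dpos by blast
      finally show ?thesis by simp
    qed
    have \<delta>B: "B * \<delta> \<le> \<delta>1 / 4"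
    proof -
      have "B * \<delta> \<le> (B + 1) * \<delta>" using \<delta> by simp
      also have "\<dots> \<le> (B + 1) * (\<delta>1 / ((B + 1) * 4))"
        using B0 by (intro mult_left_mono) (auto simp: \<delta>_def)
      also have "\<dots> = \<delta>1 / 4" using cancel[of "B + 1" \<delta>1 4] B0
        by (metis add_nonneg_pos mult.commute zero_less_one)
      finally show ?thesis .
    qed
    define dom where "dom f = {x \<in> units G. \<pi> x \<in> src H ` f}" for f
    \<comment> \<open>These generators make each part of \<P> lie in one atom of \<Q>, inside or
      outside each compact set and each domain, have a \<rho>-small image under every f in F and
      give every k in K small oscillation.\<close>
    define \<C> where "\<C> = \<Q> \<union> C ` \<Q> \<union> (\<lambda>(f, n). act_vimage f n) ` (F \<times> N) \<union> dom ` F \<union> (\<Union>k\<in>K. L k)"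
    have \<C>fin: "finite \<C>" unfolding \<C>_def using Q'(1) F(1) N(1) K(1) L(1) by auto
    have \<C>sets: "\<C> \<subseteq> sets \<mu>"
      unfolding \<C>_def dom_def
      using Q'(3) Csets act_vimage_measurable(1) F(2) G.open_sets N(2) dom_measurable L(2) by auto
    define \<P> where "\<P> = atoms_of (units G) \<C>"
    have P: "finite_borel_partition G \<mu> \<P>" unfolding \<P>_def by (rule G.finite_borel_atoms[OF \<C>fin \<C>sets])
    note P' = G.fbpD[OF P]
    have dec: "D \<subseteq> S \<or> D \<inter> S = {}" if "D \<in> \<P>" "S \<in> \<C>" for D S
      using atoms_of_decide[of D "units G" \<C> S] that unfolding \<P>_def by blast
    have "\<exists>B\<in>\<Q>. D \<subseteq> B" if D: "D \<in> \<P>" for D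
    proof -
      obtain y where y: "y \<in> D" using P'(7)[OF D] by blast
      then obtain B where B: "B \<in> \<Q>" "y \<in> B" using P'(4)[OF D] Q'(6) by blast
      then have "B \<in> \<C>" by (simp add: \<C>_def)
      then show ?thesis using dec[OF D] y B by blast
    qed
    then have ref: "refines (units G) \<P> \<Q>" using P'(2) Q'(2) by (simp add: refines_def)
    define \<R> where "\<R> = partition_power G H \<pi> \<P> F"
    note \<R> = partition_power[OF P F, folded \<R>_def]
    have \<C>\<R>: "S \<in> sigma_sets (units G) \<R>" if S: "S \<in> \<C>" for S
    proof -
      have sub: "\<And>S. S \<in> \<C> \<Longrightarrow> S \<subseteq> units G" using \<C>sets G.sets_mu by blast
      obtain R' where R': "R' \<subseteq> \<P>" "S = \<Union>R'"
        using atoms_of_coarsest(2)[OF sub S] unfolding \<P>_def by blast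
      have "\<Union>R' \<in> sigma_sets (units G) \<R>"
      proof (rule sigma_sets_UNION)
        show "countable R'" using finite_subset[OF R'(1) P'(1)] by (rule countable_finite)
        show "\<And>b. b \<in> R' \<Longrightarrow> b \<in> sigma_sets (units G) \<R>" using R'(1) \<R>(3) by blast
      qed
      then show ?thesis using R'(2) by simp
    qed
    interpret \<Sigma>: sigma_algebra "units G" "sigma_sets (units G) \<R>"
      using G.fbpD(4)[OF \<R>(1)] by (intro sigma_algebra_sigma_sets) auto
    have R\<R>: "R \<in> sigma_sets (units G) \<R>"
      unfolding R_def using Q'(1) \<C>\<R> by (intro \<Sigma>.finite_UN \<Sigma>.Diff) (auto simp: \<C>_def)
    have Q\<R>: "S \<in> sigma_sets (units G) \<R>" if S: "S \<in> sigma_sets (units G) \<Q>" for S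
    proof -
      have "\<Union>{B \<in> \<Q>. B \<subseteq> S} \<in> sigma_sets (units G) \<R>"
        using Q'(1) \<C>\<R> by (intro \<Sigma>.finite_Union) (auto simp: \<C>_def)
      then show ?thesis using sigma_sets_partition[OF Q'(2) S] by simp
    qed
    define nq where "nq y = (THE B. B \<in> \<Q> \<and> y \<in> B)" for y
    have nq: "nq y = B" if "B \<in> \<Q>" "y \<in> B" for y B
      unfolding nq_def using that Q'(5) by (intro the_equality) auto
    have nq': "nq y \<in> \<Q> \<and> y \<in> nq y" if "y \<in> units G" for y
    proof -
      obtain B where B: "B \<in> \<Q>" "y \<in> B" using \<open>y \<in> units G\<close> Q'(6) by blast
      show ?thesis unfolding nq[OF B] using B by simp
    qed
    have count: "of_nat (Hom_count G \<mu> H \<pi> \<Q> \<P> F \<delta> d \<sigma>) \<le>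
        ennreal (exp (\<kappa> * real d)) * sep_number \<epsilon> (rho2 \<rho> d) (Orb G \<mu> H \<pi> \<rho> F' K \<delta>' d \<sigma>)"
      if d: "0 < d" and \<sigma>: "\<forall>f\<in>F. \<sigma> f \<in> fin_pseudogroup d" for d \<sigma>
    proof -
      define \<H> where "\<H> = Hom_sets G \<mu> H \<pi> \<P> F \<delta> d \<sigma>"
      have fin\<H>: "finite \<H>" unfolding \<H>_def by (rule finite_Hom_sets[OF P F])
      have "\<exists>x. x \<in> {1..d} \<rightarrow>\<^sub>E units G \<and>
          (\<forall>S\<in>sigma_sets (units G) \<R>. \<phi> S = {i \<in> {1..d}. x i \<in> S})" if "\<phi> \<in> \<H>" for \<phi>
        using Hom_points[OF P F that[unfolded \<H>_def], folded \<R>_def] by metis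
      then have "\<forall>\<phi>\<in>\<H>. \<exists>x. x \<in> {1..d} \<rightarrow>\<^sub>E units G \<and>
          (\<forall>S\<in>sigma_sets (units G) \<R>. \<phi> S = {i \<in> {1..d}. x i \<in> S})" by (rule ballI)
      from bchoice[OF this] obtain Z where "\<forall>\<phi>\<in>\<H>. Z \<phi> \<in> {1..d} \<rightarrow>\<^sub>E units G \<and>
          (\<forall>S\<in>sigma_sets (units G) \<R>. \<phi> S = {i \<in> {1..d}. Z \<phi> i \<in> S})" by (elim exE)
      then have Z: "\<And>\<phi>. \<phi> \<in> \<H> \<Longrightarrow> Z \<phi> \<in> {1..d} \<rightarrow>\<^sub>E units G"
          "\<And>\<phi> S. \<phi> \<in> \<H> \<Longrightarrow> S \<in> sigma_sets (units G) \<R> \<Longrightarrow> \<phi> S = {i \<in> {1..d}. Z \<phi> i \<in> S}"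
        by simp_all
      have orb: "rho2 \<rho>e d (\<lambda>i. ac f (Z \<phi> i)) (\<lambda>i. map_option (Z \<phi>) (fin_apply (\<sigma> f) i)) < \<delta>1"
        if \<phi>: "\<phi> \<in> \<H>" and f: "f \<in> F" for \<phi> f
      proof -
        note sf = bspec[OF \<sigma> f]
        have fp: "f \<in> pseudogroup H H.M" using f F(2) by blast
        have small: "\<rho> y y' \<le> \<delta>1 / 2"
          if D: "D \<in> \<P>" and y: "y \<in> act_set G H \<pi> f D" "y' \<in> act_set G H \<pi> f D" for D y y'
        proof -
          obtain x x' where x: "x \<in> D" "ac f x = Some y" "x' \<in> D" "ac f x' = Some y'"
            using y unfolding act_set_def by blast
          have xu: "x \<in> units G" "x' \<in> units G" using x P'(4)[OF D] by auto
          have "y \<in> units G" using act_unit[OF fp xu(1) x(2)] .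
          then obtain n where n: "n \<in> N" "y \<in> n" using N(3) by blast
          then have "x \<in> act_vimage f n" unfolding act_vimage_def using x xu by auto
          moreover have "act_vimage f n \<in> \<C>" unfolding \<C>_def using f n(1) by auto
          ultimately have "x' \<in> act_vimage f n" using dec[OF D] x(1,3) by blast
          then have "y' \<in> n" unfolding act_vimage_def using x(4) by auto
          then show ?thesis using N(4)[OF n] by (simp add: less_imp_le)
        qed
        have decf: "D \<subseteq> {x \<in> units G. \<pi> x \<in> src H ` f} \<or> D \<inter> {x \<in> units G. \<pi> x \<in> src H ` f} = {}"
          if "D \<in> \<P>" for D
          using dec[OF that, of "dom f"] f unfolding \<C>_def dom_def by blast
        have bad: "real (card {i \<in> {1..d}. \<delta>1 / 2 < orb_dist f (Z \<phi>) (\<sigma> f) i}) \<le> 3 * \<delta> * real d"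
          by (rule Hom_orb_dist[OF P F d sf f \<phi>[unfolded \<H>_def] Z(1)[OF \<phi>] _ decf small])
            (use Z(2)[OF \<phi>] \<delta>1(1) in \<open>auto simp: \<R>_def\<close>)
        have "(\<Sum>i\<in>{1..d}. (orb_dist f (Z \<phi>) (\<sigma> f) i)\<^sup>2) / real d \<le> (\<delta>1 / 2)\<^sup>2 + 3 * \<delta> * diam\<^sup>2"
          using \<delta>1(1) by (intro rho2_le[OF d orb_dist_bounds[OF fp Z(1)[OF \<phi>] sf] bad]) auto
        also have "\<dots> \<le> \<delta>1\<^sup>2 / 2" using \<delta>d by (simp add: power_divide)
        also have "\<dots> < \<delta>1\<^sup>2" using \<delta>1(1) by simp
        finally show ?thesis
          unfolding rho2_def using \<delta>1(1) real_sqrt_less_mono by fastforce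
      qed
      have err: "(\<Sum>D\<in>\<R>. \<bar>freq d (Z \<phi>) D - measure \<mu> D\<bar>) < \<delta>" if \<phi>: "\<phi> \<in> \<H>" for \<phi>
      proof -
        have "(\<Sum>D\<in>\<R>. \<bar>fin_size d (\<phi> D) - measure \<mu> D\<bar>) < \<delta>"
          using \<phi> unfolding \<H>_def Hom_sets_def Let_def \<R>_def by auto
        then show ?thesis
          using Z(2)[OF \<phi>] by (simp add: freq_def sigma_sets.Basic cong: sum.cong)
      qed
      have inOrb: "Z \<phi> \<in> Orb G \<mu> H \<pi> \<rho> F' K \<delta>' d \<sigma>" if \<phi>: "\<phi> \<in> \<H>" for \<phi>
        unfolding Orb_def
      proof (intro CollectI conjI ballI)
        show "Z \<phi> \<in> {1..d} \<rightarrow>\<^sub>E units G" by (rule Z(1)[OF \<phi>])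
        show "rho2 \<rho>e d (\<lambda>i. ac f (Z \<phi> i)) (\<lambda>i. map_option (Z \<phi>) (fin_apply (\<sigma> f) i)) < \<delta>'" if "f \<in> F'" for f
          using orb[OF \<phi>, of f] that \<delta>1(2) by (simp add: F_def)
        fix k assume k: "k \<in> K"
        have "(\<Sum>D\<in>\<P>. \<bar>freq d (Z \<phi>) D - measure \<mu> D\<bar>) \<le> \<delta>"
          using G.freq_error[OF \<R>(1) P'(1), of "\<lambda>D. D"] \<R>(3) P'(5) err[OF \<phi>] by (meson le_less_trans less_imp_le)
        moreover have "\<bar>k x - k y\<bar> \<le> \<delta>1 / 4" if D: "D \<in> \<P>" "x \<in> D" "y \<in> D" for D x y
        proof -
          have "x \<in> units G" using D P'(4) by blast
          then obtain n where n: "n \<in> L k" "x \<in> n" using L(3)[OF k] by blast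
          then have "n \<in> \<C>" unfolding \<C>_def using k by blast
          then have "y \<in> n" using dec[OF D(1)] D(2,3) n(2) by blast
          then show ?thesis using L(4)[OF k n] by (simp add: less_imp_le)
        qed
        ultimately have "\<bar>(\<Sum>i\<in>{1..d}. k (Z \<phi> i)) / real d - (\<integral>y. k y \<partial>\<mu>)\<bar> \<le> 2 * (\<delta>1 / 4) + B * \<delta>"
          using G.empirical_integral[OF P bspec[OF K(2) k] _ BB[OF k] Z(1)[OF \<phi>] d _ B0] by blast
        also have "\<dots> < \<delta>'" using \<delta>B \<delta>1 by simp
        finally show "\<bar>(\<Sum>i\<in>{1..d}. k (Z \<phi> i)) / real d - (\<integral>y. k y \<partial>\<mu>)\<bar> < \<delta>'" .
      qed
      have rest: "real (card {i \<in> {1..d}. Z \<phi> i \<in> R}) \<le> (a / 8 + a / 32) * real d" if \<phi>: "\<phi> \<in> \<H>" for \<phi>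
      proof -
        have "\<bar>freq d (Z \<phi>) R - measure \<mu> R\<bar> \<le> \<delta>"
          using G.freq_error[OF \<R>(1), of "{()}" "\<lambda>_. R" d "Z \<phi>"] R\<R> err[OF \<phi>] by simp
        then have "freq d (Z \<phi>) R \<le> a / 8 + a / 32" using R8 \<delta>a by linarith
        then show ?thesis using d by (simp add: freq_def fin_size_def field_simps)
      qed
      have oclose: "real (card {i \<in> {1..d}. r / 3 < orb_dist e (Z \<phi>) (\<sigma> e) i}) \<le> b * real d"
        if \<phi>: "\<phi> \<in> \<H>" and e: "e \<in> E" for \<phi> e
      proof -
        have eF: "e \<in> F" unfolding F_def using e by blast
        then have ep: "e \<in> pseudogroup H H.M" using F(2) by blast
        have "sqrt ((\<Sum>i\<in>{1..d}. (orb_dist e (Z \<phi>) (\<sigma> e) i)\<^sup>2) / real d) \<le> \<epsilon>"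
          using orb[OF \<phi> eF] \<delta>1(3) unfolding rho2_def by linarith
        from markov_count[OF d _ _ this, of "r / 3"]
        show ?thesis
          using r orb_dist_bounds[OF ep Z(1)[OF \<phi>] bspec[OF \<sigma> eF]] unfolding \<epsilon>b by simp
      qed
      \<comment> \<open>The \<Q>-name of the chosen tuple. It determines the restriction of \<phi>
        to the algebra of \<Q>, so names can be counted instead.\<close>
      define nm where "nm \<phi> = restrict (\<lambda>i. nq (Z \<phi> i)) {1..d}" for \<phi>
      have Zu: "Z \<phi> i \<in> units G" if "\<phi> \<in> \<H>" "i \<in> {1..d}" for \<phi> i using Z(1)[OF that(1)] that(2) by blast
      have ham: "real (card {i \<in> {1..d}. nm \<phi> i \<noteq> nq (Z \<psi> i)}) \<le> a * real d"
        if \<phi>: "\<phi> \<in> \<H>" and \<psi>: "\<psi> \<in> \<H>" and near: "rho2 \<rho> d (Z \<phi>) (Z \<psi>) \<le> \<epsilon>" for \<phi> \<psi>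
      proof -
        have "real (card {i \<in> {1..d}. r / 3 < \<rho> (Z \<phi> i) (Z \<psi> i)}) \<le> b * real d"
          using markov_count[OF d, of "r / 3" "\<lambda>i. \<rho> (Z \<phi> i) (Z \<psi> i)" \<epsilon>] r rho_nonneg[OF Zu[OF \<phi>] Zu[OF \<psi>]] near
          unfolding rho2_def \<epsilon>b by simp
        then have "real (card {i \<in> {1..d}. \<exists>e\<in>E. r < \<rho> (app e (Z \<phi> i)) (app e (Z \<psi> i))}) \<le>
            3 * real (card E) * b * real d"
          using \<sigma> oclose[OF \<phi>] oclose[OF \<psi>]
          by (intro generating_close[OF E r d _ Z(1)[OF \<phi>] Z(1)[OF \<psi>], of \<sigma>]) (auto simp: F_def)
        also have "\<dots> \<le> a / 2 * real d" using b3 by (intro mult_right_mono) auto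
        finally have far: "real (card {i \<in> {1..d}. \<exists>e\<in>E. r < \<rho> (app e (Z \<phi> i)) (app e (Z \<psi> i))}) \<le> a / 2 * real d" .
        have "{i \<in> {1..d}. nm \<phi> i \<noteq> nq (Z \<psi> i)} \<subseteq> {i \<in> {1..d}. Z \<phi> i \<in> R} \<union> {i \<in> {1..d}. Z \<psi> i \<in> R} \<union>
            {i \<in> {1..d}. \<exists>e\<in>E. r < \<rho> (app e (Z \<phi> i)) (app e (Z \<psi> i))}"
        proof
          fix i assume "i \<in> {i \<in> {1..d}. nm \<phi> i \<noteq> nq (Z \<psi> i)}"
          then have i: "i \<in> {1..d}" and "nm \<phi> i \<noteq> nq (Z \<psi> i)" by blast+
          moreover from i have "nm \<phi> i = nq (Z \<phi> i)" unfolding nm_def by (rule restrict_apply')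
          ultimately have i: "i \<in> {1..d}" "nq (Z \<phi> i) \<noteq> nq (Z \<psi> i)" by simp_all
          note u = Zu[OF \<phi> i(1)] Zu[OF \<psi> i(1)]
          show "i \<in> {i \<in> {1..d}. Z \<phi> i \<in> R} \<union> {i \<in> {1..d}. Z \<psi> i \<in> R} \<union>
            {i \<in> {1..d}. \<exists>e\<in>E. r < \<rho> (app e (Z \<phi> i)) (app e (Z \<psi> i))}"
          proof (rule ccontr)
            assume n: "\<not> ?thesis"
            then have "Z \<phi> i \<in> C (nq (Z \<phi> i))" "Z \<psi> i \<in> C (nq (Z \<psi> i))"
              using nq'[OF u(1)] nq'[OF u(2)] i(1) unfolding R_def by auto
            then have "(Z \<phi> i, Z \<psi> i) \<in> Bd" unfolding Bd_def using nq'[OF u(1)] nq'[OF u(2)] i(2) by auto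
            moreover have "\<forall>e\<in>E. \<rho> (app e (Z \<phi> i)) (app e (Z \<psi> i)) \<le> r" using n i(1) by auto
            ultimately show False using sepW[OF u] by blast
          qed
        qed
        from card_mono[OF _ this]
        have "card {i \<in> {1..d}. nm \<phi> i \<noteq> nq (Z \<psi> i)} \<le> card ({i \<in> {1..d}. Z \<phi> i \<in> R} \<union> {i \<in> {1..d}. Z \<psi> i \<in> R} \<union>
            {i \<in> {1..d}. \<exists>e\<in>E. r < \<rho> (app e (Z \<phi> i)) (app e (Z \<psi> i))})" by simp
        also have "\<dots> \<le> card {i \<in> {1..d}. Z \<phi> i \<in> R} + card {i \<in> {1..d}. Z \<psi> i \<in> R} +
            card {i \<in> {1..d}. \<exists>e\<in>E. r < \<rho> (app e (Z \<phi> i)) (app e (Z \<psi> i))}"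
          by (rule order_trans[OF card_Un_le add_right_mono[OF card_Un_le]])
        finally have "real (card {i \<in> {1..d}. nm \<phi> i \<noteq> nq (Z \<psi> i)}) \<le>
            (a / 8 + a / 32) * real d + (a / 8 + a / 32) * real d + a / 2 * real d"
          using rest[OF \<phi>] rest[OF \<psi>] far by linarith
        \<comment> \<open>Twice 5/32 for the visits of the two tuples to R and 16/32 for the
          separated translates.\<close>
        also have "\<dots> = (a * real d) * (13 / 16)" by (simp add: field_simps)
        also have "\<dots> \<le> a * real d" using a by simp
        finally show ?thesis .
      qed
      have nmQ: "nm \<phi> \<in> {1..d} \<rightarrow>\<^sub>E \<Q>" if "\<phi> \<in> \<H>" for \<phi>
        unfolding nm_def using nq' Zu[OF that] by auto
      define g where "g n = restrict (\<lambda>S. {i \<in> {1..d}. n i \<subseteq> S}) (sigma_sets (units G) \<Q>)" for n :: "nat \<Rightarrow> 'g set"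
      have "restrict \<phi> (sigma_sets (units G) \<Q>) = g (nm \<phi>)" if \<phi>: "\<phi> \<in> \<H>" for \<phi>
        unfolding g_def
      proof (rule restrict_ext)
        fix S assume S: "S \<in> sigma_sets (units G) \<Q>"
        have "Z \<phi> i \<in> S \<longleftrightarrow> nm \<phi> i \<subseteq> S" if i: "i \<in> {1..d}" for i
        proof
          assume "Z \<phi> i \<in> S"
          then obtain B where "B \<in> \<Q>" "B \<subseteq> S" "Z \<phi> i \<in> B"
            using sigma_sets_partition[OF Q'(2) S] by blast
          then show "nm \<phi> i \<subseteq> S" using nq i by (simp add: nm_def)
        next
          assume "nm \<phi> i \<subseteq> S"
          then show "Z \<phi> i \<in> S" using nq'[OF Zu[OF \<phi> i]] i by (auto simp: nm_def)
        qed
        then show "\<phi> S = {i \<in> {1..d}. nm \<phi> i \<subseteq> S}" using Z(2)[OF \<phi> Q\<R>[OF S]] by auto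
      qed
      then have "(\<lambda>\<phi>. restrict \<phi> (sigma_sets (units G) \<Q>)) ` \<H> = g ` nm ` \<H>"
        by (simp add: image_image cong: image_cong)
      then have Hc: "Hom_count G \<mu> H \<pi> \<Q> \<P> F \<delta> d \<sigma> \<le> card (nm ` \<H>)"
        unfolding Hom_count_def \<H>_def[symmetric] using fin\<H> by (simp add: card_image_le)
      \<comment> \<open>All names lie in Hamming balls around the names of a maximal separated set,
        so their number is at most its cardinality times exp(\<kappa> d).\<close>
      obtain S where S: "S \<subseteq> Z ` \<H>" "\<And>x y. x \<in> S \<Longrightarrow> y \<in> S \<Longrightarrow> x \<noteq> y \<Longrightarrow> \<epsilon> < rho2 \<rho> d x y"
        "\<And>z. z \<in> Z ` \<H> \<Longrightarrow> \<exists>s\<in>S. z = s \<or> rho2 \<rho> d z s \<le> \<epsilon> \<or> rho2 \<rho> d s z \<le> \<epsilon>"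
        using maximal_separated[of "Z ` \<H>" \<epsilon> "rho2 \<rho> d"] fin\<H> by blast
      have finS: "finite S" using finite_subset[OF S(1)] fin\<H> by blast
      define ham_ball where "ham_ball s = {n \<in> {1..d} \<rightarrow>\<^sub>E \<Q>. real (card {i \<in> {1..d}. n i \<noteq> nq (s i)}) \<le> a * real d}"
        for s :: "nat \<Rightarrow> 'g"
      have "nm ` \<H> \<subseteq> (\<Union>s\<in>S. ham_ball s)"
      proof
        fix n assume "n \<in> nm ` \<H>"
        then obtain \<phi> where \<phi>: "\<phi> \<in> \<H>" "n = nm \<phi>" by blast
        then obtain s where s: "s \<in> S" "Z \<phi> = s \<or> rho2 \<rho> d (Z \<phi>) s \<le> \<epsilon> \<or> rho2 \<rho> d s (Z \<phi>) \<le> \<epsilon>"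
          using S(3)[of "Z \<phi>"] by blast
        obtain \<psi> where \<psi>: "\<psi> \<in> \<H>" "s = Z \<psi>" using S(1) s(1) by blast
        have "rho2 \<rho> d s (Z \<phi>) = rho2 \<rho> d (Z \<phi>) s"
          unfolding rho2_def \<psi>(2) using rho_sym[OF Zu[OF \<psi>(1)] Zu[OF \<phi>(1)]] by simp
        moreover have "rho2 \<rho> d s s \<le> \<epsilon>"
          unfolding rho2_def \<psi>(2) using rho_refl[OF Zu[OF \<psi>(1)]] \<epsilon> by simp
        ultimately have "rho2 \<rho> d (Z \<phi>) (Z \<psi>) \<le> \<epsilon>" using s(2) \<psi>(2) by auto
        then have "n \<in> ham_ball s"
          unfolding ham_ball_def \<phi>(2) \<psi>(2) using ham[OF \<phi>(1) \<psi>(1)] nmQ[OF \<phi>(1)] by blast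
        then show "n \<in> (\<Union>s\<in>S. ham_ball s)" using s(1) by blast
      qed
      then have "card (nm ` \<H>) \<le> (\<Sum>s\<in>S. card (ham_ball s))"
      proof (intro card_le_sum_bound finite_imageI fin\<H> finS)
        show "finite (ham_ball s)" for s
          unfolding ham_ball_def by (rule finite_subset[of _ "{1..d} \<rightarrow>\<^sub>E \<Q>"]) (auto intro: finite_PiE Q'(1))
      qed
      then have "real (card (nm ` \<H>)) \<le> (\<Sum>s\<in>S. real (card (ham_ball s)))"
        unfolding of_nat_sum[symmetric] by (rule of_nat_mono)
      also have "\<dots> \<le> real (card S) * exp (\<kappa> * real d)"
        using sum_bounded_above[of S "\<lambda>s. real (card (ham_ball s))" "exp (\<kappa> * real d)"] ball[of d]
        unfolding ham_ball_def by simp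
      finally have "real (card (nm ` \<H>)) \<le> exp (\<kappa> * real d) * real (card S)"
        by (simp add: mult.commute)
      then have "real (Hom_count G \<mu> H \<pi> \<Q> \<P> F \<delta> d \<sigma>) \<le> exp (\<kappa> * real d) * real (card S)"
        using of_nat_mono[OF Hc] by (rule order_trans[rotated])
      then have "ennreal (real (Hom_count G \<mu> H \<pi> \<Q> \<P> F \<delta> d \<sigma>)) \<le> ennreal (exp (\<kappa> * real d) * real (card S))"
        by (rule ennreal_leI)
      then have "of_nat (Hom_count G \<mu> H \<pi> \<Q> \<P> F \<delta> d \<sigma>) \<le> ennreal (exp (\<kappa> * real d)) * of_nat (card S)"
        by (simp add: ennreal_mult ennreal_of_nat_eq_real_of_nat)
      also have "\<dots> \<le> ennreal (exp (\<kappa> * real d)) * sep_number \<epsilon> (rho2 \<rho> d) (Orb G \<mu> H \<pi> \<rho> F' K \<delta>' d \<sigma>)"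
        using S(1,2) inOrb by (intro mult_left_mono card_le_sep_number finS) auto
      finally show ?thesis .
    qed
    have "F' \<subseteq> F" unfolding F_def by blast
    with P ref F \<delta> count show "\<exists>\<P> F \<delta>. finite_borel_partition G \<mu> \<P> \<and> refines (units G) \<P> \<Q> \<and> finite F \<and>
        F \<subseteq> pseudogroup H H.M \<and> units H \<in> F \<and> F' \<subseteq> F \<and> 0 < \<delta> \<and>
        (\<forall>d \<sigma>. 0 < d \<longrightarrow> (\<forall>f\<in>F. \<sigma> f \<in> fin_pseudogroup d) \<longrightarrow>
          of_nat (Hom_count G \<mu> H \<pi> \<Q> \<P> F \<delta> d \<sigma>) \<le>
          ennreal (exp (\<kappa> * real d)) * sep_number \<epsilon> (rho2 \<rho> d) (Orb G \<mu> H \<pi> \<rho> F' K \<delta>' d \<sigma>))"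
      by (intro exI[of _ \<P>] exI[of _ F] exI[of _ \<delta>]) simp
  qed
qed

end

section \<open>The metric entropy is at most the partition entropy\<close>

text \<open>With equal totals the positive and negative deviations have the same sum, so one-sided
  bounds control both. It converts the lower bounds obtained from test functions into two-sided
  frequency errors.\<close>

lemma sum_abs_balanced:
  fixes a b :: "'i \<Rightarrow> real"
  assumes "(\<Sum>i\<in>I. a i) = (\<Sum>i\<in>I. b i)" "\<And>i. i \<in> I \<Longrightarrow> b i - t \<le> a i" "0 \<le> t"
  shows "(\<Sum>i\<in>I. \<bar>a i - b i\<bar>) \<le> 2 * t * real (card I)"
proof -
  have "(\<Sum>i\<in>I. \<bar>a i - b i\<bar>) \<le> (\<Sum>i\<in>I. (a i - b i) + 2 * t)"
    using assms(2,3) by (intro sum_mono) (force simp: abs_if)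
  also have "\<dots> = 2 * t * real (card I)" using assms(1) by (simp add: sum.distrib sum_subtractf)
  finally show ?thesis .
qed

lemma card_sym_diff:
  assumes "finite A" "finite B"
  shows "real (card (sym_diff A B)) = real (card A) + real (card B) - 2 * real (card (A \<inter> B))"
proof -
  have "card (sym_diff A B) = card (A - B) + card (B - A)"
    using assms by (intro card_Un_disjoint) auto
  moreover have "card A = card (A - B) + card (A \<inter> B)" "card B = card (B - A) + card (A \<inter> B)"
    using card_Int_Diff[OF assms(1), of B] card_Int_Diff[OF assms(2), of A] by (auto simp: Int_commute)
  ultimately show ?thesis by simp
qed

lemma card_sum_disjoint_le:
  assumes "finite I" "finite S" "\<And>i. i \<in> I \<Longrightarrow> T i \<subseteq> S"
    "\<And>i j. i \<in> I \<Longrightarrow> j \<in> I \<Longrightarrow> i \<noteq> j \<Longrightarrow> T i \<inter> T j = {}"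
  shows "(\<Sum>i\<in>I. card (T i)) \<le> card S"
proof -
  have "(\<Sum>i\<in>I. card (T i)) = card (\<Union>i\<in>I. T i)"
    using assms(1,4) finite_subset[OF assms(3,2)] by (intro card_UN_disjoint[symmetric]) auto
  also have "\<dots> \<le> card S" using assms(2,3) by (intro card_mono) auto
  finally show ?thesis .
qed

text \<open>Each symmetric difference is expanded into cardinalities. Disjointness bounds the images
  \<open>fin_image s (U i)\<close> in total by the domain of s, and the matched indices
  \<open>T i - J\<close> bound the intersections from below.\<close>

lemma matching_count:
  assumes s: "s \<in> fin_pseudogroup d" and I: "finite I" and J: "finite J"
    and U: "\<And>i j. i \<in> I \<Longrightarrow> j \<in> I \<Longrightarrow> i \<noteq> j \<Longrightarrow> U i \<inter> U j = {}"
    and V: "\<And>i. i \<in> I \<Longrightarrow> finite (V i)"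
    and T: "\<And>i j. i \<in> I \<Longrightarrow> j \<in> I \<Longrightarrow> i \<noteq> j \<Longrightarrow> T i \<inter> T j = {}" "\<And>i. i \<in> I \<Longrightarrow> finite (T i)"
    and match: "\<And>i n. i \<in> I \<Longrightarrow> n \<in> T i - J \<Longrightarrow> n \<in> U i \<and> (\<exists>k\<in>V i. (k, n) \<in> s)"
  shows "(\<Sum>i\<in>I. real (card (sym_diff (fin_image s (U i)) (V i)))) \<le>
    real (card (snd ` s)) + (\<Sum>i\<in>I. real (card (V i))) - 2 * ((\<Sum>i\<in>I. real (card (T i))) - real (card J))"
proof -
  have fs: "finite (snd ` s)" using finite_fin_pseudogroup_mem[OF s] by simp
  have fU: "finite (fin_image s (U i))" for i
    using finite_subset[OF fin_image_subset[OF s]] by blast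
  have "fin_image s (U i) = fin_image s (U i \<inter> snd ` s)" for i unfolding fin_image_def by force
  then have "card (fin_image s (U i)) = card (U i \<inter> snd ` s)" for i
    using card_injective_relation[OF s] by (metis inf_le2)
  moreover have "(\<Sum>i\<in>I. card (U i \<inter> snd ` s)) \<le> card (snd ` s)"
    using U by (intro card_sum_disjoint_le I fs) blast+
  ultimately have 1: "(\<Sum>i\<in>I. real (card (fin_image s (U i)))) \<le> real (card (snd ` s))"
    by (simp add: of_nat_sum[symmetric] del: of_nat_sum)
  have "card (T i - J) \<le> card (fin_image s (U i) \<inter> V i)" if i: "i \<in> I" for i
  proof -
    have "T i - J \<subseteq> snd ` s" using match[OF i] by force
    then have "card (T i - J) = card (fin_image s (T i - J))" using card_injective_relation[OF s] by simp
    also have "\<dots> \<le> card (fin_image s (U i) \<inter> V i)"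
    proof (rule card_mono)
      show "finite (fin_image s (U i) \<inter> V i)" using fU by blast
      show "fin_image s (T i - J) \<subseteq> fin_image s (U i) \<inter> V i"
      proof
        fix k assume "k \<in> fin_image s (T i - J)"
        then obtain n where n: "n \<in> T i - J" "(k, n) \<in> s" unfolding fin_image_def by blast
        then obtain k' where "n \<in> U i" "k' \<in> V i" "(k', n) \<in> s" using match[OF i n(1)] by blast
        moreover from this have "k' = k" using fin_pseudogroupD(2)[OF s _ n(2)] by blast
        ultimately show "k \<in> fin_image s (U i) \<inter> V i" unfolding fin_image_def by blast
      qed
    qed
    finally show ?thesis .
  qed
  then have "(\<Sum>i\<in>I. real (card (T i - J))) \<le> (\<Sum>i\<in>I. real (card (fin_image s (U i) \<inter> V i)))"
    by (intro sum_mono of_nat_mono)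
  moreover have "(\<Sum>i\<in>I. real (card (T i))) - real (card J) \<le> (\<Sum>i\<in>I. real (card (T i - J)))"
  proof -
    have "card (T i) = card (T i - J) + card (T i \<inter> J)" if "i \<in> I" for i
      using card_Int_Diff[OF T(2)[OF that], of J] by simp
    then have "(\<Sum>i\<in>I. card (T i)) = (\<Sum>i\<in>I. card (T i - J)) + (\<Sum>i\<in>I. card (T i \<inter> J))"
      by (simp add: sum.distrib[symmetric])
    moreover have "(\<Sum>i\<in>I. card (T i \<inter> J)) \<le> card J"
      using T(1) by (intro card_sum_disjoint_le I J) blast+
    ultimately have "(\<Sum>i\<in>I. card (T i)) \<le> (\<Sum>i\<in>I. card (T i - J)) + card J" by linarith
    then have "real (\<Sum>i\<in>I. card (T i)) \<le> real ((\<Sum>i\<in>I. card (T i - J)) + card J)" by (rule of_nat_mono)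
    then show ?thesis by simp
  qed
  ultimately have 2: "(\<Sum>i\<in>I. real (card (T i))) - real (card J) \<le> (\<Sum>i\<in>I. real (card (fin_image s (U i) \<inter> V i)))"
    by linarith
  have "(\<Sum>i\<in>I. real (card (sym_diff (fin_image s (U i)) (V i)))) =
      (\<Sum>i\<in>I. real (card (fin_image s (U i))) + real (card (V i)) - 2 * real (card (fin_image s (U i) \<inter> V i)))"
    using fU V by (intro sum.cong refl card_sym_diff) auto
  also have "\<dots> = (\<Sum>i\<in>I. real (card (fin_image s (U i)))) + (\<Sum>i\<in>I. real (card (V i))) -
      2 * (\<Sum>i\<in>I. real (card (fin_image s (U i) \<inter> V i)))"
    by (simp add: sum_subtractf sum.distrib sum_distrib_left)
  finally have 3: "(\<Sum>i\<in>I. real (card (sym_diff (fin_image s (U i)) (V i)))) =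
      (\<Sum>i\<in>I. real (card (fin_image s (U i)))) + (\<Sum>i\<in>I. real (card (V i))) -
      2 * (\<Sum>i\<in>I. real (card (fin_image s (U i) \<inter> V i)))" .
  have gen: "a = u + v - 2 * w \<Longrightarrow> u \<le> c \<Longrightarrow> p - j \<le> w \<Longrightarrow> a \<le> c + v - 2 * (p - j)"
    for a u v w c p j :: real by (simp add: algebra_simps)
  show ?thesis by (rule gen[OF 3 1 2])
qed

text \<open>Because (i, j) maps j to i, the groupoid product and relational composition take their
  factors in the same order.\<close>

lemma set_mult_full_groupoid:
  assumes "s \<subseteq> {1..d} \<times> {1..d}" "t \<subseteq> {1..d} \<times> {1..d}"
  shows "set_mult (full_groupoid d) s t = s O t"
proof -
  have "(a, b) \<in> set_mult (full_groupoid d) s t \<longleftrightarrow> (a, b) \<in> s O t" for a b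
    using assms unfolding set_mult_def composable_def full_groupoid_def
    by (auto simp: relcomp.simps) fastforce+
  then show ?thesis by auto
qed

context etale_gpd
begin

text \<open>Normality separates two closed sets at a time; finite intersections make the
  neighbourhoods pairwise disjoint, and normality once more inserts the inner layer W. The gap
  between W and U is the tolerance for points that are only approximately equal.\<close>

lemma disjoint_open_nhds:
  assumes I: "finite I" and C: "\<And>i. i \<in> I \<Longrightarrow> closedin X (C i)" "\<And>i. i \<in> I \<Longrightarrow> C i \<subseteq> n i"
      "\<And>i. i \<in> I \<Longrightarrow> openin X (n i)" "\<And>i j. i \<in> I \<Longrightarrow> j \<in> I \<Longrightarrow> i \<noteq> j \<Longrightarrow> C i \<inter> C j = {}"
  obtains U W where "\<And>i. i \<in> I \<Longrightarrow> openin X (U i)" "\<And>i. i \<in> I \<Longrightarrow> U i \<subseteq> n i"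
    "\<And>i. i \<in> I \<Longrightarrow> openin X (W i)" "\<And>i. i \<in> I \<Longrightarrow> C i \<subseteq> W i" "\<And>i. i \<in> I \<Longrightarrow> X closure_of (W i) \<subseteq> U i"
    "\<And>i j. i \<in> I \<Longrightarrow> j \<in> I \<Longrightarrow> i \<noteq> j \<Longrightarrow> U i \<inter> U j = {}"
proof -
  have "\<exists>P Q. openin X P \<and> openin X Q \<and> C i \<subseteq> P \<and> C j \<subseteq> Q \<and> P \<inter> Q = {}"
    if "i \<in> I" "j \<in> I" "i \<noteq> j" for i j
  proof -
    have "disjnt (C i) (C j)" using C(4)[OF that] by (simp add: disjnt_def)
    then show ?thesis
      using normal_X C(1)[OF that(1)] C(1)[OF that(2)] unfolding normal_space_def disjnt_def by metis
  qed
  then obtain P Q where PQ: "\<And>i j. i \<in> I \<Longrightarrow> j \<in> I \<Longrightarrow> i \<noteq> j \<Longrightarrow>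
      openin X (P i j) \<and> openin X (Q i j) \<and> C i \<subseteq> P i j \<and> C j \<subseteq> Q i j \<and> P i j \<inter> Q i j = {}" by metis
  define U where "U i = n i \<inter> (units G \<inter> (\<Inter>j\<in>I - {i}. P i j \<inter> Q j i))" for i
  have Uo: "openin X (U i)" if i: "i \<in> I" for i
  proof -
    have "openin X (topspace X \<inter> (\<Inter>j\<in>I - {i}. P i j \<inter> Q j i))"
      using I PQ i openin_topspace[of X] by (intro openin_Int_Inter) (auto intro!: openin_Int)
    then show ?thesis unfolding U_def topspace_X by (rule openin_Int[OF C(3)[OF i]])
  qed
  have CU: "C i \<subseteq> U i" if i: "i \<in> I" for i
  proof -
    have "C i \<subseteq> P i j \<inter> Q j i" if j: "j \<in> I - {i}" for j using PQ[of i j] PQ[of j i] i j by blast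
    then have "C i \<subseteq> (\<Inter>j\<in>I - {i}. P i j \<inter> Q j i)" by (rule INT_greatest)
    then show ?thesis unfolding U_def using C(2)[OF i] closedin_subset[OF C(1)[OF i]] by simp
  qed
  have "\<exists>W. openin X W \<and> C i \<subseteq> W \<and> X closure_of W \<subseteq> U i" if i: "i \<in> I" for i
    using normal_X C(1)[OF i] Uo[OF i] CU[OF i] unfolding normal_space_alt by metis
  then obtain W where W: "\<And>i. i \<in> I \<Longrightarrow> openin X (W i) \<and> C i \<subseteq> W i \<and> X closure_of (W i) \<subseteq> U i" by metis
  have "U i \<inter> U j = {}" if ij: "i \<in> I" "j \<in> I" "i \<noteq> j" for i j
  proof -
    have "U i \<subseteq> P i j" "U j \<subseteq> Q i j" unfolding U_def using ij by auto
    then show ?thesis using PQ[OF ij] by blast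
  qed
  then show ?thesis using that[of U W] Uo W unfolding U_def by auto
qed

text \<open>Half of \<eta> is lost to the continuous minorant of the indicator, half to the test of
  its mean.\<close>

lemma empirical_lower_bound:
  assumes \<O>: "finite \<O>" "\<And>U. U \<in> \<O> \<Longrightarrow> openin X U" and \<eta>: "0 < \<eta>"
  obtains K where "finite K" "\<forall>k\<in>K. continuous_map X euclideanreal k"
    "\<And>d x U. 0 < d \<Longrightarrow> x \<in> {1..d} \<rightarrow>\<^sub>E units G \<Longrightarrow>
      \<forall>k\<in>K. \<bar>(\<Sum>i\<in>{1..d}. k (x i)) / real d - (\<integral>y. k y \<partial>\<mu>)\<bar> < \<eta> / 2 \<Longrightarrow> U \<in> \<O> \<Longrightarrow>
      measure \<mu> U - \<eta> \<le> freq d x U"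
proof -
  have "\<exists>k. continuous_map X euclideanreal k \<and> (\<forall>x\<in>units G. k x \<le> indicator U x) \<and>
      measure \<mu> U - \<eta> / 2 < (\<integral>x. k x \<partial>\<mu>)" if "U \<in> \<O>" for U
    using open_test_function[OF \<O>(2)[OF that], of "\<eta> / 2"] \<eta> by (metis half_gt_zero)
  then obtain k where k: "\<And>U. U \<in> \<O> \<Longrightarrow> continuous_map X euclideanreal (k U)"
    "\<And>U x. U \<in> \<O> \<Longrightarrow> x \<in> units G \<Longrightarrow> k U x \<le> indicator U x"
    "\<And>U. U \<in> \<O> \<Longrightarrow> measure \<mu> U - \<eta> / 2 < (\<integral>x. k U x \<partial>\<mu>)" by metis
  show ?thesis
  proof (rule that[of "k ` \<O>"])
    fix d :: nat and x U
    assume d: "0 < d" and x: "x \<in> {1..d} \<rightarrow>\<^sub>E units G" and U: "U \<in> \<O>"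
      and t: "\<forall>k\<in>k ` \<O>. \<bar>(\<Sum>i\<in>{1..d}. k (x i)) / real d - (\<integral>y. k y \<partial>\<mu>)\<bar> < \<eta> / 2"
    have "(\<Sum>i\<in>{1..d}. k U (x i)) \<le> (\<Sum>i\<in>{1..d}. indicator U (x i))"
      using k(2)[OF U] x by (intro sum_mono) (auto simp: PiE_iff)
    also have "\<dots> = real (card {i \<in> {1..d}. x i \<in> U})"
      by (simp add: indicator_def sum.If_cases Int_def)
    finally have "(\<Sum>i\<in>{1..d}. k U (x i)) / real d \<le> freq d x U"
      unfolding freq_def fin_size_def by (rule divide_right_mono) simp
    moreover have "\<bar>(\<Sum>i\<in>{1..d}. k U (x i)) / real d - (\<integral>y. k U y \<partial>\<mu>)\<bar> < \<eta> / 2" using t U by blast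
    ultimately show "measure \<mu> U - \<eta> \<le> freq d x U" using k(3)[OF U] by linarith
  qed (use \<O>(1) k(1) in auto)
qed

end

context entropy_setting
begin

text \<open>The converse of \<open>Hom_points\<close>: reading off membership preserves the Boolean
  operations, so only the two numerical conditions are left.\<close>

lemma Hom_of_tuple:
  assumes P: "finite_borel_partition G \<mu> \<P>" and F: "finite F" "F \<subseteq> pseudogroup H H.M" "units H \<in> F"
    and z: "\<And>i. i \<in> {1..d} \<Longrightarrow> z i \<in> units G"
    and act: "\<And>f. f \<in> F \<Longrightarrow> (\<Sum>P\<in>\<P>. fin_size d (sym_diff (fin_image (\<sigma> f) {i \<in> {1..d}. z i \<in> P})
        {i \<in> {1..d}. z i \<in> act_set G H \<pi> f P})) < \<delta>"
    and err: "(\<Sum>B\<in>partition_power G H \<pi> \<P> F. \<bar>freq d z B - measure \<mu> B\<bar>) < \<delta>"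
  shows "restrict (\<lambda>S. {i \<in> {1..d}. z i \<in> S}) (sigma_sets (units G) (partition_power G H \<pi> \<P> F)) \<in>
    Hom_sets G \<mu> H \<pi> \<P> F \<delta> d \<sigma>"
proof -
  note \<R> = partition_power[OF P F]
  let ?\<Sigma> = "sigma_sets (units G) (partition_power G H \<pi> \<P> F)"
  let ?\<phi> = "restrict (\<lambda>S. {i \<in> {1..d}. z i \<in> S}) ?\<Sigma>"
  interpret \<Sigma>: sigma_algebra "units G" ?\<Sigma>
    using G.fbpD(4)[OF \<R>(1)] by (intro sigma_algebra_sigma_sets) auto
  have 1: "?\<phi> S = {i \<in> {1..d}. z i \<in> S}" if "S \<in> ?\<Sigma>" for S using that by simp
  have 2: "(\<Sum>P\<in>\<P>. fin_size d (sym_diff (fin_image (\<sigma> f) (?\<phi> P)) (?\<phi> (act_set G H \<pi> f P)))) < \<delta>"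
    if f: "f \<in> F" for f
  proof -
    have "(\<Sum>P\<in>\<P>. fin_size d (sym_diff (fin_image (\<sigma> f) (?\<phi> P)) (?\<phi> (act_set G H \<pi> f P)))) =
        (\<Sum>P\<in>\<P>. fin_size d (sym_diff (fin_image (\<sigma> f) {i \<in> {1..d}. z i \<in> P})
          {i \<in> {1..d}. z i \<in> act_set G H \<pi> f P}))"
      by (intro sum.cong refl) (simp only: 1[OF \<R>(3)] 1[OF \<R>(2)[OF f]])
    then show ?thesis using act[OF f] by simp
  qed
  have "(\<Sum>B\<in>partition_power G H \<pi> \<P> F. \<bar>fin_size d (?\<phi> B) - measure \<mu> B\<bar>) =
      (\<Sum>B\<in>partition_power G H \<pi> \<P> F. \<bar>freq d z B - measure \<mu> B\<bar>)"
    by (intro sum.cong refl) (simp add: freq_def sigma_sets.Basic)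
  then have 3: "(\<Sum>B\<in>partition_power G H \<pi> \<P> F. \<bar>fin_size d (?\<phi> B) - measure \<mu> B\<bar>) < \<delta>"
    using err by simp
  have 4: "?\<phi> (units G) = {1..d}" using z by auto
  have 5: "?\<phi> {} = {}" by simp
  have 6: "?\<phi> (S \<union> S') = ?\<phi> S \<union> ?\<phi> S' \<and> ?\<phi> (S \<inter> S') = ?\<phi> S \<inter> ?\<phi> S'"
    if "S \<in> ?\<Sigma>" "S' \<in> ?\<Sigma>" for S S'
    using that \<Sigma>.Un[OF that] \<Sigma>.Int[OF that] by auto
  have 7: "?\<phi> \<in> ?\<Sigma> \<rightarrow>\<^sub>E Pow {1..d}" by auto
  show ?thesis unfolding Hom_sets_def Let_def using 2 3 4 5 6 7 by blast
qed

text \<open>Apply \<open>matching_count\<close> with the sets \<open>W B\<close> as T. After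
  division by d, the domain of s, the images f . B and the matched indices all have totals
  controlled by the measure m of the domain of f; m cancels as m + m - 2 m, leaving 3 \<eta> from
  the domain, 2 \<eta> from J, u from the frequencies and 2 t for each part.\<close>

lemma action_error:
  assumes P: "finite_borel_partition G \<mu> \<P>" and F: "finite F" "F \<subseteq> pseudogroup H H.M" "units H \<in> F"
    and d: "0 < d" and f: "f \<in> F" and s: "s \<in> fin_pseudogroup d"
    and disj: "\<And>B B'. B \<in> \<P> \<Longrightarrow> B' \<in> \<P> \<Longrightarrow> B \<noteq> B' \<Longrightarrow> W B \<inter> W B' = {}"
    and low: "\<And>B. B \<in> \<P> \<Longrightarrow> measure \<mu> (act_set G H \<pi> f B) - t \<le> freq d x (W B)"
    and J: "J \<subseteq> {1..d}" "real (card J) \<le> \<eta> * real d"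
    and good: "\<And>B i. B \<in> \<P> \<Longrightarrow> i \<in> {1..d} - J \<Longrightarrow> x i \<in> W B \<Longrightarrow>
        z i \<in> B \<and> (\<exists>k\<in>{1..d}. z k \<in> act_set G H \<pi> f B \<and> (k, i) \<in> s)"
    and dom: "real (card (snd ` s)) \<le> (measure \<nu> (src H ` f) + 3 * \<eta>) * real d"
    and err: "(\<Sum>B\<in>partition_power G H \<pi> \<P> F. \<bar>freq d z B - measure \<mu> B\<bar>) \<le> u"
  shows "(\<Sum>B\<in>\<P>. fin_size d (sym_diff (fin_image s {i \<in> {1..d}. z i \<in> B})
        {i \<in> {1..d}. z i \<in> act_set G H \<pi> f B})) \<le> 5 * \<eta> + u + 2 * (real (card \<P>) * t)"
proof -
  let ?a = "act_set G H \<pi> f"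
  note P' = G.fbpD[OF P]
  note \<R> = partition_power[OF P F]
  have fp: "f \<in> pseudogroup H H.M" using f F(2) by blast
  have aS: "?a B \<inter> ?a B' = {}" if B: "B \<in> \<P>" "B' \<in> \<P>" "B \<noteq> B'" for B B'
  proof (rule ccontr)
    assume "?a B \<inter> ?a B' \<noteq> {}"
    then obtain y v w where y: "v \<in> B" "w \<in> B'" "ac f v = Some y" "ac f w = Some y"
      unfolding act_set_def by blast
    then have "v = w" using act_inj[OF fp] P'(4) B by blast
    then show False using y P'(5)[OF B] by blast
  qed
  have tot: "(\<Sum>B\<in>\<P>. measure \<mu> (?a B)) = measure \<nu> (src H ` f)"
  proof -
    have "(\<Sum>B\<in>\<P>. measure \<mu> (?a B)) = (\<Sum>B\<in>\<P>. measure \<mu> {x \<in> B. \<pi> x \<in> src H ` f})"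
      using act_set_measurable(2)[OF fp P'(3)] by simp
    also have "\<dots> = measure \<mu> (\<Union>B\<in>\<P>. {x \<in> B. \<pi> x \<in> src H ` f})"
    proof (rule G.measure_UN_disjoint[symmetric, OF P'(1)])
      fix B assume B: "B \<in> \<P>"
      have "{x \<in> B. \<pi> x \<in> src H ` f} = B \<inter> {x \<in> units G. \<pi> x \<in> src H ` f}" using P'(4)[OF B] by auto
      then show "{x \<in> B. \<pi> x \<in> src H ` f} \<in> sets \<mu>" using P'(3)[OF B] dom_measurable[OF fp] by simp
    qed (use P'(5) in blast)
    also have "(\<Union>B\<in>\<P>. {x \<in> B. \<pi> x \<in> src H ` f}) = {x \<in> units G. \<pi> x \<in> src H ` f}" using P'(6) by auto
    also have "measure \<mu> \<dots> = measure \<nu> (src H ` f)"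
      using measure_vimage H.src_image fp H.pseudogroup_iff by blast
    finally show ?thesis .
  qed
  have "(\<Sum>B\<in>\<P>. \<bar>freq d z (?a B) - measure \<mu> (?a B)\<bar>) \<le> u"
    using G.freq_error[OF \<R>(1) P'(1), of ?a] \<R>(2)[OF f] aS err by (meson order_trans)
  moreover have "(\<Sum>B\<in>\<P>. freq d z (?a B)) - (\<Sum>B\<in>\<P>. measure \<mu> (?a B)) \<le>
      (\<Sum>B\<in>\<P>. \<bar>freq d z (?a B) - measure \<mu> (?a B)\<bar>)"
    unfolding sum_subtractf[symmetric] by (intro sum_mono) simp
  ultimately have V: "(\<Sum>B\<in>\<P>. freq d z (?a B)) \<le> measure \<nu> (src H ` f) + u" using tot by linarith
  have gen: "A \<le> S + V - 2 * (T - j) \<Longrightarrow> S \<le> m + 3 * \<eta> \<Longrightarrow> j \<le> \<eta> \<Longrightarrow> V \<le> m + u \<Longrightarrow> m - q \<le> T \<Longrightarrow>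
      A \<le> 5 * \<eta> + u + 2 * q" for A S V T j m q :: real unfolding right_diff_distrib by linarith
  have "(\<Sum>B\<in>\<P>. measure \<mu> (?a B) - t) \<le> (\<Sum>B\<in>\<P>. freq d x (W B))" by (intro sum_mono low)
  then have T: "measure \<nu> (src H ` f) - real (card \<P>) * t \<le> (\<Sum>B\<in>\<P>. freq d x (W B))"
    unfolding sum_subtractf tot by simp
  let ?U = "\<lambda>B. {i \<in> {1..d}. z i \<in> B}" and ?V = "\<lambda>B. {i \<in> {1..d}. z i \<in> ?a B}"
    and ?T = "\<lambda>B. {i \<in> {1..d}. x i \<in> W B}"
  have "(\<Sum>B\<in>\<P>. real (card (sym_diff (fin_image s (?U B)) (?V B)))) \<le>
      real (card (snd ` s)) + (\<Sum>B\<in>\<P>. real (card (?V B))) - 2 * ((\<Sum>B\<in>\<P>. real (card (?T B))) - real (card J))"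
  proof (rule matching_count[OF s P'(1) finite_subset[OF J(1)]])
    show "?U B \<inter> ?U B' = {}" if "B \<in> \<P>" "B' \<in> \<P>" "B \<noteq> B'" for B B' using P'(5)[OF that] by blast
    show "?T B \<inter> ?T B' = {}" if "B \<in> \<P>" "B' \<in> \<P>" "B \<noteq> B'" for B B' using disj[OF that] by blast
    show "n \<in> ?U B \<and> (\<exists>k\<in>?V B. (k, n) \<in> s)" if "B \<in> \<P>" "n \<in> ?T B - J" for B n
      using good[OF that(1), of n] that(2) by blast
  qed auto
  from divide_right_mono[OF this, of "real d"]
  have 1: "(\<Sum>B\<in>\<P>. fin_size d (sym_diff (fin_image s (?U B)) (?V B))) \<le>
      fin_size d (snd ` s) + (\<Sum>B\<in>\<P>. freq d z (?a B)) - 2 * ((\<Sum>B\<in>\<P>. freq d x (W B)) - fin_size d J)"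
    unfolding freq_def fin_size_def sum_divide_distrib[symmetric]
    by (simp add: add_divide_distrib diff_divide_distrib)
  have 2: "fin_size d (snd ` s) \<le> measure \<nu> (src H ` f) + 3 * \<eta>"
    using dom d by (simp add: fin_size_def field_simps)
  have 3: "fin_size d J \<le> \<eta>" using J(2) d by (simp add: fin_size_def field_simps)
  show ?thesis by (rule gen[OF 1 2 3 V T])
qed

text \<open>Put y = f . x_i and k = \<sigma> f i. Then e . y = (e f) . x_i is close to x at \<sigma>
  (e f) i, which up to the multiplicativity error is \<sigma> e k, and x there is close to e . x_k.
  This is why the products e f must be among the elements tested by the orbit condition.\<close>

lemma translate_close:
  assumes E: "finite E" "E \<subseteq> top_full_group H" and r: "0 < r" and diam: "0 < diam" and \<eta>: "0 < \<eta>"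
  obtains \<delta>' \<delta>m where "0 < \<delta>'" "0 < \<delta>m"
    "\<And>d \<sigma> f x. 0 < d \<Longrightarrow> f \<in> pseudogroup H H.M \<Longrightarrow> x \<in> {1..d} \<rightarrow>\<^sub>E units G \<Longrightarrow>
      \<forall>e\<in>E. set_mult H e f \<in> pseudogroup H H.M \<Longrightarrow>
      \<forall>g\<in>insert f (E \<union> (\<lambda>e. set_mult H e f) ` E). \<sigma> g \<in> fin_pseudogroup d \<and>
        rho2 \<rho>e d (\<lambda>i. ac g (x i)) (\<lambda>i. map_option x (fin_apply (\<sigma> g) i)) < \<delta>' \<Longrightarrow>
      \<forall>e\<in>E. fin_size d (sym_diff (\<sigma> (set_mult H e f)) (set_mult (full_groupoid d) (\<sigma> e) (\<sigma> f))) < \<delta>m \<Longrightarrow>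
      \<exists>J\<subseteq>{1..d}. real (card J) \<le> \<eta> * real d \<and> (\<forall>i\<in>{1..d} - J.
        (ac f (x i) = None \<longleftrightarrow> fin_apply (\<sigma> f) i = None) \<and>
        (\<forall>y k. ac f (x i) = Some y \<longrightarrow> fin_apply (\<sigma> f) i = Some k \<longrightarrow>
          (\<forall>e\<in>E. \<rho> (app e y) (app e (x k)) \<le> r)))"
proof -
  \<comment> \<open>Two comparisons cost 2 t <= r; t < diam ensures that at a good index both sides
    are defined or neither is.\<close>
  define t where "t = min (r / 2) (diam / 2)"
  have t: "0 < t" "t < diam" "2 * t \<le> r" unfolding t_def using r diam by auto
  define c where "c = real (card E) + 1"
  have c: "0 < c" "real (card E) \<le> c" by (simp_all add: c_def)
  \<comment> \<open>One exceptional set for f and three for each e in E make 1 + 3 card E <= 4 c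
    sets of proportion b.\<close>
  define b where "b = \<eta> / (4 * c)"
  have b: "0 < b" unfolding b_def using \<eta> c by simp
  define \<delta>' where "\<delta>' = t * sqrt b"
  have \<delta>': "0 < \<delta>'" "\<delta>'\<^sup>2 / t\<^sup>2 = b" unfolding \<delta>'_def using t b by (simp_all add: power_mult_distrib)
  show ?thesis
  proof (rule that[OF \<delta>'(1) b])
    fix d \<sigma> f x
    assume d: "0 < d" and f: "f \<in> pseudogroup H H.M" and x: "x \<in> {1..d} \<rightarrow>\<^sub>E units G"
      and ef: "\<forall>e\<in>E. set_mult H e f \<in> pseudogroup H H.M"
      and orb: "\<forall>g\<in>insert f (E \<union> (\<lambda>e. set_mult H e f) ` E). \<sigma> g \<in> fin_pseudogroup d \<and>
        rho2 \<rho>e d (\<lambda>i. ac g (x i)) (\<lambda>i. map_option x (fin_apply (\<sigma> g) i)) < \<delta>'"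
      and mult: "\<forall>e\<in>E. fin_size d (sym_diff (\<sigma> (set_mult H e f)) (set_mult (full_groupoid d) (\<sigma> e) (\<sigma> f))) < b"
    have sf: "\<sigma> f \<in> fin_pseudogroup d" and se: "\<And>e. e \<in> E \<Longrightarrow> \<sigma> e \<in> fin_pseudogroup d"
      and sef: "\<And>e. e \<in> E \<Longrightarrow> \<sigma> (set_mult H e f) \<in> fin_pseudogroup d" using orb by auto
    have ep: "\<And>e. e \<in> E \<Longrightarrow> e \<in> pseudogroup H H.M" using E(2) top_full_group_pseudogroup by blast
    have xu: "x i \<in> units G" if "i \<in> {1..d}" for i using x that by blast
    define N where "N g = {i \<in> {1..d}. t < orb_dist g x (\<sigma> g) i}" for g
    have N: "real (card (N g)) \<le> b * real d"
      if g: "g \<in> insert f (E \<union> (\<lambda>e. set_mult H e f) ` E)" "g \<in> pseudogroup H H.M" for g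
    proof -
      have "sqrt ((\<Sum>i\<in>{1..d}. (orb_dist g x (\<sigma> g) i)\<^sup>2) / real d) \<le> \<delta>'"
        using orb g(1) unfolding rho2_def by (force intro: less_imp_le)
      from markov_count[OF d t(1) _ this]
      show ?thesis unfolding \<delta>'(2) N_def using orb g orb_dist_bounds[OF g(2) x] by blast
    qed
    \<comment> \<open>Exceptions of e occurring at \<sigma> f i, pulled back to i by a partial
      injection.\<close>
    define N3 where "N3 e = {i. \<exists>k\<in>N e. (k, i) \<in> \<sigma> f}" for e
    have N3: "N3 e \<subseteq> {1..d}" "card (N3 e) \<le> card (N e)" for e
    proof -
      show "N3 e \<subseteq> {1..d}" unfolding N3_def using fin_pseudogroupD(1)[OF sf] by blast
      have "N3 e \<subseteq> snd ` \<sigma> f" unfolding N3_def by force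
      then have "card (N3 e) = card (fin_image (\<sigma> f) (N3 e))" using card_injective_relation[OF sf] by simp
      also have "\<dots> \<le> card (N e)"
        using fin_pseudogroupD(2)[OF sf] by (intro card_mono) (auto simp: N_def N3_def fin_image_def)
      finally show "card (N3 e) \<le> card (N e)" .
    qed
    define D where "D e = sym_diff (\<sigma> (set_mult H e f)) (\<sigma> e O \<sigma> f)" for e
    define N4 where "N4 e = snd ` D e" for e
    have D: "D e \<subseteq> {1..d} \<times> {1..d}" if "e \<in> E" for e
      unfolding D_def using fin_pseudogroupD(1)[OF sf] fin_pseudogroupD(1)[OF se[OF that]]
        fin_pseudogroupD(1)[OF sef[OF that]] by blast
    have N4: "N4 e \<subseteq> {1..d}" "real (card (N4 e)) \<le> b * real d" if e: "e \<in> E" for e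
    proof -
      show "N4 e \<subseteq> {1..d}" unfolding N4_def using D[OF e] by auto
      have "card (N4 e) \<le> card (D e)"
        unfolding N4_def using finite_subset[OF D[OF e]] by (intro card_image_le) simp
      moreover have "real (card (D e)) < b * real d"
        using bspec[OF mult e] d
        unfolding D_def fin_size_def set_mult_full_groupoid[OF fin_pseudogroupD(1)[OF se[OF e]] fin_pseudogroupD(1)[OF sf]]
        by (simp add: field_simps)
      ultimately show "real (card (N4 e)) \<le> b * real d" by linarith
    qed
    define J where "J = N f \<union> (\<Union>e\<in>E. N (set_mult H e f) \<union> N3 e \<union> N4 e)"
    have J1: "J \<subseteq> {1..d}" unfolding J_def using N3(1) N4(1) by (auto simp: N_def)
    have "card J \<le> card (N f) + card (\<Union>e\<in>E. N (set_mult H e f) \<union> N3 e \<union> N4 e)"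
      unfolding J_def by (rule card_Un_le)
    also have "\<dots> \<le> card (N f) + (\<Sum>e\<in>E. card (N (set_mult H e f) \<union> N3 e \<union> N4 e))"
      using card_UN_le[OF E(1)] by simp
    also have "\<dots> \<le> card (N f) + (\<Sum>e\<in>E. card (N (set_mult H e f)) + card (N3 e) + card (N4 e))"
      by (intro add_left_mono sum_mono order_trans[OF card_Un_le add_right_mono[OF card_Un_le]])
    finally have "real (card J) \<le> real (card (N f) + (\<Sum>e\<in>E. card (N (set_mult H e f)) + card (N3 e) + card (N4 e)))"
      by (rule of_nat_mono)
    also have "\<dots> = real (card (N f)) + (\<Sum>e\<in>E. real (card (N (set_mult H e f))) + real (card (N3 e)) + real (card (N4 e)))"
      by simp
    also have "\<dots> \<le> b * real d + (\<Sum>e\<in>E. 3 * (b * real d))"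
    proof (intro add_mono sum_mono)
      show "real (card (N f)) \<le> b * real d" using N[of f] f by simp
      fix e assume e: "e \<in> E"
      have "real (card (N (set_mult H e f))) \<le> b * real d" using N[of "set_mult H e f"] e ef by simp
      moreover have "real (card (N e)) \<le> b * real d" using N[of e] e ep by simp
      ultimately show "real (card (N (set_mult H e f))) + real (card (N3 e)) + real (card (N4 e)) \<le> 3 * (b * real d)"
        using N3(2)[of e] N4(2)[OF e] by linarith
    qed
    also have "\<dots> = (1 + 3 * real (card E)) * (b * real d)" by (simp add: algebra_simps)
    also have "\<dots> \<le> (4 * c) * (b * real d)" using b by (intro mult_right_mono) (auto simp: c_def)
    also have "\<dots> = \<eta> * real d" unfolding b_def using c by simp
    finally have J2: "real (card J) \<le> \<eta> * real d" .
    have "(ac f (x i) = None \<longleftrightarrow> fin_apply (\<sigma> f) i = None) \<and>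
        (\<forall>y k. ac f (x i) = Some y \<longrightarrow> fin_apply (\<sigma> f) i = Some k \<longrightarrow>
          (\<forall>e\<in>E. \<rho> (app e y) (app e (x k)) \<le> r))" if i: "i \<in> {1..d} - J" for i
    proof (intro conjI allI impI ballI)
      have fi: "orb_dist f x (\<sigma> f) i \<le> t" using i unfolding J_def N_def by auto
      show "ac f (x i) = None \<longleftrightarrow> fin_apply (\<sigma> f) i = None"
        using fi t(2) by (cases "ac f (x i)"; cases "fin_apply (\<sigma> f) i") auto
      fix y k e assume y: "ac f (x i) = Some y" and k: "fin_apply (\<sigma> f) i = Some k" and e: "e \<in> E"
      have eF: "e \<in> top_full_group H" using E(2) e by blast
      have id: "i \<in> {1..d}" using i by blast
      have ki: "(k, i) \<in> \<sigma> f" using k fin_apply_Some[OF sf] by blast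
      then have kd: "k \<in> {1..d}" using fin_pseudogroupD(1)[OF sf] by blast
      have yu: "y \<in> units G" using act_unit[OF f xu[OF id] y] .
      have "i \<notin> N3 e" using i e unfolding J_def by blast
      then have "k \<notin> N e" unfolding N3_def using ki by blast
      then have ek: "orb_dist e x (\<sigma> e) k \<le> t" using kd unfolding N_def by auto
      have ak: "ac e (x k) = Some (app e (x k))" by (rule act_full[OF eF xu[OF kd]])
      then obtain l where l: "fin_apply (\<sigma> e) k = Some l"
        using ek t(2) by (cases "fin_apply (\<sigma> e) k") auto
      have lk: "(l, k) \<in> \<sigma> e" using l fin_apply_Some[OF se[OF e]] by blast
      then have ld: "l \<in> {1..d}" using fin_pseudogroupD(1)[OF se[OF e]] by blast
      have 1: "\<rho> (app e (x k)) (x l) \<le> t" using ek ak l by simp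
      have "(l, i) \<in> \<sigma> e O \<sigma> f" using lk ki by blast
      moreover have "(l, i) \<notin> D e"
      proof
        assume "(l, i) \<in> D e"
        then have "i \<in> N4 e" unfolding N4_def by force
        then show False using i e unfolding J_def by blast
      qed
      ultimately have "(l, i) \<in> \<sigma> (set_mult H e f)" unfolding D_def by blast
      then have li: "fin_apply (\<sigma> (set_mult H e f)) i = Some l" using fin_apply_Some[OF sef[OF e]] by blast
      have "ac (set_mult H e f) (x i) = Some (app e y)"
        using act_set_mult[OF ep[OF e] f bspec[OF ef e] xu[OF id]] y act_full[OF eF yu] by simp
      moreover have "orb_dist (set_mult H e f) x (\<sigma> (set_mult H e f)) i \<le> t"
        using i e unfolding J_def N_def by auto
      ultimately have 2: "\<rho> (app e y) (x l) \<le> t" using li by simp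
      have u: "app e y \<in> units G" "app e (x k) \<in> units G" "x l \<in> units G"
        using app_unit[OF eF] yu xu kd ld by auto
      show "\<rho> (app e y) (app e (x k)) \<le> r"
        using rho_triangle[OF u(1,3,2)] rho_sym[OF u(3,2)] 1 2 t(3) by linarith
    qed
    then show "\<exists>J\<subseteq>{1..d}. real (card J) \<le> \<eta> * real d \<and> (\<forall>i\<in>{1..d} - J.
        (ac f (x i) = None \<longleftrightarrow> fin_apply (\<sigma> f) i = None) \<and>
        (\<forall>y k. ac f (x i) = Some y \<longrightarrow> fin_apply (\<sigma> f) i = Some k \<longrightarrow>
          (\<forall>e\<in>E. \<rho> (app e y) (app e (x k)) \<le> r)))"
      using J1 J2 by blast
  qed
qed

end

lemma sep_number_mono:
  assumes "\<And>x y. x \<in> X \<Longrightarrow> y \<in> X \<Longrightarrow> D x y \<le> D' x y"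
  shows "sep_number \<epsilon> D X \<le> sep_number \<epsilon> D' X"
  unfolding sep_number_def
proof (rule SUP_subset_mono)
  show "{S. finite S \<and> S \<subseteq> X \<and> (\<forall>x\<in>S. \<forall>y\<in>S. x \<noteq> y \<longrightarrow> \<epsilon> < D x y)} \<subseteq>
      {S. finite S \<and> S \<subseteq> X \<and> (\<forall>x\<in>S. \<forall>y\<in>S. x \<noteq> y \<longrightarrow> \<epsilon> < D' x y)}"
    using assms by (intro Collect_mono) (meson less_le_trans subsetD)
qed simp

text \<open>The image changes only at first components of pairs in the symmetric difference, at most
  one for each pair.\<close>

lemma fin_image_perturb:
  assumes "s \<in> fin_pseudogroup d" "s' \<in> fin_pseudogroup d" "finite Y"
  shows "fin_size d (sym_diff (fin_image s X) Y) \<le>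
    fin_size d (sym_diff (fin_image s' X) Y) + fin_size d (sym_diff s s')"
proof -
  have fin: "finite (sym_diff s s')"
    using finite_fin_pseudogroup_mem[OF assms(1)] finite_fin_pseudogroup_mem[OF assms(2)] by simp
  have "finite (fin_image s' X)" using finite_subset[OF fin_image_subset[OF assms(2)]] by blast
  then have f2: "finite (sym_diff (fin_image s' X) Y)" using assms(3) by simp
  have "sym_diff (fin_image s X) Y \<subseteq> sym_diff (fin_image s' X) Y \<union> fst ` sym_diff s s'"
    unfolding fin_image_def by force
  then have "card (sym_diff (fin_image s X) Y) \<le> card (sym_diff (fin_image s' X) Y \<union> fst ` sym_diff s s')"
    using f2 fin by (intro card_mono) auto
  also have "\<dots> \<le> card (sym_diff (fin_image s' X) Y) + card (fst ` sym_diff s s')" by (rule card_Un_le)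
  also have "card (fst ` sym_diff s s') \<le> card (sym_diff s s')" by (rule card_image_le[OF fin])
  finally have "real (card (sym_diff (fin_image s X) Y)) \<le>
      real (card (sym_diff (fin_image s' X) Y)) + real (card (sym_diff s s'))" by linarith
  from divide_right_mono[OF this, of "real d"] show ?thesis
    unfolding fin_size_def by (simp add: add_divide_distrib)
qed

context entropy_setting
begin

lemma eventually_continuous:
  assumes ac: "asymptotically_continuous H H.M \<nu> A" and F: "finite F" "F \<subseteq> pseudogroup H H.M" and \<eta>: "0 < \<eta>"
  shows "eventually (\<lambda>j. AE \<sigma> in law A j. \<forall>f\<in>F. \<forall>g\<in>F.
    ennreal (fin_size (degree A j) (sym_diff (\<sigma> f) (\<sigma> g))) < ennreal \<eta> + source_mass H \<nu> (sym_diff f g)) net"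
  unfolding eventually_net_filter[OF directed]
  using ac[unfolded asymptotically_continuous_def, rule_format, OF F \<eta>] .

text \<open>A tuple of points is turned into a homomorphism by moving every point close to a large compact
  subset of an atom into that atom.\<close>

lemma sep_number_le_Hom_count:
  assumes reg: "regular_measure H \<nu>" and ac: "asymptotically_continuous H H.M \<nu> A"
    and diam: "0 < diam" and \<epsilon>: "0 < \<epsilon>"
  obtains \<Q> where "finite_borel_partition G \<mu> \<Q>"
    "\<And>\<P> F \<delta>. finite_borel_partition G \<mu> \<P> \<Longrightarrow> refines (units G) \<P> \<Q> \<Longrightarrow> finite F \<Longrightarrow>
      F \<subseteq> pseudogroup H H.M \<Longrightarrow> units H \<in> F \<Longrightarrow> 0 < \<delta> \<Longrightarrow>
      \<exists>\<delta>' F' K. 0 < \<delta>' \<and> finite F' \<and> F' \<subseteq> top_pseudogroup H \<nu> \<and> finite K \<and>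
        (\<forall>k\<in>K. continuous_map G.X euclideanreal k) \<and>
        eventually (\<lambda>j. j \<in> idx A \<longrightarrow> (AE \<sigma> in law A j.
          sep_number \<epsilon> (rho_inf \<rho> (degree A j)) (Orb G \<mu> H \<pi> \<rho> F' K \<delta>' (degree A j) \<sigma>) \<le>
          of_nat (Hom_count G \<mu> H \<pi> \<Q> \<P> F \<delta> (degree A j) \<sigma>))) net"
proof -
  obtain N where N: "finite N" "\<And>n. n \<in> N \<Longrightarrow> openin G.X n" "\<Union>N = units G"
    "\<And>n x y. n \<in> N \<Longrightarrow> x \<in> n \<Longrightarrow> y \<in> n \<Longrightarrow> \<rho> x y < \<epsilon>"
    using G.pseudometric_cover[OF pseudometric \<epsilon>] by metis
  \<comment> \<open>Each atom of \<Q> lies in a member of a cover by \<rho>-small sets, so equal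
    labels will force distance below \<epsilon> at every single index, as \<open>rho_inf\<close>
    demands.\<close>
  define \<Q> where "\<Q> = atoms_of (units G) N"
  have Q: "finite_borel_partition G \<mu> \<Q>"
    unfolding \<Q>_def using N(2) G.open_sets by (intro G.finite_borel_atoms N(1)) auto
  note Q' = G.fbpD[OF Q]
  have "\<exists>n\<in>N. B \<subseteq> n" if B: "B \<in> \<Q>" for B
  proof -
    obtain y where y: "y \<in> B" using Q'(7)[OF B] by blast
    then obtain n where n: "n \<in> N" "y \<in> n" using Q'(4)[OF B] N(3) by blast
    then show ?thesis using atoms_of_decide[of B "units G" N n] B y unfolding \<Q>_def by blast
  qed
  then obtain nn where nn: "\<And>B. B \<in> \<Q> \<Longrightarrow> nn B \<in> N" "\<And>B. B \<in> \<Q> \<Longrightarrow> B \<subseteq> nn B" by metis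
  show ?thesis
  proof (rule that[OF Q])
    fix \<P> F and \<delta> :: real
    assume P: "finite_borel_partition G \<mu> \<P>" and ref: "refines (units G) \<P> \<Q>" and F: "finite F"
      "F \<subseteq> pseudogroup H H.M" "units H \<in> F" and \<delta>: "0 < \<delta>"
    note P' = G.fbpD[OF P]
    define \<R> where "\<R> = partition_power G H \<pi> \<P> F"
    note \<R> = partition_power[OF P F, folded \<R>_def]
    note R' = G.fbpD[OF \<R>(1)]
    have Fp: "f \<in> pseudogroup H H.M" if "f \<in> F" for f using F(2) that by blast
    define M where "M = real (card \<R>) + 1"
    define p' where "p' = real (card \<P>) + 1"
    \<comment> \<open>All errors below add up to at most 21 M p' \<eta>; the factor 30 makes the
      final bound strict.\<close>
    define \<eta> where "\<eta> = \<delta> / (30 * (M * p'))"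
    have M: "1 \<le> M" and p': "1 \<le> p'" by (simp_all add: M_def p'_def)
    then have Mp: "1 \<le> M * p'" by (metis mult_mono' mult_1 zero_le_one)
    have \<eta>: "0 < \<eta>" unfolding \<eta>_def using \<delta> Mp by simp
    have \<eta>\<delta>: "30 * (M * p') * \<eta> = \<delta>" unfolding \<eta>_def using M p' by simp
    have "\<exists>q\<in>\<Q>. B \<subseteq> q" if B: "B \<in> \<R>" for B
    proof -
      obtain D where "D \<in> \<P>" "B \<subseteq> D" using \<R>(4) B unfolding refines_def by blast
      moreover from this obtain q where "q \<in> \<Q>" "D \<subseteq> q" using ref unfolding refines_def by blast
      ultimately show ?thesis by blast
    qed
    then obtain qq where qq: "\<And>B. B \<in> \<R> \<Longrightarrow> qq B \<in> \<Q>" "\<And>B. B \<in> \<R> \<Longrightarrow> B \<subseteq> qq B" by metis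
    have "\<exists>C. closedin G.X C \<and> C \<subseteq> B \<and> measure \<mu> (B - C) < \<eta>" if "B \<in> \<R>" for B
      using G.inner_closed[OF R'(3)[OF that] \<eta>] by metis
    then obtain C where C: "\<And>B. B \<in> \<R> \<Longrightarrow> closedin G.X (C B)" "\<And>B. B \<in> \<R> \<Longrightarrow> C B \<subseteq> B"
      "\<And>B. B \<in> \<R> \<Longrightarrow> measure \<mu> (B - C B) < \<eta>" by metis
    have Csets: "C B \<in> sets \<mu>" if "B \<in> \<R>" for B by (rule G.closed_sets[OF C(1)[OF that]])
    have Cn: "C B \<subseteq> nn (qq B)" if "B \<in> \<R>" for B using C(2)[OF that] qq[OF that] nn(2) by blast
    have no: "openin G.X (nn (qq B))" if "B \<in> \<R>" for B using qq(1)[OF that] nn(1) N(2) by blast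
    have Cd: "C B \<inter> C B' = {}" if "B \<in> \<R>" "B' \<in> \<R>" "B \<noteq> B'" for B B'
      using C(2) R'(5) that by blast
    \<comment> \<open>Keeping \<open>U B\<close> inside the cover member chosen for the \<Q>-atom of
      B guarantees that moving a point of \<open>U B\<close> into B does not leave that
      member.\<close>
    have "\<exists>U W. \<forall>B\<in>\<R>. openin G.X (U B) \<and> U B \<subseteq> nn (qq B) \<and> openin G.X (W B) \<and> C B \<subseteq> W B \<and>
        G.X closure_of (W B) \<subseteq> U B \<and> (\<forall>B'\<in>\<R>. B \<noteq> B' \<longrightarrow> U B \<inter> U B' = {})"
    proof (rule G.disjoint_open_nhds[of \<R> C "\<lambda>B. nn (qq B)"])
      fix U W
      assume "\<And>B. B \<in> \<R> \<Longrightarrow> openin G.X (U B)" "\<And>B. B \<in> \<R> \<Longrightarrow> U B \<subseteq> nn (qq B)"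
        "\<And>B. B \<in> \<R> \<Longrightarrow> openin G.X (W B)" "\<And>B. B \<in> \<R> \<Longrightarrow> C B \<subseteq> W B"
        "\<And>B. B \<in> \<R> \<Longrightarrow> G.X closure_of (W B) \<subseteq> U B"
        "\<And>B B'. B \<in> \<R> \<Longrightarrow> B' \<in> \<R> \<Longrightarrow> B \<noteq> B' \<Longrightarrow> U B \<inter> U B' = {}"
      then show ?thesis by (intro exI[of _ U] exI[of _ W]) simp
    qed (fact R'(1) C(1) Cn no Cd)+
    then obtain U W where "\<forall>B\<in>\<R>. openin G.X (U B) \<and> U B \<subseteq> nn (qq B) \<and> openin G.X (W B) \<and> C B \<subseteq> W B \<and>
        G.X closure_of (W B) \<subseteq> U B \<and> (\<forall>B'\<in>\<R>. B \<noteq> B' \<longrightarrow> U B \<inter> U B' = {})" by (elim exE)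
    then have U: "\<And>B. B \<in> \<R> \<Longrightarrow> openin G.X (U B)" "\<And>B. B \<in> \<R> \<Longrightarrow> U B \<subseteq> nn (qq B)"
      and W: "\<And>B. B \<in> \<R> \<Longrightarrow> openin G.X (W B)" "\<And>B. B \<in> \<R> \<Longrightarrow> C B \<subseteq> W B"
        "\<And>B. B \<in> \<R> \<Longrightarrow> G.X closure_of (W B) \<subseteq> U B"
      and Ud: "\<And>B B'. B \<in> \<R> \<Longrightarrow> B' \<in> \<R> \<Longrightarrow> B \<noteq> B' \<Longrightarrow> U B \<inter> U B' = {}"
      by simp_all
    have WcW: "W B \<subseteq> G.X closure_of (W B)" if "B \<in> \<R>" for B
      using openin_subset[OF W(1)[OF that]] by (rule closure_of_subset)
    have WU: "W B \<subseteq> U B" if "B \<in> \<R>" for B using WcW[OF that] W(3)[OF that] by blast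
    define bb where "bb y = (SOME B. B \<in> \<R> \<and> y \<in> U B)" for y
    have bb: "bb y = B" if "B \<in> \<R>" "y \<in> U B" for y B
      unfolding bb_def
    proof (rule some_equality)
      show "B' = B" if "B' \<in> \<R> \<and> y \<in> U B'" for B' using Ud[of B' B] that \<open>B \<in> \<R>\<close> \<open>y \<in> U B\<close> by blast
    qed (use that in simp)
    \<comment> \<open>Points outside all \<open>U B\<close> stay where they are; for them membership
      in an atom of \<Q> gives membership in its cover member directly.\<close>
    define \<tau> where "\<tau> y = (if \<exists>B\<in>\<R>. y \<in> U B then SOME p. p \<in> bb y else y)" for y
    have \<tau>2: "\<tau> y \<in> B" if "B \<in> \<R>" "y \<in> U B" for y B
      using that bb[OF that] R'(7)[OF that(1)] some_in_eq[of B] unfolding \<tau>_def by auto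
    have \<tau>1: "\<tau> y \<in> units G" if "y \<in> units G" for y
    proof (cases "\<exists>B\<in>\<R>. y \<in> U B")
      case True
      then show ?thesis using \<tau>2 R'(4) by blast
    qed (use that in \<open>simp add: \<tau>_def\<close>)
    have \<tau>3: "y \<in> nn q" if q: "q \<in> \<Q>" "\<tau> y \<in> q" for y q
    proof (cases "\<exists>B\<in>\<R>. y \<in> U B")
      case True
      then obtain B where B: "B \<in> \<R>" "y \<in> U B" by blast
      then have "\<tau> y \<in> qq B" using \<tau>2 qq(2) by blast
      then have "q = qq B" using Q'(5)[OF q(1) qq(1)[OF B(1)]] q(2) by blast
      then show ?thesis using U(2)[OF B(1)] B(2) by blast
    next
      case False
      then have "\<tau> y = y" by (simp add: \<tau>_def)
      then show ?thesis using q nn(2) by auto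
    qed
    define ok where "ok f t \<longleftrightarrow> (case t of (C, U, V) \<Rightarrow> C \<in> sets H.M \<and> C \<subseteq> f \<and> bisection H U \<and> C \<subseteq> U \<and>
      openin H.X V \<and> src H ` C \<subseteq> V \<and> H.X closure_of V \<subseteq> src H ` U \<and>
      measure \<nu> (H.X closure_of V - V) = 0 \<and>
      measure \<nu> (H.X closure_of V) < measure \<nu> (src H ` f) + \<eta> \<and> measure \<nu> (src H ` (f - C)) < \<eta> \<and>
      source_mass H \<nu> (sym_diff f {u \<in> U. src H u \<in> V}) \<le> ennreal (3 * \<eta>))" for f t
    have "\<exists>t. ok f t" if f: "f \<in> F" for f
    proof (rule H.top_pseudogroup_dense[OF reg Fp[OF f] \<eta>])
      fix C U V
      assume "C \<in> sets H.M" "C \<subseteq> f" "bisection H U" "C \<subseteq> U" "openin H.X V" "src H ` C \<subseteq> V"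
        "H.X closure_of V \<subseteq> src H ` U" "measure \<nu> (H.X closure_of V - V) = 0"
        "measure \<nu> (H.X closure_of V) < measure \<nu> (src H ` f) + \<eta>" "measure \<nu> (src H ` (f - C)) < \<eta>"
        "source_mass H \<nu> (sym_diff f {u \<in> U. src H u \<in> V}) \<le> ennreal (3 * \<eta>)"
      then show ?thesis unfolding ok_def by (intro exI[of _ "(C, U, V)"]) simp
    qed
    then have "\<forall>f\<in>F. \<exists>t. ok f t" by (rule ballI)
    from bchoice[OF this] obtain tt where tt: "\<forall>f\<in>F. ok f (tt f)" by (elim exE)
    define Cf where "Cf f = fst (tt f)" for f
    define Uf where "Uf f = fst (snd (tt f))" for f
    define Vf where "Vf f = snd (snd (tt f))" for f
    have Cf: "Cf f \<in> sets H.M" "Cf f \<subseteq> f" "bisection H (Uf f)" "Cf f \<subseteq> Uf f" "openin H.X (Vf f)"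
      "src H ` Cf f \<subseteq> Vf f" "H.X closure_of (Vf f) \<subseteq> src H ` Uf f"
      "measure \<nu> (H.X closure_of (Vf f) - Vf f) = 0"
      "measure \<nu> (H.X closure_of (Vf f)) < measure \<nu> (src H ` f) + \<eta>" "measure \<nu> (src H ` (f - Cf f)) < \<eta>"
      "source_mass H \<nu> (sym_diff f {u \<in> Uf f. src H u \<in> Vf f}) \<le> ennreal (3 * \<eta>)" if "f \<in> F" for f
      using bspec[OF tt that] unfolding ok_def Cf_def Uf_def Vf_def case_prod_unfold by simp_all
    \<comment> \<open>The replacement of f in the topological pseudogroup: the orbit condition can
      be imposed on it, but not on f.\<close>
    define g where "g f = {u \<in> Uf f. src H u \<in> Vf f}" for f
    have VcV: "Vf f \<subseteq> H.X closure_of (Vf f)" if "f \<in> F" for f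
      using openin_subset[OF Cf(5)[OF that]] by (rule closure_of_subset)
    have g_top: "g f \<in> top_pseudogroup H \<nu>" if "f \<in> F" for f
      unfolding g_def using Cf[OF that] by (intro H.top_pseudogroupI)
    have gp: "g f \<in> pseudogroup H H.M" if "f \<in> F" for f using g_top[OF that] H.top_pseudogroup_subset by blast
    have gsrc: "src H ` g f = Vf f" if "f \<in> F" for f
      unfolding g_def using VcV[OF that] Cf(7)[OF that] by auto
    have gbis: "bisection H (g f)" if "f \<in> F" for f
      unfolding g_def by (rule H.restrict_bisection[OF Cf(3,5)[OF that]])
    \<comment> \<open>Excludes that a point of the closed inner layer is E-close to a point outside
      the outer one. Thus, if \<open>g f\<close> carries x_i into \<open>W B\<close>, then at a good
      index x at \<sigma> (g f) i lies in \<open>U B\<close> and is moved into B.\<close>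
    define Bd where "Bd = (\<Union>B\<in>\<R>. (G.X closure_of (W B)) \<times> (units G - U B))"
    have "closedin (prod_topology G.X G.X) ((G.X closure_of (W B)) \<times> (units G - U B))" if "B \<in> \<R>" for B
      using closedin_diff[OF closedin_topspace U(1)[OF that]] by (simp add: closedin_prod_Times_iff)
    then have "closedin (prod_topology G.X G.X) Bd"
      unfolding Bd_def using R'(1) by (intro closedin_Union) auto
    then have W0: "openin (prod_topology G.X G.X) (units G \<times> units G - Bd)"
      using openin_diff[OF openin_topspace, of "prod_topology G.X G.X" Bd] by simp
    have diag: "(x, x) \<in> units G \<times> units G - Bd" if "x \<in> units G" for x
      using that W(3) unfolding Bd_def by blast
    obtain E r where E: "finite E" "E \<subseteq> top_full_group H" and r: "0 < r"
      and sepW: "\<And>x y. x \<in> units G \<Longrightarrow> y \<in> units G \<Longrightarrow> \<forall>e\<in>E. \<rho> (app e x) (app e y) \<le> r \<Longrightarrow>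
          (x, y) \<in> units G \<times> units G - Bd"
      using generating_separation[OF pseudometric generating W0 diag] by blast
    have eg: "set_mult H e (g f) \<in> top_pseudogroup H \<nu>" if f: "f \<in> F" and e: "e \<in> E" for f e
    proof -
      have eF: "e \<in> top_full_group H" using E(2) e by blast
      show ?thesis
        unfolding g_def H.set_mult_restrict
        using H.set_mult_bisection[OF eF Cf(3)[OF f]] Cf[OF f] by (intro H.top_pseudogroupI) simp_all
    qed
    obtain \<delta>1 \<delta>m where \<delta>1: "0 < \<delta>1" "0 < \<delta>m" and close: "\<And>d \<sigma> f x. 0 < d \<Longrightarrow> f \<in> pseudogroup H H.M \<Longrightarrow>
      x \<in> {1..d} \<rightarrow>\<^sub>E units G \<Longrightarrow> \<forall>e\<in>E. set_mult H e f \<in> pseudogroup H H.M \<Longrightarrow>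
      \<forall>g\<in>insert f (E \<union> (\<lambda>e. set_mult H e f) ` E). \<sigma> g \<in> fin_pseudogroup d \<and>
        rho2 \<rho>e d (\<lambda>i. ac g (x i)) (\<lambda>i. map_option x (fin_apply (\<sigma> g) i)) < \<delta>1 \<Longrightarrow>
      \<forall>e\<in>E. fin_size d (sym_diff (\<sigma> (set_mult H e f)) (set_mult (full_groupoid d) (\<sigma> e) (\<sigma> f))) < \<delta>m \<Longrightarrow>
      \<exists>J\<subseteq>{1..d}. real (card J) \<le> \<eta> * real d \<and> (\<forall>i\<in>{1..d} - J.
        (ac f (x i) = None \<longleftrightarrow> fin_apply (\<sigma> f) i = None) \<and>
        (\<forall>y k. ac f (x i) = Some y \<longrightarrow> fin_apply (\<sigma> f) i = Some k \<longrightarrow>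
          (\<forall>e\<in>E. \<rho> (app e y) (app e (x k)) \<le> r)))"
      by (rule translate_close[OF E r diam \<eta>]) blast
    define WW where "WW S = (\<Union>B\<in>{B \<in> \<R>. B \<subseteq> S}. W B)" for S
    \<comment> \<open>Points seen, through the open sets W, to lie in D and to be carried by
      \<open>g f\<close> into f . D. Being open, these sets have frequencies bounded below by test
      functions.\<close>
    define Op where "Op f D = WW D \<inter> act_vimage (g f) (WW (act_set G H \<pi> f D))" for f D
    have WWo: "openin G.X (WW S)" for S unfolding WW_def using W(1) by blast
    have Opo: "openin G.X (Op f D)" if "f \<in> F" for f D
      unfolding Op_def by (intro openin_Int WWo act_vimage_open[OF gbis[OF that]])
    \<comment> \<open>A lower bound for the frequency of this complement is the upper bound needed
      for the domain of \<sigma> (g f).\<close>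
    define Y where "Y f = units G - {x \<in> units G. \<pi> x \<in> H.X closure_of (Vf f)}" for f
    have clV_sets: "H.X closure_of (Vf f) \<in> sets \<nu>" for f by (intro H.closed_sets closedin_closure_of)
    have Yo: "openin G.X (Y f)" for f
    proof -
      have "openin H.X (units H - H.X closure_of (Vf f))"
        using openin_diff[OF openin_topspace[of H.X] closedin_closure_of[of H.X "Vf f"]] by simp
      then have "openin G.X {x \<in> units G. \<pi> x \<in> units H - H.X closure_of (Vf f)}" by (rule unit_vimage_open)
      moreover have "{x \<in> units G. \<pi> x \<in> units H - H.X closure_of (Vf f)} = Y f"
        unfolding Y_def using pi_unit by auto
      ultimately show ?thesis by simp
    qed
    define \<O> where "\<O> = W ` \<R> \<union> (\<lambda>(f, D). Op f D) ` (F \<times> \<P>) \<union> Y ` F"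
    have \<O>: "finite \<O>" "\<And>S. S \<in> \<O> \<Longrightarrow> openin G.X S"
      unfolding \<O>_def using R'(1) F(1) P'(1) W(1) Opo Yo by auto
    obtain K where K: "finite K" "\<forall>k\<in>K. continuous_map G.X euclideanreal k"
      and emp: "\<And>d x S. 0 < d \<Longrightarrow> x \<in> {1..d} \<rightarrow>\<^sub>E units G \<Longrightarrow>
        \<forall>k\<in>K. \<bar>(\<Sum>i\<in>{1..d}. k (x i)) / real d - (\<integral>y. k y \<partial>\<mu>)\<bar> < \<eta> / 2 \<Longrightarrow> S \<in> \<O> \<Longrightarrow>
        measure \<mu> S - \<eta> \<le> freq d x S"
      using G.empirical_lower_bound[OF \<O> \<eta>] by blast
    define \<delta>' where "\<delta>' = min \<delta>1 (\<eta> / 2)"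
    have \<delta>': "0 < \<delta>'" "\<delta>' \<le> \<delta>1" "\<delta>' \<le> \<eta> / 2" unfolding \<delta>'_def using \<delta>1(1) \<eta> by auto
    define F' where "F' = g ` F \<union> E \<union> (\<lambda>(f, e). set_mult H e (g f)) ` (F \<times> E)"
    have F': "finite F'" "F' \<subseteq> top_pseudogroup H \<nu>"
      unfolding F'_def using F(1) E g_top eg H.top_full_group_subset by auto
    have F'p: "F' \<subseteq> pseudogroup H H.M" using F'(2) H.top_pseudogroup_subset by blast
    define Rest where "Rest = (\<Union>B\<in>\<R>. B - C B)"
    have Rsets: "Rest \<in> sets \<mu>" unfolding Rest_def using R'(1,3) Csets by (intro sets.finite_UN sets.Diff) auto
    have "measure \<mu> Rest \<le> (\<Sum>B\<in>\<R>. measure \<mu> (B - C B))"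
      unfolding Rest_def using R'(1,3) Csets by (intro G.finite_measure_subadditive_finite) auto
    also have "\<dots> \<le> real (card \<R>) * \<eta>"
      using sum_bounded_above[of \<R> "\<lambda>B. measure \<mu> (B - C B)" \<eta>] less_imp_le[OF C(3)] by simp
    also have "\<dots> \<le> M * \<eta>" using \<eta> by (intro mult_right_mono) (auto simp: M_def)
    finally have Rest: "measure \<mu> Rest \<le> M * \<eta>" .
    \<comment> \<open>The loss is M \<eta> for x in \<open>Rest\<close>, M \<eta> for f . x in
      \<open>Rest\<close> and \<eta> for the part of f outside the piece \<open>Cf f\<close> shared
      with \<open>g f\<close>.\<close>
    have low: "measure \<mu> (act_set G H \<pi> f D) - (2 * M + 1) * \<eta> \<le> measure \<mu> (Op f D)"
      if f: "f \<in> F" and D: "D \<in> \<P>" for f D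
    proof -
      note fp = Fp[OF f]
      have fD: "f - Cf f \<in> pseudogroup H H.M"
        using H.pseudogroup_subset[OF fp] pseudogroupD(4)[OF fp] Cf(1)[OF f] by (metis Diff_subset sets.Diff)
      let ?X = "{x \<in> units G. \<pi> x \<in> src H ` (f - Cf f)}"
      have Xs: "?X \<in> sets \<mu>" by (rule dom_measurable[OF fD])
      have Xm: "measure \<mu> ?X < \<eta>"
        using measure_vimage[of "src H ` (f - Cf f)"] H.src_image fD H.pseudogroup_iff Cf(10)[OF f] by auto
      have Vs: "act_vimage f Rest \<in> sets \<mu>" "measure \<mu> (act_vimage f Rest) \<le> M * \<eta>"
        using act_vimage_measurable[OF fp Rsets] Rest by auto
      have cover: "{x \<in> D. \<pi> x \<in> src H ` f} \<subseteq> Op f D \<union> (Rest \<union> (?X \<union> act_vimage f Rest))"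
      proof
        fix x assume "x \<in> {x \<in> D. \<pi> x \<in> src H ` f}"
        then have x: "x \<in> D" "x \<in> units G" "\<pi> x \<in> src H ` f" using P'(4)[OF D] by auto
        show "x \<in> Op f D \<union> (Rest \<union> (?X \<union> act_vimage f Rest))"
        proof (rule ccontr)
          assume n: "\<not> ?thesis"
          have block: "\<exists>B\<in>\<R>. B \<subseteq> S \<and> y \<in> W B" if y: "y \<in> S" "y \<notin> Rest" and S: "S \<in> sigma_sets (units G) \<R>" for y S
          proof -
            have "y \<in> \<Union>{B \<in> \<R>. B \<subseteq> S}" using sigma_sets_partition[OF R'(2) S] y(1) by simp
            then obtain B where B: "B \<in> \<R>" "B \<subseteq> S" "y \<in> B" by blast
            then have "y \<in> C B" using y(2) unfolding Rest_def by blast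
            then show ?thesis using B W(2)[OF B(1)] by blast
          qed
          obtain y where y: "ac f x = Some y" using x(3) act_None[of f x] by auto
          obtain \<gamma> where \<gamma>: "\<gamma> \<in> arrows G" "\<pi> \<gamma> \<in> f" "src G \<gamma> = x" "rng G \<gamma> = y"
            using y act_Some[OF pseudogroupD(1,2)[OF fp] x(2)] by blast
          have sx: "src H (\<pi> \<gamma>) = \<pi> x" using src_pi[OF \<gamma>(1)] \<gamma>(3) by simp
          have "\<pi> x \<notin> src H ` (f - Cf f)" using n x(2) by blast
          then have "\<pi> \<gamma> \<in> Cf f" using \<gamma>(2) sx by (metis DiffI image_eqI)
          then have "\<pi> \<gamma> \<in> g f" unfolding g_def using Cf(4,6)[OF f] by blast
          then have gy: "ac (g f) x = Some y"
            using act_Some[OF pseudogroupD(1,2)[OF gp[OF f]] x(2)] \<gamma> by blast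
          have yA: "y \<in> act_set G H \<pi> f D" unfolding act_set_def using x(1) y by blast
          have "y \<notin> Rest" using n x(2) y unfolding act_vimage_def by blast
          then obtain B' where B': "B' \<in> \<R>" "B' \<subseteq> act_set G H \<pi> f D" "y \<in> W B'"
            using block[OF yA _ \<R>(2)[OF f D]] by blast
          obtain B where B: "B \<in> \<R>" "B \<subseteq> D" "x \<in> W B" using block[OF x(1) _ \<R>(3)[OF D]] n by blast
          have "x \<in> WW D" "y \<in> WW (act_set G H \<pi> f D)" unfolding WW_def using B B' by blast+
          then have "x \<in> Op f D" unfolding Op_def act_vimage_def using gy x(2) by blast
          then show False using n by blast
        qed
      qed
      have Os: "Op f D \<in> sets \<mu>" by (rule G.open_sets[OF Opo[OF f]])
      have "measure \<mu> (act_set G H \<pi> f D) = measure \<mu> {x \<in> D. \<pi> x \<in> src H ` f}"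
        by (rule act_set_measurable(2)[OF fp P'(3)[OF D]])
      also have "\<dots> \<le> measure \<mu> (Op f D \<union> (Rest \<union> (?X \<union> act_vimage f Rest)))"
        using cover Os Rsets Xs Vs(1) by (intro G.finite_measure_mono sets.Un) auto
      also have "\<dots> \<le> measure \<mu> (Op f D) + measure \<mu> (Rest \<union> (?X \<union> act_vimage f Rest))"
        using Os Rsets Xs Vs(1) by (intro measure_Un_le sets.Un)
      also have "measure \<mu> (Rest \<union> (?X \<union> act_vimage f Rest)) \<le> measure \<mu> Rest + measure \<mu> (?X \<union> act_vimage f Rest)"
        using Rsets Xs Vs(1) by (intro measure_Un_le sets.Un)
      also have "measure \<mu> (?X \<union> act_vimage f Rest) \<le> measure \<mu> ?X + measure \<mu> (act_vimage f Rest)"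
        using Xs Vs(1) by (intro measure_Un_le)
      finally have "measure \<mu> (act_set G H \<pi> f D) \<le> measure \<mu> (Op f D) + (M * \<eta> + (\<eta> + M * \<eta>))"
        using Rest Xm Vs(2) by linarith
      then show ?thesis by (simp add: algebra_simps)
    qed
    have tuple: "restrict (\<lambda>S. {i \<in> {1..d}. \<tau> (x i) \<in> S}) (sigma_sets (units G) \<R>) \<in> Hom_sets G \<mu> H \<pi> \<P> F \<delta> d \<sigma>"
      if d: "0 < d" and \<sigma>: "\<And>f. f \<in> pseudogroup H H.M \<Longrightarrow> \<sigma> f \<in> fin_pseudogroup d"
        and mult: "multiplicative H d (E \<union> g ` F) \<delta>m \<sigma>"
        and cont: "\<And>f. f \<in> F \<Longrightarrow> fin_size d (sym_diff (\<sigma> f) (\<sigma> (g f))) \<le> 4 * \<eta>"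
        and x: "x \<in> Orb G \<mu> H \<pi> \<rho> F' K \<delta>' d \<sigma>" for d \<sigma> x
    proof -
      have xE: "x \<in> {1..d} \<rightarrow>\<^sub>E units G"
        and xF: "\<And>f. f \<in> F' \<Longrightarrow> rho2 \<rho>e d (\<lambda>i. ac f (x i)) (\<lambda>i. map_option x (fin_apply (\<sigma> f) i)) < \<delta>'"
        and xK: "\<And>k. k \<in> K \<Longrightarrow> \<bar>(\<Sum>i\<in>{1..d}. k (x i)) / real d - (\<integral>y. k y \<partial>\<mu>)\<bar> < \<delta>'"
        using x unfolding Orb_def by auto
      have xu: "x i \<in> units G" if "i \<in> {1..d}" for i using xE that by blast
      have "\<forall>k\<in>K. \<bar>(\<Sum>i\<in>{1..d}. k (x i)) / real d - (\<integral>y. k y \<partial>\<mu>)\<bar> < \<eta> / 2"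
        using xK \<delta>'(3) by (meson less_le_trans)
      note fr = emp[OF d xE this]
      let ?z = "\<lambda>i. \<tau> (x i)"
      have zu: "?z i \<in> units G" if "i \<in> {1..d}" for i using \<tau>1 xu that by blast
      \<comment> \<open>One \<eta> for the passage from B to \<open>C B\<close>, one for the test
        functions.\<close>
      have "measure \<mu> B - 2 * \<eta> \<le> freq d ?z B" if B: "B \<in> \<R>" for B
      proof -
        have "measure \<mu> B - \<eta> \<le> measure \<mu> (C B)"
          using C(2,3)[OF B] G.finite_measure_Diff[OF R'(3)[OF B] Csets[OF B] C(2)[OF B]] by linarith
        also have "\<dots> \<le> measure \<mu> (W B)"
          using W(2)[OF B] G.open_sets[OF W(1)[OF B]] by (rule G.finite_measure_mono)
        also have "\<dots> \<le> freq d x (W B) + \<eta>" using fr[of "W B"] B unfolding \<O>_def by fastforce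
        also have "freq d x (W B) \<le> freq d ?z B"
          unfolding freq_def fin_size_def using \<tau>2[OF B] WU[OF B]
          by (intro divide_right_mono of_nat_mono card_mono) auto
        finally show ?thesis by simp
      qed
      moreover have "(\<Sum>B\<in>\<R>. freq d ?z B) = (\<Sum>B\<in>\<R>. measure \<mu> B)"
      proof -
        have "{i \<in> {1..d}. ?z i \<in> units G} = {1..d}" using zu by auto
        then have "freq d ?z (\<Union>B\<in>\<R>. B) = 1" using d R'(6) by (simp add: freq_def fin_size_def)
        moreover have "measure \<mu> (\<Union>B\<in>\<R>. B) = 1" using R'(6) G.prob_space G.space_mu by simp
        moreover have "freq d ?z (\<Union>B\<in>\<R>. B) = (\<Sum>B\<in>\<R>. freq d ?z B)"
          by (rule freq_UN[OF R'(1)]) (use R'(5) in blast)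
        moreover have "measure \<mu> (\<Union>B\<in>\<R>. B) = (\<Sum>B\<in>\<R>. measure \<mu> B)"
          by (rule G.measure_UN_disjoint[OF R'(1)]) (use R'(3,5) in blast)+
        ultimately show ?thesis by simp
      qed
      ultimately have "(\<Sum>B\<in>\<R>. \<bar>freq d ?z B - measure \<mu> B\<bar>) \<le> 2 * (2 * \<eta>) * real (card \<R>)"
        using \<eta> by (intro sum_abs_balanced) auto
      also have "\<dots> \<le> 4 * \<eta> * M" using \<eta> by (simp add: M_def)
      finally have err: "(\<Sum>B\<in>\<R>. \<bar>freq d ?z B - measure \<mu> B\<bar>) \<le> 4 * \<eta> * M" .
      have bound: "\<eta> \<le> \<eta> * (M * p')" "\<eta> * M \<le> \<eta> * (M * p')" "\<eta> * p' \<le> \<eta> * (M * p')"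
        using \<eta> Mp M p' by simp_all
      have act: "(\<Sum>D\<in>\<P>. fin_size d (sym_diff (fin_image (\<sigma> f) {i \<in> {1..d}. ?z i \<in> D})
          {i \<in> {1..d}. ?z i \<in> act_set G H \<pi> f D})) < \<delta>" if f: "f \<in> F" for f
      proof -
        let ?a = "act_set G H \<pi> f" and ?s = "\<sigma> (g f)"
        note sg = \<sigma>[OF gp[OF f]]
        have "\<exists>J\<subseteq>{1..d}. real (card J) \<le> \<eta> * real d \<and> (\<forall>i\<in>{1..d} - J.
          (ac (g f) (x i) = None \<longleftrightarrow> fin_apply ?s i = None) \<and>
          (\<forall>y k. ac (g f) (x i) = Some y \<longrightarrow> fin_apply ?s i = Some k \<longrightarrow>
            (\<forall>e\<in>E. \<rho> (app e y) (app e (x k)) \<le> r)))"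
        proof (rule close[OF d gp[OF f] xE])
          have sub: "insert (g f) (E \<union> (\<lambda>e. set_mult H e (g f)) ` E) \<subseteq> F'" unfolding F'_def using f by auto
          show "\<forall>e\<in>E. set_mult H e (g f) \<in> pseudogroup H H.M" using eg[OF f] H.top_pseudogroup_subset by blast
          show "\<forall>h\<in>insert (g f) (E \<union> (\<lambda>e. set_mult H e (g f)) ` E). \<sigma> h \<in> fin_pseudogroup d \<and>
            rho2 \<rho>e d (\<lambda>i. ac h (x i)) (\<lambda>i. map_option x (fin_apply (\<sigma> h) i)) < \<delta>1"
          proof
            fix h assume "h \<in> insert (g f) (E \<union> (\<lambda>e. set_mult H e (g f)) ` E)"
            then have h: "h \<in> F'" using sub by blast
            show "\<sigma> h \<in> fin_pseudogroup d \<and> rho2 \<rho>e d (\<lambda>i. ac h (x i)) (\<lambda>i. map_option x (fin_apply (\<sigma> h) i)) < \<delta>1"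
              using \<sigma>[of h] h F'p xF[OF h] \<delta>'(2) by auto
          qed
          show "\<forall>e\<in>E. fin_size d (sym_diff (\<sigma> (set_mult H e (g f))) (set_mult (full_groupoid d) (\<sigma> e) ?s)) < \<delta>m"
            using mult f unfolding multiplicative_def by blast
        qed
        then obtain J where J: "J \<subseteq> {1..d}" "real (card J) \<le> \<eta> * real d" and
          Jn: "\<And>i. i \<in> {1..d} - J \<Longrightarrow> ac (g f) (x i) = None \<longleftrightarrow> fin_apply ?s i = None" and
          Js: "\<And>i y k. i \<in> {1..d} - J \<Longrightarrow> ac (g f) (x i) = Some y \<Longrightarrow> fin_apply ?s i = Some k \<Longrightarrow>
            \<forall>e\<in>E. \<rho> (app e y) (app e (x k)) \<le> r" by metis
        have good: "?z i \<in> D \<and> (\<exists>k\<in>{1..d}. ?z k \<in> ?a D \<and> (k, i) \<in> ?s)"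
          if D: "D \<in> \<P>" and i: "i \<in> {1..d} - J" "x i \<in> Op f D" for D i
        proof
          have xi: "x i \<in> units G" using xu i(1) by blast
          obtain B where B: "B \<in> \<R>" "B \<subseteq> D" "x i \<in> W B" using i(2) unfolding Op_def WW_def by blast
          then show "?z i \<in> D" using \<tau>2[OF B(1)] WU[OF B(1)] by blast
          obtain y B' where y: "ac (g f) (x i) = Some y" and B': "B' \<in> \<R>" "B' \<subseteq> ?a D" "y \<in> W B'"
            using i(2) unfolding Op_def act_vimage_def WW_def by blast
          then obtain k where k: "fin_apply ?s i = Some k" using Jn[OF i(1)] by auto
          then have ki: "(k, i) \<in> ?s" using fin_apply_Some[OF sg] by blast
          then have kd: "k \<in> {1..d}" using fin_pseudogroupD(1)[OF sg] by blast
          have yu: "y \<in> units G" by (rule act_unit[OF gp[OF f] xi y])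
          have "(y, x k) \<notin> Bd" using sepW[OF yu xu[OF kd] Js[OF i(1) y k]] by blast
          then have "x k \<in> U B'" unfolding Bd_def using B' WcW[OF B'(1)] xu[OF kd] by blast
          then have "?z k \<in> ?a D" using \<tau>2[OF B'(1)] B'(2) by blast
          then show "\<exists>k\<in>{1..d}. ?z k \<in> ?a D \<and> (k, i) \<in> ?s" using kd ki by blast
        qed
        \<comment> \<open>The three \<eta> come from J, from the test function of \<open>Y f\<close>
          and from the excess of the closure of \<open>Vf f\<close> over the domain of f.\<close>
        have dom: "real (card (snd ` ?s)) \<le> (measure \<nu> (src H ` f) + 3 * \<eta>) * real d"
        proof -
          let ?V = "{x \<in> units G. \<pi> x \<in> H.X closure_of (Vf f)}"
          have "snd ` ?s \<subseteq> J \<union> {i \<in> {1..d}. x i \<in> ?V}"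
          proof
            fix i assume "i \<in> snd ` ?s"
            then obtain k where ki: "(k, i) \<in> ?s" by force
            then have id: "i \<in> {1..d}" using fin_pseudogroupD(1)[OF sg] by blast
            show "i \<in> J \<union> {i \<in> {1..d}. x i \<in> ?V}"
            proof (cases "i \<in> J")
              case False
              have "fin_apply ?s i = Some k" using ki fin_apply_Some[OF sg] by blast
              then have "ac (g f) (x i) \<noteq> None" using Jn[of i] False id by auto
              then have "\<pi> (x i) \<in> Vf f" using act_None[of "g f" "x i"] gsrc[OF f] by auto
              then show ?thesis using VcV[OF f] id xu[OF id] by auto
            qed simp
          qed
          then have "card (snd ` ?s) \<le> card (J \<union> {i \<in> {1..d}. x i \<in> ?V})"
            using finite_subset[OF J(1)] by (intro card_mono) auto
          then have "card (snd ` ?s) \<le> card J + card {i \<in> {1..d}. x i \<in> ?V}"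
            using card_Un_le order_trans by blast
          then have 1: "real (card (snd ` ?s)) \<le> real (card J) + real (card {i \<in> {1..d}. x i \<in> ?V})" by linarith
          have "freq d x ?V + freq d x (Y f) = freq d x (units G)"
          proof -
            have "freq d x (\<Union>b\<in>{True, False}. if b then ?V else Y f) = (\<Sum>b\<in>{True, False}. freq d x (if b then ?V else Y f))"
              by (rule freq_UN) (auto simp: Y_def)
            moreover have "(\<Union>b\<in>{True, False}. if b then ?V else Y f) = units G" by (auto simp: Y_def)
            ultimately show ?thesis by simp
          qed
          moreover have "freq d x (units G) = 1" by (rule freq_full[OF d xE])
          moreover have "measure \<mu> (Y f) - \<eta> \<le> freq d x (Y f)" using fr[of "Y f"] f unfolding \<O>_def by blast
          moreover have "measure \<mu> (Y f) = 1 - measure \<nu> (H.X closure_of (Vf f))"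
            unfolding Y_def using G.prob_compl[OF unit_vimage_measurable[OF clV_sets]] measure_vimage[OF clV_sets]
            by (simp add: G.space_mu)
          ultimately have "freq d x ?V \<le> measure \<nu> (src H ` f) + 2 * \<eta>" using Cf(9)[OF f] by linarith
          then have "real (card {i \<in> {1..d}. x i \<in> ?V}) \<le> (measure \<nu> (src H ` f) + 2 * \<eta>) * real d"
            using d by (simp add: freq_def fin_size_def field_simps)
          then show ?thesis using 1 J(2) by (simp add: algebra_simps)
        qed
        have disj: "Op f D \<inter> Op f D' = {}" if D: "D \<in> \<P>" "D' \<in> \<P>" "D \<noteq> D'" for D D'
        proof (rule ccontr)
          assume "Op f D \<inter> Op f D' \<noteq> {}"
          then obtain y B B' where y: "B \<in> \<R>" "B \<subseteq> D" "y \<in> W B" "B' \<in> \<R>" "B' \<subseteq> D'" "y \<in> W B'"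
            unfolding Op_def WW_def by blast
          then have "\<tau> y \<in> D" "\<tau> y \<in> D'" using \<tau>2 WU by blast+
          then show False using P'(5)[OF D] by blast
        qed
        have lowf: "measure \<mu> (?a D) - (2 * M + 2) * \<eta> \<le> freq d x (Op f D)" if D: "D \<in> \<P>" for D
        proof -
          have "Op f D \<in> \<O>" unfolding \<O>_def using f D by auto
          from fr[OF this] low[OF f D] show ?thesis by (simp add: algebra_simps)
        qed
        have 1: "(\<Sum>D\<in>\<P>. fin_size d (sym_diff (fin_image ?s {i \<in> {1..d}. ?z i \<in> D}) {i \<in> {1..d}. ?z i \<in> ?a D}))
            \<le> 5 * \<eta> + 4 * \<eta> * M + 2 * (real (card \<P>) * ((2 * M + 2) * \<eta>))"
          by (rule action_error[OF P F d f sg disj lowf J good dom err[unfolded \<R>_def]])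
        have "(\<Sum>D\<in>\<P>. fin_size d (sym_diff (fin_image (\<sigma> f) {i \<in> {1..d}. ?z i \<in> D}) {i \<in> {1..d}. ?z i \<in> ?a D}))
          \<le> (\<Sum>D\<in>\<P>. fin_size d (sym_diff (fin_image ?s {i \<in> {1..d}. ?z i \<in> D}) {i \<in> {1..d}. ?z i \<in> ?a D}) + 4 * \<eta>)"
        proof (rule sum_mono)
          fix D
          show "fin_size d (sym_diff (fin_image (\<sigma> f) {i \<in> {1..d}. ?z i \<in> D}) {i \<in> {1..d}. ?z i \<in> ?a D}) \<le>
            fin_size d (sym_diff (fin_image ?s {i \<in> {1..d}. ?z i \<in> D}) {i \<in> {1..d}. ?z i \<in> ?a D}) + 4 * \<eta>"
            using fin_image_perturb[OF \<sigma>[OF Fp[OF f]] sg, of "{i \<in> {1..d}. ?z i \<in> ?a D}" "{i \<in> {1..d}. ?z i \<in> D}"]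
              cont[OF f] by simp
        qed
        also have "\<dots> \<le> 5 * \<eta> + 4 * \<eta> * M + 2 * (real (card \<P>) * ((2 * M + 2) * \<eta>)) + real (card \<P>) * (4 * \<eta>)"
          using 1 by (simp add: sum.distrib)
        also have "\<dots> \<le> 5 * \<eta> + 4 * \<eta> * M + 2 * (p' * ((2 * M + 2) * \<eta>)) + p' * (4 * \<eta>)"
          using M \<eta> by (intro add_mono mult_left_mono mult_right_mono order_refl) (auto simp: p'_def)
        also have "\<dots> = 5 * \<eta> + 4 * (\<eta> * M) + 4 * (\<eta> * (M * p')) + 8 * (\<eta> * p')" by (simp add: algebra_simps)
        \<comment> \<open>The coefficients are 5 + 4 + 4 + 8, after enlarging each term to a
          multiple of \<eta> M p'.\<close>
        also have "\<dots> \<le> 21 * (\<eta> * (M * p'))" using bound by linarith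
        also have "\<dots> < 30 * (\<eta> * (M * p'))" using \<eta> Mp by simp
        also have "\<dots> = \<delta>" using \<eta>\<delta> by (simp add: algebra_simps)
        finally show ?thesis .
      qed
      have "0 < \<eta> * (M * p')" using \<eta> Mp by simp
      then have "4 * \<eta> * M < 30 * (\<eta> * (M * p'))" using bound(2) by linarith
      then have "(\<Sum>B\<in>\<R>. \<bar>freq d ?z B - measure \<mu> B\<bar>) < \<delta>" using err \<eta>\<delta> by (simp add: algebra_simps)
      then show ?thesis
        using Hom_of_tuple[OF P F, of d ?z \<sigma> \<delta>] zu act unfolding \<R>_def by blast
    qed
    have count: "sep_number \<epsilon> (rho_inf \<rho> d) (Orb G \<mu> H \<pi> \<rho> F' K \<delta>' d \<sigma>) \<le> of_nat (Hom_count G \<mu> H \<pi> \<Q> \<P> F \<delta> d \<sigma>)"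
      if d: "0 < d" and \<sigma>: "\<And>f. f \<in> pseudogroup H H.M \<Longrightarrow> \<sigma> f \<in> fin_pseudogroup d"
        and mult: "multiplicative H d (E \<union> g ` F) \<delta>m \<sigma>"
        and cont: "\<And>f. f \<in> F \<Longrightarrow> fin_size d (sym_diff (\<sigma> f) (\<sigma> (g f))) \<le> 4 * \<eta>" for d \<sigma>
      unfolding sep_number_def
    proof (rule SUP_least)
      fix S assume "S \<in> {S. finite S \<and> S \<subseteq> Orb G \<mu> H \<pi> \<rho> F' K \<delta>' d \<sigma> \<and>
          (\<forall>x\<in>S. \<forall>y\<in>S. x \<noteq> y \<longrightarrow> \<epsilon> < rho_inf \<rho> d x y)}"
      then have S: "finite S" "S \<subseteq> Orb G \<mu> H \<pi> \<rho> F' K \<delta>' d \<sigma>"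
        "\<And>x y. x \<in> S \<Longrightarrow> y \<in> S \<Longrightarrow> x \<noteq> y \<Longrightarrow> \<epsilon> < rho_inf \<rho> d x y" by blast+
      define \<phi> where "\<phi> x = restrict (\<lambda>S. {i \<in> {1..d}. \<tau> (x i) \<in> S}) (sigma_sets (units G) \<R>)" for x
      define \<psi> where "\<psi> x = restrict (\<phi> x) (sigma_sets (units G) \<Q>)" for x
      have QR: "q \<in> sigma_sets (units G) \<R>" if q: "q \<in> \<Q>" for q
      proof -
        have "q = \<Union>{B \<in> \<R>. B \<subseteq> q}"
        proof (intro equalityI subsetI)
          fix y assume y: "y \<in> q"
          then obtain B where B: "B \<in> \<R>" "y \<in> B" using Q'(4)[OF q] R'(6) by blast
          then have "qq B = q" using Q'(5)[OF qq(1)[OF B(1)] q] qq(2)[OF B(1)] y by blast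
          then show "y \<in> \<Union>{B \<in> \<R>. B \<subseteq> q}" using B qq(2)[OF B(1)] by blast
        qed blast
        then show ?thesis using sigma_sets_Union[OF R'(1), of "{B \<in> \<R>. B \<subseteq> q}"] by simp
      qed
      \<comment> \<open>If two tuples give the same restricted homomorphism, at each index both
        moved points lie in one atom, hence both original points in one cover member at distance
        below \<epsilon>. At an index attaining the maximum this contradicts separation in
        \<open>rho_inf\<close>.\<close>
      have "inj_on \<psi> S"
      proof (rule inj_onI, rule ccontr)
        fix x y assume xy: "x \<in> S" "y \<in> S" "\<psi> x = \<psi> y" "x \<noteq> y"
        have "finite ((\<lambda>i. \<rho> (x i) (y i)) ` {1..d})" "(\<lambda>i. \<rho> (x i) (y i)) ` {1..d} \<noteq> {}" using d by auto
        from Max_in[OF this] obtain i where i: "i \<in> {1..d}" "rho_inf \<rho> d x y = \<rho> (x i) (y i)"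
          unfolding rho_inf_def by blast
        have xu: "x i \<in> units G" using S(2) xy(1) i(1) unfolding Orb_def by blast
        obtain q where q: "q \<in> \<Q>" "\<tau> (x i) \<in> q" using \<tau>1[OF xu] Q'(6) by blast
        have q\<Sigma>: "q \<in> sigma_sets (units G) \<Q>" using q(1) by (rule sigma_sets.Basic)
        have "\<psi> x q = {i \<in> {1..d}. \<tau> (x i) \<in> q}" "\<psi> y q = {i \<in> {1..d}. \<tau> (y i) \<in> q}"
          unfolding \<psi>_def \<phi>_def using q\<Sigma> QR[OF q(1)] by simp_all
        then have "{i \<in> {1..d}. \<tau> (x i) \<in> q} = {i \<in> {1..d}. \<tau> (y i) \<in> q}" using xy(3) by simp
        then have "\<tau> (y i) \<in> q" using q(2) i(1) by blast
        then have "\<rho> (x i) (y i) < \<epsilon>" using N(4)[OF nn(1)[OF q(1)]] \<tau>3[OF q] \<tau>3[OF q(1)] by blast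
        then show False using S(3)[OF xy(1,2,4)] i(2) by simp
      qed
      then have "card S = card (\<psi> ` S)" by (simp add: card_image)
      also have "\<dots> \<le> Hom_count G \<mu> H \<pi> \<Q> \<P> F \<delta> d \<sigma>"
        unfolding Hom_count_def
      proof (rule card_mono)
        show "finite ((\<lambda>\<phi>. restrict \<phi> (sigma_sets (units G) \<Q>)) ` Hom_sets G \<mu> H \<pi> \<P> F \<delta> d \<sigma>)"
          by (intro finite_imageI finite_Hom_sets P F)
        have "\<phi> x \<in> Hom_sets G \<mu> H \<pi> \<P> F \<delta> d \<sigma>" if "x \<in> S" for x
          unfolding \<phi>_def using tuple[OF d \<sigma> mult cont] S(2) that by blast
        then show "\<psi> ` S \<subseteq> (\<lambda>\<phi>. restrict \<phi> (sigma_sets (units G) \<Q>)) ` Hom_sets G \<mu> H \<pi> \<P> F \<delta> d \<sigma>"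
          unfolding \<psi>_def by blast
      qed
      finally show "of_nat (card S) \<le> (of_nat (Hom_count G \<mu> H \<pi> \<Q> \<P> F \<delta> d \<sigma>) :: ennreal)" by simp
    qed
    have gF: "finite (E \<union> g ` F)" "E \<union> g ` F \<subseteq> pseudogroup H H.M" "finite (F \<union> g ` F)" "F \<union> g ` F \<subseteq> pseudogroup H H.M"
      using E top_full_group_pseudogroup F gp by auto
    have "eventually (\<lambda>j. j \<in> idx A \<longrightarrow> (AE \<sigma> in law A j.
          sep_number \<epsilon> (rho_inf \<rho> (degree A j)) (Orb G \<mu> H \<pi> \<rho> F' K \<delta>' (degree A j) \<sigma>) \<le>
          of_nat (Hom_count G \<mu> H \<pi> \<Q> \<P> F \<delta> (degree A j) \<sigma>))) net"
      using eventually_multiplicative[OF gF(1,2) \<delta>1(2)] eventually_continuous[OF ac gF(3,4) \<eta>]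
    proof eventually_elim
      case (elim j)
      show ?case
      proof
        assume j: "j \<in> idx A"
        show "AE \<sigma> in law A j. sep_number \<epsilon> (rho_inf \<rho> (degree A j)) (Orb G \<mu> H \<pi> \<rho> F' K \<delta>' (degree A j) \<sigma>) \<le>
          of_nat (Hom_count G \<mu> H \<pi> \<Q> \<P> F \<delta> (degree A j) \<sigma>)"
          using elim AE_space
        proof eventually_elim
          case (elim \<sigma>)
          have "\<sigma> f \<in> fin_pseudogroup (degree A j)" if "f \<in> pseudogroup H H.M" for f
            using elim(3) that unfolding space_law[OF j] by blast
          moreover have "fin_size (degree A j) (sym_diff (\<sigma> f) (\<sigma> (g f))) \<le> 4 * \<eta>" if f: "f \<in> F" for f
          proof -
            have "ennreal (fin_size (degree A j) (sym_diff (\<sigma> f) (\<sigma> (g f)))) < ennreal \<eta> + source_mass H \<nu> (sym_diff f (g f))"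
              using elim(2) f by blast
            also have "\<dots> \<le> ennreal \<eta> + ennreal (3 * \<eta>)"
              using Cf(11)[OF f] unfolding g_def by (rule add_left_mono)
            also have "\<dots> = ennreal (4 * \<eta>)" using \<eta> by (simp flip: ennreal_plus)
            finally show ?thesis using \<eta> by (simp add: ennreal_less_iff fin_size_def)
          qed
          ultimately show ?case using count[OF law(1)[OF j] _ elim(1)] by blast
        qed
      qed
    qed
    then show "\<exists>\<delta>' F' K. 0 < \<delta>' \<and> finite F' \<and> F' \<subseteq> top_pseudogroup H \<nu> \<and> finite K \<and>
        (\<forall>k\<in>K. continuous_map G.X euclideanreal k) \<and>
        eventually (\<lambda>j. j \<in> idx A \<longrightarrow> (AE \<sigma> in law A j.
          sep_number \<epsilon> (rho_inf \<rho> (degree A j)) (Orb G \<mu> H \<pi> \<rho> F' K \<delta>' (degree A j) \<sigma>) \<le>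
          of_nat (Hom_count G \<mu> H \<pi> \<Q> \<P> F \<delta> (degree A j) \<sigma>))) net"
      using \<delta>'(1) F' K by (intro exI[of _ \<delta>'] exI[of _ F'] exI[of _ K]) simp
  qed
qed

end

section \<open>Comparison of the entropies\<close>

lemma Lp_norm_le_one:
  assumes M: "prob_space M" and p: "1 \<le> p" and f: "f \<in> borel_measurable M" "\<And>x. f x \<le> 1"
  shows "Lp_norm p M f \<le> 1"
proof (cases "p = \<top>")
  case True
  then show ?thesis using f by (simp add: Lp_norm_def esssup_I)
next
  case False
  interpret prob_space M by (rule M)
  have one: "ennreal_powr 1 a = 1" for a by (simp add: ennreal_powr_def)
  have "(\<integral>\<^sup>+ x. ennreal_powr (f x) (enn2real p) \<partial>M) \<le> (\<integral>\<^sup>+ x. 1 \<partial>M)"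
    using ennreal_powr_mono[OF _ f(2), of "enn2real p"] one by (intro nn_integral_mono) simp
  also have "\<dots> = 1" by (simp add: emeasure_space_1)
  finally have "ennreal_powr (\<integral>\<^sup>+ x. ennreal_powr (f x) (enn2real p) \<partial>M) (1 / enn2real p) \<le>
      ennreal_powr 1 (1 / enn2real p)" by (intro ennreal_powr_mono) simp_all
  then show ?thesis using False by (simp add: Lp_norm_def one)
qed

context entropy_setting
begin

lemma Orb_cong:
  "\<forall>f\<in>F. \<sigma> f = \<sigma>' f \<Longrightarrow> Orb G \<mu> H \<pi> \<rho> F K \<delta> d \<sigma> = Orb G \<mu> H \<pi> \<rho> F K \<delta> d \<sigma>'"
  unfolding Orb_def by simp

lemma Hom_count_cong:
  "\<forall>f\<in>F. \<sigma> f = \<sigma>' f \<Longrightarrow> Hom_count G \<mu> H \<pi> \<Q> \<P> F \<delta> d \<sigma> = Hom_count G \<mu> H \<pi> \<Q> \<P> F \<delta> d \<sigma>'"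
  unfolding Hom_count_def Hom_sets_def Let_def by simp

lemma rho2_le_rho_inf:
  assumes d: "0 < d" and x: "x \<in> {1..d} \<rightarrow>\<^sub>E units G" "y \<in> {1..d} \<rightarrow>\<^sub>E units G"
  shows "rho2 \<rho> d x y \<le> rho_inf \<rho> d x y"
proof -
  have le: "\<rho> (x i) (y i) \<le> rho_inf \<rho> d x y" if "i \<in> {1..d}" for i
    unfolding rho_inf_def using that by (intro Max_ge) auto
  have nn: "0 \<le> \<rho> (x i) (y i)" if "i \<in> {1..d}" for i
    using x that by (intro rho_nonneg) auto
  have m: "0 \<le> rho_inf \<rho> d x y" using le[of 1] nn[of 1] d by simp
  have "(\<Sum>i\<in>{1..d}. (\<rho> (x i) (y i))\<^sup>2) \<le> real d * (rho_inf \<rho> d x y)\<^sup>2"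
    using sum_bounded_above[of "{1..d}" "\<lambda>i. (\<rho> (x i) (y i))\<^sup>2" "(rho_inf \<rho> d x y)\<^sup>2"] le nn
    by (simp add: power_mono)
  then have "(\<Sum>i\<in>{1..d}. (\<rho> (x i) (y i))\<^sup>2) / real d \<le> (rho_inf \<rho> d x y)\<^sup>2"
    using d by (simp add: field_simps)
  then have "rho2 \<rho> d x y \<le> sqrt ((rho_inf \<rho> d x y)\<^sup>2)"
    unfolding rho2_def by (rule real_sqrt_le_mono)
  then show ?thesis using m by simp
qed

text \<open>A quadratic mean is dominated by the maximum, and separation numbers are monotone in the
  metric; either exponent is therefore enclosed between \<open>rho2\<close> and
  \<open>rho_inf\<close>.\<close>

lemma sep_number_exponent:
  assumes d: "0 < d"
  shows "sep_number \<epsilon> (rho2 \<rho> d) (Orb G \<mu> H \<pi> \<rho> F K \<delta> d \<sigma>) \<le> sep_number \<epsilon> (rho_q q \<rho> d) (Orb G \<mu> H \<pi> \<rho> F K \<delta> d \<sigma>)"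
    "sep_number \<epsilon> (rho_q q \<rho> d) (Orb G \<mu> H \<pi> \<rho> F K \<delta> d \<sigma>) \<le> sep_number \<epsilon> (rho_inf \<rho> d) (Orb G \<mu> H \<pi> \<rho> F K \<delta> d \<sigma>)"
proof -
  have "rho2 \<rho> d x y \<le> rho_q q \<rho> d x y \<and> rho_q q \<rho> d x y \<le> rho_inf \<rho> d x y"
    if "x \<in> Orb G \<mu> H \<pi> \<rho> F K \<delta> d \<sigma>" "y \<in> Orb G \<mu> H \<pi> \<rho> F K \<delta> d \<sigma>" for x y
  proof -
    have "rho2 \<rho> d x y \<le> rho_inf \<rho> d x y"
      using that d unfolding Orb_def by (intro rho2_le_rho_inf) auto
    then show ?thesis unfolding rho_q_def by (cases q) auto
  qed
  then show "sep_number \<epsilon> (rho2 \<rho> d) (Orb G \<mu> H \<pi> \<rho> F K \<delta> d \<sigma>) \<le> sep_number \<epsilon> (rho_q q \<rho> d) (Orb G \<mu> H \<pi> \<rho> F K \<delta> d \<sigma>)"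
    "sep_number \<epsilon> (rho_q q \<rho> d) (Orb G \<mu> H \<pi> \<rho> F K \<delta> d \<sigma>) \<le> sep_number \<epsilon> (rho_inf \<rho> d) (Orb G \<mu> H \<pi> \<rho> F K \<delta> d \<sigma>)"
    by (blast intro: sep_number_mono)+
qed

text \<open>The quantifiers match: \<epsilon> is chosen from \<Q> and \<kappa> alone, so it can
  enter the supremum, while \<P>, F and \<delta> answer each \<delta>', F', K inside the infima.
  Then \<kappa> tends to 0.\<close>

lemma sofic_entropy_le: "sofic_entropy G \<mu> H H.M \<pi> A \<beta> p \<le> pm_entropy G \<mu> H \<nu> \<pi> A \<beta> p \<rho> q"
  unfolding sofic_entropy_def
proof (rule SUP_least)
  fix \<Q> assume "\<Q> \<in> {\<Q>. finite_borel_partition G \<mu> \<Q>}"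
  then have Q: "finite_borel_partition G \<mu> \<Q>" by simp
  let ?L = "INF \<P>\<in>{\<P>. finite_borel_partition G \<mu> \<P> \<and> refines (units G) \<P> \<Q>}. partition_entropy G \<mu> H H.M \<pi> A \<beta> p \<Q> \<P>"
  have eps: "?L \<le> pm_entropy G \<mu> H \<nu> \<pi> A \<beta> p \<rho> q + ereal \<kappa>" if \<kappa>: "0 < \<kappa>" for \<kappa>
  proof -
    obtain \<epsilon> where \<epsilon>: "0 < \<epsilon>" and ex: "\<And>\<delta>' F' K. 0 < \<delta>' \<Longrightarrow> finite F' \<Longrightarrow> F' \<subseteq> top_pseudogroup H \<nu> \<Longrightarrow> finite K \<Longrightarrow>
      \<forall>k\<in>K. continuous_map G.X euclideanreal k \<Longrightarrow>
      \<exists>\<P> F \<delta>. finite_borel_partition G \<mu> \<P> \<and> refines (units G) \<P> \<Q> \<and> finite F \<and>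
        F \<subseteq> pseudogroup H H.M \<and> units H \<in> F \<and> F' \<subseteq> F \<and> 0 < \<delta> \<and>
        (\<forall>d \<sigma>. 0 < d \<longrightarrow> (\<forall>f\<in>F. \<sigma> f \<in> fin_pseudogroup d) \<longrightarrow>
          of_nat (Hom_count G \<mu> H \<pi> \<Q> \<P> F \<delta> d \<sigma>) \<le>
          ennreal (exp (\<kappa> * real d)) * sep_number \<epsilon> (rho2 \<rho> d) (Orb G \<mu> H \<pi> \<rho> F' K \<delta>' d \<sigma>))"
      apply (rule Hom_count_le_sep_number[OF Q \<kappa>])
      subgoal premises prems by (rule prems(1)[OF prems(2)]) (rule prems(3))
      done
    have step: "?L - ereal \<kappa> \<le> growth_rate A \<beta> p (\<lambda>d \<sigma>. sep_number \<epsilon> (rho_q q \<rho> d) (Orb G \<mu> H \<pi> \<rho> F' K \<delta>' d \<sigma>))"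
      if h: "0 < \<delta>'" "finite F'" "F' \<subseteq> top_pseudogroup H \<nu>" "finite K" "\<forall>k\<in>K. continuous_map G.X euclideanreal k"
      for \<delta>' F' K
    proof -
      obtain \<P> F \<delta> where P: "finite_borel_partition G \<mu> \<P>" "refines (units G) \<P> \<Q>" and F: "finite F"
        "F \<subseteq> pseudogroup H H.M" "units H \<in> F" "F' \<subseteq> F" and \<delta>: "0 < \<delta>" and le: "\<And>d \<sigma>. 0 < d \<Longrightarrow> \<forall>f\<in>F. \<sigma> f \<in> fin_pseudogroup d \<Longrightarrow>
          of_nat (Hom_count G \<mu> H \<pi> \<Q> \<P> F \<delta> d \<sigma>) \<le>
          ennreal (exp (\<kappa> * real d)) * sep_number \<epsilon> (rho2 \<rho> d) (Orb G \<mu> H \<pi> \<rho> F' K \<delta>' d \<sigma>)"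
        using ex[OF h] by blast
      have "?L \<le> partition_entropy G \<mu> H H.M \<pi> A \<beta> p \<Q> \<P>" using P by (intro INF_lower) simp
      also have "\<dots> \<le> growth_rate A \<beta> p (\<lambda>d \<sigma>. of_nat (Hom_count G \<mu> H \<pi> \<Q> \<P> F \<delta> d \<sigma>))"
        unfolding partition_entropy_def using F \<delta> by (intro INF_lower2[of F] INF_lower2[of \<delta>]) auto
      also have "\<dots> \<le> growth_rate A \<beta> p (\<lambda>d \<sigma>. sep_number \<epsilon> (rho_q q \<rho> d) (Orb G \<mu> H \<pi> \<rho> F' K \<delta>' d \<sigma>)) + ereal \<kappa>"
      proof (rule growth_rate_le[OF F(1,2)])
        show "of_nat (Hom_count G \<mu> H \<pi> \<Q> \<P> F \<delta> d \<sigma>) = (of_nat (Hom_count G \<mu> H \<pi> \<Q> \<P> F \<delta> d \<sigma>') :: ennreal)"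
          if "\<forall>f\<in>F. \<sigma> f = \<sigma>' f" for d \<sigma> \<sigma>' by (simp add: Hom_count_cong[OF that])
        show "sep_number \<epsilon> (rho_q q \<rho> d) (Orb G \<mu> H \<pi> \<rho> F' K \<delta>' d \<sigma>) =
            sep_number \<epsilon> (rho_q q \<rho> d) (Orb G \<mu> H \<pi> \<rho> F' K \<delta>' d \<sigma>')"
          if "\<forall>f\<in>F. \<sigma> f = \<sigma>' f" for d \<sigma> \<sigma>'
        proof -
          have "\<forall>f\<in>F'. \<sigma> f = \<sigma>' f" using that F(4) by blast
          from Orb_cong[OF this] show ?thesis by simp
        qed
        show "eventually (\<lambda>j. j \<in> idx A \<longrightarrow> (AE \<sigma> in law A j. of_nat (Hom_count G \<mu> H \<pi> \<Q> \<P> F \<delta> (degree A j) \<sigma>) \<le>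
          ennreal (exp (\<kappa> * real (degree A j))) *
            sep_number \<epsilon> (rho_q q \<rho> (degree A j)) (Orb G \<mu> H \<pi> \<rho> F' K \<delta>' (degree A j) \<sigma>))) net"
        proof (rule always_eventually, intro allI impI)
          fix j assume j: "j \<in> idx A"
          show "AE \<sigma> in law A j. of_nat (Hom_count G \<mu> H \<pi> \<Q> \<P> F \<delta> (degree A j) \<sigma>) \<le>
            ennreal (exp (\<kappa> * real (degree A j))) *
              sep_number \<epsilon> (rho_q q \<rho> (degree A j)) (Orb G \<mu> H \<pi> \<rho> F' K \<delta>' (degree A j) \<sigma>)"
            using AE_space
          proof eventually_elim
            case (elim \<sigma>)
            then have "\<forall>f\<in>F. \<sigma> f \<in> fin_pseudogroup (degree A j)"
              using F(2) unfolding space_law[OF j] by blast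
            from le[OF law(1)[OF j] this] show ?case
              by (rule order_trans) (intro mult_left_mono sep_number_exponent(1)[OF law(1)[OF j]], simp)
          qed
        qed
      qed
      finally show ?thesis by (simp add: ereal_minus_le)
    qed
    have "?L - ereal \<kappa> \<le> (INF \<delta>'\<in>{0<..}. INF F'\<in>{F. finite F \<and> F \<subseteq> top_pseudogroup H \<nu>}.
        INF K\<in>{K. finite K \<and> (\<forall>k\<in>K. continuous_map G.X euclideanreal k)}.
          growth_rate A \<beta> p (\<lambda>d \<sigma>. sep_number \<epsilon> (rho_q q \<rho> d) (Orb G \<mu> H \<pi> \<rho> F' K \<delta>' d \<sigma>)))"
      by (intro INF_greatest step) auto
    also have "\<dots> \<le> pm_entropy G \<mu> H \<nu> \<pi> A \<beta> p \<rho> q"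
      unfolding pm_entropy_def using \<epsilon> by (intro SUP_upper) simp
    finally show ?thesis by (simp add: ereal_minus_le)
  qed
  show "?L \<le> pm_entropy G \<mu> H \<nu> \<pi> A \<beta> p \<rho> q" by (rule ereal_le_epsilon2) (rule eps)
qed

text \<open>Here \<Q> answers \<epsilon>, and \<delta>', F', K answer each \<P>, F, \<delta>.
  Separated tuples inject into homomorphisms, so there is no exponential loss and the constant is
  0.\<close>

lemma pm_entropy_le:
  assumes reg: "regular_measure H \<nu>" and ac: "asymptotically_continuous H H.M \<nu> A" and diam: "0 < diam"
  shows "pm_entropy G \<mu> H \<nu> \<pi> A \<beta> p \<rho> q \<le> sofic_entropy G \<mu> H H.M \<pi> A \<beta> p"
  unfolding pm_entropy_def
proof (rule SUP_least)
  fix \<epsilon> :: real assume "\<epsilon> \<in> {0<..}"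
  then have \<epsilon>: "0 < \<epsilon>" by simp
  let ?R = "INF \<delta>'\<in>{0<..}. INF F'\<in>{F. finite F \<and> F \<subseteq> top_pseudogroup H \<nu>}.
        INF K\<in>{K. finite K \<and> (\<forall>k\<in>K. continuous_map G.X euclideanreal k)}.
          growth_rate A \<beta> p (\<lambda>d \<sigma>. sep_number \<epsilon> (rho_q q \<rho> d) (Orb G \<mu> H \<pi> \<rho> F' K \<delta>' d \<sigma>))"
  obtain \<Q> where Q: "finite_borel_partition G \<mu> \<Q>" and ex: "\<And>\<P> F \<delta>. finite_borel_partition G \<mu> \<P> \<Longrightarrow>
      refines (units G) \<P> \<Q> \<Longrightarrow> finite F \<Longrightarrow> F \<subseteq> pseudogroup H H.M \<Longrightarrow> units H \<in> F \<Longrightarrow> 0 < \<delta> \<Longrightarrow>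
      \<exists>\<delta>' F' K. 0 < \<delta>' \<and> finite F' \<and> F' \<subseteq> top_pseudogroup H \<nu> \<and> finite K \<and>
        (\<forall>k\<in>K. continuous_map G.X euclideanreal k) \<and>
        eventually (\<lambda>j. j \<in> idx A \<longrightarrow> (AE \<sigma> in law A j.
          sep_number \<epsilon> (rho_inf \<rho> (degree A j)) (Orb G \<mu> H \<pi> \<rho> F' K \<delta>' (degree A j) \<sigma>) \<le>
          of_nat (Hom_count G \<mu> H \<pi> \<Q> \<P> F \<delta> (degree A j) \<sigma>))) net"
    using sep_number_le_Hom_count[OF reg ac diam \<epsilon>] by blast
  have step: "?R \<le> growth_rate A \<beta> p (\<lambda>d \<sigma>. of_nat (Hom_count G \<mu> H \<pi> \<Q> \<P> F \<delta> d \<sigma>))"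
    if h: "finite_borel_partition G \<mu> \<P>" "refines (units G) \<P> \<Q>" "finite F" "F \<subseteq> pseudogroup H H.M"
      "units H \<in> F" "0 < \<delta>" for \<P> F \<delta>
  proof -
    obtain \<delta>' F' K where \<delta>': "0 < \<delta>'" and F': "finite F'" "F' \<subseteq> top_pseudogroup H \<nu>" and K: "finite K"
        "\<forall>k\<in>K. continuous_map G.X euclideanreal k" and
      ev: "eventually (\<lambda>j. j \<in> idx A \<longrightarrow> (AE \<sigma> in law A j.
          sep_number \<epsilon> (rho_inf \<rho> (degree A j)) (Orb G \<mu> H \<pi> \<rho> F' K \<delta>' (degree A j) \<sigma>) \<le>
          of_nat (Hom_count G \<mu> H \<pi> \<Q> \<P> F \<delta> (degree A j) \<sigma>))) net"
      using ex[OF h] by blast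
    have "?R \<le> growth_rate A \<beta> p (\<lambda>d \<sigma>. sep_number \<epsilon> (rho_q q \<rho> d) (Orb G \<mu> H \<pi> \<rho> F' K \<delta>' d \<sigma>))"
      using \<delta>' F' K by (intro INF_lower2[of \<delta>'] INF_lower2[of F'] INF_lower2[of K]) auto
    also have "\<dots> \<le> growth_rate A \<beta> p (\<lambda>d \<sigma>. of_nat (Hom_count G \<mu> H \<pi> \<Q> \<P> F \<delta> d \<sigma>)) + ereal 0"
    proof (rule growth_rate_le[of "F \<union> F'"])
      show "finite (F \<union> F')" using h(3) F'(1) by simp
      show "F \<union> F' \<subseteq> pseudogroup H H.M" using h(4) F'(2) H.top_pseudogroup_subset by blast
      show "sep_number \<epsilon> (rho_q q \<rho> d) (Orb G \<mu> H \<pi> \<rho> F' K \<delta>' d \<sigma>) =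
            sep_number \<epsilon> (rho_q q \<rho> d) (Orb G \<mu> H \<pi> \<rho> F' K \<delta>' d \<sigma>')"
        if "\<forall>f\<in>F \<union> F'. \<sigma> f = \<sigma>' f" for d \<sigma> \<sigma>'
      proof -
        have "\<forall>f\<in>F'. \<sigma> f = \<sigma>' f" using that by blast
        from Orb_cong[OF this] show ?thesis by simp
      qed
      show "of_nat (Hom_count G \<mu> H \<pi> \<Q> \<P> F \<delta> d \<sigma>) = (of_nat (Hom_count G \<mu> H \<pi> \<Q> \<P> F \<delta> d \<sigma>') :: ennreal)"
        if "\<forall>f\<in>F \<union> F'. \<sigma> f = \<sigma>' f" for d \<sigma> \<sigma>'
      proof -
        have "\<forall>f\<in>F. \<sigma> f = \<sigma>' f" using that by blast
        from Hom_count_cong[OF this] show ?thesis by simp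
      qed
      show "eventually (\<lambda>j. j \<in> idx A \<longrightarrow> (AE \<sigma> in law A j.
          sep_number \<epsilon> (rho_q q \<rho> (degree A j)) (Orb G \<mu> H \<pi> \<rho> F' K \<delta>' (degree A j) \<sigma>) \<le>
          ennreal (exp (0 * real (degree A j))) * of_nat (Hom_count G \<mu> H \<pi> \<Q> \<P> F \<delta> (degree A j) \<sigma>))) net"
        using ev
      proof eventually_elim
        case (elim j)
        show ?case
        proof
          assume j: "j \<in> idx A"
          with elim have "AE \<sigma> in law A j.
            sep_number \<epsilon> (rho_inf \<rho> (degree A j)) (Orb G \<mu> H \<pi> \<rho> F' K \<delta>' (degree A j) \<sigma>) \<le>
            of_nat (Hom_count G \<mu> H \<pi> \<Q> \<P> F \<delta> (degree A j) \<sigma>)" by blast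
          then show "AE \<sigma> in law A j.
            sep_number \<epsilon> (rho_q q \<rho> (degree A j)) (Orb G \<mu> H \<pi> \<rho> F' K \<delta>' (degree A j) \<sigma>) \<le>
            ennreal (exp (0 * real (degree A j))) * of_nat (Hom_count G \<mu> H \<pi> \<Q> \<P> F \<delta> (degree A j) \<sigma>)"
          proof eventually_elim
            case (elim \<sigma>)
            from order_trans[OF sep_number_exponent(2)[OF law(1)[OF j]] this] show ?case by simp
          qed
        qed
      qed
    qed
    finally show ?thesis by simp
  qed
  have "?R \<le> (INF \<P>\<in>{\<P>. finite_borel_partition G \<mu> \<P> \<and> refines (units G) \<P> \<Q>}. partition_entropy G \<mu> H H.M \<pi> A \<beta> p \<Q> \<P>)"
    unfolding partition_entropy_def by (intro INF_greatest step) auto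
  also have "\<dots> \<le> sofic_entropy G \<mu> H H.M \<pi> A \<beta> p"
    unfolding sofic_entropy_def using Q by (intro SUP_upper) simp
  finally show "?R \<le> sofic_entropy G \<mu> H H.M \<pi> A \<beta> p" .
qed

text \<open>Translates of a vanishing pseudo-metric vanish, so the generating property admits only
  one unit, and surjectivity of \<pi> carries this to H. The case is separate because \<rho> cannot
  tell the extra symbol from a point.\<close>

lemma diam_zero_singleton:
  assumes "diam = 0"
  obtains x where "units G = {x}" "units H = {\<pi> x}"
proof -
  have eq: "x = y" if xy: "x \<in> units G" "y \<in> units G" for x y
  proof (rule ccontr)
    assume "x \<noteq> y"
    then obtain f where f: "f \<in> top_full_group H" "0 < \<rho>e (ac f x) (ac f y)"
      using generating xy unfolding dynamically_generating_def by blast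
    then have "0 < \<rho> (app f x) (app f y)" using act_full[OF f(1)] xy by simp
    then show False using rho_le_diam[OF app_unit[OF f(1) xy(1)] app_unit[OF f(1) xy(2)]] assms by simp
  qed
  obtain x where x: "x \<in> units G" using units_nonempty by blast
  have G1: "units G = {x}" using x eq by blast
  have "y = \<pi> x" if y: "y \<in> units H" for y
  proof -
    have "\<pi> ` arrows G = arrows H" using factor unfolding pmp_factor_def class_bijective_factor_def by (elim conjE)
    then have "y \<in> \<pi> ` arrows G" using y H.units_subset by (simp add: subset_iff)
    then obtain g where g: "g \<in> arrows G" "\<pi> g = y" by (elim imageE) simp
    then have "y = \<pi> (src G g)" using src_pi[OF g(1)] H.src_unit[OF y] by simp
    then show ?thesis using G.src_units[OF g(1)] G1 by simp
  qed
  then have "units H = {\<pi> x}" using pi_unit[OF x] by blast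
  with G1 show ?thesis by (rule that)
qed

text \<open>A pair of s that also lies in s O s is a unit, by injectivity in both directions; so s
  is covered by its idempotence error and its units. It is applied to the model of the empty
  element.\<close>

lemma card_near_empty:
  assumes s: "s \<in> fin_pseudogroup d" and D: "real (card (sym_diff s (s O s))) < t"
    and tr: "real (card (s \<inter> units (full_groupoid d))) < t"
  shows "real (card s) < 2 * t"
proof -
  have fs: "finite s" by (rule finite_fin_pseudogroup_mem[OF s])
  have "finite (s O s)"
    using finite_subset[of "s O s" "{1..d} \<times> {1..d}"] fin_pseudogroupD(1)[OF s] by blast
  then have fD: "finite (sym_diff s (s O s))" using fs by simp
  have "s \<subseteq> sym_diff s (s O s) \<union> (s \<inter> units (full_groupoid d))"
  proof
    fix e assume e: "e \<in> s"
    obtain i j where ij: "e = (i, j)" by (cases e)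
    show "e \<in> sym_diff s (s O s) \<union> (s \<inter> units (full_groupoid d))"
    proof (cases "e \<in> s O s")
      case True
      then obtain k where k: "(i, k) \<in> s" "(k, j) \<in> s" using ij by blast
      then have "k = j" using fin_pseudogroupD(3)[OF s] e ij by blast
      then have "i = j" using fin_pseudogroupD(2)[OF s, of i j j] k e ij by blast
      then show ?thesis using e ij fin_pseudogroupD(1)[OF s] by (auto simp: units_def full_groupoid_def)
    qed (use e in blast)
  qed
  then have "card s \<le> card (sym_diff s (s O s) \<union> (s \<inter> units (full_groupoid d)))"
    using fD fs by (intro card_mono) auto
  also have "\<dots> \<le> card (sym_diff s (s O s)) + card (s \<inter> units (full_groupoid d))" by (rule card_Un_le)
  finally show ?thesis using D tr by linarith
qed

text \<open>If s O t is close to some u of nearly full trace, it has many pairs, and their distinct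
  first components all lie in the range of s. It is applied with u the model of the unit space and t
  that of an inverse.\<close>

lemma card_near_full:
  assumes s: "s \<in> fin_pseudogroup d" and t: "t \<in> fin_pseudogroup d" and u: "u \<in> fin_pseudogroup d"
    and D: "real (card (sym_diff u (s O t))) < r" and tr: "real d - r < real (card (u \<inter> units (full_groupoid d)))"
  shows "real d - 2 * r < real (card (fin_image s {1..d}))"
proof -
  have fu: "finite u" by (rule finite_fin_pseudogroup_mem[OF u])
  have fst: "finite (s O t)"
    using finite_subset[of "s O t" "{1..d} \<times> {1..d}"] fin_pseudogroupD(1)[OF s] fin_pseudogroupD(1)[OF t] by blast
  have "card (u \<inter> units (full_groupoid d)) \<le> card u" using fu by (intro card_mono) auto
  moreover have "card u \<le> card (sym_diff u (s O t) \<union> (s O t))" using fu fst by (intro card_mono) auto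
  moreover have "card (sym_diff u (s O t) \<union> (s O t)) \<le> card (sym_diff u (s O t)) + card (s O t)" by (rule card_Un_le)
  moreover have "card (s O t) \<le> card (fin_image s {1..d})"
  proof (rule card_inj_on_le[of fst])
    show "inj_on fst (s O t)"
      using fin_pseudogroupD(3)[OF s] fin_pseudogroupD(3)[OF t] by (fastforce intro!: inj_onI)
    show "fst ` (s O t) \<subseteq> fin_image s {1..d}"
      using fin_pseudogroupD(1)[OF s] unfolding fin_image_def by force
    show "finite (fin_image s {1..d})" using finite_subset[OF fin_image_subset[OF s]] by blast
  qed
  ultimately show ?thesis using D tr by linarith
qed

text \<open>Over a single unit the constant tuple is the candidate. The model of an empty f must be
  nearly empty; every other f is a single arrow fixing the unit, and its model must have nearly full
  range. Idempotence, inverses and traces give both with error below 2 \<delta> / 3.\<close>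

lemma Hom_nonempty_singleton:
  assumes x: "units G = {x}" "units H = {\<pi> x}" and P: "finite_borel_partition G \<mu> \<P>"
    and F: "finite F" "F \<subseteq> pseudogroup H H.M" "units H \<in> F" and \<delta>: "0 < \<delta>"
  obtains F' where "finite F'" "F' \<subseteq> pseudogroup H H.M"
    "\<And>d \<sigma>. 0 < d \<Longrightarrow> \<forall>f\<in>pseudogroup H H.M. \<sigma> f \<in> fin_pseudogroup d \<Longrightarrow>
      multiplicative H d F' (\<delta> / 3) \<sigma> \<Longrightarrow> trace_preserving H \<nu> d F' (\<delta> / 3) \<sigma> \<Longrightarrow>
      Hom_sets G \<mu> H \<pi> \<P> F \<delta> d \<sigma> \<noteq> {}"
proof -
  \<comment> \<open>The empty set, the units and an inverse for each nonempty f are added because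
    the two counting lemmas use their products and traces.\<close>
  define F' where "F' = {{}, units H} \<union> F \<union> (\<lambda>f. {ginv H (SOME h. h \<in> f)}) ` (F - {{}})"
  have sing: "{h} \<in> pseudogroup H H.M" if "h \<in> arrows H" for h
  proof -
    have "closedin H.T {h}"
      using H.hausdorff that Hausdorff_imp_t1_space t1_space_closedin_singleton by fastforce
    then show ?thesis unfolding H.pseudogroup_iff by (simp add: borel_of_closed)
  qed
  have empty: "{} \<in> pseudogroup H H.M" unfolding H.pseudogroup_iff by simp
  have F': "F' \<subseteq> pseudogroup H H.M"
  proof -
    have "{ginv H (SOME h. h \<in> f)} \<in> pseudogroup H H.M" if "f \<in> F - {{}}" for f
    proof -
      have "(SOME h. h \<in> f) \<in> f" using that by (simp add: some_in_eq)
      then have "(SOME h. h \<in> f) \<in> arrows H" using that F(2) pseudogroupD(1) by blast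
      then show ?thesis by (intro sing H.inv_arrow)
    qed
    then show ?thesis unfolding F'_def using F(2) empty H.units_pseudogroup by blast
  qed
  have part: "\<P>' = {{x}}" if "finite_borel_partition G \<mu> \<P>'" for \<P>'
  proof -
    note p = G.fbpD[OF that]
    have "B = {x}" if "B \<in> \<P>'" for B
      using p(4)[OF that] p(7)[OF that] unfolding x(1) subset_singleton_iff by simp
    moreover have "\<P>' \<noteq> {}" using p(6) x(1) by auto
    ultimately show ?thesis by blast
  qed
  have mx: "measure \<mu> {x} = 1" using G.prob_space G.space_mu x(1) by simp
  show ?thesis
  proof (rule that[of F'])
    show "finite F'" unfolding F'_def using F(1) by simp
    show "F' \<subseteq> pseudogroup H H.M" by (rule F')
    fix d \<sigma>
    assume d: "0 < d" and \<sigma>: "\<forall>f\<in>pseudogroup H H.M. \<sigma> f \<in> fin_pseudogroup d"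
      and mult: "multiplicative H d F' (\<delta> / 3) \<sigma>" and tr: "trace_preserving H \<nu> d F' (\<delta> / 3) \<sigma>"
    have mult': "real (card (sym_diff (\<sigma> (set_mult H f g)) (\<sigma> f O \<sigma> g))) < \<delta> / 3 * real d"
      if "f \<in> F'" "g \<in> F'" for f g
    proof -
      have "fin_size d (sym_diff (\<sigma> (set_mult H f g)) (set_mult (full_groupoid d) (\<sigma> f) (\<sigma> g))) < \<delta> / 3"
        using mult that unfolding multiplicative_def by blast
      moreover have "set_mult (full_groupoid d) (\<sigma> f) (\<sigma> g) = \<sigma> f O \<sigma> g"
        using that F' \<sigma> fin_pseudogroupD(1) by (intro set_mult_full_groupoid[of _ d]) blast+
      ultimately show ?thesis using d by (simp add: fin_size_def field_simps)
    qed
    have \<sigma>0: "\<sigma> {} \<in> fin_pseudogroup d" and \<sigma>1: "\<sigma> (units H) \<in> fin_pseudogroup d"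
      using \<sigma> empty H.units_pseudogroup by auto
    have "\<bar>fin_trace d (\<sigma> {}) - gtrace H \<nu> {}\<bar> < \<delta> / 3" using tr unfolding trace_preserving_def F'_def by blast
    then have t0: "real (card (\<sigma> {} \<inter> units (full_groupoid d))) < \<delta> / 3 * real d"
      using d by (simp add: fin_trace_def fin_size_def gtrace_def field_simps)
    have "\<bar>fin_trace d (\<sigma> (units H)) - gtrace H \<nu> (units H)\<bar> < \<delta> / 3"
      using tr unfolding trace_preserving_def F'_def by blast
    moreover have "gtrace H \<nu> (units H) = 1" using H.prob_space H.space_mu by (simp add: gtrace_def)
    ultimately have "1 - \<delta> / 3 < fin_trace d (\<sigma> (units H))" by linarith
    then have t1: "real d - \<delta> / 3 * real d < real (card (\<sigma> (units H) \<inter> units (full_groupoid d)))"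
      using d by (simp add: fin_trace_def fin_size_def field_simps)
    have seg: "{i. Suc 0 \<le> i \<and> i \<le> d} = {Suc 0..d}" by auto
    have act: "fin_size d (sym_diff (fin_image (\<sigma> f) {i \<in> {1..d}. x \<in> {x}}) {i \<in> {1..d}. x \<in> act_set G H \<pi> f {x}}) < \<delta>"
      if f: "f \<in> F" for f
    proof (cases "f = {}")
      case True
      have "act_set G H \<pi> f {x} = {}" unfolding act_set_def act_def True by simp
      moreover have "real (card (\<sigma> {})) < 2 * (\<delta> / 3 * real d)"
      proof (rule card_near_empty[OF \<sigma>0 _ t0])
        have "set_mult H {} {} = {}" unfolding set_mult_def by simp
        then show "real (card (sym_diff (\<sigma> {}) (\<sigma> {} O \<sigma> {}))) < \<delta> / 3 * real d"
          using mult'[of "{}" "{}"] unfolding F'_def by simp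
      qed
      moreover have "card (fin_image (\<sigma> {}) {1..d}) \<le> card (\<sigma> {})"
      proof -
        have "fin_image (\<sigma> {}) {1..d} \<subseteq> fst ` \<sigma> {}" unfolding fin_image_def by force
        then show ?thesis
          using card_mono[OF finite_imageI[OF finite_fin_pseudogroup_mem[OF \<sigma>0]]]
            card_image_le[OF finite_fin_pseudogroup_mem[OF \<sigma>0], of fst] by (meson order_trans)
      qed
      ultimately have "real (card (fin_image (\<sigma> {}) {1..d})) < 2 * (\<delta> / 3 * real d)" by linarith
      then have "real (card (fin_image (\<sigma> {}) {1..d})) < \<delta> * real d" using \<delta> d by simp
      then show ?thesis using d True \<open>act_set G H \<pi> f {x} = {}\<close> by (simp add: fin_size_def field_simps seg)
    next
      case False
      have fp: "f \<in> pseudogroup H H.M" using f F(2) by blast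
      define h where "h = (SOME h. h \<in> f)"
      have h: "h \<in> f" unfolding h_def using False by (simp add: some_in_eq)
      have hA: "h \<in> arrows H" using h pseudogroupD(1)[OF fp] by blast
      have src: "src H k = \<pi> x" "rng H k = \<pi> x" if "k \<in> arrows H" for k
        using H.src_units[OF that] H.rng_units[OF that] x(2) by auto
      have "k = h" if "k \<in> f" for k
        using inj_onD[OF pseudogroupD(2)[OF fp] _ that h] src(1)[OF hA] src(1)[of k] that pseudogroupD(1)[OF fp] by auto
      then have fh: "f = {h}" using h by blast
      have "\<pi> x \<in> src H ` f" using h src(1)[OF hA] by (metis image_eqI)
      then obtain y where y: "ac f x = Some y" using act_None[of f x] by auto
      have "y = x" using act_unit[OF fp _ y] x(1) by simp
      then have ax: "x \<in> act_set G H \<pi> f {x}" unfolding act_set_def using y by auto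
      have hi: "{ginv H h} \<in> F'" unfolding F'_def h_def using f False by blast
      have "(h, ginv H h) \<in> composable H" using hA by (simp add: composable_def H.inv_arrow H.rng_inv)
      then have "set_mult H f {ginv H h} = {rng H h}"
        unfolding set_mult_def fh using H.mult_inv[OF hA] by auto
      then have m: "set_mult H f {ginv H h} = units H" using src(2)[OF hA] x(2) by simp
      have "real d - 2 * (\<delta> / 3 * real d) < real (card (fin_image (\<sigma> f) {1..d}))"
      proof (rule card_near_full[OF _ _ \<sigma>1 _ t1])
        show "\<sigma> f \<in> fin_pseudogroup d" "\<sigma> {ginv H h} \<in> fin_pseudogroup d"
          using \<sigma> fp hi F' by blast+
        show "real (card (sym_diff (\<sigma> (units H)) (\<sigma> f O \<sigma> {ginv H h}))) < \<delta> / 3 * real d"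
          using mult'[OF _ hi, of f] m f unfolding F'_def by simp
      qed
      moreover have "card (sym_diff (fin_image (\<sigma> f) {1..d}) {1..d}) = d - card (fin_image (\<sigma> f) {1..d})"
      proof -
        have sub: "fin_image (\<sigma> f) {1..d} \<subseteq> {1..d}" using fin_image_subset \<sigma> fp by blast
        then have "sym_diff (fin_image (\<sigma> f) {1..d}) {1..d} = {1..d} - fin_image (\<sigma> f) {1..d}" by auto
        then show ?thesis using card_Diff_subset[OF finite_subset[OF sub] sub] by simp
      qed
      moreover have "card (fin_image (\<sigma> f) {1..d}) \<le> d"
        using card_mono[of "{1..d}" "fin_image (\<sigma> f) {1..d}"] fin_image_subset \<sigma> fp by auto
      ultimately have "real (card (sym_diff (fin_image (\<sigma> f) {1..d}) {1..d})) < 2 * (\<delta> / 3 * real d)"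
        by (simp add: of_nat_diff)
      moreover have "2 * (\<delta> / 3 * real d) \<le> \<delta> * real d" using \<delta> d by simp
      ultimately have "real (card (sym_diff (fin_image (\<sigma> f) {1..d}) {1..d})) < \<delta> * real d" by linarith
      then have "fin_size d (sym_diff (fin_image (\<sigma> f) {1..d}) {1..d}) < \<delta>"
        using d by (simp add: fin_size_def field_simps)
      then show ?thesis using ax by (simp add: seg)
    qed
    have fx: "freq d (\<lambda>_. x) {x} = 1" using d by (simp add: freq_def fin_size_def seg)
    show "Hom_sets G \<mu> H \<pi> \<P> F \<delta> d \<sigma> \<noteq> {}"
      using Hom_of_tuple[OF P F, of d "\<lambda>_. x" \<sigma> \<delta>] act \<delta> x(1) fx mx
      unfolding part[OF P] part[OF partition_power(1)[OF P F], unfolded part[OF P]] by auto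
  qed
qed

text \<open>There is at most one approximate orbit, so its count has norm at most 1. Homomorphisms
  exist whenever \<sigma> is multiplicative and preserves traces, eventually with probability above
  1/2, so their count has norm at least 1/2; the factor 2 is absorbed by exp(\<kappa> d) because the
  degrees tend to infinity.\<close>

lemma pm_entropy_le_singleton:
  assumes "diam = 0"
  shows "pm_entropy G \<mu> H \<nu> \<pi> A \<beta> p \<rho> q \<le> sofic_entropy G \<mu> H H.M \<pi> A \<beta> p"
  unfolding pm_entropy_def
proof (rule SUP_least)
  fix \<epsilon> :: real assume "\<epsilon> \<in> {0<..}"
  obtain x where x: "units G = {x}" "units H = {\<pi> x}" by (rule diam_zero_singleton[OF assms])
  let ?R = "INF \<delta>'\<in>{0<..}. INF F'\<in>{F. finite F \<and> F \<subseteq> top_pseudogroup H \<nu>}.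
        INF K\<in>{K. finite K \<and> (\<forall>k\<in>K. continuous_map G.X euclideanreal k)}.
          growth_rate A \<beta> p (\<lambda>d \<sigma>. sep_number \<epsilon> (rho_q q \<rho> d) (Orb G \<mu> H \<pi> \<rho> F' K \<delta>' d \<sigma>))"
  define S where "S d \<sigma> = sep_number \<epsilon> (rho_q q \<rho> d) (Orb G \<mu> H \<pi> \<rho> {} {} 1 d \<sigma>)" for d \<sigma>
  have S1: "S d \<sigma> \<le> 1" for d \<sigma>
    unfolding S_def sep_number_def
  proof (rule SUP_least)
    fix Z assume "Z \<in> {S. finite S \<and> S \<subseteq> Orb G \<mu> H \<pi> \<rho> {} {} 1 d \<sigma> \<and>
      (\<forall>x\<in>S. \<forall>y\<in>S. x \<noteq> y \<longrightarrow> \<epsilon> < rho_q q \<rho> d x y)}"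
    then have "Z \<subseteq> {1..d} \<rightarrow>\<^sub>E {x}" unfolding Orb_def x(1) by blast
    then have "Z \<subseteq> {restrict (\<lambda>_. x) {1..d}}" by (auto simp: PiE_iff extensional_def fun_eq_iff)
    then have "card Z \<le> card {restrict (\<lambda>_. x) {1..d}}" by (intro card_mono) auto
    then have "(of_nat (card Z) :: ennreal) \<le> of_nat 1" by (intro of_nat_mono) simp
    then show "(of_nat (card Z) :: ennreal) \<le> 1" by simp
  qed
  have Q: "finite_borel_partition G \<mu> {units G}"
    unfolding finite_borel_partition_def using units_nonempty G.units_measurable
    by (auto simp: partition_on_def G.sets_mu)
  have step: "?R \<le> growth_rate A \<beta> p (\<lambda>d \<sigma>. of_nat (Hom_count G \<mu> H \<pi> {units G} \<P> F \<delta> d \<sigma>))"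
    if P: "finite_borel_partition G \<mu> \<P>" and F: "finite F" "F \<subseteq> pseudogroup H H.M" "units H \<in> F" and \<delta>: "0 < \<delta>"
    for \<P> F \<delta>
  proof -
    obtain F' where F': "finite F'" "F' \<subseteq> pseudogroup H H.M" and
      ne: "\<And>d \<sigma>. 0 < d \<Longrightarrow> \<forall>f\<in>pseudogroup H H.M. \<sigma> f \<in> fin_pseudogroup d \<Longrightarrow>
      multiplicative H d F' (\<delta> / 3) \<sigma> \<Longrightarrow> trace_preserving H \<nu> d F' (\<delta> / 3) \<sigma> \<Longrightarrow>
      Hom_sets G \<mu> H \<pi> \<P> F \<delta> d \<sigma> \<noteq> {}"
      by (rule Hom_nonempty_singleton[OF x P F \<delta>]) blast
    have \<delta>3: "0 < \<delta> / 3" using \<delta> by simp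
    let ?T = "\<lambda>j. {\<sigma> \<in> space (law A j). trace_preserving H \<nu> (degree A j) F' (\<delta> / 3) \<sigma>}"
    have "\<forall>F \<delta>. finite F \<longrightarrow> F \<subseteq> pseudogroup H H.M \<longrightarrow> 0 < \<delta> \<longrightarrow>
        ((\<lambda>j. measure (law A j) {\<sigma> \<in> space (law A j). trace_preserving H \<nu> (degree A j) F \<delta> \<sigma>}) \<longlongrightarrow> 1) net"
      using sofic unfolding sofic_approximation_def by (elim conjE)
    then have "((\<lambda>j. measure (law A j) (?T j)) \<longlongrightarrow> 1) net" using F' \<delta>3 by simp
    then have ev1: "eventually (\<lambda>j. 1 / 2 < measure (law A j) (?T j)) net"
      by (rule order_tendstoD(1)) simp
    have deg: "filterlim (degree A) at_top net"
      using sofic unfolding sofic_approximation_def by (elim conjE)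
    have eps: "growth_rate A \<beta> p S \<le> growth_rate A \<beta> p (\<lambda>d \<sigma>. of_nat (Hom_count G \<mu> H \<pi> {units G} \<P> F \<delta> d \<sigma>)) + ereal \<kappa>"
      if \<kappa>: "0 < \<kappa>" for \<kappa>
    proof (rule growth_rate_Lp_le)
      \<comment> \<open>From this degree on exp(\<kappa> d) is at least 2.\<close>
      have "eventually (\<lambda>j. nat \<lceil>ln 2 / \<kappa>\<rceil> \<le> degree A j) net"
        using deg unfolding filterlim_at_top by blast
      then show "eventually (\<lambda>j. j \<in> idx A \<longrightarrow> Lp_norm p (law A j) (S (degree A j)) \<le>
        ennreal (exp (\<kappa> * real (degree A j))) *
          Lp_norm p (law A j) (\<lambda>\<sigma>. of_nat (Hom_count G \<mu> H \<pi> {units G} \<P> F \<delta> (degree A j) \<sigma>))) net"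
        using ev1 eventually_multiplicative[OF F' \<delta>3]
      proof eventually_elim
        case (elim j)
        show ?case
        proof
          assume j: "j \<in> idx A"
          let ?L = "Lp_norm p (law A j) (\<lambda>\<sigma>. of_nat (Hom_count G \<mu> H \<pi> {units G} \<P> F \<delta> (degree A j) \<sigma>))"
          have "S (degree A j) \<in> borel_measurable (law A j)"
          proof (rule measurable_finitely_determined[OF _ _ law(3,4)[OF j]])
            show "finite {}" "{} \<subseteq> pseudogroup H H.M" by auto
            show "S (degree A j) \<sigma> = S (degree A j) \<sigma>'" for \<sigma> \<sigma>' unfolding S_def Orb_def by simp
          qed
          then have "Lp_norm p (law A j) (S (degree A j)) \<le> 1"
            by (rule Lp_norm_le_one[OF law(2)[OF j] p _ S1])
          also have "1 \<le> ennreal (exp (\<kappa> * real (degree A j))) * ennreal (1 / 2)"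
          proof -
            have "ln 2 / \<kappa> \<le> real (degree A j)" using elim(1) by linarith
            then have "ln 2 \<le> \<kappa> * real (degree A j)" using \<kappa> by (simp add: field_simps)
            then have "2 \<le> exp (\<kappa> * real (degree A j))" by (metis exp_le_cancel_iff exp_ln zero_less_numeral)
            then have "1 \<le> exp (\<kappa> * real (degree A j)) * (1 / 2)" by simp
            then have "ennreal 1 \<le> ennreal (exp (\<kappa> * real (degree A j)) * (1 / 2))" by (rule ennreal_leI)
            also have "\<dots> = ennreal (exp (\<kappa> * real (degree A j))) * ennreal (1 / 2)" by (rule ennreal_mult) auto
            finally show ?thesis by simp
          qed
          also have "\<dots> \<le> ennreal (exp (\<kappa> * real (degree A j))) * ?L"
          proof (rule mult_left_mono[OF Lp_norm_ge_half[OF law(2)[OF j] p]])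
            \<comment> \<open>By convention \<open>measure\<close> is 0 on nonmeasurable sets, so
              positive measure already implies measurability.\<close>
            show "?T j \<in> sets (law A j)"
            proof (rule ccontr)
              assume "?T j \<notin> sets (law A j)"
              then have "measure (law A j) (?T j) = 0" by (rule measure_notin_sets)
              then show False using elim(2) by simp
            qed
            show "1 / 2 \<le> measure (law A j) (?T j)" using elim(2) by simp
            show "AE \<sigma> in law A j. \<sigma> \<in> ?T j \<longrightarrow> 1 \<le> (of_nat (Hom_count G \<mu> H \<pi> {units G} \<P> F \<delta> (degree A j) \<sigma>) :: ennreal)"
              using elim(3) AE_space
            proof eventually_elim
              case (elim \<sigma>)
              show ?case
              proof
                assume "\<sigma> \<in> ?T j"
                then have "Hom_sets G \<mu> H \<pi> \<P> F \<delta> (degree A j) \<sigma> \<noteq> {}"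
                  using elim space_law[OF j] by (intro ne law(1)[OF j]) auto
                then have "0 < Hom_count G \<mu> H \<pi> {units G} \<P> F \<delta> (degree A j) \<sigma>"
                  unfolding Hom_count_def using finite_Hom_sets[OF P F] by (simp add: card_gt_0_iff)
                then have "(of_nat 1 :: ennreal) \<le> of_nat (Hom_count G \<mu> H \<pi> {units G} \<P> F \<delta> (degree A j) \<sigma>)"
                  by (intro of_nat_mono) simp
                then show "1 \<le> (of_nat (Hom_count G \<mu> H \<pi> {units G} \<P> F \<delta> (degree A j) \<sigma>) :: ennreal)" by simp
              qed
            qed
          qed simp
          finally show "Lp_norm p (law A j) (S (degree A j)) \<le> ennreal (exp (\<kappa> * real (degree A j))) * ?L" .
        qed
      qed
    qed
    have "growth_rate A \<beta> p S \<le> growth_rate A \<beta> p (\<lambda>d \<sigma>. of_nat (Hom_count G \<mu> H \<pi> {units G} \<P> F \<delta> d \<sigma>))"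
      by (rule ereal_le_epsilon2) (rule eps)
    moreover have "?R \<le> growth_rate A \<beta> p S"
      unfolding S_def[abs_def] by (intro INF_lower2[of 1] INF_lower2[of "{}"]) auto
    ultimately show ?thesis by (rule order_trans[rotated])
  qed
  have "?R \<le> (INF \<P>\<in>{\<P>. finite_borel_partition G \<mu> \<P> \<and> refines (units G) \<P> {units G}}. partition_entropy G \<mu> H H.M \<pi> A \<beta> p {units G} \<P>)"
    unfolding partition_entropy_def by (intro INF_greatest step) auto
  also have "\<dots> \<le> sofic_entropy G \<mu> H H.M \<pi> A \<beta> p"
    unfolding sofic_entropy_def using Q by (intro SUP_upper) simp
  finally show "?R \<le> sofic_entropy G \<mu> H H.M \<pi> A \<beta> p" .
qed

end

theorem theorem9p5:
  fixes G :: "'g top_groupoid" and \<mu> :: "'g measure"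
    and H :: "'h top_groupoid" and \<nu> :: "'h measure"
    and \<pi> :: "'g \<Rightarrow> 'h" and A :: "('j, 'h) approx" and \<beta> :: "'j bias" and p :: ennreal
    and \<rho> :: "'g \<Rightarrow> 'g \<Rightarrow> real"
  assumes "pmp_topological_groupoid G \<mu>" and "pmp_topological_groupoid H \<nu>"
    and "compact_space (unit_top G)" and "metrizable_space (unit_top G)"
    and "compact_space (unit_top H)" and "metrizable_space (unit_top H)"
    and "pmp_factor G \<mu> H \<nu> \<pi>" and "continuous_map (gtop G) (gtop H) \<pi>"
    and "sofic_approximation H (borel_of (gtop H)) \<nu> A"
    and "is_bias (idx A) (idx_le A) \<beta>" and "1 \<le> p"
    and "continuous_pseudometric (unit_top G) \<rho>"
    and "dynamically_generating G H \<pi> \<rho>"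
    and "etale H" and "etale G"
    and "regular_measure H \<nu>"
    and "asymptotically_continuous H (borel_of (gtop H)) \<nu> A"
  shows "\<forall>q. pm_entropy G \<mu> H \<nu> \<pi> A \<beta> p \<rho> q = sofic_entropy G \<mu> H (borel_of (gtop H)) \<pi> A \<beta> p"
proof
  fix q
  interpret G: etale_gpd G \<mu> using assms by unfold_locales auto
  interpret H: etale_gpd H \<nu> using assms by unfold_locales auto
  interpret entropy_setting G \<mu> H \<nu> \<pi> A \<beta> p \<rho> using assms by unfold_locales auto
  have "pm_entropy G \<mu> H \<nu> \<pi> A \<beta> p \<rho> q \<le> sofic_entropy G \<mu> H H.M \<pi> A \<beta> p"
  \<comment> \<open>A positive diameter is what lets \<open>translate_close\<close> detect the extra
    symbol.\<close>
  proof (cases "diam = 0")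
    case True
    then show ?thesis by (rule pm_entropy_le_singleton)
  next
    case False
    then have "0 < diam" using diam_nonneg by simp
    then show ?thesis using assms by (intro pm_entropy_le)
  qed
  then show "pm_entropy G \<mu> H \<nu> \<pi> A \<beta> p \<rho> q = sofic_entropy G \<mu> H (borel_of (gtop H)) \<pi> A \<beta> p"
    using sofic_entropy_le by (rule antisym)
qed


end
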